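(* Let $v$ be a gradient flow on a surface $S$ and let $x\in S$ be an isolated singular point of $v$ (that is, $x$ is an isolated point of the set of singular points). Then $x$ is a non-trivial finitely sectored singular point without elliptic sectors.
   Context: A surface is a two-dimensional manifold, possibly with boundary and not necessarily orientable. A flow $v$ on $S$ is a continuous $\mathbb{R}$-action, with $v_t=v(t,\cdot)$. A point $x$ is singular if $v_t(x)=x$ for all $t$. Two flows are topologically equivalent if there is a homeomorphism sending orbits to orbits and preserving orbit directions. A flow is gradient if it is topologically equivalent to a flow generated by a gradient vector field. Sectors. For a singular point $x$ and a subset $A$, the restriction $v|_A$ is a sector for $x$ if there are a non-degenerate interval $I\subseteq[0,2\pi)$ and a homeomorphism $h:\{x\}\sqcup A\to\{0\}\sqcup\{(r\cos\theta,r\sin\theta): r\in(0,1),\theta\in I\}$ with $h^{-1}(0)=x$. A parabolic sector is a sector topologically equivalent to a flow box together with a point $(\pm\infty,0)$ representing $x$ (all its orbit arcs tend to $x$ in one and the same time direction). A hyperbolic sector is one topologically equivalent to a Reeb component together with one added point at infinity representing $x$ (modelled on a closed quadrant of a linear saddle: bounded by one orbit tending to $x$ and one orbit emanating from $x$, all other orbit arcs passing by $x$). An elliptic sector is one topologically equivalent to the interior of a Reeb component together with one added point at infinity representing $x$ (a nested family of orbits each having $x$ as both $\alpha$-limit and $\omega$-limit). A center is a singular point having a neighborhood on which the flow is topologically equivalent to a rotation of a disk about its fixed point. A singular point $x$ is finitely sectored if either it is a center, or it has an open neighborhood which is an open disk (a half-disk if $x\in\partial S$) and is a finite union of $\{x\}$,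 parabolic sectors, hyperbolic sectors and elliptic sectors such that any two distinct sectors intersect in at most two orbit arcs. A finitely sectored singular point is non-trivial if it is not a center. *)

theory Defs
  imports "HOL-Analysis.Analysis"
begin

section \<open>Surfaces\<close>

text \<open>The plane is modelled by \<^typ>\<open>complex\<close>, used throughout as a two-dimensional real vector space.\<close>

definition half_plane :: "complex set" where
  "half_plane = {z. Im z \<ge> 0}"

type_synonym 'a chart = "'a set \<times> ('a \<Rightarrow> complex)"

text \<open>Interior charts need no separate clause, since every open disk embeds as an open subset of the
  open half-plane.\<close>

definition chart :: "'a topology \<Rightarrow> 'a chart \<Rightarrow> bool" where
  "chart S c \<longleftrightarrow> (case c of (U, \<phi>) \<Rightarrow>
     openin S U \<and> openin (top_of_set half_plane) (\<phi> ` U) \<and>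
     homeomorphic_map (subtopology S U) (top_of_set (\<phi> ` U)) \<phi>)"

definition surface :: "'a topology \<Rightarrow> bool" where
  "surface S \<longleftrightarrow> Hausdorff_space S \<and> second_countable S \<and>
     (\<forall>p\<in>topspace S. \<exists>U \<phi>. chart S (U, \<phi>) \<and> p \<in> U)"

definition surface_boundary :: "'a topology \<Rightarrow> 'a set" where
  "surface_boundary S = {p. \<exists>U \<phi>. chart S (U, \<phi>) \<and> p \<in> U \<and> Im (\<phi> p) = 0}"

section \<open>Flows and topological equivalence\<close>

definition flow :: "'a topology \<Rightarrow> (real \<Rightarrow> 'a \<Rightarrow> 'a) \<Rightarrow> bool" where
  "flow S v \<longleftrightarrow>
     continuous_map (prod_topology euclideanreal S) S (\<lambda>(t, p). v t p) \<and>
     (\<forall>p\<in>topspace S. v 0 p = p) \<and>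
     (\<forall>p\<in>topspace S. \<forall>s t. v (s + t) p = v s (v t p))"

definition singular_points :: "'a topology \<Rightarrow> (real \<Rightarrow> 'a \<Rightarrow> 'a) \<Rightarrow> 'a set" where
  "singular_points S v = {p \<in> topspace S. \<forall>t. v t p = p}"

definition isolated_singular_point :: "'a topology \<Rightarrow> (real \<Rightarrow> 'a \<Rightarrow> 'a) \<Rightarrow> 'a \<Rightarrow> bool" where
  "isolated_singular_point S v x \<longleftrightarrow>
     (\<exists>U. openin S U \<and> U \<inter> singular_points S v = {x})"

text \<open>The orbit arc of \<open>p\<close> in the restriction of \<open>v\<close> to \<open>A\<close> is the image of the following time
  interval under \<open>\<lambda>t. v t p\<close>; for \<open>A = topspace S\<close> it is the whole orbit.\<close>

definition time_interval :: "(real \<Rightarrow> 'a \<Rightarrow> 'a) \<Rightarrow> 'a set \<Rightarrow> 'a \<Rightarrow> real set" where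
  "time_interval v A p = connected_component_set {t. v t p \<in> A} 0"

text \<open>A homeomorphism of \<open>A\<close> onto \<open>B\<close> that maps the orbit arcs of \<open>v\<close> in \<open>A\<close> onto the orbit arcs of
  \<open>w\<close> in \<open>B\<close> and preserves their directions. The increasing bijection \<open>\<tau>\<close> is the induced change of
  time; it also makes sense of directions on periodic orbits.\<close>

definition equivalence_on ::
  "'a topology \<Rightarrow> (real \<Rightarrow> 'a \<Rightarrow> 'a) \<Rightarrow> 'a set \<Rightarrow>
   'b topology \<Rightarrow> (real \<Rightarrow> 'b \<Rightarrow> 'b) \<Rightarrow> 'b set \<Rightarrow> ('a \<Rightarrow> 'b) \<Rightarrow> bool" where
  "equivalence_on S v A S' w B h \<longleftrightarrow>
     A \<subseteq> topspace S \<and> B \<subseteq> topspace S' \<and>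
     homeomorphic_map (subtopology S A) (subtopology S' B) h \<and>
     (\<forall>p\<in>A. \<exists>\<tau>::real \<Rightarrow> real.
        strict_mono_on (time_interval v A p) \<tau> \<and>
        \<tau> ` time_interval v A p = time_interval w B (h p) \<and> \<tau> 0 = 0 \<and>
        (\<forall>t\<in>time_interval v A p. h (v t p) = w (\<tau> t) (h p)))"

definition topologically_equivalent ::
  "'a topology \<Rightarrow> (real \<Rightarrow> 'a \<Rightarrow> 'a) \<Rightarrow> 'b topology \<Rightarrow> (real \<Rightarrow> 'b \<Rightarrow> 'b) \<Rightarrow> bool" where
  "topologically_equivalent S v S' w \<longleftrightarrow>
     (\<exists>h. equivalence_on S v (topspace S) S' w (topspace S') h)"

section \<open>Gradient flows\<close>

text \<open>On an open set, being of class \<open>C\<^sup>n\<close> is expressed by iterated partial derivatives.\<close>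

primrec Cn_on_open ::
  "nat \<Rightarrow> ('a::euclidean_space \<Rightarrow> 'b::real_normed_vector) \<Rightarrow> 'a set \<Rightarrow> bool" where
  "Cn_on_open 0 f W \<longleftrightarrow> continuous_on W f"
| "Cn_on_open (Suc n) f W \<longleftrightarrow>
     (\<forall>z\<in>W. f differentiable (at z)) \<and>
     (\<forall>i\<in>Basis. Cn_on_open n (\<lambda>z. frechet_derivative f (at z) i) W)"

text \<open>On an arbitrary set, class \<open>C\<^sup>r\<close> (with \<open>r = \<infinity>\<close> allowed) means that the function locally extends
  to a function of class \<open>C\<^sup>r\<close> on an open set of the ambient space, as usual for half-planes.\<close>

definition Cr_on ::
  "enat \<Rightarrow> ('a::euclidean_space \<Rightarrow> 'b::real_normed_vector) \<Rightarrow> 'a set \<Rightarrow> bool" where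
  "Cr_on r f V \<longleftrightarrow> (\<forall>z\<in>V. \<exists>W F. open W \<and> z \<in> W \<and>
     (\<forall>n. enat n \<le> r \<longrightarrow> Cn_on_open n F W) \<and> (\<forall>y\<in>V \<inter> W. F y = f y))"

definition transition :: "'a chart \<Rightarrow> 'a chart \<Rightarrow> complex \<Rightarrow> complex" where
  "transition c d = snd d \<circ> inv_into (fst c) (snd c)"

definition smooth_atlas :: "'a topology \<Rightarrow> 'a chart set \<Rightarrow> bool" where
  "smooth_atlas S \<A> \<longleftrightarrow>
     (\<forall>c\<in>\<A>. chart S c) \<and> (\<Union>c\<in>\<A>. fst c) = topspace S \<and>
     (\<forall>c\<in>\<A>. \<forall>d\<in>\<A>. Cr_on \<infinity> (transition c d) (snd c ` (fst c \<inter> fst d)))"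

text \<open>\<open>g c p a b\<close> is the value of the metric at \<open>p\<close> on the tangent vectors that have the coordinates
  \<open>a\<close> and \<open>b\<close> in the chart \<open>c\<close>. Derivatives are taken within the chart images, so that boundary
  points are covered.\<close>

definition riemannian_metric ::
  "'a chart set \<Rightarrow> ('a chart \<Rightarrow> 'a \<Rightarrow> complex \<Rightarrow> complex \<Rightarrow> real) \<Rightarrow> bool" where
  "riemannian_metric \<A> g \<longleftrightarrow>
     (\<forall>c\<in>\<A>. \<forall>p\<in>fst c. bilinear (g c p) \<and>
        (\<forall>a b. g c p a b = g c p b a) \<and> (\<forall>a. a \<noteq> 0 \<longrightarrow> g c p a a > 0)) \<and>
     (\<forall>c\<in>\<A>. \<forall>a b. Cr_on \<infinity> (\<lambda>z. g c (inv_into (fst c) (snd c) z) a b) (snd c ` fst c)) \<and>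
     (\<forall>c\<in>\<A>. \<forall>d\<in>\<A>. \<forall>p\<in>fst c \<inter> fst d. \<forall>D.
        (transition c d has_derivative D) (at (snd c p) within snd c ` (fst c \<inter> fst d)) \<longrightarrow>
        (\<forall>a b. g c p a b = g d p (D a) (D b)))"

text \<open>\<open>X c p\<close> is the coordinate vector of the field at \<open>p\<close> in the chart \<open>c\<close>. The last clause is
  \<open>df = g(X, -)\<close>, which determines \<open>X\<close> and hence its behaviour under changes of charts. For a
  function of class \<open>C\<^sup>1\<close> the field is continuous, so gradient fields of all classes \<open>C\<^sup>r\<close> with
  \<open>r \<ge> 0\<close> are covered.\<close>

definition gradient_vector_field ::
  "'a chart set \<Rightarrow> ('a chart \<Rightarrow> 'a \<Rightarrow> complex \<Rightarrow> complex \<Rightarrow> real) \<Rightarrow> ('a \<Rightarrow> real) \<Rightarrow>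
   ('a chart \<Rightarrow> 'a \<Rightarrow> complex) \<Rightarrow> bool" where
  "gradient_vector_field \<A> g f X \<longleftrightarrow>
     (\<forall>c\<in>\<A>. Cr_on 1 (f \<circ> inv_into (fst c) (snd c)) (snd c ` fst c)) \<and>
     (\<forall>c\<in>\<A>. \<forall>p\<in>fst c.
        ((f \<circ> inv_into (fst c) (snd c)) has_derivative g c p (X c p))
          (at (snd c p) within snd c ` fst c))"

text \<open>By the group law, it suffices to prescribe the velocity at time \<open>0\<close> of every orbit.\<close>

definition generates ::
  "'a chart set \<Rightarrow> ('a chart \<Rightarrow> 'a \<Rightarrow> complex) \<Rightarrow> (real \<Rightarrow> 'a \<Rightarrow> 'a) \<Rightarrow> bool" where
  "generates \<A> X w \<longleftrightarrow>
     (\<forall>c\<in>\<A>. \<forall>p\<in>fst c. ((\<lambda>t. snd c (w t p)) has_vector_derivative X c p) (at 0))"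

text \<open>A surface carrying an equivalent flow is homeomorphic to \<open>S\<close>, so letting \<open>S'\<close> range over
  topologies on the same type is no restriction.\<close>

definition gradient_flow :: "'a topology \<Rightarrow> (real \<Rightarrow> 'a \<Rightarrow> 'a) \<Rightarrow> bool" where
  "gradient_flow S v \<longleftrightarrow> flow S v \<and>
     (\<exists>(S' :: 'a topology) w \<A> g f X.
        surface S' \<and> smooth_atlas S' \<A> \<and> riemannian_metric \<A> g \<and>
        gradient_vector_field \<A> g f X \<and> flow S' w \<and> generates \<A> X w \<and>
        topologically_equivalent S v S' w)"

section \<open>Models of sectors\<close>

text \<open>The space \<open>B\<close> with one added point \<^term>\<open>None\<close> at that end of \<open>B\<close> where \<open>e\<close> tends to \<open>+\<infinity>\<close>: the
  sets containing some \<open>{p \<in> B. e p > c}\<close> are the punctured neighbourhoods of the new point. This is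
  not the one-point compactification, as \<open>B\<close> is also unbounded in other directions.\<close>

definition add_end :: "'b::topological_space set \<Rightarrow> ('b \<Rightarrow> real) \<Rightarrow> 'b option topology" where
  "add_end B e = topology (\<lambda>W. W \<subseteq> insert None (Some ` B) \<and>
     openin (top_of_set B) {p \<in> B. Some p \<in> W} \<and>
     (None \<in> W \<longrightarrow> (\<exists>c. \<forall>p\<in>B. e p > c \<longrightarrow> Some p \<in> W)))"

lemma openin_add_end:
  "openin (add_end B e) W \<longleftrightarrow> W \<subseteq> insert None (Some ` B) \<and>
     openin (top_of_set B) {p \<in> B. Some p \<in> W} \<and>
     (None \<in> W \<longrightarrow> (\<exists>c. \<forall>p\<in>B. e p > c \<longrightarrow> Some p \<in> W))"
proof -
  let ?P = "\<lambda>W. W \<subseteq> insert None (Some ` B) \<and>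
     openin (top_of_set B) {p \<in> B. Some p \<in> W} \<and>
     (None \<in> W \<longrightarrow> (\<exists>c. \<forall>p\<in>B. e p > c \<longrightarrow> Some p \<in> W))"
  have "istopology ?P"
    unfolding istopology_def
  proof (intro conjI allI impI)
    fix V W assume V: "?P V" and W: "?P W"
    have "{p \<in> B. Some p \<in> V \<inter> W} = {p \<in> B. Some p \<in> V} \<inter> {p \<in> B. Some p \<in> W}"
      by blast
    moreover have "\<exists>c. \<forall>p\<in>B. e p > c \<longrightarrow> Some p \<in> V \<inter> W" if "None \<in> V \<inter> W"
    proof -
      from that V W obtain c d where
        "\<forall>p\<in>B. e p > c \<longrightarrow> Some p \<in> V" "\<forall>p\<in>B. e p > d \<longrightarrow> Some p \<in> W"
        by blast
      then show ?thesis
        by (intro exI[of _ "max c d"]) auto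
    qed
    ultimately show "V \<inter> W \<subseteq> insert None (Some ` B)"
      and "openin (top_of_set B) {p \<in> B. Some p \<in> V \<inter> W}"
      and "None \<in> V \<inter> W \<Longrightarrow> \<exists>c. \<forall>p\<in>B. e p > c \<longrightarrow> Some p \<in> V \<inter> W"
      using V W by (blast, metis (no_types, lifting) openin_Int, blast)
  next
    fix \<K> assume K: "\<forall>K\<in>\<K>. ?P K"
    have "{p \<in> B. Some p \<in> \<Union>\<K>} = (\<Union>K\<in>\<K>. {p \<in> B. Some p \<in> K})"
      by blast
    then show "openin (top_of_set B) {p \<in> B. Some p \<in> \<Union>\<K>}"
      using K by (metis (no_types, lifting) openin_Union imageE)
    show "\<Union>\<K> \<subseteq> insert None (Some ` B)"
      using K by blast
    assume "None \<in> \<Union>\<K>"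
    then show "\<exists>c. \<forall>p\<in>B. e p > c \<longrightarrow> Some p \<in> \<Union>\<K>"
      using K by (meson UnionE UnionI)
  qed
  then show ?thesis
    by (simp add: add_end_def topology_inverse')
qed

lemma topspace_add_end [simp]: "topspace (add_end B e) = insert None (Some ` B)"
proof -
  have "{p \<in> B. Some p \<in> insert None (Some ` B)} = B"
    by auto
  then have "openin (add_end B e) (insert None (Some ` B))"
    unfolding openin_add_end by auto
  then show ?thesis
    by (metis openin_add_end openin_subset openin_topspace subset_antisym)
qed

text \<open>Extension of a flow by a fixed point \<^term>\<open>None\<close>.\<close>

definition add_fixed_point :: "(real \<Rightarrow> 'b \<Rightarrow> 'b) \<Rightarrow> real \<Rightarrow> 'b option \<Rightarrow> 'b option" where
  "add_fixed_point w t = map_option (w t)"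

definition translation_flow :: "real \<Rightarrow> real \<times> real \<Rightarrow> real \<times> real" where
  "translation_flow t = (\<lambda>(s, y). (s + t, y))"

text \<open>The flow of the vector field \<open>(cos \<theta>, sin \<theta>)\<close> on the strip \<open>\<bar>\<theta>\<bar> \<le> \<pi>/2\<close>, written in the coordinate
  \<open>s = sin \<theta>\<close>. Its orbits in \<open>[-1, 1] \<times> \<real>\<close> are the line \<open>s = -1\<close> (downwards), the line \<open>s = 1\<close>
  (upwards), and the vertical translates of the graph of \<open>- ln (1 - s\<^sup>2) / 2\<close> over \<open>(-1, 1)\<close>, i.e.
  they form a Reeb component.\<close>

definition reeb_flow :: "real \<Rightarrow> real \<times> real \<Rightarrow> real \<times> real" where
  "reeb_flow t = (\<lambda>(s, y). ((s * cosh t + sinh t) / (cosh t + s * sinh t),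
                            y + ln (cosh t + s * sinh t)))"

section \<open>Sectors and finitely sectored singular points\<close>

definition nondegenerate_interval :: "real set \<Rightarrow> bool" where
  "nondegenerate_interval I \<longleftrightarrow> is_interval I \<and> (\<exists>a\<in>I. \<exists>b\<in>I. a < b)"

definition sector :: "'a topology \<Rightarrow> (real \<Rightarrow> 'a \<Rightarrow> 'a) \<Rightarrow> 'a \<Rightarrow> 'a set \<Rightarrow> bool" where
  "sector S v x A \<longleftrightarrow> x \<in> singular_points S v \<and> A \<subseteq> topspace S \<and> x \<notin> A \<and>
     (\<exists>I h. nondegenerate_interval I \<and> I \<subseteq> {0..<2 * pi} \<and>
        homeomorphic_map (subtopology S (insert x A))
          (top_of_set (insert 0 {rcis r \<theta> | r \<theta>. r \<in> {0<..<1} \<and> \<theta> \<in> I})) h \<and>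
        h x = 0)"

definition modelled_on ::
  "'a topology \<Rightarrow> (real \<Rightarrow> 'a \<Rightarrow> 'a) \<Rightarrow> 'a \<Rightarrow> 'a set \<Rightarrow>
   (real \<Rightarrow> 'b \<Rightarrow> 'b) \<Rightarrow> 'b::topological_space set \<Rightarrow> ('b \<Rightarrow> real) \<Rightarrow> bool" where
  "modelled_on S v x A w B e \<longleftrightarrow>
     (\<exists>h. equivalence_on S v (insert x A)
            (add_end B e) (add_fixed_point w) (topspace (add_end B e)) h \<and> h x = None)"

text \<open>The two alternatives correspond to the points \<open>(+\<infinity>, 0)\<close> and \<open>(-\<infinity>, 0)\<close>.\<close>

definition parabolic_sector :: "'a topology \<Rightarrow> (real \<Rightarrow> 'a \<Rightarrow> 'a) \<Rightarrow> 'a \<Rightarrow> 'a set \<Rightarrow> bool" where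
  "parabolic_sector S v x A \<longleftrightarrow> sector S v x A \<and>
     (\<exists>J. nondegenerate_interval J \<and>
        (modelled_on S v x A translation_flow (UNIV \<times> J) fst \<or>
         modelled_on S v x A translation_flow (UNIV \<times> J) (\<lambda>p. - fst p)))"

text \<open>The orbits in the interior of \<^const>\<open>reeb_flow\<close> have both ends at \<open>y \<rightarrow> +\<infinity>\<close>. Hence the point
  at infinity is at the opposite end for a hyperbolic sector and at this end for an elliptic one.\<close>

definition hyperbolic_sector :: "'a topology \<Rightarrow> (real \<Rightarrow> 'a \<Rightarrow> 'a) \<Rightarrow> 'a \<Rightarrow> 'a set \<Rightarrow> bool" where
  "hyperbolic_sector S v x A \<longleftrightarrow> sector S v x A \<and>
     modelled_on S v x A reeb_flow ({-1..1} \<times> UNIV) (\<lambda>p. - snd p)"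

definition elliptic_sector :: "'a topology \<Rightarrow> (real \<Rightarrow> 'a \<Rightarrow> 'a) \<Rightarrow> 'a \<Rightarrow> 'a set \<Rightarrow> bool" where
  "elliptic_sector S v x A \<longleftrightarrow> sector S v x A \<and>
     modelled_on S v x A reeb_flow ({-1<..<1} \<times> UNIV) snd"

definition orbit_arc :: "'a topology \<Rightarrow> (real \<Rightarrow> 'a \<Rightarrow> 'a) \<Rightarrow> 'a set \<Rightarrow> bool" where
  "orbit_arc S v C \<longleftrightarrow> (\<exists>p T. p \<in> topspace S \<and> nondegenerate_interval T \<and>
     inj_on (\<lambda>t. v t p) T \<and> C = (\<lambda>t. v t p) ` T)"

definition center :: "'a topology \<Rightarrow> (real \<Rightarrow> 'a \<Rightarrow> 'a) \<Rightarrow> 'a \<Rightarrow> bool" where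
  "center S v x \<longleftrightarrow> x \<in> singular_points S v \<and>
     (\<exists>N U h. openin S U \<and> x \<in> U \<and> U \<subseteq> N \<and> h x = 0 \<and>
        equivalence_on S v N euclidean (\<lambda>t z. cis t * z) (ball 0 1) h)"

definition sector_decomposition ::
  "'a topology \<Rightarrow> (real \<Rightarrow> 'a \<Rightarrow> 'a) \<Rightarrow> 'a \<Rightarrow> 'a set \<Rightarrow> 'a set set \<Rightarrow> bool" where
  "sector_decomposition S v x U \<S> \<longleftrightarrow>
     openin S U \<and> x \<in> U \<and>
     subtopology S U homeomorphic_space
       top_of_set (if x \<in> surface_boundary S then ball 0 1 \<inter> half_plane else ball 0 1) \<and>
     finite \<S> \<and> U = insert x (\<Union>\<S>) \<and>
     (\<forall>A\<in>\<S>. parabolic_sector S v x A \<or> hyperbolic_sector S v x A \<or> elliptic_sector S v x A) \<and>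
     (\<forall>A\<in>\<S>. \<forall>B\<in>\<S>. A \<noteq> B \<longrightarrow>
        (\<exists>\<C>. finite \<C> \<and> card \<C> \<le> 2 \<and> (\<forall>C\<in>\<C>. orbit_arc S v C) \<and> A \<inter> B = \<Union>\<C>))"

definition finitely_sectored :: "'a topology \<Rightarrow> (real \<Rightarrow> 'a \<Rightarrow> 'a) \<Rightarrow> 'a \<Rightarrow> bool" where
  "finitely_sectored S v x \<longleftrightarrow> x \<in> singular_points S v \<and>
     (center S v x \<or> (\<exists>U \<S>. sector_decomposition S v x U \<S>))"

definition nontrivial_finitely_sectored :: "'a topology \<Rightarrow> (real \<Rightarrow> 'a \<Rightarrow> 'a) \<Rightarrow> 'a \<Rightarrow> bool" where
  "nontrivial_finitely_sectored S v x \<longleftrightarrow> finitely_sectored S v x \<and> \<not> center S v x"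

end

theory Submission
 imports Defs "HOL-Complex_Analysis.Complex_Analysis"
begin

text \<open>The Lyapunov function \<open>F\<close> of a gradient flow increases strictly along nonconstant orbits, which excludes
elliptic sectors and centers. Near \<open>x\<close>, parametrise the orbits by the values of \<open>f = F - F x\<close>. The level sets of \<open>f\<close>
off \<open>x\<close> are one-dimensional; let \<open>C\<close> be the compact set of points of level \<open>-\<epsilon>\<close> whose orbits tend to \<open>x\<close>.
A gap of \<open>C\<close> inside a short arc of the level set would produce a closed curve of level \<open>0\<close> around a local
extremum of \<open>f\<close>, against the maximum principle. So \<open>C\<close> is covered by finitely many arcs that lie in \<open>C\<close> or meet it
in one end: the orbits from the former make up parabolic sectors, those from the latter hyperbolic sectors that
end with orbits emanating from \<open>x\<close>; level \<open>\<epsilon>\<close> is treated likewise. The union of \<open>x\<close> and these orbits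
contracts to \<open>x\<close> along the flow, so by the Riemann mapping theorem it is a disk, and a half-disk at a boundary
point, where the Riemann map of the doubled neighborhood is taken equivariant under conjugation.\<close>

section \<open>Sequences and relative topologies\<close>

text \<open>The gradient field is merely continuous and the given flow is only topologically
  equivalent to its flow, so neither time nor smooth coordinates survive. The values of
  \<open>f\<close> do: they order each orbit, and flowing from one level to another is canonical.
  Continuity has a price. A zero of the gradient need not be a rest point, so a nonconstant orbit
  may pass through critical points, where the level set has no chart from the inverse function
  theorem. But every orbit has noncritical points at arbitrarily small times, and the flow carries a
  level arc from there to any other level of the orbit. A priori the stable set could meet level
  \<open>-\<epsilon>\<close> in any compact set, a Cantor set for instance; excluding gaps is what
  makes the number of sectors finite. The closed half-plane is the only local model: an interior
  point is one whose disk stays in the open half-plane. The sector models concern complete orbits of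
  the surface, which may leave the chart. Strict growth of the Lyapunov function is used once more
  to show that an orbit which has left a sector does not come back into it.\<close>

lemma openin_eventually_sequentially:
 fixes x :: "nat \<Rightarrow> 'a::metric_space"
 assumes "openin (top_of_set X) A" "a \<in> A" "x \<longlonglongrightarrow> a" "\<forall>\<^sub>F n in sequentially. x n \<in> X"
 shows "\<forall>\<^sub>F n in sequentially. x n \<in> A"
proof -
 obtain W where W: "open W" "A = X \<inter> W" using assms(1) by (auto simp: openin_open)
 hence "\<forall>\<^sub>F n in sequentially. x n \<in> W" using assms(2,3) by (auto dest: topological_tendstoD)
 with assms(4) show ?thesis by eventually_elim (use W in auto)
qed

lemma not_openin_sequenceE:
 fixes X :: "'a::metric_space set"
 assumes "\<not> openin (top_of_set X) A" "A \<subseteq> X"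
 obtains x a where "a \<in> A" "x \<longlonglongrightarrow> a" "\<And>n. x n \<in> X - A"
proof -
 obtain a where a: "a \<in> A" "\<And>e. e > 0 \<Longrightarrow> \<exists>y\<in>X. dist y a < e \<and> y \<notin> A"
  using assms by (auto simp: openin_euclidean_subtopology_iff)
 have "\<exists>y\<in>X - A. dist y a < 1 / real (Suc n)" for n using a(2)[of "1 / real (Suc n)"] by auto
 then obtain x where x: "\<And>n. x n \<in> X - A" "\<And>n. dist (x n) a < 1 / real (Suc n)" by metis
 have "(\<lambda>n. dist (x n) a) \<longlonglongrightarrow> 0"
 proof (rule tendsto_sandwich[OF _ _ tendsto_const])
  show "(\<lambda>n. 1 / real (Suc n)) \<longlonglongrightarrow> 0" using LIMSEQ_inverse_real_of_nat by (simp add: inverse_eq_divide)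
  show "\<forall>\<^sub>F n in sequentially. dist (x n) a \<le> 1 / real (Suc n)"
   using x(2) by (intro always_eventually allI less_imp_le)
 qed auto
 thus thesis using that a(1) x(1) tendsto_dist_iff by blast
qed

text \<open>The pattern for continuity at the singular point: the sector charts take values in the
  compact \<open>K\<close>, where it is enough to identify the cluster points.\<close>

lemma compact_tendsto_unique:
 fixes x :: "nat \<Rightarrow> 'a::metric_space"
 assumes "compact K" "\<forall>\<^sub>F n in sequentially. x n \<in> K"
  and "\<And>r l. strict_mono (r::nat \<Rightarrow> nat) \<Longrightarrow> (x \<circ> r) \<longlonglongrightarrow> l \<Longrightarrow> l \<in> K \<Longrightarrow> l = a"
 shows "x \<longlonglongrightarrow> a"
proof (rule ccontr)
 assume "\<not> x \<longlonglongrightarrow> a"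
 then obtain e where e: "e > 0" "\<exists>\<^sub>F n in sequentially. dist (x n) a \<ge> e"
  by (auto simp: tendsto_iff frequently_def not_le)
 hence "\<exists>\<^sub>F n in sequentially. dist (x n) a \<ge> e \<and> x n \<in> K"
  using assms(2) frequently_eventually_frequently by fastforce
 hence "infinite {n. dist (x n) a \<ge> e \<and> x n \<in> K}" by (simp add: INFM_iff_infinite flip: cofinite_eq_sequentially)
 then obtain s where s: "strict_mono (s::nat \<Rightarrow> nat)" "\<And>n. dist (x (s n)) a \<ge> e \<and> x (s n) \<in> K"
  using infinite_enumerate by blast
 from s(2) have "\<forall>n. (x \<circ> s) n \<in> K" by simp
 then obtain l r where l: "l \<in> K" "strict_mono (r::nat \<Rightarrow> nat)" "((x \<circ> s) \<circ> r) \<longlonglongrightarrow> l"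
  using \<open>compact K\<close> unfolding compact_def by blast
 hence "l = a" using assms(3)[of "s \<circ> r" l] s(1) by (simp add: strict_mono_o o_assoc)
 with l(3) have "\<forall>\<^sub>F n in sequentially. dist ((x \<circ> s \<circ> r) n) a < e" using e(1) tendstoD by blast
 thus False using s(2) by (auto simp: eventually_sequentially not_less)
    (meson le_refl not_less)
qed

lemma frequently_subsequenceE:
 assumes "\<exists>\<^sub>F n in sequentially. P n"
 obtains r where "strict_mono (r::nat \<Rightarrow> nat)" "\<And>n. P (r n)"
proof -
 have "infinite {n. P n}" using assms by (simp add: INFM_iff_infinite flip: cofinite_eq_sequentially)
 thus thesis using infinite_enumerate that by blast
qed

section \<open>Flows parametrised by a Lyapunov function\<close>

text \<open>The one-sided case \<open>J = {0..1}\<close> is that of a point on the boundary of the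
  surface, where the level set ends. The last clause is imposed for all small \<open>e\<close>: the
  images of \<open>\<bar>s\<bar> < e\<close> then form a neighborhood base of \<open>p\<close> in
  its level set, and the notion survives shrinking \<open>T\<close>.\<close>

definition level_arc :: "'a topology \<Rightarrow> ('a \<Rightarrow> real) \<Rightarrow> 'a \<Rightarrow> bool" where
 "level_arc T f p \<longleftrightarrow> (\<exists>\<sigma> J. (J = {-1..1::real} \<or> J = {0..1}) \<and>
   continuous_map (top_of_set J) T \<sigma> \<and> inj_on \<sigma> J \<and> \<sigma> 0 = p \<and> (\<forall>s\<in>J. f (\<sigma> s) = f p) \<and>
   (\<forall>e. 0 < e \<and> e \<le> 1 \<longrightarrow> (\<exists>W. openin T W \<and> {y \<in> W. f y = f p} = \<sigma> ` {s\<in>J. \<bar>s\<bar> < e})))"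

lemma symmetric_interval_scale:
 assumes J: "J = {-1..1::real} \<or> J = {0..1}" and d: "0 < d" "d \<le> 1" and e: "e \<le> 1"
 shows "{s\<in>J. \<bar>s\<bar> < d * e} = (\<lambda>s. d * s) ` {s\<in>J. \<bar>s\<bar> < e}" "s \<in> J \<Longrightarrow> d * s \<in> J \<and> \<bar>d * s\<bar> \<le> d"
proof -
 have dJ: "d * s \<in> J \<and> \<bar>d * s\<bar> \<le> d" if "s \<in> J" for s
 proof -
  have "\<bar>s\<bar> \<le> 1" using that J by auto
  hence *: "\<bar>d * s\<bar> \<le> d" using d(1) by (simp add: abs_mult mult_left_le)
  hence "d * s \<le> 1" "- 1 \<le> d * s" using d(2) by linarith+
  thus ?thesis using * J that d by (auto simp: zero_le_mult_iff)
 qed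
 thus "s \<in> J \<Longrightarrow> d * s \<in> J \<and> \<bar>d * s\<bar> \<le> d" .
 show "{s\<in>J. \<bar>s\<bar> < d * e} = (\<lambda>s. d * s) ` {s\<in>J. \<bar>s\<bar> < e}"
 proof
  show "(\<lambda>s. d * s) ` {s\<in>J. \<bar>s\<bar> < e} \<subseteq> {s\<in>J. \<bar>s\<bar> < d * e}" using dJ d(1) by (auto simp: abs_mult)
  show "{s\<in>J. \<bar>s\<bar> < d * e} \<subseteq> (\<lambda>s. d * s) ` {s\<in>J. \<bar>s\<bar> < e}"
  proof
   fix s assume s: "s \<in> {s\<in>J. \<bar>s\<bar> < d * e}"
   hence "\<bar>s / d\<bar> < e" using d(1) by (simp add: field_simps)
   moreover from this have "-1 \<le> s / d" "s / d \<le> 1" using e by linarith+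
   moreover have "0 \<le> s \<Longrightarrow> 0 \<le> s / d" using d(1) by simp
   ultimately show "s \<in> (\<lambda>s. d * s) ` {s\<in>J. \<bar>s\<bar> < e}" using s J d(1) by (intro image_eqI[of _ _ "s / d"]) auto
  qed
 qed
qed

lemma level_arc_open_subset:
 assumes la: "level_arc S f p" and Op: "openin S O'" "p \<in> O'"
 shows "level_arc (subtopology S O') f p"
proof -
 obtain \<sigma> J where J: "J = {-1..1::real} \<or> J = {0..1}"
  and \<sigma>: "continuous_map (top_of_set J) S \<sigma>" "inj_on \<sigma> J" "\<sigma> 0 = p" "\<forall>s\<in>J. f (\<sigma> s) = f p"
  and W: "\<forall>e. 0 < e \<and> e \<le> 1 \<longrightarrow> (\<exists>W. openin S W \<and> {y \<in> W. f y = f p} = \<sigma> ` {s\<in>J. \<bar>s\<bar> < e})"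
  using la unfolding level_arc_def by blast
 have "openin (top_of_set J) {s \<in> topspace (top_of_set J). \<sigma> s \<in> O'}"
  by (rule openin_continuous_map_preimage[OF \<sigma>(1) Op(1)])
 moreover have "0 \<in> {s \<in> topspace (top_of_set J). \<sigma> s \<in> O'}" using J \<sigma>(3) Op(2) by auto
 ultimately obtain r where r: "r > 0" "\<forall>s\<in>J. dist s 0 < r \<longrightarrow> s \<in> {s \<in> topspace (top_of_set J). \<sigma> s \<in> O'}"
  unfolding openin_euclidean_subtopology_iff by blast
 \<comment> \<open>Strictly below \<open>r\<close>, so that the parameters with
   \<open>\<bar>s\<bar> \<le> d\<close>, end points included, are mapped into
   \<open>O'\<close>.\<close>
 define d where "d = min 1 (r / 2)"
 have d: "0 < d" "d \<le> 1" "d < r" using r(1) by (auto simp: d_def)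
 have dJ: "d * s \<in> J" "\<bar>d * s\<bar> \<le> d" if "s \<in> J" for s
  using symmetric_interval_scale(2)[OF J d(1,2) order_refl that] by auto
 have \<sigma>O: "\<sigma> (d * s) \<in> O'" if "s \<in> J" for s using r(2) dJ[OF that] d(3) by (auto simp: dist_real_def)
 show ?thesis unfolding level_arc_def
 proof (intro exI[of _ "\<lambda>s. \<sigma> (d * s)"] exI[of _ J] conjI allI impI)
  show "J = {-1..1} \<or> J = {0..1}" by (rule J)
  have "continuous_map (top_of_set J) (top_of_set J) (\<lambda>s. d * s)" using dJ(1) by (auto intro!: continuous_intros)
  hence "continuous_map (top_of_set J) S (\<sigma> \<circ> (\<lambda>s. d * s))" using \<sigma>(1) by (rule continuous_map_compose)
  thus "continuous_map (top_of_set J) (subtopology S O') (\<lambda>s. \<sigma> (d * s))"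
   using \<sigma>O by (auto simp: continuous_map_in_subtopology o_def)
  show "inj_on (\<lambda>s. \<sigma> (d * s)) J" using inj_onD[OF \<sigma>(2)] dJ(1) d(1) by (force intro!: inj_onI)
  show "\<sigma> (d * 0) = p" using \<sigma>(3) by simp
  show "\<forall>s\<in>J. f (\<sigma> (d * s)) = f p" using \<sigma>(4) dJ(1) by blast
  fix e :: real assume e: "0 < e \<and> e \<le> 1"
  have "d * e \<le> 1" using d e by (simp add: mult_le_one)
  then obtain W where W: "openin S W" "{y \<in> W. f y = f p} = \<sigma> ` {s\<in>J. \<bar>s\<bar> < d * e}"
   using W d(1) e by (meson mult_pos_pos)
  have "{y \<in> O' \<inter> W. f y = f p} = {y \<in> W. f y = f p} \<inter> O'" by blast
  also have "\<dots> = (\<lambda>s. \<sigma> (d * s)) ` {s\<in>J. \<bar>s\<bar> < e}"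
   unfolding W(2) symmetric_interval_scale(1)[OF J d(1,2) conjunct2[OF e]] image_image using \<sigma>O by auto
  finally show "\<exists>W. openin (subtopology S O') W \<and> {y \<in> W. f y = f p} = (\<lambda>s. \<sigma> (d * s)) ` {s\<in>J. \<bar>s\<bar> < e}"
   using openin_subtopology_Int2[OF W(1)] by blast
 qed
qed

text \<open>\<open>I z\<close> stands for the set of levels on the orbit arc of \<open>z\<close> in
  the punctured half-disk, and \<open>\<Psi> c z\<close> for the point of that arc at level
  \<open>c\<close>. The axioms keep of the flow only what this parametrisation shows.
  \<open>level_arcs0\<close> asks for an arc at one level of each orbit, because other points of the
  orbit may be critical.\<close>

locale level_flow =
 fixes x0 :: complex and R :: real and f :: "complex \<Rightarrow> real"
  and I :: "complex \<Rightarrow> real set" and \<Psi> :: "real \<Rightarrow> complex \<Rightarrow> complex"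
 assumes x0_half_plane: "x0 \<in> half_plane"
  and R_pos: "R > 0"
  and continuous_f: "continuous_on (ball x0 R \<inter> half_plane) f"
  and f_x0: "f x0 = 0"
  and level_mem0: "\<And>z. z \<in> ball x0 R \<inter> half_plane - {x0} \<Longrightarrow> f z \<in> I z"
  and levels_interval0: "\<And>z. z \<in> ball x0 R \<inter> half_plane - {x0} \<Longrightarrow> is_interval (I z)"
  and \<Psi>_mem0: "\<And>z c. z \<in> ball x0 R \<inter> half_plane - {x0} \<Longrightarrow> c \<in> I z \<Longrightarrow>
          \<Psi> c z \<in> ball x0 R \<inter> half_plane - {x0}"
  and f_\<Psi>0: "\<And>z c. z \<in> ball x0 R \<inter> half_plane - {x0} \<Longrightarrow> c \<in> I z \<Longrightarrow> f (\<Psi> c z) = c"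
  and \<Psi>_self0: "\<And>z. z \<in> ball x0 R \<inter> half_plane - {x0} \<Longrightarrow> \<Psi> (f z) z = z"
  and levels_\<Psi>0: "\<And>z c. z \<in> ball x0 R \<inter> half_plane - {x0} \<Longrightarrow> c \<in> I z \<Longrightarrow> I (\<Psi> c z) = I z"
  and \<Psi>_\<Psi>0: "\<And>z c d. z \<in> ball x0 R \<inter> half_plane - {x0} \<Longrightarrow> c \<in> I z \<Longrightarrow> d \<in> I z \<Longrightarrow>
          \<Psi> d (\<Psi> c z) = \<Psi> d z"
  and open_levels0: "openin (top_of_set (UNIV \<times> (ball x0 R \<inter> half_plane - {x0})))
            {(c, z). z \<in> ball x0 R \<inter> half_plane - {x0} \<and> c \<in> I z}"
  and continuous_\<Psi>0: "continuous_on {(c, z). z \<in> ball x0 R \<inter> half_plane - {x0} \<and> c \<in> I z}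
             (\<lambda>(c, z). \<Psi> c z)"
  and level_arcs0: "\<And>z. z \<in> ball x0 R \<inter> half_plane - {x0} \<Longrightarrow>
     \<exists>c\<in>I z. level_arc (top_of_set (ball x0 R \<inter> half_plane - {x0})) f (\<Psi> c z)"
begin

definition V where "V = ball x0 R \<inter> half_plane - {x0}"

lemmas level_mem = level_mem0[folded V_def]
lemmas levels_interval = levels_interval0[folded V_def]
lemmas \<Psi>_mem = \<Psi>_mem0[folded V_def]
lemmas f_\<Psi> = f_\<Psi>0[folded V_def]
lemmas \<Psi>_self = \<Psi>_self0[folded V_def]
lemmas levels_\<Psi> = levels_\<Psi>0[folded V_def]
lemmas \<Psi>_\<Psi> = \<Psi>_\<Psi>0[folded V_def]
lemmas open_levels = open_levels0[folded V_def]
lemmas continuous_\<Psi> = continuous_\<Psi>0[folded V_def]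
lemmas level_arcs = level_arcs0[folded V_def]

abbreviation dom where "dom \<equiv> {(c, z). z \<in> V \<and> c \<in> I z}"

text \<open>The halved radius leaves room: a limit of points of \<open>K\<close> is again in
  \<open>K\<close>, hence it is \<open>x0\<close> or a point of \<open>V\<close>, where
  \<open>\<Psi>\<close> is continuous.\<close>

definition K where "K = cball x0 (R / 2) \<inter> half_plane"

lemma K_subset: "K - {x0} \<subseteq> V" using R_pos by (auto simp: K_def V_def dist_commute)

lemma V_subset: "V \<subseteq> ball x0 R \<inter> half_plane" and x0_notin_V: "x0 \<notin> V" by (auto simp: V_def)

lemma compact_K: "compact K"
proof -
 have "closed half_plane" unfolding half_plane_def using closed_halfspace_Im_ge[of 0] by simp
 thus ?thesis unfolding K_def by (intro compact_Int_closed) auto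
qed

lemma convex_K: "convex K" unfolding K_def half_plane_def using convex_halfspace_Im_ge[of 0]
 by (intro convex_Int) auto

lemma continuous_f_K: "continuous_on K f"
 by (rule continuous_on_subset[OF continuous_f]) (use R_pos in \<open>auto simp: K_def dist_commute\<close>)

lemma tendsto_f:
 assumes "z \<longlonglongrightarrow> z'" "\<And>n. z n \<in> ball x0 R \<inter> half_plane" "z' \<in> ball x0 R \<inter> half_plane"
 shows "(\<lambda>n. f (z n)) \<longlonglongrightarrow> f z'" using continuous_f assms by (auto simp: continuous_on_sequentially o_def)

lemma tendsto_f_K:
 assumes "z \<longlonglongrightarrow> z'" "\<And>n. z n \<in> K"
 shows "z' \<in> K" "(\<lambda>n. f (z n)) \<longlonglongrightarrow> f z'"
proof -
 show "z' \<in> K" using closed_sequentially[OF compact_imp_closed[OF compact_K]] assms by blast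
 thus "(\<lambda>n. f (z n)) \<longlonglongrightarrow> f z'" using continuous_f_K assms by (auto simp: continuous_on_sequentially o_def)
qed

lemma tendsto_\<Psi>:
 assumes "z \<in> V" "c \<in> I z" "zs \<longlonglongrightarrow> z" "cs \<longlonglongrightarrow> c" "\<forall>\<^sub>F n in sequentially. zs n \<in> V"
 shows "\<forall>\<^sub>F n in sequentially. cs n \<in> I (zs n)" "(\<lambda>n. \<Psi> (cs n) (zs n)) \<longlonglongrightarrow> \<Psi> c z"
proof -
 have lim: "(\<lambda>n. (cs n, zs n)) \<longlonglongrightarrow> (c, z)" using assms by (intro tendsto_Pair)
 have ev: "\<forall>\<^sub>F n in sequentially. (cs n, zs n) \<in> dom" by (rule openin_eventually_sequentially[OF open_levels _ lim])
    (use assms in \<open>auto elim: eventually_mono\<close>)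
 thus "\<forall>\<^sub>F n in sequentially. cs n \<in> I (zs n)" by (auto elim: eventually_mono)
 have "((\<lambda>(c, z). \<Psi> c z) \<longlongrightarrow> \<Psi> c z) (at (c, z) within dom)" using continuous_\<Psi> assms by (auto simp: continuous_on_def)
 hence "((\<lambda>n. (\<lambda>(c, z). \<Psi> c z) (cs n, zs n)) \<longlongrightarrow> (\<lambda>(c, z). \<Psi> c z) (c, z)) sequentially" using assms
  by (intro continuous_on_tendsto_compose[OF continuous_\<Psi> lim _ ev]) auto
 thus "(\<lambda>n. \<Psi> (cs n) (zs n)) \<longlonglongrightarrow> \<Psi> c z" by simp
qed

lemma levels_mem_interval: "z \<in> V \<Longrightarrow> a \<in> I z \<Longrightarrow> b \<in> I z \<Longrightarrow> a \<le> c \<Longrightarrow> c \<le> b \<Longrightarrow> c \<in> I z"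
 using levels_interval mem_is_interval_1_I by blast

lemma levels_open:
 assumes "z \<in> V" "c \<in> I z"
 obtains e where "e > 0" "c - e \<in> I z" "c + e \<in> I z"
proof -
 have t: "(\<lambda>n. c + 1 / real (Suc n)) \<longlonglongrightarrow> c + 0" "(\<lambda>n. c - 1 / real (Suc n)) \<longlonglongrightarrow> c - 0" using LIMSEQ_inverse_real_of_nat
  by (intro tendsto_intros; simp add: inverse_eq_divide)+
 have "\<forall>\<^sub>F n in sequentially. c + 1 / real (Suc n) \<in> I z"
  "\<forall>\<^sub>F n in sequentially. c - 1 / real (Suc n) \<in> I z"
  using tendsto_\<Psi>(1)[OF assms tendsto_const, of "\<lambda>n. c + 1 / real (Suc n)"] t
   tendsto_\<Psi>(1)[OF assms tendsto_const, of "\<lambda>n. c - 1 / real (Suc n)"] assms by auto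
 hence "\<forall>\<^sub>F n in sequentially. c + 1 / real (Suc n) \<in> I z \<and> c - 1 / real (Suc n) \<in> I z" by eventually_elim auto
 then obtain n where "c + 1 / real (Suc n) \<in> I z \<and> c - 1 / real (Suc n) \<in> I z"
  by (auto simp: eventually_sequentially)
 thus thesis by (intro that[of "1 / real (Suc n)"]) auto
qed

lemma \<Psi>_eqD:
 assumes "z \<in> V" "c \<in> I z" "z' \<in> V" "c' \<in> I z'" "\<Psi> c z = \<Psi> c' z'"
 shows "c = c'" "I z = I z'" "d \<in> I z \<Longrightarrow> \<Psi> d z = \<Psi> d z'"
proof -
 show "c = c'" using f_\<Psi> assms by metis
 show "I z = I z'" using levels_\<Psi> assms by metis
 thus "\<Psi> d z = \<Psi> d z'" if "d \<in> I z" using \<Psi>_\<Psi> assms that by metis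
qed

lemma \<Psi>_sym:
 assumes "z \<in> V" "c \<in> I z" shows "\<Psi> (f z) (\<Psi> c z) = z" "f z \<in> I (\<Psi> c z)"
 using assms \<Psi>_\<Psi> \<Psi>_self level_mem levels_\<Psi> by auto

text \<open>Time reversal negates \<open>f\<close>, the levels and the parameter of
  \<open>\<Psi>\<close>. It interchanges the stable and the unstable side, so statements are proved
  for one side and transferred through this instance.\<close>

lemma reversed:
 "level_flow x0 R (\<lambda>z. - f z) (\<lambda>z. uminus ` I z) (\<lambda>c. \<Psi> (- c))"
proof (unfold_locales, fold V_def)
 show "x0 \<in> half_plane" "R > 0" by (fact x0_half_plane R_pos)+
 show "continuous_on (ball x0 R \<inter> half_plane) (\<lambda>z. - f z)" by (intro continuous_intros continuous_f)
 show "- f x0 = 0" using f_x0 by simp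
 show "- f z \<in> uminus ` I z" if "z \<in> V" for z using level_mem that by auto
 show "is_interval (uminus ` I z)" if "z \<in> V" for z using levels_interval[OF that] by (simp add: is_interval_uminus)
 show "\<Psi> (- c) z \<in> V" if "z \<in> V" "c \<in> uminus ` I z" for z c using that \<Psi>_mem by force
 show "- f (\<Psi> (- c) z) = c" if "z \<in> V" "c \<in> uminus ` I z" for z c using that f_\<Psi> by force
 show "\<Psi> (- (- f z)) z = z" if "z \<in> V" for z using that \<Psi>_self by simp
 show "uminus ` I (\<Psi> (- c) z) = uminus ` I z" if "z \<in> V" "c \<in> uminus ` I z" for z c using that levels_\<Psi> by force
 show "\<Psi> (- d) (\<Psi> (- c) z) = \<Psi> (- d) z" if "z \<in> V" "c \<in> uminus ` I z" "d \<in> uminus ` I z" for z c d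
  using that \<Psi>_\<Psi> by force
 let ?D = "{(c, z). z \<in> V \<and> c \<in> uminus ` I z}"
 let ?m = "\<lambda>p::real \<times> complex. (- fst p, snd p)"
 have D: "?D = (UNIV \<times> V) \<inter> ?m -` dom" by force
 have m: "continuous_on A ?m" for A by (intro continuous_intros)
 show "openin (top_of_set (UNIV \<times> V)) ?D" unfolding D by (rule continuous_openin_preimage[OF m _ open_levels]) auto
 have "continuous_on ?D ((\<lambda>(c, z). \<Psi> c z) \<circ> ?m)"
  by (rule continuous_on_compose[OF m continuous_on_subset[OF continuous_\<Psi>]]) (use D in auto)
 thus "continuous_on ?D (\<lambda>(c, z). \<Psi> (- c) z)" by (simp add: o_def case_prod_unfold)
 show "\<exists>c\<in>uminus ` I z. level_arc (top_of_set V) (\<lambda>z. - f z) (\<Psi> (- c) z)" if "z \<in> V" for z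
  using level_arcs[OF that] by (simp add: level_arc_def)
qed

end

section \<open>Stable and unstable sets of the singular point\<close>

context level_flow
begin

text \<open>Staying in \<open>K\<close> takes the place of convergence to \<open>x0\<close>: it is
  inherited by limits other than \<open>x0\<close>, and \<open>Ws_aux\<close> shows that it forces
  convergence.\<close>

definition Ws where "Ws = {z \<in> K - {x0}. \<forall>c\<in>I z. f z \<le> c \<longrightarrow> \<Psi> c z \<in> K}"
definition Wu where "Wu = {z \<in> K - {x0}. \<forall>c\<in>I z. c \<le> f z \<longrightarrow> \<Psi> c z \<in> K}"

lemma reversed_Ws: "level_flow.Ws x0 R (\<lambda>z. - f z) (\<lambda>z. uminus ` I z) (\<lambda>c. \<Psi> (- c)) = Wu"
 unfolding level_flow.Ws_def[OF reversed] Wu_def by auto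

lemma reversed_Wu: "level_flow.Wu x0 R (\<lambda>z. - f z) (\<lambda>z. uminus ` I z) (\<lambda>c. \<Psi> (- c)) = Ws"
 unfolding level_flow.Wu_def[OF reversed] Ws_def by auto

lemma Ws_V: "z \<in> Ws \<Longrightarrow> z \<in> V" and Ws_K: "z \<in> Ws \<Longrightarrow> z \<in> K"
 and Wu_V: "z \<in> Wu \<Longrightarrow> z \<in> V" and Wu_K: "z \<in> Wu \<Longrightarrow> z \<in> K" using K_subset by (auto simp: Ws_def Wu_def)

text \<open>The levels of the orbit are bounded above, as \<open>f\<close> is bounded on
  \<open>K\<close>; let \<open>w\<close> be their supremum. A cluster point other than
  \<open>x0\<close> of the orbit towards level \<open>w\<close> would lie in \<open>V\<close> at
  level \<open>w\<close>. Since the domain of \<open>\<Psi>\<close> is open, \<open>w\<close> would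
  be a level of nearby points of the orbit, whose levels are those of \<open>z\<close>; but a
  supremum of an open set of levels is not attained. So the only cluster point is \<open>x0\<close>,
  and \<open>w = f x0 = 0\<close>.\<close>

lemma Ws_aux:
 assumes z: "z \<in> Ws"
 shows "Sup (I z) = 0" "0 \<notin> I z" "bdd_above (I z)"
  "\<And>cs. cs \<longlonglongrightarrow> 0 \<Longrightarrow> (\<And>n. cs n \<in> I z) \<Longrightarrow> (\<And>n. cs n \<ge> f z) \<Longrightarrow> (\<lambda>n. \<Psi> (cs n) z) \<longlonglongrightarrow> x0"
proof -
 have V: "z \<in> V" using Ws_V z by blast
 have fK: "bounded (f ` K)" using compact_K continuous_f_K compact_continuous_image compact_imp_bounded by blast
 then obtain B where B: "\<And>y. y \<in> K \<Longrightarrow> \<bar>f y\<bar> \<le> B" by (auto simp: bounded_iff)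
 have "c \<le> B" if "c \<in> I z" for c
 proof (cases "f z \<le> c")
  case True
  hence "\<Psi> c z \<in> K" using z that by (auto simp: Ws_def)
  thus ?thesis using B f_\<Psi>[OF V that] by fastforce
 next
  case False
  thus ?thesis using B[of z] z by (auto simp: Ws_def)
 qed
 thus bdd: "bdd_above (I z)" by (auto simp: bdd_above_def)
 define w where "w = Sup (I z)"
 have le_w: "c \<le> w" if "c \<in> I z" for c unfolding w_def using bdd that by (simp add: cSup_upper)
 have w_notin: "w \<notin> I z"
 proof
  assume "w \<in> I z"
  then obtain e where "e > 0" "w + e \<in> I z" using levels_open[OF V] by blast
  thus False using le_w[of "w + e"] by simp
 qed
 have mem: "f z \<in> I z" using level_mem V by blast
 have lim: "(\<lambda>n. \<Psi> (cs n) z) \<longlonglongrightarrow> x0 \<and> w = 0" if "cs \<longlonglongrightarrow> w" "\<And>n. cs n \<in> I z" "\<And>n. cs n \<ge> f z" for cs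
 proof -
  have inK: "\<Psi> (cs n) z \<in> K" for n using z that by (auto simp: Ws_def)
  have *: "l = x0 \<and> w = 0" if r: "strict_mono (r :: nat \<Rightarrow> nat)" "((\<lambda>n. \<Psi> (cs n) z) \<circ> r) \<longlonglongrightarrow> l" for r l
  proof -
   have l: "l \<in> K" "(\<lambda>n. f (((\<lambda>n. \<Psi> (cs n) z) \<circ> r) n)) \<longlonglongrightarrow> f l" using tendsto_f_K[OF r(2)] inK by auto
   have "(\<lambda>n. f (((\<lambda>n. \<Psi> (cs n) z) \<circ> r) n)) = cs \<circ> r" using f_\<Psi>[OF V \<open>\<And>n. cs n \<in> I z\<close>] by auto
   moreover have "(cs \<circ> r) \<longlonglongrightarrow> w" using LIMSEQ_subseq_LIMSEQ \<open>cs \<longlonglongrightarrow> w\<close> r(1) by blast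
   ultimately have fl: "f l = w" using l(2) LIMSEQ_unique by metis
   have "l = x0"
   proof (rule ccontr)
    assume "l \<noteq> x0"
    hence lV: "l \<in> V" using l K_subset by blast
    have "\<forall>\<^sub>F n in sequentially. w \<in> I (((\<lambda>n. \<Psi> (cs n) z) \<circ> r) n)"
     by (rule tendsto_\<Psi>(1)[OF lV _ r(2) tendsto_const])
       (use fl level_mem[OF lV] \<Psi>_mem[OF V \<open>\<And>n. cs n \<in> I z\<close>] in auto)
    thus False using levels_\<Psi>[OF V \<open>\<And>n. cs n \<in> I z\<close>] w_notin by (auto simp: eventually_sequentially)
   qed
   thus ?thesis using fl f_x0 by simp
  qed
  have "(\<lambda>n. \<Psi> (cs n) z) \<longlonglongrightarrow> x0" by (rule compact_tendsto_unique[OF compact_K]) (use inK * in auto)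
  moreover have "w = 0" using *[OF strict_mono_id, of x0] calculation by simp
  ultimately show ?thesis by simp
 qed
 have fz_less: "f z < w" using mem le_w w_notin by (metis less_eq_real_def)
 have "w = 0"
 proof -
  \<comment> \<open>Truncated at \<open>f z\<close>, so that the whole sequence consists of levels
    of the forward orbit.\<close>
  define cs where "cs = (\<lambda>n. max (f z) (w - 1 / real (Suc n)))"
  have t: "(\<lambda>n. w - 1 / real (Suc n)) \<longlonglongrightarrow> w - 0"
   using LIMSEQ_inverse_real_of_nat by (intro tendsto_intros; simp add: inverse_eq_divide)
  have "cs \<longlonglongrightarrow> max (f z) (w - 0)" unfolding cs_def by (intro tendsto_max t tendsto_const)
  hence "cs \<longlonglongrightarrow> w" using fz_less by simp
  moreover have "cs n \<in> I z" for n
  proof -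
   have "cs n < w" unfolding cs_def using fz_less by simp
   then obtain d where "d \<in> I z" "cs n < d" unfolding w_def using mem less_cSup_iff[OF _ bdd] by blast
   thus ?thesis using levels_mem_interval[OF V mem \<open>d \<in> I z\<close>, of "cs n"] by (auto simp: cs_def)
  qed
  ultimately show ?thesis using lim[of cs] by (auto simp: cs_def)
 qed
 thus "Sup (I z) = 0" "0 \<notin> I z"
  "\<And>cs. cs \<longlonglongrightarrow> 0 \<Longrightarrow> (\<And>n. cs n \<in> I z) \<Longrightarrow> (\<And>n. cs n \<ge> f z) \<Longrightarrow> (\<lambda>n. \<Psi> (cs n) z) \<longlonglongrightarrow> x0" using w_def w_notin lim by auto
qed

lemma Ws_levels_neg: assumes "z \<in> Ws" "c \<in> I z" shows "c < 0" using Ws_aux(1,2,3)[OF assms(1)] assms(2)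
 by (metis cSup_upper less_eq_real_def)

lemma Ws_neg: "z \<in> Ws \<Longrightarrow> f z < 0" using Ws_levels_neg level_mem Ws_V by blast

lemma Ws_levels: assumes "z \<in> Ws" "f z \<le> c" "c < 0" shows "c \<in> I z"
proof -
 have V: "z \<in> V" using Ws_V assms by blast
 hence "I z \<noteq> {}" using level_mem by blast
 then obtain d where "d \<in> I z" "c < d" using Ws_aux(1,3)[OF assms(1)] less_cSup_iff[of "I z" c] assms by auto
 thus ?thesis using levels_mem_interval[OF V level_mem[OF V]] assms by auto
qed

lemma Ws_tendsto:
 assumes "z \<in> Ws" "cs \<longlonglongrightarrow> 0" "\<And>n. cs n \<in> I z"
 shows "(\<lambda>n. \<Psi> (cs n) z) \<longlonglongrightarrow> x0"
proof -
 have "\<forall>\<^sub>F n in sequentially. cs n > f z" using assms Ws_neg order_tendstoD(1) by blast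
 then obtain N where N: "\<And>n. n \<ge> N \<Longrightarrow> cs n > f z" by (auto simp: eventually_sequentially)
 have "(\<lambda>n. \<Psi> (cs (n + N)) z) \<longlonglongrightarrow> x0" by (rule Ws_aux(4)[OF assms(1), where cs = "\<lambda>n. cs (n + N)"])
    (use assms N in \<open>auto simp: LIMSEQ_ignore_initial_segment less_imp_le\<close>)
 thus ?thesis by (rule LIMSEQ_offset)
qed

lemma Ws_forward:
 assumes "z \<in> Ws" "c \<in> I z" "f z \<le> c"
 shows "\<Psi> c z \<in> Ws"
proof -
 have V: "z \<in> V" using Ws_V assms by blast
 have K: "\<Psi> c z \<in> K - {x0}" using x0_notin_V assms \<Psi>_mem[OF V] by (auto simp: Ws_def)
 show ?thesis unfolding Ws_def using K assms f_\<Psi>[OF V] levels_\<Psi>[OF V] \<Psi>_\<Psi>[OF V] by (auto simp: Ws_def)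
qed

lemmas Wu_levels_pos = level_flow.Ws_levels_neg[OF reversed, unfolded reversed_Ws]
lemmas Wu_tendsto_aux = level_flow.Ws_tendsto[OF reversed, unfolded reversed_Ws]

lemma Wu_levels_pos': "z \<in> Wu \<Longrightarrow> c \<in> I z \<Longrightarrow> c > 0" using Wu_levels_pos[of z "- c"] by auto

lemma Wu_pos: "z \<in> Wu \<Longrightarrow> f z > 0" using Wu_levels_pos' level_mem Wu_V by blast

lemma Wu_levels: "z \<in> Wu \<Longrightarrow> c \<le> f z \<Longrightarrow> 0 < c \<Longrightarrow> c \<in> I z"
 using level_flow.Ws_levels[OF reversed, unfolded reversed_Ws, of z "- c"] by force

lemma Wu_tendsto:
 "z \<in> Wu \<Longrightarrow> cs \<longlonglongrightarrow> 0 \<Longrightarrow> (\<And>n. cs n \<in> I z) \<Longrightarrow> (\<lambda>n. \<Psi> (cs n) z) \<longlonglongrightarrow> x0"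
 using Wu_tendsto_aux[of z "\<lambda>n. - cs n"] tendsto_minus[of cs 0] by auto

lemma Wu_backward: "z \<in> Wu \<Longrightarrow> c \<in> I z \<Longrightarrow> c \<le> f z \<Longrightarrow> \<Psi> c z \<in> Wu"
 using level_flow.Ws_forward[OF reversed, unfolded reversed_Ws, of z "- c"] by auto

text \<open>A limit of orbit segments in \<open>K\<close> is either an orbit segment or breaks at \<open>x0\<close>.\<close>

lemma segments_limit:
 assumes "\<And>n. zs n \<in> V" "\<And>n. ds n \<in> I (zs n)" "\<And>n. f (zs n) \<le> ds n"
  and seg: "\<And>n c. f (zs n) \<le> c \<Longrightarrow> c \<le> ds n \<Longrightarrow> \<Psi> c (zs n) \<in> K"
  and lim: "zs \<longlonglongrightarrow> z" "z \<noteq> x0" "(\<lambda>n. \<Psi> (ds n) (zs n)) \<longlonglongrightarrow> p"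
 shows "z \<in> Ws \<or> (p \<noteq> x0 \<and> f p \<in> I z \<and> p = \<Psi> (f p) z \<and> f z \<le> f p \<and>
      (\<forall>c. f z \<le> c \<and> c \<le> f p \<longrightarrow> \<Psi> c z \<in> K))"
proof -
 have zsK: "zs n \<in> K" for n using seg[of n "f (zs n)"] assms(3)[of n] \<Psi>_self[OF assms(1)] by auto
 have zK: "z \<in> K" "(\<lambda>n. f (zs n)) \<longlonglongrightarrow> f z" using tendsto_f_K[OF lim(1)] zsK by auto
 hence zV: "z \<in> V" using K_subset lim by blast
 have pK: "p \<in> K" "(\<lambda>n. f (\<Psi> (ds n) (zs n))) \<longlonglongrightarrow> f p" using tendsto_f_K[OF lim(3)] seg assms by auto
 hence ds: "ds \<longlonglongrightarrow> f p" using f_\<Psi> assms by simp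
 have le: "f z \<le> f p" using LIMSEQ_le[OF zK(2) ds] assms(3) by auto
 have inK: "\<Psi> c z \<in> K" if c: "c \<in> I z" "f z \<le> c" "c \<le> f p" for c
 proof -
  \<comment> \<open>Clamping \<open>c\<close> to the levels of the \<open>n\<close>-th segment does
    not change the limit, because \<open>c\<close> lies between the limits of the two end
    levels.\<close>
  define cs where "cs = (\<lambda>n. max (f (zs n)) (min c (ds n)))"
  have "cs \<longlonglongrightarrow> max (f z) (min c (f p))" unfolding cs_def by (intro tendsto_max tendsto_min zK ds tendsto_const)
  hence cs: "cs \<longlonglongrightarrow> c" using c by simp
  have "(\<lambda>n. \<Psi> (cs n) (zs n)) \<longlonglongrightarrow> \<Psi> c z" by (rule tendsto_\<Psi>(2)[OF zV c(1) lim(1) cs]) (use assms in auto)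
  moreover have "\<Psi> (cs n) (zs n) \<in> K" for n by (rule seg) (use assms(3)[of n] in \<open>auto simp: cs_def\<close>)
  ultimately show ?thesis using tendsto_f_K(1) by blast
 qed
 show ?thesis
 proof (cases "f p \<in> I z")
  case True
  have "(\<lambda>n. \<Psi> (ds n) (zs n)) \<longlonglongrightarrow> \<Psi> (f p) z" by (rule tendsto_\<Psi>(2)[OF zV True lim(1) ds]) (use assms in auto)
  hence p: "p = \<Psi> (f p) z" using lim(3) LIMSEQ_unique by blast
  hence "p \<noteq> x0" using x0_notin_V \<Psi>_mem[OF zV True] by auto
  moreover have "\<forall>c. f z \<le> c \<and> c \<le> f p \<longrightarrow> \<Psi> c z \<in> K"
   using inK True levels_mem_interval[OF zV level_mem[OF zV] True] by blast
  ultimately show ?thesis using True p le by blast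
 next
  case False
  \<comment> \<open>The orbit of \<open>z\<close> ends before level \<open>f p\<close>, so all of
    its forward part is a limit of the segments.\<close>
  have "c \<le> f p" if "c \<in> I z" "f z \<le> c" for c
   using that False levels_mem_interval[OF zV level_mem[OF zV] that(1), of "f p"] le by force
  hence "z \<in> Ws" unfolding Ws_def using zK lim inK by auto
  thus ?thesis ..
 qed
qed

lemma segments_limit':
 assumes "\<And>n. zs n \<in> V" "\<And>n. ds n \<in> I (zs n)" "\<And>n. ds n \<le> f (zs n)"
  and "\<And>n c. ds n \<le> c \<Longrightarrow> c \<le> f (zs n) \<Longrightarrow> \<Psi> c (zs n) \<in> K"
  and "zs \<longlonglongrightarrow> z" "z \<noteq> x0" "(\<lambda>n. \<Psi> (ds n) (zs n)) \<longlonglongrightarrow> p"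
 shows "z \<in> Wu \<or> (p \<noteq> x0 \<and> f p \<in> I z \<and> p = \<Psi> (f p) z \<and> f p \<le> f z \<and>
      (\<forall>c. f p \<le> c \<and> c \<le> f z \<longrightarrow> \<Psi> c z \<in> K))"
proof -
 have "z \<in> Wu \<or> (p \<noteq> x0 \<and> - f p \<in> uminus ` I z \<and> p = \<Psi> (- (- f p)) z \<and> - f z \<le> - f p \<and>
      (\<forall>c. - f z \<le> c \<and> c \<le> - f p \<longrightarrow> \<Psi> (- c) z \<in> K))"
  by (rule level_flow.segments_limit[OF reversed, unfolded reversed_Ws,
     where zs = zs and ds = "\<lambda>n. - ds n"]) (use assms in auto)
 thus ?thesis by (metis (no_types, lifting) add.inverse_inverse image_iff neg_le_iff_le)
qed

lemma Ws_closed: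
 assumes "\<And>n. zs n \<in> Ws" "zs \<longlonglongrightarrow> z" "z \<noteq> x0"
 shows "z \<in> Ws"
proof -
 have zK: "z \<in> K" "(\<lambda>n. f (zs n)) \<longlonglongrightarrow> f z" using tendsto_f_K[OF assms(2)] assms Ws_K by auto
 hence zV: "z \<in> V" using K_subset assms by blast
 have "\<Psi> c z \<in> K" if c: "c \<in> I z" "f z \<le> c" for c
 proof -
  have cs: "(\<lambda>n. max (f (zs n)) c) \<longlonglongrightarrow> max (f z) c" by (intro tendsto_max zK tendsto_const)
  hence cs: "(\<lambda>n. max (f (zs n)) c) \<longlonglongrightarrow> c" using c by simp
  have ev: "\<forall>\<^sub>F n in sequentially. zs n \<in> V" by (intro always_eventually allI Ws_V assms(1))
  have "\<forall>\<^sub>F n in sequentially. \<Psi> (max (f (zs n)) c) (zs n) \<in> K" using tendsto_\<Psi>(1)[OF zV c(1) assms(2) cs ev]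
  proof eventually_elim
   case (elim n)
   thus ?case using assms(1)[of n] by (auto simp: Ws_def)
  qed
  moreover have "(\<lambda>n. \<Psi> (max (f (zs n)) c) (zs n)) \<longlonglongrightarrow> \<Psi> c z" by (rule tendsto_\<Psi>(2)[OF zV c(1) assms(2) cs ev])
  ultimately show ?thesis using compact_imp_closed[OF compact_K] by (intro Lim_in_closed_set) auto
 qed
 thus ?thesis unfolding Ws_def using zK assms by auto
qed

lemmas Wu_closed = level_flow.Ws_closed[OF reversed, unfolded reversed_Ws]

text \<open>The levels at which the orbit has distance \<open>R / 2\<close> from \<open>x0\<close>
  form a compact set \<open>D\<close>, whose least element is the first contact: by the intermediate
  value theorem a point outside \<open>K\<close> is preceded by an element of
  \<open>D\<close>.\<close>

lemma exit_K:
 assumes "z \<in> K - {x0}" "z \<notin> Ws"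
 obtains d where "d \<in> I z" "f z \<le> d" "dist x0 (\<Psi> d z) = R / 2" "\<And>c. f z \<le> c \<Longrightarrow> c \<le> d \<Longrightarrow> \<Psi> c z \<in> K"
proof -
 have V: "z \<in> V" using assms K_subset by blast
 obtain b where b: "b \<in> I z" "f z \<le> b" "\<Psi> b z \<notin> K" using assms by (auto simp: Ws_def)
 have sub: "c \<in> I z" if "c \<in> {f z..b}" for c using levels_mem_interval[OF V level_mem[OF V] b(1)] that by auto
 have "continuous_on {f z..b} ((\<lambda>(c, z). \<Psi> c z) \<circ> (\<lambda>c. (c, z)))"
  by (rule continuous_on_compose[OF _ continuous_on_subset[OF continuous_\<Psi>]])
    (use V sub in \<open>auto intro!: continuous_intros\<close>)
 hence cont: "continuous_on {f z..b} (\<lambda>c. dist x0 (\<Psi> c z))" by (auto simp: o_def intro!: continuous_intros)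
 have inK: "\<Psi> c z \<in> K \<longleftrightarrow> dist x0 (\<Psi> c z) \<le> R / 2" if "c \<in> {f z..b}" for c
  using \<Psi>_mem[OF V sub[OF that]] V_subset by (auto simp: K_def)
 have z: "dist x0 (\<Psi> (f z) z) \<le> R / 2" using \<Psi>_self[OF V] assms by (auto simp: K_def)
 have bgt: "dist x0 (\<Psi> b z) > R / 2" using inK[of b] b by auto
 define D where "D = {c \<in> {f z..b}. dist x0 (\<Psi> c z) = R / 2}"
 have ivt: "\<exists>d\<in>D. d \<le> c" if c: "c \<in> {f z..b}" "dist x0 (\<Psi> c z) \<ge> R / 2" for c
 proof -
  have "\<exists>d\<ge>f z. d \<le> c \<and> dist x0 (\<Psi> d z) = R / 2" by (rule IVT') (use z c cont in \<open>auto elim: continuous_on_subset\<close>)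
  thus ?thesis using c by (auto simp: D_def)
 qed
 have "compact D" unfolding D_def compact_eq_bounded_closed
 proof
  show "bounded {c \<in> {f z..b}. dist x0 (\<Psi> c z) = R / 2}"
   by (rule bounded_subset[OF bounded_closed_interval[of "f z" b]]) auto
  show "closed {c \<in> {f z..b}. dist x0 (\<Psi> c z) = R / 2}"
   by (rule continuous_closed_preimage_constant[OF cont closed_atLeastAtMost])
 qed
 moreover have "D \<noteq> {}" using ivt[of b] bgt b by auto
 ultimately obtain d where d: "d \<in> D" "\<And>c. c \<in> D \<Longrightarrow> d \<le> c" using compact_attains_inf by metis
 show thesis
 proof (rule that[of d])
  show "d \<in> I z" "f z \<le> d" "dist x0 (\<Psi> d z) = R / 2" using d sub by (auto simp: D_def)
  fix c assume c: "f z \<le> c" "c \<le> d"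
  have cb: "c \<in> {f z..b}" using c d by (auto simp: D_def)
  show "\<Psi> c z \<in> K"
  proof (rule ccontr)
   assume "\<Psi> c z \<notin> K"
   hence gt: "dist x0 (\<Psi> c z) > R / 2" using inK[OF cb] by auto
   then obtain d' where "d' \<in> D" "d' \<le> c" using ivt[OF cb] by auto
   hence "c = d" using d c by force
   thus False using gt d by (auto simp: D_def)
  qed
 qed
qed

lemma exit_K':
 assumes "z \<in> K - {x0}" "z \<notin> Wu"
 obtains d where "d \<in> I z" "d \<le> f z" "dist x0 (\<Psi> d z) = R / 2" "\<And>c. d \<le> c \<Longrightarrow> c \<le> f z \<Longrightarrow> \<Psi> c z \<in> K"
proof -
 obtain d where d: "d \<in> uminus ` I z" "- f z \<le> d" "dist x0 (\<Psi> (- d) z) = R / 2"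
  "\<And>c. - f z \<le> c \<Longrightarrow> c \<le> d \<Longrightarrow> \<Psi> (- c) z \<in> K"
  using level_flow.exit_K[OF reversed, unfolded reversed_Ws, OF assms] by blast
 show thesis
 proof (rule that[of "- d"])
  show "\<Psi> c z \<in> K" if "- d \<le> c" "c \<le> f z" for c using d(4)[of "- c"] that by auto
 qed (use d in auto)
qed

text \<open>The only limit point that \<open>Ws\<close> can miss is \<open>x0\<close>, so the trace
  of \<open>Ws\<close> on the outer half-circle is compact, and \<open>f\<close> is negative on
  it.\<close>

lemma Ws_boundary:
 obtains e where "e > 0" "\<And>z. z \<in> Ws \<Longrightarrow> dist x0 z = R / 2 \<Longrightarrow> f z < - e"
proof -
 have "compact (Ws \<inter> {z. dist x0 z = R / 2})"
 proof (subst compact_eq_bounded_closed, intro conjI)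
  show "bounded (Ws \<inter> {z. dist x0 z = R / 2})"
   by (rule bounded_subset[OF compact_imp_bounded[OF compact_K]]) (use Ws_K in blast)
  show "closed (Ws \<inter> {z. dist x0 z = R / 2})" unfolding closed_sequential_limits
  proof safe
   fix x l assume x: "\<forall>n. x n \<in> Ws \<inter> {z. dist x0 z = R / 2}" "x \<longlonglongrightarrow> l"
   have "(\<lambda>n. dist x0 (x n)) \<longlonglongrightarrow> dist x0 l" by (intro tendsto_intros x)
   moreover have "(\<lambda>n. dist x0 (x n)) = (\<lambda>n. R / 2)" using x(1) by auto
   ultimately show d: "dist x0 l = R / 2" using LIMSEQ_unique[OF _ tendsto_const] by metis
   hence "l \<noteq> x0" using R_pos by auto
   thus "l \<in> Ws" using Ws_closed[of x l] x by auto
  qed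
 qed
 moreover have "continuous_on (Ws \<inter> {z. dist x0 z = R / 2}) f"
  by (rule continuous_on_subset[OF continuous_f_K]) (use Ws_K in blast)
 ultimately have *: "Ws \<inter> {z. dist x0 z = R / 2} \<noteq> {} \<Longrightarrow>
   \<exists>m\<in>Ws \<inter> {z. dist x0 z = R / 2}. \<forall>z\<in>Ws \<inter> {z. dist x0 z = R / 2}. f z \<le> f m" using continuous_attains_sup by blast
 show thesis
 proof (cases "Ws \<inter> {z. dist x0 z = R / 2} = {}")
  case True
  thus ?thesis using that[of 1] by auto
 next
  case False
  then obtain m where m: "m \<in> Ws" "\<And>z. z \<in> Ws \<Longrightarrow> dist x0 z = R / 2 \<Longrightarrow> f z \<le> f m" using * by auto
  show ?thesis using Ws_neg[OF m(1)] m(2) by (intro that[of "- f m / 2"]) force+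
 qed
qed

text \<open>Up to such a threshold the stable and the unstable set stay off the outer half-circle:
  their points with level at most \<open>e\<close> in absolute value have distance less than
  \<open>R / 2\<close> from \<open>x0\<close>.\<close>

definition eps_bound where
 "eps_bound e \<longleftrightarrow> e > 0 \<and> (\<forall>z\<in>Ws \<union> Wu. dist x0 z = R / 2 \<longrightarrow> \<bar>f z\<bar> > e)"

lemma eps_bound_exists: "\<exists>e. eps_bound e"
proof -
 obtain e1 where e1: "e1 > 0" "\<And>z. z \<in> Ws \<Longrightarrow> dist x0 z = R / 2 \<Longrightarrow> f z < - e1" using Ws_boundary by blast
 obtain e2 where e2: "e2 > 0" "\<And>z. z \<in> Wu \<Longrightarrow> dist x0 z = R / 2 \<Longrightarrow> - f z < - e2"
  using level_flow.Ws_boundary[OF reversed, unfolded reversed_Ws] by blast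
 have "\<bar>f z\<bar> > min e1 e2" if "z \<in> Ws \<union> Wu" "dist x0 z = R / 2" for z
  using that e1(2)[of z] e2(2)[of z] e1(1) e2(1) by force
 thus ?thesis unfolding eps_bound_def using e1(1) e2(1) by (intro exI[of _ "min e1 e2"]) auto
qed

lemma reversed_eps_bound:
 "level_flow.eps_bound x0 R (\<lambda>z. - f z) (\<lambda>z. uminus ` I z) (\<lambda>c. \<Psi> (- c)) e \<longleftrightarrow> eps_bound e"
 unfolding level_flow.eps_bound_def[OF reversed] eps_bound_def reversed_Ws reversed_Wu by auto

end

section \<open>Orbit segments between the levels \<open>-\<epsilon>\<close> and
  \<open>\<epsilon>\<close>\<close>

locale sectored_flow = level_flow +
 fixes \<epsilon> :: real
 assumes eps: "eps_bound \<epsilon>"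
begin

lemma sectored_reversed:
 "sectored_flow x0 R (\<lambda>z. - f z) (\<lambda>z. uminus ` I z) (\<lambda>c. \<Psi> (- c)) \<epsilon>"
 unfolding sectored_flow_def sectored_flow_axioms_def using reversed eps reversed_eps_bound by auto

lemma eps_pos: "\<epsilon> > 0" using eps by (simp add: eps_bound_def)

lemma Ws_exit: "z \<in> Ws \<Longrightarrow> dist x0 z = R / 2 \<Longrightarrow> f z < - \<epsilon>" using eps Ws_neg[of z] unfolding eps_bound_def by force

lemma Wu_exit: "z \<in> Wu \<Longrightarrow> dist x0 z = R / 2 \<Longrightarrow> f z > \<epsilon>" using eps Wu_pos[of z] unfolding eps_bound_def by force

text \<open>Orbits passing close to the stable set of \<open>x0\<close> stay in \<open>K\<close> until level \<open>\<epsilon>\<close>: a limit of exit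
 points would lie on the boundary of \<open>K\<close> in the unstable set, at a level at most \<open>\<epsilon>\<close>.\<close>

lemma forward_segment:
 assumes lim: "ps \<longlonglongrightarrow> p" and p: "p \<in> insert x0 Ws" "f p \<ge> - \<epsilon>"
  and ps: "\<And>n. ps n \<in> K - {x0}" "\<And>n. ps n \<notin> Ws"
 shows "\<forall>\<^sub>F n in sequentially. \<epsilon> \<in> I (ps n) \<and> (\<forall>c. f (ps n) \<le> c \<and> c \<le> \<epsilon> \<longrightarrow> \<Psi> c (ps n) \<in> K)"
proof (rule ccontr)
 define bad where "bad = (\<lambda>n. \<not> (\<epsilon> \<in> I (ps n) \<and> (\<forall>c. f (ps n) \<le> c \<and> c \<le> \<epsilon> \<longrightarrow> \<Psi> c (ps n) \<in> K)))"
 assume "\<not> (\<forall>\<^sub>F n in sequentially. \<epsilon> \<in> I (ps n) \<and> (\<forall>c. f (ps n) \<le> c \<and> c \<le> \<epsilon> \<longrightarrow> \<Psi> c (ps n) \<in> K))"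
 hence "\<exists>\<^sub>F n in sequentially. bad n" by (simp only: bad_def frequently_def not_not not_False_eq_True)
 then obtain r where r: "strict_mono (r :: nat \<Rightarrow> nat)" "\<And>n. bad (r n)" using frequently_subsequenceE by blast
 have "\<exists>d. d \<in> I (ps n) \<and> f (ps n) \<le> d \<and> dist x0 (\<Psi> d (ps n)) = R / 2 \<and>
     (\<forall>c. f (ps n) \<le> c \<and> c \<le> d \<longrightarrow> \<Psi> c (ps n) \<in> K)" for n using exit_K[of "ps n"] ps by (metis (no_types, lifting))
 then obtain ds where ds: "\<And>n. ds n \<in> I (ps n)" "\<And>n. f (ps n) \<le> ds n"
   "\<And>n. dist x0 (\<Psi> (ds n) (ps n)) = R / 2" "\<And>n c. f (ps n) \<le> c \<Longrightarrow> c \<le> ds n \<Longrightarrow> \<Psi> c (ps n) \<in> K" by metis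
 have V: "ps n \<in> V" for n using ps K_subset by blast
 have fp: "(\<lambda>n. f (ps n)) \<longlonglongrightarrow> f p" "p \<in> K" using tendsto_f_K[OF lim] ps by auto
 have fps: "f p \<le> 0" using p Ws_neg f_x0 by (auto simp: less_imp_le)
 have ev: "\<forall>\<^sub>F n in sequentially. f (ps n) < \<epsilon>" by (rule order_tendstoD(2)[OF fp(1)]) (use fps eps_pos in auto)
 \<comment> \<open>If the first contact with the half-circle came after level
   \<open>\<epsilon>\<close>, the segment up to \<open>\<epsilon>\<close> would lie in
   \<open>K\<close>.\<close>
 have ds_le: "ds n \<le> \<epsilon>" if "bad n" "f (ps n) < \<epsilon>" for n
 proof (rule ccontr)
  assume "\<not> ds n \<le> \<epsilon>"
  hence "\<epsilon> \<in> I (ps n)" "\<forall>c. f (ps n) \<le> c \<and> c \<le> \<epsilon> \<longrightarrow> \<Psi> c (ps n) \<in> K"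
   using levels_mem_interval[OF V level_mem[OF V] ds(1)] that ds(4) by auto
  thus False using that by (auto simp: bad_def)
 qed
 have "\<forall>n. \<Psi> (ds (r n)) (ps (r n)) \<in> K" using ds by auto
 then obtain y s where y: "y \<in> K" "strict_mono (s::nat \<Rightarrow> nat)"
   "((\<lambda>n. \<Psi> (ds (r n)) (ps (r n))) \<circ> s) \<longlonglongrightarrow> y" using compact_K unfolding compact_def by meson
 define t where "t = r \<circ> s"
 have t: "strict_mono t" "\<And>n. bad (t n)" using r y by (auto simp: t_def strict_mono_o)
 have ty: "(\<lambda>n. \<Psi> (ds (t n)) (ps (t n))) \<longlonglongrightarrow> y" using y(3) by (simp add: t_def o_def)
 have tp: "(\<lambda>n. ps (t n)) \<longlonglongrightarrow> p" using LIMSEQ_subseq_LIMSEQ[OF lim t(1)] by (simp add: o_def)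
 have "(\<lambda>n. dist x0 (\<Psi> (ds (t n)) (ps (t n)))) \<longlonglongrightarrow> dist x0 y" by (intro tendsto_intros ty)
 hence dy: "dist x0 y = R / 2" unfolding ds(3) using LIMSEQ_unique[OF _ tendsto_const] by metis
 hence yx: "y \<noteq> x0" using R_pos by auto
 have "(\<lambda>n. f (\<Psi> (ds (t n)) (ps (t n)))) \<longlonglongrightarrow> f y" by (rule tendsto_f_K(2)[OF ty]) (use ds in auto)
 hence fy: "(\<lambda>n. ds (t n)) \<longlonglongrightarrow> f y" using f_\<Psi>[OF V ds(1)] by simp
 have "\<forall>\<^sub>F n in sequentially. f (ps (t n)) < \<epsilon>" by (rule eventually_subseq[OF t(1) ev])
 hence "\<forall>\<^sub>F n in sequentially. ds (t n) \<le> \<epsilon>" by eventually_elim (use ds_le t in auto)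
 hence fy_le: "f y \<le> \<epsilon>" using tendsto_upperbound[OF fy] by simp
 have mem: "f (ps n) \<in> I (\<Psi> (ds n) (ps n))" for n using \<Psi>_sym(2)[OF V ds(1)] .
 have self: "\<Psi> (f (ps n)) (\<Psi> (ds n) (ps n)) = ps n" for n using \<Psi>_sym(1)[OF V ds(1)] .
 have seg: "\<Psi> c (\<Psi> (ds n) (ps n)) \<in> K" if "f (ps n) \<le> c" "c \<le> ds n" for n c
 proof -
  have "c \<in> I (ps n)" using levels_mem_interval[OF V level_mem[OF V] ds(1)] that by auto
  thus ?thesis using \<Psi>_\<Psi>[OF V ds(1)] ds(4) that by auto
 qed
 \<comment> \<open>The segments are read backwards, from the contact points with limit
   \<open>y\<close> to the points with limit \<open>p\<close>. Either alternative puts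
   \<open>y\<close> on the half-circle at a level that \<open>eps_bound\<close> forbids.\<close>
 have "y \<in> Wu \<or> (p \<noteq> x0 \<and> f p \<in> I y \<and> p = \<Psi> (f p) y \<and> f p \<le> f y \<and>
      (\<forall>c. f p \<le> c \<and> c \<le> f y \<longrightarrow> \<Psi> c y \<in> K))"
  by (rule segments_limit'[where zs = "\<lambda>n. \<Psi> (ds (t n)) (ps (t n))" and ds = "\<lambda>n. f (ps (t n))"])
    (use \<Psi>_mem[OF V ds(1)] mem f_\<Psi>[OF V ds(1)] ds(2) seg ty yx self tp in auto)
 thus False
 proof
  assume "y \<in> Wu"
  thus False using Wu_exit dy fy_le by force
 next
  assume *: "p \<noteq> x0 \<and> f p \<in> I y \<and> p = \<Psi> (f p) y \<and> f p \<le> f y \<and>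
      (\<forall>c. f p \<le> c \<and> c \<le> f y \<longrightarrow> \<Psi> c y \<in> K)"
  have yV: "y \<in> V" using y yx K_subset by blast
  have "p \<in> Ws" using * p by auto
  moreover have "f y \<in> I p" "\<Psi> (f y) p = y" using \<Psi>_sym[OF yV, of "f p"] * by auto
  ultimately have "y \<in> Ws" using Ws_forward[of p "f y"] * by auto
  thus False using Ws_exit[OF _ dy] * p by force
 qed
qed

lemma backward_segment:
 assumes "ps \<longlonglongrightarrow> p" "p \<in> insert x0 Wu" "f p \<le> \<epsilon>"
  and "\<And>n. ps n \<in> K - {x0}" "\<And>n. ps n \<notin> Wu"
 shows "\<forall>\<^sub>F n in sequentially. - \<epsilon> \<in> I (ps n) \<and> (\<forall>c. - \<epsilon> \<le> c \<and> c \<le> f (ps n) \<longrightarrow> \<Psi> c (ps n) \<in> K)"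
proof -
 have "\<forall>\<^sub>F n in sequentially. \<epsilon> \<in> uminus ` I (ps n) \<and>
   (\<forall>c. - f (ps n) \<le> c \<and> c \<le> \<epsilon> \<longrightarrow> \<Psi> (- c) (ps n) \<in> K)"
  by (rule sectored_flow.forward_segment[OF sectored_reversed, unfolded reversed_Ws, of ps p]) (use assms in auto)
 thus ?thesis
 proof eventually_elim
  case (elim n)
  have "\<Psi> c (ps n) \<in> K" if "- \<epsilon> \<le> c" "c \<le> f (ps n)" for c
   using elim that by (metis add.inverse_inverse neg_le_iff_le)
  thus ?case using elim by auto
 qed
qed

end

section \<open>Arcs in level sets\<close>

lemma inj_on_scaled:
 fixes c :: real
 assumes "inj_on \<sigma> J" "c \<noteq> 0" "\<And>s. s \<in> J \<Longrightarrow> c * s \<in> J"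
 shows "inj_on (\<lambda>s. \<sigma> (c * s)) J" using assms(2) inj_onD[OF assms(1) _ assms(3) assms(3)] by (auto intro: inj_onI)

context level_flow
begin

lemma continuous_on_\<Psi>:
 assumes "continuous_on A c" "continuous_on A g" "\<And>a. a \<in> A \<Longrightarrow> g a \<in> V \<and> c a \<in> I (g a)"
 shows "continuous_on A (\<lambda>a. \<Psi> (c a) (g a))"
proof -
 have "continuous_on A ((\<lambda>(c, z). \<Psi> c z) \<circ> (\<lambda>a. (c a, g a)))"
  by (rule continuous_on_compose[OF _ continuous_on_subset[OF continuous_\<Psi>]])
    (use assms in \<open>auto intro!: continuous_intros\<close>)
 thus ?thesis by (simp add: o_def)
qed

lemma open_levels_fixed: "openin (top_of_set V) {y \<in> V. c \<in> I y}"
proof -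
 have "openin (top_of_set V) (V \<inter> (\<lambda>y. (c, y)) -` dom)"
  by (rule continuous_openin_preimage[OF _ _ open_levels]) (auto intro!: continuous_intros)
 moreover have "V \<inter> (\<lambda>y. (c, y)) -` dom = {y \<in> V. c \<in> I y}" by auto
 ultimately show ?thesis by simp
qed

abbreviation level where "level c \<equiv> {y \<in> V. f y = c}"

text \<open>An arc is given only at some level \<open>c\<close> of the orbit. Flowing it to level
  \<open>f z\<close> keeps it injective and open in its level set, because \<open>\<Psi> c\<close>
  inverts the transport near \<open>z\<close>.\<close>

lemma section_arc:
 assumes z: "z \<in> V"
 shows "\<exists>\<sigma> J. (J = {-1..1} \<or> J = {0..1::real}) \<and> continuous_on J \<sigma> \<and> inj_on \<sigma> J \<and> \<sigma> 0 = z \<and>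
  \<sigma> ` J \<subseteq> level (f z) \<and> (\<forall>e. 0 < e \<and> e \<le> 1 \<longrightarrow> openin (top_of_set (level (f z))) (\<sigma> ` {s\<in>J. \<bar>s\<bar> < e}))"
proof -
 obtain c where c: "c \<in> I z" and la: "level_arc (top_of_set V) f (\<Psi> c z)" using level_arcs[OF z] by blast
 \<comment> \<open>Shrinking the arc to orbits that reach level \<open>f z\<close> makes the
   transport defined on all of it.\<close>
 define O' where "O' = {y \<in> V. f z \<in> I y}"
 have O': "openin (top_of_set V) O'" unfolding O'_def by (rule open_levels_fixed)
 have fc: "f (\<Psi> c z) = c" using f_\<Psi>[OF z c] .
 have "\<Psi> c z \<in> O'" using \<Psi>_mem[OF z c] \<Psi>_sym[OF z c] by (simp add: O'_def)
 hence "level_arc (subtopology (top_of_set V) O') f (\<Psi> c z)" by (rule level_arc_open_subset[OF la O'])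
 moreover have "subtopology (top_of_set V) O' = top_of_set O'"
  unfolding subtopology_subtopology by (auto simp: O'_def intro!: arg_cong[of _ _ top_of_set])
 ultimately obtain \<sigma> J where J: "J = {-1..1::real} \<or> J = {0..1}"
  and \<sigma>: "continuous_map (top_of_set J) (top_of_set O') \<sigma>" "inj_on \<sigma> J" "\<sigma> 0 = \<Psi> c z" "\<forall>s\<in>J. f (\<sigma> s) = c"
  and W: "\<forall>e. 0 < e \<and> e \<le> 1 \<longrightarrow> (\<exists>W. openin (top_of_set O') W \<and> {y \<in> W. f y = c} = \<sigma> ` {s\<in>J. \<bar>s\<bar> < e})"
  unfolding level_arc_def fc by auto
 have cont: "continuous_on J \<sigma>" and im: "\<sigma> ` J \<subseteq> O'" using \<sigma>(1) by auto
 have \<sigma>V: "\<sigma> s \<in> V" "f z \<in> I (\<sigma> s)" "c \<in> I (\<sigma> s)" "\<Psi> c (\<sigma> s) = \<sigma> s" if "s \<in> J" for s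
 proof -
  show V: "\<sigma> s \<in> V" and "f z \<in> I (\<sigma> s)" using that im by (auto simp: O'_def)
  show "c \<in> I (\<sigma> s)" "\<Psi> c (\<sigma> s) = \<sigma> s" using level_mem[OF V] \<Psi>_self[OF V] \<sigma>(4) that by auto
 qed
 define \<tau> where "\<tau> s = \<Psi> (f z) (\<sigma> s)" for s
 have \<tau>: "\<tau> s \<in> level (f z)" "c \<in> I (\<tau> s)" "\<Psi> c (\<tau> s) = \<sigma> s" if "s \<in> J" for s
  using \<Psi>_mem[OF \<sigma>V(1,2)[OF that]] f_\<Psi>[OF \<sigma>V(1,2)[OF that]] levels_\<Psi>[OF \<sigma>V(1,2)[OF that]]
   \<Psi>_\<Psi>[OF \<sigma>V(1,2,3)[OF that]] \<sigma>V(3,4)[OF that] by (simp_all add: \<tau>_def)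
 define D where "D = {y \<in> V. c \<in> I y}"
 have D: "openin (top_of_set V) D" unfolding D_def by (rule open_levels_fixed)
 have c\<Psi>: "continuous_on D (\<Psi> c)" by (rule continuous_on_\<Psi>) (auto simp: D_def intro: continuous_intros)
 have opn: "openin (top_of_set (level (f z))) (\<tau> ` {s\<in>J. \<bar>s\<bar> < e})" if e: "0 < e \<and> e \<le> 1" for e
 proof -
  obtain W where W: "openin (top_of_set O') W" "{y \<in> W. f y = c} = \<sigma> ` {s\<in>J. \<bar>s\<bar> < e}" using W e by blast
  have "openin (top_of_set V) W" using W(1) O' by (rule openin_trans)
  hence "openin (top_of_set D) (D \<inter> \<Psi> c -` W)"
   using \<Psi>_mem by (intro continuous_openin_preimage[OF c\<Psi>]) (auto simp: D_def)
  hence "openin (top_of_set V) (D \<inter> \<Psi> c -` W)" using D by (rule openin_trans)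
  then obtain T where T: "open T" "D \<inter> \<Psi> c -` W = V \<inter> T" by (auto simp: openin_open)
  have "\<tau> ` {s\<in>J. \<bar>s\<bar> < e} = level (f z) \<inter> T"
  proof
   show "\<tau> ` {s\<in>J. \<bar>s\<bar> < e} \<subseteq> level (f z) \<inter> T"
   proof (rule image_subsetI)
    fix s assume s: "s \<in> {s\<in>J. \<bar>s\<bar> < e}"
    hence "\<sigma> s \<in> W" using W(2) by blast
    hence "\<tau> s \<in> D \<inter> \<Psi> c -` W" using \<tau>[of s] s by (simp add: D_def)
    thus "\<tau> s \<in> level (f z) \<inter> T" using T(2) \<tau>(1)[of s] s by auto
   qed
   show "level (f z) \<inter> T \<subseteq> \<tau> ` {s\<in>J. \<bar>s\<bar> < e}"
   proof
    fix y assume y: "y \<in> level (f z) \<inter> T"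
    hence yD: "y \<in> V" "c \<in> I y" "\<Psi> c y \<in> W" using T by (auto simp: D_def)
    hence "\<Psi> c y \<in> \<sigma> ` {s\<in>J. \<bar>s\<bar> < e}" using f_\<Psi> W(2) by blast
    then obtain s where s: "s \<in> {s\<in>J. \<bar>s\<bar> < e}" "\<Psi> c y = \<sigma> s" by blast
    have "y = \<tau> s" using \<Psi>_sym(1)[OF yD(1,2)] y s(2) by (simp add: \<tau>_def)
    thus "y \<in> \<tau> ` {s\<in>J. \<bar>s\<bar> < e}" using s(1) by blast
   qed
  qed
  thus ?thesis using openin_open_Int[OF T(1)] by metis
 qed
 show ?thesis
 proof (intro exI conjI allI impI)
  show "J = {-1..1} \<or> J = {0..1}" by (rule J)
  show "continuous_on J \<tau>" unfolding \<tau>_def by (rule continuous_on_\<Psi>[OF continuous_on_const cont]) (use \<sigma>V in auto)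
  show "inj_on \<tau> J" using inj_onD[OF \<sigma>(2)] \<tau>(3) by (metis inj_onI)
  show "\<tau> 0 = z" using \<sigma>(3) \<Psi>_sym[OF z c] by (simp add: \<tau>_def)
  show "\<tau> ` J \<subseteq> level (f z)" using \<tau>(1) by blast
 qed (rule opn)
qed

text \<open>Maximum principle: the inside of a level curve contains no local extremum of \<open>f\<close>.\<close>

lemma no_level_loop:
 assumes g: "simple_path g" "pathfinish g = pathstart g" "path_image g \<subseteq> K"
  and x0: "x0 \<in> path_image g" and f0: "\<And>z. z \<in> path_image g \<Longrightarrow> f z = 0"
 shows False
proof -
 define N where "N = inside (path_image g)"
 have N: "N \<noteq> {}" "open N" "bounded N" "N \<inter> path_image g = {}" "frontier N = path_image g"
  using Jordan_inside_outside[OF g(1,2)] by (auto simp: N_def)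
 \<comment> \<open>Convexity of \<open>K\<close> keeps the inside of the curve within
   \<open>K\<close>; as the curve itself passes through \<open>x0\<close>, the inside avoids
   \<open>x0\<close>.\<close>
 have "N \<subseteq> K" using outside_subset_convex[OF convex_K g(3)] inside_Int_outside unfolding N_def by blast
 hence NV: "N \<subseteq> V" using K_subset x0 N(4) by blast
 have clN: "closure N = N \<union> path_image g" using N closure_Un_frontier by metis
 have "closure N \<subseteq> K" using clN \<open>N \<subseteq> K\<close> g(3) by simp
 hence cont: "continuous_on (closure N) f" using continuous_on_subset[OF continuous_f_K] by blast
 have cpt: "compact (closure N)" "closure N \<noteq> {}" using N by (auto simp: compact_closure)
 \<comment> \<open>No point of \<open>N\<close> is a local extremum, since \<open>f\<close> takes
   larger and smaller values along the orbit. The sign \<open>s\<close> treats maxima and minima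
   together.\<close>
 have move: "\<exists>y'\<in>N. s * f y < s * f y'" if y: "y \<in> N" and s: "s = 1 \<or> s = -1" for y and s :: real
 proof -
  have yV: "y \<in> V" using y NV by blast
  have "(\<lambda>n. f y + s * (1 / real (Suc n))) \<longlonglongrightarrow> f y + s * 0"
   using LIMSEQ_inverse_real_of_nat by (intro tendsto_intros) (simp add: inverse_eq_divide)
  hence cs: "(\<lambda>n. f y + s * (1 / real (Suc n))) \<longlonglongrightarrow> f y" by simp
  have ev: "\<forall>\<^sub>F n in sequentially. y \<in> V" using yV by simp
  have "\<forall>\<^sub>F n in sequentially. f y + s * (1 / real (Suc n)) \<in> I y"
   by (rule tendsto_\<Psi>(1)[OF yV level_mem[OF yV] tendsto_const cs ev])
  moreover have "(\<lambda>n. \<Psi> (f y + s * (1 / real (Suc n))) y) \<longlonglongrightarrow> y"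
   using tendsto_\<Psi>(2)[OF yV level_mem[OF yV] tendsto_const cs ev] \<Psi>_self[OF yV] by simp
  hence "\<forall>\<^sub>F n in sequentially. \<Psi> (f y + s * (1 / real (Suc n))) y \<in> N" using topological_tendstoD N(2) y by blast
  ultimately have "\<forall>\<^sub>F n in sequentially. f y + s * (1 / real (Suc n)) \<in> I y \<and>
    \<Psi> (f y + s * (1 / real (Suc n))) y \<in> N" by (rule eventually_conj)
  then obtain n where n: "f y + s * (1 / real (Suc n)) \<in> I y" "\<Psi> (f y + s * (1 / real (Suc n))) y \<in> N"
   by (auto simp: eventually_sequentially)
  have "f (\<Psi> (f y + s * (1 / real (Suc n))) y) = f y + s * (1 / real (Suc n))" using f_\<Psi>[OF yV n(1)] .
  thus ?thesis using n(2) s by (intro bexI[of _ "\<Psi> (f y + s * (1 / real (Suc n))) y"]) auto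
 qed
 have bound: "s * f y \<le> 0" if s: "s = 1 \<or> s = -1" and y: "y \<in> N" for s :: real and y
 proof -
  have "continuous_on (closure N) (\<lambda>y. s * f y)" by (intro continuous_intros cont)
  then obtain m where m: "m \<in> closure N" "\<And>y. y \<in> closure N \<Longrightarrow> s * f y \<le> s * f m"
   using continuous_attains_sup[OF cpt] by blast
  have "m \<notin> N"
  proof
   assume "m \<in> N"
   then obtain y' where "y' \<in> N" "s * f m < s * f y'" using move[OF _ s] by blast
   thus False using m(2)[of y'] clN by auto
  qed
  hence "f m = 0" using m(1) clN f0 by auto
  thus ?thesis using m(2)[of y] y clN by auto
 qed
 obtain y where y: "y \<in> N" using N by blast
 have zero: "f y = 0" if "y \<in> N" for y using bound[of 1 y] bound[of "-1" y] that by auto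
 show False using move[OF y, of 1] zero y by auto
qed

end

section \<open>The entry level: orbits that end at the singular point and orbits that pass
  by\<close>

context sectored_flow
begin

definition C where "C = {z \<in> Ws. f z = - \<epsilon>}"
definition G where "G = {z \<in> V. f z = - \<epsilon> \<and> \<epsilon> \<in> I z \<and> (\<forall>c. - \<epsilon> \<le> c \<and> c \<le> \<epsilon> \<longrightarrow> \<Psi> c z \<in> K)}"
definition C' where "C' = {z \<in> Wu. f z = \<epsilon>}"
definition G' where "G' = {z \<in> V. f z = \<epsilon> \<and> - \<epsilon> \<in> I z \<and> (\<forall>c. - \<epsilon> \<le> c \<and> c \<le> \<epsilon> \<longrightarrow> \<Psi> c z \<in> K)}"

lemma reversed_C: "sectored_flow.C x0 R (\<lambda>z. - f z) (\<lambda>z. uminus ` I z) (\<lambda>c. \<Psi> (- c)) \<epsilon> = C'"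
 unfolding sectored_flow.C_def[OF sectored_reversed] C'_def reversed_Ws by auto

lemma reversed_C': "sectored_flow.C' x0 R (\<lambda>z. - f z) (\<lambda>z. uminus ` I z) (\<lambda>c. \<Psi> (- c)) \<epsilon> = C"
 unfolding sectored_flow.C'_def[OF sectored_reversed] C_def reversed_Wu by auto

lemma G'_reverse_aux: "(\<forall>c. - \<epsilon> \<le> c \<and> c \<le> \<epsilon> \<longrightarrow> P (- c)) \<longleftrightarrow> (\<forall>c. - \<epsilon> \<le> c \<and> c \<le> \<epsilon> \<longrightarrow> P c)"
 by (metis add.inverse_inverse neg_le_iff_le)

lemma reversed_G: "sectored_flow.G x0 R (\<lambda>z. - f z) (\<lambda>z. uminus ` I z) (\<lambda>c. \<Psi> (- c)) \<epsilon> = G'"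
 unfolding sectored_flow.G_def[OF sectored_reversed] G'_def G'_reverse_aux[of "\<lambda>c. \<Psi> c _ \<in> K"] by force

lemma C_L: "C \<subseteq> level (- \<epsilon>)" and G_L: "G \<subseteq> level (- \<epsilon>)" using Ws_V by (auto simp: C_def G_def)

lemma C_G_disjoint: "C \<inter> G = {}" using Ws_levels_neg[of _ \<epsilon>] eps_pos by (force simp: C_def G_def)

lemma C_inner: "z \<in> C \<Longrightarrow> dist x0 z < R / 2" using Ws_exit[of z] Ws_K[of z] by (force simp: C_def K_def)

lemma compact_C: "compact C" unfolding compact_eq_bounded_closed
proof
 show "bounded C" by (rule bounded_subset[OF compact_imp_bounded[OF compact_K]]) (use Ws_K C_def in blast)
 show "closed C" unfolding closed_sequential_limits
 proof (intro allI impI, elim conjE)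
  fix x l assume x: "\<forall>n. x n \<in> C" "x \<longlonglongrightarrow> l"
  have "(\<lambda>n. f (x n)) \<longlonglongrightarrow> f l" by (rule tendsto_f_K(2)[OF x(2)]) (use x Ws_K C_def in blast)
  moreover have "(\<lambda>n. f (x n)) = (\<lambda>n. - \<epsilon>)" using x by (auto simp: C_def)
  ultimately have fl: "f l = - \<epsilon>" using LIMSEQ_unique[OF _ tendsto_const] by metis
  hence "l \<noteq> x0" using f_x0 eps_pos by auto
  thus "l \<in> C" using Ws_closed[OF _ x(2)] x(1) fl by (auto simp: C_def)
 qed
qed

text \<open>Otherwise points of neither kind would converge to \<open>z\<close>. They end up in
  \<open>K\<close>, because \<open>z\<close> is off the half-circle, and
  \<open>forward_segment\<close> keeps their orbits in \<open>K\<close> up to level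
  \<open>\<epsilon>\<close>, which is membership in \<open>G\<close>.\<close>

lemma C_neighbourhood:
 assumes "z \<in> C"
 obtains d where "d > 0" "level (- \<epsilon>) \<inter> ball z d \<subseteq> C \<union> G"
proof -
 have "z \<notin> closure (level (- \<epsilon>) - (C \<union> G))"
 proof
  assume "z \<in> closure (level (- \<epsilon>) - (C \<union> G))"
  then obtain q where q: "\<And>n. q n \<in> level (- \<epsilon>) - (C \<union> G)" "q \<longlonglongrightarrow> z" unfolding closure_sequential by auto
  have "\<forall>\<^sub>F n in sequentially. dist x0 (q n) < R / 2"
   by (rule order_tendstoD(2)[OF tendsto_dist[OF tendsto_const q(2)]]) (use C_inner assms in auto)
  then obtain N where N: "\<And>n. n \<ge> N \<Longrightarrow> dist x0 (q n) < R / 2" by (auto simp: eventually_sequentially)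
  have "\<forall>\<^sub>F n in sequentially. \<epsilon> \<in> I (q (n + N)) \<and>
    (\<forall>c. f (q (n + N)) \<le> c \<and> c \<le> \<epsilon> \<longrightarrow> \<Psi> c (q (n + N)) \<in> K)"
  proof (rule forward_segment[where p = z])
   show "(\<lambda>n. q (n + N)) \<longlonglongrightarrow> z" using q(2) LIMSEQ_ignore_initial_segment by blast
   show "z \<in> insert x0 Ws" "- \<epsilon> \<le> f z" using assms by (auto simp: C_def)
   show "q (n + N) \<in> K - {x0}" for n
    using N[of "n + N"] q(1)[of "n + N"] V_subset x0_notin_V by (fastforce simp: K_def)
   show "q (n + N) \<notin> Ws" for n using q(1)[of "n + N"] by (auto simp: C_def)
  qed
  then obtain n where n: "\<epsilon> \<in> I (q (n + N))"
    "\<forall>c. f (q (n + N)) \<le> c \<and> c \<le> \<epsilon> \<longrightarrow> \<Psi> c (q (n + N)) \<in> K" by (auto simp: eventually_sequentially)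
  hence "q (n + N) \<in> G" using q(1)[of "n + N"] by (auto simp: G_def)
  thus False using q(1) by blast
 qed
 then obtain d where "d > 0" "ball z d \<subseteq> - closure (level (- \<epsilon>) - (C \<union> G))"
  by (meson ComplI open_Compl closed_closure open_contains_ball)
 moreover have "q \<in> C \<union> G" if "q \<in> level (- \<epsilon>) \<inter> ball z d" for q
 proof (rule ccontr)
  assume "q \<notin> C \<union> G"
  hence "q \<in> closure (level (- \<epsilon>) - (C \<union> G))" using that by (intro subsetD[OF closure_subset]) blast
  thus False using calculation(2) that by blast
 qed
 ultimately show thesis by (intro that[of d]) blast+
qed

lemma G_levels: "z \<in> G \<Longrightarrow> - \<epsilon> \<le> c \<Longrightarrow> c \<le> \<epsilon> \<Longrightarrow> c \<in> I z"
 using level_mem[of z] levels_mem_interval[of z "- \<epsilon>" \<epsilon> c] by (auto simp: G_def)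

text \<open>At level \<open>0\<close> the orbits passing by can only accumulate at
  \<open>x0\<close>: another limit would lie in \<open>Wu\<close>, where levels are positive, or on
  the orbit of \<open>z\<close>, whose levels are negative.\<close>

lemma segments_to_x0:
 assumes q: "q \<longlonglongrightarrow> z" "z \<in> C" "\<And>n. q n \<in> G" and cs: "cs \<longlonglongrightarrow> 0" "\<And>n. - \<epsilon> \<le> cs n" "\<And>n. cs n \<le> \<epsilon>"
  and p: "(\<lambda>n. \<Psi> (cs n) (q n)) \<longlonglongrightarrow> p"
 shows "p = x0"
proof (rule ccontr)
 assume "p \<noteq> x0"
 have qV: "q n \<in> V" "f (q n) = - \<epsilon>" for n using q(3)[of n] by (auto simp: G_def)
 have csI: "cs n \<in> I (q n)" for n using G_levels q(3) cs by blast
 have inK: "\<Psi> c (q n) \<in> K" if "- \<epsilon> \<le> c" "c \<le> \<epsilon>" for n c using q(3)[of n] that by (auto simp: G_def)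
 have "p \<in> K" "(\<lambda>n. f (\<Psi> (cs n) (q n))) \<longlonglongrightarrow> f p" using tendsto_f_K[OF p] inK cs by auto
 hence fp: "f p = 0" using LIMSEQ_unique[OF cs(1)] f_\<Psi>[OF qV(1) csI] by simp
 have pV: "p \<in> V" using \<open>p \<in> K\<close> \<open>p \<noteq> x0\<close> K_subset by blast
 have self: "\<Psi> (- \<epsilon>) (\<Psi> (cs n) (q n)) = q n" "- \<epsilon> \<in> I (\<Psi> (cs n) (q n))" for n
  using \<Psi>_sym[OF qV(1) csI] qV(2) by metis+
 have seg: "\<Psi> c (\<Psi> (cs n) (q n)) \<in> K" if "- \<epsilon> \<le> c" "c \<le> cs n" for n c
  using \<Psi>_\<Psi>[OF qV(1) csI, of c] G_levels[OF q(3), of c] inK[of c n] that cs(3)[of n] by auto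
 have "p \<in> Wu \<or> (z \<noteq> x0 \<and> f z \<in> I p \<and> z = \<Psi> (f z) p \<and> f z \<le> f p \<and>
      (\<forall>c. f z \<le> c \<and> c \<le> f p \<longrightarrow> \<Psi> c p \<in> K))"
  by (rule segments_limit'[where zs = "\<lambda>n. \<Psi> (cs n) (q n)" and ds = "\<lambda>n. - \<epsilon>"])
    (use \<Psi>_mem[OF qV(1) csI] self f_\<Psi>[OF qV(1) csI] cs seg p \<open>p \<noteq> x0\<close> q(1) in auto)
 thus False
 proof
  assume "p \<in> Wu" thus False using Wu_pos fp by force
 next
  assume *: "z \<noteq> x0 \<and> f z \<in> I p \<and> z = \<Psi> (f z) p \<and> f z \<le> f p \<and>
      (\<forall>c. f z \<le> c \<and> c \<le> f p \<longrightarrow> \<Psi> c p \<in> K)"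
  hence "0 \<in> I z" using levels_\<Psi>[OF pV, of "f z"] level_mem[OF pV] fp by auto
  thus False using Ws_levels_neg[of z 0] assms(2) by (auto simp: C_def)
 qed
qed

text \<open>Between two points of \<open>C\<close> on a short arc, the points of level \<open>0\<close> on the intermediate orbits
 would form a loop through \<open>x0\<close>.\<close>

lemma no_gap:
 fixes a b :: real
 assumes \<sigma>: "continuous_on {a..b} \<sigma>" "inj_on \<sigma> {a..b}" and ab: "a < b" "\<sigma> a \<in> C" "\<sigma> b \<in> C"
  and gap: "\<And>u. a < u \<Longrightarrow> u < b \<Longrightarrow> \<sigma> u \<in> G"
 shows False
proof -
 define h where "h = (\<lambda>u. a + u * (b - a))"
 have h: "a < h u" "h u < b" if "0 < u" "u < 1" for u
  using that ab by (auto simp: h_def) (smt (verit) mult_less_cancel_right2)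
 have h01: "h u \<in> {a..b}" if "u \<in> {0..1}" for u
  using that ab by (auto simp: h_def mult_left_le_one_le) (smt (verit) mult_left_le_one_le)
 have h_inj: "h u = h u' \<Longrightarrow> u = u'" for u u' using ab by (auto simp: h_def)
 have hG: "\<sigma> (h u) \<in> G" if "0 < u" "u < 1" for u using gap h that by blast
 \<comment> \<open>A closed curve: by \<open>segments_to_x0\<close> the points of level
   \<open>0\<close> on the orbits through the gap tend to \<open>x0\<close> at both ends of the
   gap.\<close>
 define g where "g = (\<lambda>u. if u \<in> {0<..<1} then \<Psi> 0 (\<sigma> (h u)) else x0)"
 have zero: "0 \<in> I (\<sigma> (h u))" if "0 < u" "u < 1" for u using G_levels[OF hG[OF that]] eps_pos by auto
 have V: "\<sigma> (h u) \<in> V" "f (\<sigma> (h u)) = - \<epsilon>" if "0 < u" "u < 1" for u using hG[OF that] by (auto simp: G_def)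
 have x0K: "x0 \<in> K" using R_pos x0_half_plane by (auto simp: K_def)
 have gK: "g u \<in> K" for u using hG[of u] eps_pos x0K by (auto simp: g_def G_def)
 have gx0: "g u \<noteq> x0" if "0 < u" "u < 1" for u using \<Psi>_mem[OF V(1) zero, of u] that x0_notin_V by (auto simp: g_def)
 have cont\<sigma>h: "continuous_on {0..1} (\<lambda>u. \<sigma> (h u))"
  by (rule continuous_on_compose2[OF \<sigma>(1)]) (use h01 in \<open>auto simp: h_def intro!: continuous_intros\<close>)
 have "continuous_on {0..1} g" unfolding continuous_on_sequentially o_def
 proof (intro allI ballI impI, elim conjE)
  fix us u assume u: "u \<in> {0..1::real}" "\<forall>n. us n \<in> {0..1}" "us \<longlonglongrightarrow> u"
  have lim: "(\<lambda>n. \<sigma> (h (us n))) \<longlonglongrightarrow> \<sigma> (h u)" using cont\<sigma>h u unfolding continuous_on_sequentially o_def by blast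
  show "(\<lambda>n. g (us n)) \<longlonglongrightarrow> g u"
  proof (cases "u \<in> {0<..<1}")
   case True
   hence u01: "0 < u" "u < 1" by auto
   have ev: "\<forall>\<^sub>F n in sequentially. us n \<in> {0<..<1}" using topological_tendstoD[OF u(3) _ True] by simp
   have "(\<lambda>n. \<Psi> 0 (\<sigma> (h (us n)))) \<longlonglongrightarrow> \<Psi> 0 (\<sigma> (h u))"
    by (rule tendsto_\<Psi>(2)[OF V(1)[OF u01] zero[OF u01] lim tendsto_const])
      (use ev in eventually_elim, use V in auto)
   moreover have "\<forall>\<^sub>F n in sequentially. \<Psi> 0 (\<sigma> (h (us n))) = g (us n)"
    using ev by eventually_elim (auto simp: g_def)
   ultimately show ?thesis using True Lim_transform_eventually by (fastforce simp: g_def)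
  next
   case False
   hence e: "\<sigma> (h u) \<in> C" using u(1) ab by (cases "u = 0") (auto simp: h_def)
   have "(\<lambda>n. g (us n)) \<longlonglongrightarrow> x0"
   proof (rule compact_tendsto_unique[OF compact_K])
    fix r l assume r: "strict_mono (r::nat \<Rightarrow> nat)" "((\<lambda>n. g (us n)) \<circ> r) \<longlonglongrightarrow> l"
    show "l = x0"
    proof (rule ccontr)
     assume l: "l \<noteq> x0"
     have "\<forall>\<^sub>F n in sequentially. ((\<lambda>n. g (us n)) \<circ> r) n \<noteq> x0" using r(2) l tendsto_imp_eventually_ne by blast
     then obtain N where N: "\<And>n. n \<ge> N \<Longrightarrow> g (us (r n)) \<noteq> x0" by (auto simp: eventually_sequentially)
     have in01: "0 < us (r (n + N))" "us (r (n + N)) < 1" for n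
      using N[of "n + N"] by (auto simp: g_def split: if_splits)
     have q: "(\<lambda>n. \<sigma> (h (us (r (n + N))))) \<longlonglongrightarrow> \<sigma> (h u)"
      using LIMSEQ_ignore_initial_segment[OF LIMSEQ_subseq_LIMSEQ[OF lim r(1)], of N] by (simp add: o_def)
     have p: "(\<lambda>n. \<Psi> 0 (\<sigma> (h (us (r (n + N)))))) \<longlonglongrightarrow> l"
      using LIMSEQ_ignore_initial_segment[OF r(2), of N] in01 by (simp add: o_def g_def)
     have "l = x0" by (rule segments_to_x0[OF q e _ tendsto_const _ _ p]) (use hG in01 eps_pos in auto)
     thus False using l by simp
    qed
   qed (use gK in auto)
   thus ?thesis using False by (auto simp: g_def)
  qed
 qed
 hence "path g" by (simp add: path_def)
 moreover have "loop_free g" unfolding loop_free_def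
 proof (intro ballI impI)
  fix u u' assume u: "u \<in> {0..1::real}" "u' \<in> {0..1}" "g u = g u'"
  show "u = u' \<or> u = 0 \<and> u' = 1 \<or> u = 1 \<and> u' = 0"
  proof (cases "u \<in> {0<..<1} \<and> u' \<in> {0<..<1}")
   case True
   hence "\<Psi> 0 (\<sigma> (h u)) = \<Psi> 0 (\<sigma> (h u'))" using u(3) by (simp add: g_def)
   \<comment> \<open>Flowing back to level \<open>-\<epsilon>\<close> recovers the parameter, so the
     curve does not cross itself.\<close>
   hence "\<Psi> (- \<epsilon>) (\<sigma> (h u)) = \<Psi> (- \<epsilon>) (\<sigma> (h u'))"
    using \<Psi>_eqD(3)[OF V(1) zero V(1) zero, of u u' "- \<epsilon>"] True level_mem[OF V(1), of u] V(2)[of u] by auto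
   hence "\<sigma> (h u) = \<sigma> (h u')" using \<Psi>_self[OF V(1)] V(2) True by (metis greaterThanLessThan_iff)
   hence "h u = h u'" using inj_onD[OF \<sigma>(2)] h01 u by blast
   thus ?thesis using h_inj by blast
  next
   case False
   hence "g u = x0 \<or> g u' = x0" by (auto simp: g_def)
   hence "u \<notin> {0<..<1}" "u' \<notin> {0<..<1}" using gx0 u(3) by auto
   thus ?thesis using u by force
  qed
 qed
 ultimately have sp: "simple_path g" by (simp add: simple_path_def)
 show False
 proof (rule no_level_loop[OF sp])
  show "pathfinish g = pathstart g" by (simp add: pathfinish_def pathstart_def g_def)
  show "path_image g \<subseteq> K" using gK by (auto simp: path_image_def)
  show "x0 \<in> path_image g" by (auto simp: path_image_def g_def intro!: image_eqI[of _ _ 0])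
  show "f z = 0" if "z \<in> path_image g" for z using that f_\<Psi>[OF V(1) zero] f_x0 by (auto simp: path_image_def g_def)
 qed
qed

text \<open>Near its start the arc lies in \<open>C \<union> G\<close>. If it meets \<open>C\<close>
  again at a parameter \<open>b\<close>, then \<open>no_gap\<close> leaves no room for points of
  \<open>G\<close> before \<open>b\<close>; if it does not, it lies in \<open>G\<close> from the
  start on.\<close>

lemma half_arc_dichotomy:
 assumes \<sigma>: "continuous_on {0..1} \<sigma>" "inj_on \<sigma> {0..1}" "\<sigma> 0 \<in> C" "\<sigma> ` {0..1} \<subseteq> level (- \<epsilon>)"
 obtains e where "0 < e" "e \<le> (1::real)" "\<sigma> ` {0<..e} \<subseteq> C \<or> \<sigma> ` {0<..e} \<subseteq> G"
proof -
 obtain d where d: "d > 0" "level (- \<epsilon>) \<inter> ball (\<sigma> 0) d \<subseteq> C \<union> G" using C_neighbourhood \<sigma>(3) by blast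
 have "(0::real) \<in> {0..1}" by simp
 then obtain e1 where e1: "e1 > 0" "\<And>s. s \<in> {0..1} \<Longrightarrow> dist s 0 < e1 \<Longrightarrow> dist (\<sigma> s) (\<sigma> 0) < d"
  using \<sigma>(1) d(1) unfolding continuous_on_iff by blast
 define e where "e = min 1 (e1 / 2)"
 have e: "0 < e" "e \<le> 1" using e1 by (auto simp: e_def)
 have CG: "\<sigma> s \<in> C \<union> G" if "0 \<le> s" "s \<le> e" for s
 proof -
  have "dist (\<sigma> s) (\<sigma> 0) < d" using that e1 by (intro e1(2)) (auto simp: e_def dist_real_def)
  moreover have "s \<in> {0..1}" using that e by simp
  hence "\<sigma> s \<in> level (- \<epsilon>)" using \<sigma>(4) by blast
  ultimately have "\<sigma> s \<in> level (- \<epsilon>) \<inter> ball (\<sigma> 0) d" by (auto simp: dist_commute)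
  thus ?thesis using d by blast
 qed
 show thesis
 proof (cases "\<sigma> ` {0<..e} \<subseteq> G")
  case True
  thus ?thesis using that e by blast
 next
  case False
  then obtain b where b: "b \<in> {0<..e}" "\<sigma> b \<notin> G" by blast
  hence b: "0 < b" "b \<le> e" "\<sigma> b \<in> C" using CG[of b] by auto
  have "\<sigma> u \<in> C" if u: "0 < u" "u \<le> b" for u
  proof (rule ccontr)
   assume uC: "\<sigma> u \<notin> C"
   have sub: "{0..b} \<subseteq> {0..1}" using b e by auto
   have cpt: "compact {s \<in> {p..q}. \<sigma> s \<in> C}" if "0 \<le> p" "q \<le> b" for p q
   proof -
    have "closed ({p..q} \<inter> \<sigma> -` C)" by (rule continuous_closed_preimage[OF continuous_on_subset[OF \<sigma>(1)]])
       (use that sub b e compact_C compact_imp_closed in auto)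
    moreover have "{s \<in> {p..q}. \<sigma> s \<in> C} = {p..q} \<inter> \<sigma> -` C" by auto
    moreover have "bounded ({p..q} \<inter> \<sigma> -` C)" by (rule bounded_subset[of "{p..q}"]) auto
    ultimately show ?thesis by (simp add: compact_eq_bounded_closed)
   qed
   have "0 \<in> {s \<in> {0..u}. \<sigma> s \<in> C}" using u \<sigma>(3) by simp
   \<comment> \<open>\<open>p\<close> and \<open>q\<close> are the last parameter in
     \<open>C\<close> before \<open>u\<close> and the first one after it: the ends of the gap around
     \<open>u\<close>.\<close>
   then obtain p where p: "p \<in> {s \<in> {0..u}. \<sigma> s \<in> C}" "\<forall>s\<in>{s \<in> {0..u}. \<sigma> s \<in> C}. s \<le> p"
    using compact_attains_sup[OF cpt[of 0 u]] u by blast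
   have "b \<in> {s \<in> {u..b}. \<sigma> s \<in> C}" using u b by simp
   then obtain q where q: "q \<in> {s \<in> {u..b}. \<sigma> s \<in> C}" "\<forall>s\<in>{s \<in> {u..b}. \<sigma> s \<in> C}. q \<le> s"
    using compact_attains_inf[OF cpt[of u b]] u by auto
   have pq: "0 \<le> p" "p < u" "u < q" "q \<le> b" using p(1) q(1) uC by (auto simp: less_le)
   hence sub': "{p..q} \<subseteq> {0..1}" using sub by auto
   show False
   proof (rule no_gap[of p q \<sigma>])
    show "continuous_on {p..q} \<sigma>" by (rule continuous_on_subset[OF \<sigma>(1) sub'])
    show "inj_on \<sigma> {p..q}" by (rule inj_on_subset[OF \<sigma>(2) sub'])
    show "p < q" using pq by simp
    show "\<sigma> p \<in> C" "\<sigma> q \<in> C" using p q by auto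
    fix s assume s: "p < s" "s < q"
    have "\<sigma> s \<notin> C"
    proof
     assume "\<sigma> s \<in> C"
     hence "s \<le> p \<or> q \<le> s" using p(2) q(2) s pq by (cases "s \<le> u") auto
     thus False using s by auto
    qed
    thus "\<sigma> s \<in> G" using CG[of s] s pq b by auto
   qed
  qed
  hence "\<sigma> ` {0<..b} \<subseteq> C" by auto
  thus ?thesis using that b e by (meson order_trans)
 qed
qed

lemma local_structure:
 assumes z: "z \<in> C"
 shows "\<exists>\<sigma> J. (J = {-1..1} \<or> J = {0..1::real}) \<and> continuous_on J \<sigma> \<and> inj_on \<sigma> J \<and> \<sigma> 0 = z \<and>
   \<sigma> ` J \<subseteq> level (- \<epsilon>) \<and> openin (top_of_set (level (- \<epsilon>))) (\<sigma> ` (J \<inter> {-1<..<1})) \<and>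
   (\<sigma> ` (J \<inter> {0<..1}) \<subseteq> C \<or> \<sigma> ` (J \<inter> {0<..1}) \<subseteq> G) \<and>
   (\<sigma> ` (J \<inter> {-1..<0}) \<subseteq> C \<or> \<sigma> ` (J \<inter> {-1..<0}) \<subseteq> G)"
proof -
 have zV: "z \<in> V" "f z = - \<epsilon>" using z C_L by auto
 obtain \<sigma> J where J: "J = {-1..1} \<or> J = {0..1::real}" and \<sigma>: "continuous_on J \<sigma>" "inj_on \<sigma> J" "\<sigma> 0 = z"
  "\<sigma> ` J \<subseteq> level (- \<epsilon>)"
  "\<forall>e. 0 < e \<and> e \<le> 1 \<longrightarrow> openin (top_of_set (level (- \<epsilon>))) (\<sigma> ` {s\<in>J. \<bar>s\<bar> < e})"
  using section_arc[OF zV(1), unfolded zV(2)] by blast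
 have J1: "{0..1} \<subseteq> J" using J by auto
 obtain e1 where e1: "0 < e1" "e1 \<le> 1" "\<sigma> ` {0<..e1} \<subseteq> C \<or> \<sigma> ` {0<..e1} \<subseteq> G"
 proof (rule half_arc_dichotomy[of \<sigma>])
  show "continuous_on {0..1} \<sigma>" "inj_on \<sigma> {0..1}" "\<sigma> ` {0..1} \<subseteq> level (- \<epsilon>)"
   using \<sigma>(1,2,4) J1 by (auto intro: continuous_on_subset inj_on_subset)
 qed (use \<sigma>(3) z in auto)
 obtain e2 where e2: "0 < e2" "e2 \<le> 1" "\<sigma> ` (J \<inter> {-e2..<0}) \<subseteq> C \<or> \<sigma> ` (J \<inter> {-e2..<0}) \<subseteq> G"
 proof (cases "J = {-1..1}")
  case False
  hence "J \<inter> {-1..<0} = {}" using J by auto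
  thus ?thesis using that[of 1] by auto
 next
  case True
  obtain e where e: "0 < e" "e \<le> 1" "(\<lambda>s. \<sigma> (- s)) ` {0<..e} \<subseteq> C \<or> (\<lambda>s. \<sigma> (- s)) ` {0<..e} \<subseteq> G"
  proof (rule half_arc_dichotomy[of "\<lambda>s. \<sigma> (- s)"])
   show "continuous_on {0..1} (\<lambda>s. \<sigma> (- s))"
    by (rule continuous_on_compose2[OF \<sigma>(1)]) (use True in \<open>auto intro!: continuous_intros\<close>)
   show "inj_on (\<lambda>s. \<sigma> (- s)) {0..1}" using inj_onD[OF \<sigma>(2)] True by (intro inj_onI) force
   show "(\<lambda>s. \<sigma> (- s)) ` {0..1} \<subseteq> level (- \<epsilon>)"
   proof (rule image_subsetI)
    fix s :: real assume "s \<in> {0..1}"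
    hence "- s \<in> J" using True by simp
    thus "\<sigma> (- s) \<in> level (- \<epsilon>)" using \<sigma>(4) by blast
   qed
  qed (use \<sigma> z in auto)
  have "(\<lambda>s. \<sigma> (- s)) ` {0<..e} = \<sigma> ` (J \<inter> {-e..<0})"
   using True e by (force simp: image_iff intro: bexI[of _ "- _"])
  thus ?thesis using that e by metis
 qed
 \<comment> \<open>Rescaling by the smaller bound makes each half of the arc of one kind over its
   full parameter range, the form in which arcs are cut into pieces later.\<close>
 define e where "e = min e1 e2"
 have e: "0 < e" "e \<le> 1" using e1 e2 by (auto simp: e_def)
 have eJ: "e * s \<in> J" if "s \<in> J" for s using symmetric_interval_scale(2)[OF J e order_refl that] by simp
 have "J \<inter> {-1<..<1} = {s\<in>J. \<bar>s\<bar> < 1}" by auto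
 hence eq: "(\<lambda>s. \<sigma> (e * s)) ` (J \<inter> {-1<..<1}) = \<sigma> ` {s\<in>J. \<bar>s\<bar> < e}"
  using symmetric_interval_scale(1)[OF J e order_refl] by (simp add: image_image)
 have pos: "(\<lambda>s. \<sigma> (e * s)) ` (J \<inter> {0<..1}) \<subseteq> \<sigma> ` {0<..e1}"
 proof (rule image_subsetI)
  fix s assume "s \<in> J \<inter> {0<..1}"
  hence "e * s \<le> e * 1" "0 < e * s" using e by (intro mult_left_mono mult_pos_pos; simp)+
  thus "\<sigma> (e * s) \<in> \<sigma> ` {0<..e1}" by (intro imageI) (auto simp: e_def)
 qed
 have neg: "(\<lambda>s. \<sigma> (e * s)) ` (J \<inter> {-1..<0}) \<subseteq> \<sigma> ` (J \<inter> {-e2..<0})"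
 proof (rule image_subsetI)
  fix s assume s: "s \<in> J \<inter> {-1..<0}"
  hence "e * (-s) \<le> e * 1" "0 < e * (-s)" using e by (intro mult_left_mono mult_pos_pos; simp)+
  thus "\<sigma> (e * s) \<in> \<sigma> ` (J \<inter> {-e2..<0})" using s eJ by (intro imageI) (auto simp: e_def)
 qed
 have "continuous_on J (\<lambda>s. \<sigma> (e * s))"
  by (rule continuous_on_compose2[OF \<sigma>(1)]) (use eJ in \<open>auto intro!: continuous_intros\<close>)
 moreover have "inj_on (\<lambda>s. \<sigma> (e * s)) J" by (rule inj_on_scaled[OF \<sigma>(2)]) (use eJ e in auto)
 moreover have "(\<lambda>s. \<sigma> (e * s)) ` J \<subseteq> level (- \<epsilon>)" using \<sigma>(4) eJ by blast
 moreover have "openin (top_of_set (level (- \<epsilon>))) ((\<lambda>s. \<sigma> (e * s)) ` (J \<inter> {-1<..<1}))"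
  unfolding eq using \<sigma>(5) e by blast
 moreover have "(\<lambda>s. \<sigma> (e * s)) ` (J \<inter> {0<..1}) \<subseteq> C \<or> (\<lambda>s. \<sigma> (e * s)) ` (J \<inter> {0<..1}) \<subseteq> G"
  using e1(3) order_trans[OF pos] by blast
 moreover have "(\<lambda>s. \<sigma> (e * s)) ` (J \<inter> {-1..<0}) \<subseteq> C \<or> (\<lambda>s. \<sigma> (e * s)) ` (J \<inter> {-1..<0}) \<subseteq> G"
  using e2(3) order_trans[OF neg] by blast
 ultimately show ?thesis using J \<sigma>(3) by (intro exI[of _ "\<lambda>s. \<sigma> (e * s)"] exI[of _ J]) simp
qed

end

section \<open>Cutting a compact subset of a one-dimensional set into arcs\<close>

lemma consecutive_elements:
 fixes t :: real
 assumes "finite E" "p \<in> E" "p \<le> t" "q \<in> E" "t < q"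
 obtains a b where "a \<in> E" "b \<in> E" "a \<le> t" "t < b" "open_segment a b \<inter> E = {}"
proof -
 define a where "a = Max {e \<in> E. e \<le> t}"
 define b where "b = Min {e \<in> E. t < e}"
 have a: "a \<in> {e \<in> E. e \<le> t}" "\<And>e. e \<in> E \<Longrightarrow> e \<le> t \<Longrightarrow> e \<le> a"
 proof -
  show "a \<in> {e \<in> E. e \<le> t}" unfolding a_def by (rule Max_in) (use assms in auto)
  show "e \<le> a" if "e \<in> E" "e \<le> t" for e unfolding a_def by (rule Max_ge) (use assms that in auto)
 qed
 have b: "b \<in> {e \<in> E. t < e}" "\<And>e. e \<in> E \<Longrightarrow> t < e \<Longrightarrow> b \<le> e"
 proof -
  show "b \<in> {e \<in> E. t < e}" unfolding b_def by (rule Min_in) (use assms in auto)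
  show "b \<le> e" if "e \<in> E" "t < e" for e unfolding b_def by (rule Min_le) (use assms that in auto)
 qed
 have "open_segment a b \<inter> E = {}" using a b by (force simp: open_segment_eq_real_ivl)
 thus thesis using that[of a b] a b by auto
qed

text \<open>Finitely many local arcs cover \<open>C\<close>. Every one of them is cut at the centers
  and end points \<open>E\<close> of all of them. The interior of a resulting piece is connected and
  avoids \<open>E\<close>, so two of the pieces that are kept have the same interior as soon as
  their interiors meet. Pieces inside \<open>G\<close> are dropped; every other piece lies in
  \<open>C\<close> or, suitably oriented, starts in \<open>C\<close> and continues in
  \<open>G\<close>.\<close>

lemma cut_into_arcs:
 fixes C G L :: "'a::metric_space set"
 assumes "compact C" and CG: "C \<inter> G = {}"
  and local: "\<And>z. z \<in> C \<Longrightarrow> \<exists>\<sigma> J. (J = {-1..1} \<or> J = {0..1::real}) \<and> continuous_on J \<sigma> \<and> inj_on \<sigma> J \<and>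
   \<sigma> 0 = z \<and> \<sigma> ` J \<subseteq> L \<and> openin (top_of_set L) (\<sigma> ` (J \<inter> {-1<..<1})) \<and>
   (\<sigma> ` (J \<inter> {0<..1}) \<subseteq> C \<or> \<sigma> ` (J \<inter> {0<..1}) \<subseteq> G) \<and>
   (\<sigma> ` (J \<inter> {-1..<0}) \<subseteq> C \<or> \<sigma> ` (J \<inter> {-1..<0}) \<subseteq> G)"
 shows "\<exists>F. finite F \<and>
  (\<forall>g\<in>F. continuous_on {0..1} g \<and> inj_on g {0..1} \<and> g ` {0..1} \<subseteq> L \<and>
    openin (top_of_set L) (g ` {0<..<1}) \<and> (g ` {0..1} \<subseteq> C \<or> (g 0 \<in> C \<and> g ` {0<..1} \<subseteq> G))) \<and>
  (\<forall>g\<in>F. \<forall>h\<in>F. g \<noteq> h \<longrightarrow> g ` {0<..<(1::real)} \<inter> h ` {0..1} = {}) \<and>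
  C \<subseteq> (\<Union>g\<in>F. g ` {0..1}) \<and>
  openin (top_of_set L) (C \<union> (\<Union>g\<in>F. g ` {0<..<1}))"
proof -
 have "\<forall>z\<in>C. \<exists>\<sigma> J. (J = {-1..1} \<or> J = {0..1::real}) \<and> continuous_on J \<sigma> \<and> inj_on \<sigma> J \<and>
   \<sigma> 0 = z \<and> \<sigma> ` J \<subseteq> L \<and> openin (top_of_set L) (\<sigma> ` (J \<inter> {-1<..<1})) \<and>
   (\<sigma> ` (J \<inter> {0<..1}) \<subseteq> C \<or> \<sigma> ` (J \<inter> {0<..1}) \<subseteq> G) \<and>
   (\<sigma> ` (J \<inter> {-1..<0}) \<subseteq> C \<or> \<sigma> ` (J \<inter> {-1..<0}) \<subseteq> G)" using local by blast
 then obtain \<sigma> J where loc: "\<forall>z\<in>C. (J z = {-1..1} \<or> J z = {0..1::real}) \<and> continuous_on (J z) (\<sigma> z) \<and> inj_on (\<sigma> z) (J z) \<and>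
   \<sigma> z 0 = z \<and> \<sigma> z ` J z \<subseteq> L \<and> openin (top_of_set L) (\<sigma> z ` (J z \<inter> {-1<..<1})) \<and>
   (\<sigma> z ` (J z \<inter> {0<..1}) \<subseteq> C \<or> \<sigma> z ` (J z \<inter> {0<..1}) \<subseteq> G) \<and>
   (\<sigma> z ` (J z \<inter> {-1..<0}) \<subseteq> C \<or> \<sigma> z ` (J z \<inter> {-1..<0}) \<subseteq> G)" unfolding bchoice_iff by blast
 have J: "J z = {-1..1} \<or> J z = {0..1}" and cont: "continuous_on (J z) (\<sigma> z)" and inj: "inj_on (\<sigma> z) (J z)"
  and \<sigma>0: "\<sigma> z 0 = z" and \<sigma>L: "\<sigma> z ` J z \<subseteq> L" and opn: "openin (top_of_set L) (\<sigma> z ` (J z \<inter> {-1<..<1}))"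
  and pos: "\<sigma> z ` (J z \<inter> {0<..1}) \<subseteq> C \<or> \<sigma> z ` (J z \<inter> {0<..1}) \<subseteq> G"
  and neg: "\<sigma> z ` (J z \<inter> {-1..<0}) \<subseteq> C \<or> \<sigma> z ` (J z \<inter> {-1..<0}) \<subseteq> G" if "z \<in> C" for z using loc that by blast+
 have J0: "0 \<in> J z" "1 \<in> J z" "J z \<subseteq> {-1..1}" "convex (J z)" "compact (J z)" if "z \<in> C" for z
  by (rule disjE[OF J[OF that]], simp_all)+
 have "\<forall>z\<in>C. \<exists>W. open W \<and> \<sigma> z ` (J z \<inter> {-1<..<1}) = L \<inter> W" using opn unfolding openin_open by blast
 then obtain W where "\<forall>z\<in>C. open (W z) \<and> \<sigma> z ` (J z \<inter> {-1<..<1}) = L \<inter> W z" unfolding bchoice_iff by blast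
 hence W: "\<And>z. z \<in> C \<Longrightarrow> open (W z)" "\<And>z. z \<in> C \<Longrightarrow> \<sigma> z ` (J z \<inter> {-1<..<1}) = L \<inter> W z" by blast+
 have zW: "z \<in> L \<inter> W z" if "z \<in> C" for z
 proof -
  have "0 \<in> J z \<inter> {-1<..<1}" using J0[OF that] by simp
  hence "\<sigma> z 0 \<in> L \<inter> W z" using W(2)[OF that] by blast
  thus ?thesis using \<sigma>0[OF that] by simp
 qed
 obtain Z where Z: "Z \<subseteq> C" "finite Z" "C \<subseteq> (\<Union>z\<in>Z. W z)" using compactE_image[OF \<open>compact C\<close>, of C W] W(1) zW by blast
 \<comment> \<open>The centers, with parameter \<open>0\<close>, are cut points as well, since the
   kind of an arc may change there.\<close>
 define E where "E = (\<Union>z\<in>Z. \<sigma> z ` ({-1, 0, 1} \<inter> J z))"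
 have "finite E" unfolding E_def using Z by auto
 define Ez where "Ez z = {t \<in> J z. \<sigma> z t \<in> E}" for z
 have finEz: "finite (Ez z)" if "z \<in> Z" for z
 proof -
  have "finite (\<sigma> z -` E \<inter> J z)" using finite_vimage_IntI[OF \<open>finite E\<close>] inj Z that by blast
  moreover have "\<sigma> z -` E \<inter> J z = Ez z" by (auto simp: Ez_def)
  ultimately show ?thesis by simp
 qed
 have special: "t \<in> Ez z" if "z \<in> Z" "t \<in> J z" "t = -1 \<or> t = 0 \<or> t = 1" for z t
  using that by (auto simp: Ez_def E_def)
 \<comment> \<open>Each piece occurs with both orientations, because a piece of mixed kind has to
   start at its end in \<open>C\<close>.\<close>
 define T where "T = {(z, a, b). z \<in> Z \<and> a \<in> Ez z \<and> b \<in> Ez z \<and> a \<noteq> b \<and> open_segment a b \<inter> Ez z = {}}"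
 have TD: "z \<in> C" "a \<in> J z" "b \<in> J z" "a \<noteq> b" "\<sigma> z a \<in> E" "\<sigma> z b \<in> E" "closed_segment a b \<subseteq> J z"
  "open_segment a b \<subseteq> J z \<inter> {-1<..<1}" if "(z, a, b) \<in> T" for z a b
 proof -
  show z: "z \<in> C" and ab: "a \<in> J z" "b \<in> J z" "a \<noteq> b" "\<sigma> z a \<in> E" "\<sigma> z b \<in> E"
   using that Z by (auto simp: T_def Ez_def)
  show cs: "closed_segment a b \<subseteq> J z" using J0(4)[OF z] ab(1,2) by (simp add: closed_segment_subset)
  show "open_segment a b \<subseteq> J z \<inter> {-1<..<1}"
  proof -
   have "a \<in> {-1..1}" "b \<in> {-1..1}" using J0(3)[OF z] ab(1,2) by blast+
   hence "open_segment a b \<subseteq> {-1<..<1}" by (auto simp: open_segment_eq_real_ivl split: if_splits)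
   thus ?thesis using cs segment_open_subset_closed by blast
  qed
 qed
 have finT: "finite T"
 proof (rule finite_subset)
  show "T \<subseteq> Z \<times> (\<Union>z\<in>Z. Ez z) \<times> (\<Union>z\<in>Z. Ez z)" by (auto simp: T_def)
  show "finite (Z \<times> (\<Union>z\<in>Z. Ez z) \<times> (\<Union>z\<in>Z. Ez z))" using Z finEz by auto
 qed
 have T_sym: "(z, b, a) \<in> T" if "(z, a, b) \<in> T" for z a b using that by (auto simp: T_def open_segment_commute)
 define arc where "arc = (\<lambda>(z, a, b) u. \<sigma> z (linepath a b u))"
 have arc_closed: "arc (z, a, b) ` {0..1} = \<sigma> z ` closed_segment a b" for z a b
  unfolding arc_def by (simp flip: linepath_image_01 add: image_image)
 have lp_open: "linepath a b ` {0<..<1} = open_segment a b" if "a \<noteq> b" for a b :: real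
  using that by (auto simp: open_segment_image_interval linepath_def)
 have arc_open: "arc (z, a, b) ` {0<..<1} = \<sigma> z ` open_segment a b" if "a \<noteq> b" for z a b
  unfolding arc_def lp_open[OF that, symmetric] by (simp add: image_image)
 have arc_ends: "arc (z, a, b) 0 = \<sigma> z a" "arc (z, a, b) 1 = \<sigma> z b" for z a b by (auto simp: arc_def linepath_def)
 have closed_split: "{0..1::real} = insert 0 (insert 1 {0<..<1})" "{0<..1::real} = insert 1 {0<..<1}" by auto
 have open_E: "\<sigma> z ` open_segment a b \<inter> E = {}" if "(z, a, b) \<in> T" for z a b
  using that TD(8)[OF that] by (auto simp: T_def Ez_def)
 have sign: "closed_segment a b \<subseteq> {0..1} \<or> closed_segment a b \<subseteq> {-1..0}" if t: "(z, a, b) \<in> T" for z a b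
 proof -
  have "0 \<in> Ez z" using special t J0 TD(1)[OF t] by (auto simp: T_def)
  hence "0 \<notin> open_segment a b" using t by (auto simp: T_def)
  thus ?thesis using TD(2,3)[OF t] J0(3)[OF TD(1)[OF t]]
   by (auto simp: open_segment_eq_real_ivl closed_segment_eq_real_ivl split: if_splits)
 qed
 define ok where "ok g \<longleftrightarrow> g ` {0..1} \<subseteq> C \<or> (g 0 \<in> C \<and> g ` {0<..1} \<subseteq> G)" for g :: "real \<Rightarrow> 'a"
 have kinds: "\<sigma> z ` closed_segment a b \<subseteq> C \<or> \<sigma> z ` closed_segment a b \<subseteq> G \<or>
   ok (arc (z, a, b)) \<or> ok (arc (z, b, a))" if t: "(z, a, b) \<in> T" for z a b
 proof -
  have z: "z \<in> C" using TD(1)[OF t] .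
  have "closed_segment a b - {0} \<subseteq> J z \<inter> {0<..1} \<or> closed_segment a b - {0} \<subseteq> J z \<inter> {-1..<0}"
   using sign[OF t] TD(7)[OF t] by fastforce
  hence "\<sigma> z ` (closed_segment a b - {0}) \<subseteq> C \<or> \<sigma> z ` (closed_segment a b - {0}) \<subseteq> G"
   using pos[OF z] neg[OF z] by blast
  hence *: "\<sigma> z ` closed_segment a b \<subseteq> C \<or> \<sigma> z ` (closed_segment a b - {0}) \<subseteq> G"
   using \<sigma>0[OF z] z by (metis image_subset_iff insertCI insert_Diff_single Diff_iff singletonD)
  have start: "ok (arc (z, a, b))"
   if t: "(z, a, b) \<in> T" "a = 0" and g: "\<sigma> z ` (closed_segment a b - {0}) \<subseteq> G" for a b
  proof -
   have "arc (z, a, b) ` {0<..1} \<subseteq> \<sigma> z ` (closed_segment a b - {0})"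
    unfolding closed_split(2) image_insert arc_open[OF TD(4)[OF t(1)]] arc_ends
    using TD(4)[OF t(1)] t(2) by (auto simp: open_segment_def)
   thus ?thesis unfolding ok_def arc_ends using g t(2) \<sigma>0[OF z] z by auto
  qed
  show ?thesis
  proof (cases "\<sigma> z ` closed_segment a b \<subseteq> C")
   case False
   hence g: "\<sigma> z ` (closed_segment a b - {0}) \<subseteq> G" using * by blast
   show ?thesis
   proof (cases "0 \<in> closed_segment a b")
    case True
    have "0 \<notin> open_segment a b" using t special[of z 0] J0(1)[OF z] by (auto simp: T_def)
    hence "a = 0 \<or> b = 0" using True by (auto simp: open_segment_def)
    thus ?thesis using start[OF t _ g] start[OF T_sym[OF t] _ g[unfolded closed_segment_commute[of a b]]] by blast
   qed (use g in auto)
  qed simp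
 qed
 have cover: "\<exists>z a b t. (z, a, b) \<in> T \<and> a \<le> t \<and> t < b \<and> y = \<sigma> z t"
  if yz: "y \<in> \<sigma> z ` (J z \<inter> {-1<..<1})" and zZ: "z \<in> Z" for y z
 proof -
  have z: "z \<in> C" using Z zZ by blast
  obtain t where t0: "t \<in> J z" "t \<in> {-1<..<1}" and t4: "y = \<sigma> z t" using yz by blast
  hence t: "t \<in> J z" "-1 < t" "t < 1" "y = \<sigma> z t" by auto
  have "\<exists>p\<in>Ez z. p \<le> t"
  proof (cases "J z = {-1..1}")
   case True thus ?thesis using special[of z "-1"] t zZ by (intro bexI[of _ "-1"]) auto
  next
   case False hence "J z = {0..1}" using J[OF z] by blast
   thus ?thesis using special[of z 0] t zZ by (intro bexI[of _ 0]) auto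
  qed
  then obtain p where p: "p \<in> Ez z" "p \<le> t" by blast
  obtain a b where "a \<in> Ez z" "b \<in> Ez z" "a \<le> t" "t < b" "open_segment a b \<inter> Ez z = {}"
   using consecutive_elements[OF finEz[OF zZ] p special[OF zZ J0(2)[OF z]] t(3)] by blast
  thus ?thesis using t(4) zZ by (intro exI[of _ z] exI[of _ a] exI[of _ b] exI[of _ t]) (auto simp: T_def)
 qed
 define F0 where "F0 = {g \<in> arc ` T. ok g}"
 have "finite F0" unfolding F0_def using finT by simp
 have F0_props: "continuous_on {0..1} g \<and> inj_on g {0..1} \<and> g ` {0..1} \<subseteq> L \<and>
    openin (top_of_set L) (g ` {0<..<1})" if g: "g \<in> F0" for g
 proof -
  obtain z a b where t: "(z, a, b) \<in> T" and g: "g = arc (z, a, b)" using g by (auto simp: F0_def)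
  note d = TD[OF t]
  have sub: "linepath a b ` {0..1} \<subseteq> J z" using d(7) by (simp add: linepath_image_01)
  have "continuous_on {0..1} g" unfolding g arc_def prod.case
   by (rule continuous_on_compose2[OF cont[OF d(1)] _ sub]) (auto intro: continuous_intros)
  moreover have "inj_on g {0..1}" unfolding g arc_def prod.case
  proof (rule inj_onI)
   fix u u' :: real assume u: "u \<in> {0..1}" "u' \<in> {0..1}" "\<sigma> z (linepath a b u) = \<sigma> z (linepath a b u')"
   have "linepath a b u = linepath a b u'" using inj_onD[OF inj[OF d(1)] u(3)] sub u by blast
   hence "(u - u') * (b - a) = 0" by (simp add: linepath_def algebra_simps)
   thus "u = u'" using d(4) by simp
  qed
  moreover have "g ` {0..1} \<subseteq> L" unfolding g arc_closed using d(1,7) \<sigma>L by blast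
  moreover have "openin (top_of_set L) (g ` {0<..<1})"
  proof -
   obtain \<tau> where \<tau>: "homeomorphism (J z) (\<sigma> z ` J z) (\<sigma> z) \<tau>"
    using homeomorphism_compact[OF J0(5)[OF d(1)] cont[OF d(1)] refl inj[OF d(1)]] by blast
   have "openin (top_of_set (J z)) (open_segment a b)"
    using d(8) by (intro open_subset) (auto simp: open_segment_eq_real_ivl)
   hence "openin (top_of_set (\<sigma> z ` J z)) (\<sigma> z ` open_segment a b)" using homeomorphism_imp_open_map[OF \<tau>] by blast
   then obtain S where S: "open S" "\<sigma> z ` open_segment a b = \<sigma> z ` J z \<inter> S" unfolding openin_open by blast
   have "\<sigma> z ` open_segment a b = \<sigma> z ` (J z \<inter> {-1<..<1}) \<inter> S" using S(2) d(8) by blast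
   thus ?thesis unfolding g arc_open[OF d(4)] using opn[OF d(1)] S(1) by (auto simp: openin_Int_open)
  qed
  ultimately show ?thesis by blast
 qed
 \<comment> \<open>The trace of the piece \<open>P\<close> on the arc \<open>\<sigma> w\<close> is
   open and closed in \<open>P\<close>, so \<open>P\<close> lies in that arc. There it corresponds
   to an interval of parameters without cut points, which cannot leave the segment from
   \<open>c\<close> to \<open>d\<close>.\<close>
 have incl: "g ` {0<..<1} \<subseteq> h ` {0<..<1}"
  if gh: "g \<in> F0" "h \<in> F0" and meet: "g ` {0<..<1} \<inter> h ` {0<..<1} \<noteq> {}" for g h
 proof -
  obtain z a b where t: "(z, a, b) \<in> T" and g: "g = arc (z, a, b)" using gh by (auto simp: F0_def)
  obtain w c d where s: "(w, c, d) \<in> T" and h: "h = arc (w, c, d)" using gh by (auto simp: F0_def)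
  note dt = TD[OF t] and ds = TD[OF s]
  define P where "P = g ` {0<..<1}"
  have "P = \<sigma> z ` open_segment a b" by (simp add: P_def g arc_open[OF dt(4)])
  moreover have "connected (\<sigma> z ` open_segment a b)"
   by (rule connected_continuous_image[OF continuous_on_subset[OF cont[OF dt(1)]]])
     (use dt(8) in \<open>auto intro: convex_connected\<close>)
  moreover have "\<sigma> z ` open_segment a b \<subseteq> L" using \<sigma>L[OF dt(1)] dt(8) by blast
  ultimately have P: "connected P" "P \<inter> E = {}" "P \<subseteq> L" using open_E[OF t] by simp_all
  define M where "M = P \<inter> \<sigma> w ` J w"
  have wZ: "w \<in> Z" using s by (auto simp: T_def)
  have M: "M = P \<inter> \<sigma> w ` (J w \<inter> {-1<..<1})"
  proof -
   have "\<sigma> w t \<in> E" if "t \<in> J w" "t \<notin> {-1<..<1}" for t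
    using that J0(3)[OF ds(1)] special[OF wZ that(1)] by (force simp: Ez_def)
   thus ?thesis using P(2) unfolding M_def by blast
  qed
  have "openin (top_of_set P) M" unfolding M using opn[OF ds(1)] P(3) by (auto simp: openin_open)
  moreover have "closedin (top_of_set P) M"
   unfolding M_def using compact_imp_closed[OF compact_continuous_image[OF cont J0(5)], OF ds(1) ds(1)]
   by (simp add: closedin_closed_Int)
  moreover have "M \<noteq> {}" using meet ds(8) unfolding h arc_open[OF ds(4)] M_def P_def by auto
  ultimately have "M = P" using P(1) connected_clopen by blast
  hence PJ: "P \<subseteq> \<sigma> w ` J w" by (auto simp: M_def)
  obtain \<tau> where \<tau>: "homeomorphism (J w) (\<sigma> w ` J w) (\<sigma> w) \<tau>"
   using homeomorphism_compact[OF J0(5)[OF ds(1)] cont[OF ds(1)] refl inj[OF ds(1)]] by blast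
  have "connected (\<tau> ` P)" by (rule connected_continuous_image[OF continuous_on_subset[OF _ PJ] P(1)])
     (use \<tau> in \<open>simp add: homeomorphism_def\<close>)
  hence ivl: "is_interval (\<tau> ` P)" by (simp add: is_interval_connected_1)
  have \<sigma>\<tau>: "\<sigma> w (\<tau> y) = y" "\<tau> y \<in> J w" if "y \<in> P" for y using \<tau> PJ that by (auto simp: homeomorphism_def)
  have notin: "c \<notin> \<tau> ` P" "d \<notin> \<tau> ` P" using \<sigma>\<tau> P(2) ds(5,6) by auto
  obtain y where y: "y \<in> P" "y \<in> \<sigma> w ` open_segment c d" using meet unfolding h arc_open[OF ds(4)] P_def by auto
  then obtain u where u: "u \<in> open_segment c d" "y = \<sigma> w u" by auto
  have "\<tau> y = u" using u \<tau> ds(8) by (auto simp: homeomorphism_def)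
  hence u\<tau>: "u \<in> \<tau> ` P" using y by auto
  have "\<tau> ` P \<subseteq> open_segment c d"
  proof
   fix v assume v: "v \<in> \<tau> ` P"
   have "closed_segment u v \<subseteq> \<tau> ` P" using ivl u\<tau> v by (simp add: closed_segment_subset is_interval_convex)
   hence "c \<notin> closed_segment u v" "d \<notin> closed_segment u v" using notin by auto
   thus "v \<in> open_segment c d"
    using u(1) by (auto simp: open_segment_eq_real_ivl closed_segment_eq_real_ivl split: if_splits)
  qed
  hence "P \<subseteq> \<sigma> w ` open_segment c d" using \<sigma>\<tau>(1) by (metis (no_types, lifting) image_eqI image_subset_iff subsetI)
  thus ?thesis unfolding h arc_open[OF ds(4)] P_def .
 qed
 have eq_or_disj: "g ` {0<..<1} \<inter> h ` {0..1} = {}" if gh: "g \<in> F0" "h \<in> F0" "g ` {0<..<1} \<noteq> h ` {0<..<1}" for g h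
 proof -
  obtain z a b where t: "(z, a, b) \<in> T" and g: "g = arc (z, a, b)" using gh by (auto simp: F0_def)
  obtain w c d where s: "(w, c, d) \<in> T" and h: "h = arc (w, c, d)" using gh by (auto simp: F0_def)
  have "g ` {0<..<1} \<inter> h ` {0<..<1} = {}" using incl[of g h] incl[of h g] gh by blast
  moreover have "g ` {0<..<1} \<inter> E = {}" unfolding g arc_open[OF TD(4)[OF t]] using open_E[OF t] .
  moreover have "h 0 \<in> E" "h 1 \<in> E" using TD(5,6)[OF s] by (auto simp: h arc_ends)
  ultimately have "h 0 \<notin> g ` {0<..<1}" "h 1 \<notin> g ` {0<..<1}" "g ` {0<..<1} \<inter> h ` {0<..<1} = {}"
   by (metis disjoint_iff)+
  moreover have "h ` {0..1} = insert (h 0) (insert (h 1) (h ` {0<..<1}))"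
   by (simp only: closed_split(1) image_insert)
  ultimately show ?thesis by (simp only: Int_insert_right if_False)
 qed
 have C_cover: "C \<subseteq> (\<Union>g\<in>F0. g ` {0..1})"
 proof
  fix y assume y: "y \<in> C"
  then obtain z where z: "z \<in> Z" "y \<in> W z" using Z by blast
  hence "y \<in> \<sigma> z ` (J z \<inter> {-1<..<1})" using W(2) Z zW[OF y] by blast
  then obtain z a b t where t: "(z, a, b) \<in> T" "a \<le> t" "t < b" "y = \<sigma> z t" using cover[OF _ z(1)] by blast
  have mem: "y \<in> \<sigma> z ` closed_segment a b" using t by (auto simp: closed_segment_eq_real_ivl)
  hence "\<not> \<sigma> z ` closed_segment a b \<subseteq> G" using y CG by blast
  then consider "ok (arc (z, a, b))" | "ok (arc (z, b, a))" using kinds[OF t(1)] by (auto simp: ok_def arc_closed)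
  thus "y \<in> (\<Union>g\<in>F0. g ` {0..1})"
  proof cases
   case 1
   thus ?thesis using mem t(1) arc_closed by (intro UN_I[of "arc (z, a, b)"]) (auto simp: F0_def)
  next
   case 2
   thus ?thesis using mem T_sym[OF t(1)] arc_closed[of z b a]
    by (intro UN_I[of "arc (z, b, a)"]) (auto simp: F0_def closed_segment_commute)
  qed
 qed
 have O_open: "openin (top_of_set L) (C \<union> (\<Union>g\<in>F0. g ` {0<..<1}))" (is "openin _ ?O")
 proof (subst openin_subopen, intro ballI)
  fix y assume y: "y \<in> ?O"
  show "\<exists>S. openin (top_of_set L) S \<and> y \<in> S \<and> S \<subseteq> ?O"
  proof (cases "y \<in> C")
   case False
   then obtain g where "g \<in> F0" "y \<in> g ` {0<..<1}" using y by blast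
   thus ?thesis using F0_props by (intro exI[of _ "g ` {0<..<1}"]) blast
  next
   case True
   then obtain z where z: "z \<in> Z" "y \<in> W z" using Z by blast
   \<comment> \<open>What has to be taken out of a local arc so that the rest lies in the claimed
     open set: the dropped pieces, and the far end points of mixed pieces, which belong to
     \<open>E \<inter> G\<close>. Both are closed.\<close>
   define Bad where "Bad = (\<Union>(z, a, b)\<in>{(z, a, b)\<in>T. \<sigma> z ` closed_segment a b \<subseteq> G}. \<sigma> z ` closed_segment a b)
     \<union> (E \<inter> G)"
   have "closed Bad" unfolding Bad_def
   proof (intro closed_Un closed_UN)
    show "finite {(z, a, b)\<in>T. \<sigma> z ` closed_segment a b \<subseteq> G}" using finT by (rule rev_finite_subset) auto
    show "\<forall>x\<in>{(z, a, b)\<in>T. \<sigma> z ` closed_segment a b \<subseteq> G}. closed (case x of (z, a, b) \<Rightarrow> \<sigma> z ` closed_segment a b)"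
    proof safe
     fix z a b assume "(z, a, b) \<in> T"
     from continuous_on_subset[OF cont[OF TD(1)[OF this]] TD(7)[OF this]]
     show "closed (\<sigma> z ` closed_segment a b)" by (intro compact_imp_closed compact_continuous_image) auto
    qed
    show "closed (E \<inter> G)" using \<open>finite E\<close> by (simp add: finite_imp_closed)
   qed
   moreover have "y \<notin> Bad" using True CG by (auto simp: Bad_def)
   moreover have zC: "z \<in> C" using Z z by blast
   moreover have "y \<in> \<sigma> z ` (J z \<inter> {-1<..<1})" using W(2) Z z zW[OF True] by blast
   moreover have "\<sigma> z ` (J z \<inter> {-1<..<1}) - Bad \<subseteq> ?O"
   proof
    fix y' assume y': "y' \<in> \<sigma> z ` (J z \<inter> {-1<..<1}) - Bad"
    then obtain z a b t where t: "(z, a, b) \<in> T" "a \<le> t" "t < b" "y' = \<sigma> z t" using cover[OF _ z(1)] by blast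
    have mem: "y' \<in> \<sigma> z ` closed_segment a b" using t by (auto simp: closed_segment_eq_real_ivl)
    have nG: "\<not> \<sigma> z ` closed_segment a b \<subseteq> G" using mem y' t(1) by (auto simp: Bad_def)
    have oks: "y' \<in> ?O" if "(z, a, b) \<in> T" "ok (arc (z, a, b))" "y' \<in> \<sigma> z ` closed_segment a b" for z a b
    proof -
     have F: "arc (z, a, b) \<in> F0" using that by (auto simp: F0_def)
     have "y' \<in> arc (z, a, b) ` {0..1}" using that(3) arc_closed by simp
     then consider "y' = arc (z, a, b) 0" | "y' = arc (z, a, b) 1" | "y' \<in> arc (z, a, b) ` {0<..<1}"
      unfolding closed_split(1) by blast
     thus ?thesis
     proof cases
      case 1
      have "arc (z, a, b) 0 \<in> C" using that(2) unfolding ok_def closed_split(1) by blast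
      thus ?thesis using 1 by simp
     next
      case 2
      have "arc (z, a, b) 1 \<in> C \<or> arc (z, a, b) 1 \<in> G" using that(2) unfolding ok_def closed_split by blast
      moreover have "arc (z, a, b) 1 \<in> E" using TD(6)[OF that(1)] arc_ends by simp
      ultimately show ?thesis using y' 2 by (auto simp: Bad_def)
     qed (use F in blast)
    qed
    show "y' \<in> ?O"
    proof (cases "\<sigma> z ` closed_segment a b \<subseteq> C")
     case True
     thus ?thesis using mem by blast
    next
     case False
     then consider "ok (arc (z, a, b))" | "ok (arc (z, b, a))" using kinds[OF t(1)] nG by blast
     thus ?thesis
     proof cases
      case 1 thus ?thesis using oks[OF t(1)] mem by blast
     next
      case 2
      have "y' \<in> \<sigma> z ` closed_segment b a" using mem by (simp only: closed_segment_commute)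
      thus ?thesis using oks[OF T_sym[OF t(1)] 2] by blast
     qed
    qed
   qed
   moreover have "openin (top_of_set L) (\<sigma> z ` (J z \<inter> {-1<..<1}) - Bad)"
    using opn[OF zC] \<open>closed Bad\<close> by (metis Diff_eq open_Compl openin_Int_open)
   ultimately show ?thesis by blast
  qed
 qed
 \<comment> \<open>One piece for each open image, as overlapping local arcs and opposite
   orientations may describe the same set.\<close>
 obtain F where FF0: "F \<subseteq> F0" and key: "inj_on (\<lambda>g. g ` {0<..<1}) F" "(\<lambda>g. g ` {0<..<1}) ` F0 = (\<lambda>g. g ` {0<..<1}) ` F"
  using subset_image_inj[THEN iffD1, OF order_refl, where f1 = "\<lambda>g. g ` {0<..<1}" and T1 = F0] by (elim exE conjE)
 \<comment> \<open>The closed arcs are determined by the open ones, so the choice of representatives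
   still covers \<open>C\<close>.\<close>
 have closure_eq: "g ` {0..1} = closure (g ` {0<..<1})" if "g \<in> F0" for g
 proof
  have c: "continuous_on {0..1} g" using F0_props that by blast
  have "closure {0<..<1::real} = {0..1}" by simp
  thus "g ` {0..1} \<subseteq> closure (g ` {0<..<1})" using image_closure_subset[of "{0<..<1}" g "closure (g ` {0<..<1})"] c
    closure_subset[of "g ` {0<..<1}"] by simp
  show "closure (g ` {0<..<1}) \<subseteq> g ` {0..1}"
   by (rule closure_minimal) (auto intro!: compact_imp_closed compact_continuous_image c)
 qed
 have 1: "finite F" using finite_subset[OF FF0 \<open>finite F0\<close>] .
 have 2: "\<forall>g\<in>F. continuous_on {0..1} g \<and> inj_on g {0..1} \<and> g ` {0..1} \<subseteq> L \<and>
    openin (top_of_set L) (g ` {0<..<1}) \<and> (g ` {0..1} \<subseteq> C \<or> (g 0 \<in> C \<and> g ` {0<..1} \<subseteq> G))"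
 proof
  fix g assume "g \<in> F"
  hence g: "g \<in> F0" using FF0 by blast
  hence "ok g" by (simp add: F0_def)
  thus "continuous_on {0..1} g \<and> inj_on g {0..1} \<and> g ` {0..1} \<subseteq> L \<and>
    openin (top_of_set L) (g ` {0<..<1}) \<and> (g ` {0..1} \<subseteq> C \<or> (g 0 \<in> C \<and> g ` {0<..1} \<subseteq> G))"
   using F0_props[OF g] unfolding ok_def by simp
 qed
 have 3: "\<forall>g\<in>F. \<forall>h\<in>F. g \<noteq> h \<longrightarrow> g ` {0<..<1} \<inter> h ` {0..1} = {}"
 proof (intro ballI impI)
  fix g h assume gh: "g \<in> F" "h \<in> F" "g \<noteq> h"
  hence "g ` {0<..<1} \<noteq> h ` {0<..<1}" using inj_onD[OF key(1)] by blast
  thus "g ` {0<..<1} \<inter> h ` {0..1} = {}" using gh FF0 by (intro eq_or_disj) auto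
 qed
 have 4: "C \<subseteq> (\<Union>g\<in>F. g ` {0..1})"
 proof
  fix y assume "y \<in> C"
  then obtain g where g: "g \<in> F0" "y \<in> g ` {0..1}" using C_cover by blast
  have "g ` {0<..<1} \<in> (\<lambda>g. g ` {0<..<1}) ` F" unfolding key(2)[symmetric] using g(1) by (rule imageI)
  then obtain h where h: "g ` {0<..<1} = h ` {0<..<1}" "h \<in> F" by (rule imageE)
  have "g ` {0..1} = h ` {0..1}" using closure_eq[OF g(1)] closure_eq[OF subsetD[OF FF0 h(2)]] h(1) by simp
  thus "y \<in> (\<Union>g\<in>F. g ` {0..1})" using g(2) h(2) by blast
 qed
 have "(\<Union>g\<in>F. g ` {0<..<1}) = (\<Union>g\<in>F0. g ` {0<..<1})" using key(2) by simp
 hence 5: "openin (top_of_set L) (C \<union> (\<Union>g\<in>F. g ` {0<..<1}))" using O_open by simp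
 show ?thesis by (intro exI[of _ F] conjI; fact)
qed

section \<open>Parametrised sectors\<close>

text \<open>The opening angle is \<open>1\<close>, so that the angle is itself the parameter of an
  arc over \<open>{0..1}\<close>; since \<open>1 < pi\<close>, it is recovered by
  \<open>Arg\<close>, which is continuous on the punctured cone.\<close>

definition cone :: "complex set" where
 "cone = (\<lambda>(r, \<theta>). rcis r \<theta>) ` ({0..1} \<times> {0..1})"

definition open_cone :: "complex set" where
 "open_cone = insert 0 {rcis r \<theta> | r \<theta>. r \<in> {0<..<1} \<and> \<theta> \<in> {0..1}}"

lemma pi_gt_1: "1 < pi" using pi_gt3 by simp

lemma cone_iff: "z \<in> cone \<longleftrightarrow> z = 0 \<or> (cmod z \<le> 1 \<and> 0 \<le> Arg z \<and> Arg z \<le> 1)"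
proof
 assume "z \<in> cone"
 then obtain r \<theta> where z: "z = rcis r \<theta>" "0 \<le> r" "r \<le> 1" "0 \<le> \<theta>" "\<theta> \<le> 1" by (auto simp: cone_def)
 show "z = 0 \<or> (cmod z \<le> 1 \<and> 0 \<le> Arg z \<and> Arg z \<le> 1)"
 proof (cases "r = 0")
  case False
  hence "Arg z = \<theta>" using z pi_gt_1 by (simp add: Arg_rcis)
  thus ?thesis using z by simp
 qed (use z in simp)
next
 assume *: "z = 0 \<or> (cmod z \<le> 1 \<and> 0 \<le> Arg z \<and> Arg z \<le> 1)"
 show "z \<in> cone"
 proof (cases "z = 0")
  case True
  hence "z = rcis 0 0" by simp
  thus ?thesis unfolding cone_def by (intro image_eqI[of _ _ "(0, 0)"]) auto
 next
  case False
  thus ?thesis using * rcis_cmod_Arg[of z] unfolding cone_def by (intro image_eqI[of _ _ "(cmod z, Arg z)"]) auto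
 qed
qed

lemma open_cone_iff: "z \<in> open_cone \<longleftrightarrow> z = 0 \<or> (cmod z < 1 \<and> 0 \<le> Arg z \<and> Arg z \<le> 1)"
proof
 assume "z \<in> open_cone"
 then consider "z = 0" | r \<theta> where "z = rcis r \<theta>" "0 < r" "r < 1" "0 \<le> \<theta>" "\<theta> \<le> 1" by (auto simp: open_cone_def)
 thus "z = 0 \<or> (cmod z < 1 \<and> 0 \<le> Arg z \<and> Arg z \<le> 1)"
 proof cases
  case 2
  hence "Arg z = \<theta>" using pi_gt_1 by (simp add: Arg_rcis)
  thus ?thesis using 2 by simp
 qed simp
next
 assume *: "z = 0 \<or> (cmod z < 1 \<and> 0 \<le> Arg z \<and> Arg z \<le> 1)"
 show "z \<in> open_cone"
 proof (cases "z = 0")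
  case False
  thus ?thesis using * rcis_cmod_Arg[of z] unfolding open_cone_def
   by (intro insertI2 CollectI exI[of _ "cmod z"] exI[of _ "Arg z"]) auto
 qed (simp add: open_cone_def)
qed

lemma compact_cone: "compact cone" unfolding cone_def
proof (rule compact_continuous_image)
 show "continuous_on ({0..1} \<times> {0..1}) (\<lambda>(r, \<theta>). rcis r \<theta>)"
  unfolding rcis_def case_prod_unfold by (intro continuous_intros)
qed (intro compact_Times compact_Icc)

lemma cone_Arg_continuous: "z \<in> cone \<Longrightarrow> z \<noteq> 0 \<Longrightarrow> isCont Arg z"
proof (rule continuous_at_Arg)
 assume z: "z \<in> cone" "z \<noteq> 0"
 hence a: "0 \<le> Arg z" "Arg z \<le> 1" by (auto simp: cone_iff)
 hence "cos (Arg z) > 0" using pi_gt3 by (intro cos_gt_zero_pi) auto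
 hence "Re (rcis (cmod z) (Arg z)) > 0" using z(2) by simp
 hence "Re z > 0" by (simp only: rcis_cmod_Arg)
 thus "z \<notin> \<real>\<^sub>\<le>\<^sub>0" by (auto simp: complex_nonpos_Reals_iff)
qed

section \<open>Parabolic charts, and the transition from level \<open>-\<epsilon>\<close> to level
  \<open>\<epsilon>\<close>\<close>

context sectored_flow
begin

lemma C_levels: "q \<in> C \<Longrightarrow> - \<epsilon> \<le> c \<Longrightarrow> c < 0 \<Longrightarrow> c \<in> I q" using Ws_levels[of q c] by (auto simp: C_def)

lemma C'_levels: "q \<in> C' \<Longrightarrow> 0 < c \<Longrightarrow> c \<le> \<epsilon> \<Longrightarrow> c \<in> I q" using Wu_levels[of q c] by (auto simp: C'_def)

lemma C_orbit: assumes "q \<in> C" "- \<epsilon> \<le> c" "c < 0" shows "\<Psi> c q \<in> Ws"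
 using Ws_forward[of q c] C_levels[OF assms] assms by (auto simp: C_def)

lemma C'_orbit: assumes "q \<in> C'" "0 < c" "c \<le> \<epsilon>" shows "\<Psi> c q \<in> Wu"
 using Wu_backward[of q c] C'_levels[OF assms] assms by (auto simp: C'_def)

lemma C_V: "q \<in> C \<Longrightarrow> q \<in> V" and C'_V: "q \<in> C' \<Longrightarrow> q \<in> V" and G_V: "q \<in> G \<Longrightarrow> q \<in> V"
 and f_C: "q \<in> C \<Longrightarrow> f q = - \<epsilon>" and f_C': "q \<in> C' \<Longrightarrow> f q = \<epsilon>" and f_G: "q \<in> G \<Longrightarrow> f q = - \<epsilon>"
 using Ws_V Wu_V by (auto simp: C_def C'_def G_def)

lemma C_self: "q \<in> C \<Longrightarrow> \<Psi> (- \<epsilon>) q = q" and C'_self: "q \<in> C' \<Longrightarrow> \<Psi> \<epsilon> q = q"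
 and G_self: "q \<in> G \<Longrightarrow> \<Psi> (- \<epsilon>) q = q" using \<Psi>_self[of q] C_V C'_V G_V f_C f_C' f_G by metis+

lemma x0_K: "x0 \<in> K" using R_pos x0_half_plane by (auto simp: K_def)

text \<open>A subsequence stays in \<open>Ws\<close> or in \<open>Wu\<close>. Both contain their
  limits other than \<open>x0\<close>, and \<open>f\<close> has no zero on either.\<close>

lemma limit_level_zero:
 assumes "\<And>n. zs n \<in> insert x0 (Ws \<union> Wu)" "zs \<longlonglongrightarrow> z" "f z = 0"
 shows "z = x0"
proof (rule ccontr)
 assume z: "z \<noteq> x0"
 hence "\<forall>\<^sub>F n in sequentially. zs n \<noteq> x0" using assms(2) tendsto_imp_eventually_ne by blast
 then obtain N where N: "\<And>n. n \<ge> N \<Longrightarrow> zs n \<noteq> x0" by (auto simp: eventually_sequentially)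
 have mem: "zs (n + N) \<in> Ws \<union> Wu" for n using N[of "n + N"] assms(1)[of "n + N"] by auto
 have lim: "(\<lambda>n. zs (n + N)) \<longlonglongrightarrow> z" using assms(2) LIMSEQ_ignore_initial_segment by blast
 show False
 proof (cases "\<exists>\<^sub>F n in sequentially. zs (n + N) \<in> Ws")
  case True
  then obtain r where r: "strict_mono (r::nat\<Rightarrow>nat)" "\<And>n. zs (r n + N) \<in> Ws" using frequently_subsequenceE by blast
  have "(\<lambda>n. zs (r n + N)) \<longlonglongrightarrow> z" using LIMSEQ_subseq_LIMSEQ[OF lim r(1)] by (simp add: o_def)
  hence "z \<in> Ws" using Ws_closed[of "\<lambda>n. zs (r n + N)"] r(2) z by blast
  thus False using Ws_neg assms(3) by force
 next
  case False
  hence "\<forall>\<^sub>F n in sequentially. zs (n + N) \<notin> Ws" by (simp add: frequently_def)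
  hence "\<forall>\<^sub>F n in sequentially. zs (n + N) \<in> Wu" by eventually_elim (use mem in blast)
  then obtain M where M: "\<And>n. n \<ge> M \<Longrightarrow> zs (n + N) \<in> Wu" by (auto simp: eventually_sequentially)
  have "(\<lambda>n. zs (n + M + N)) \<longlonglongrightarrow> z" using LIMSEQ_ignore_initial_segment[OF lim, of M] by simp
  hence "z \<in> Wu" using Wu_closed[of "\<lambda>n. zs (n + M + N)" z] M z by auto
  thus False using Wu_pos assms(3) by force
 qed
qed

text \<open>The modulus measures the level in units of \<open>-\<epsilon>\<close>: radii are orbits
  tending to \<open>x0\<close>, and the rim of the cone is the given arc.\<close>

definition parabolic_map :: "(real \<Rightarrow> complex) \<Rightarrow> complex \<Rightarrow> complex" where
 "parabolic_map g z = (if z = 0 then x0 else \<Psi> (- \<epsilon> * cmod z) (g (Arg z)))"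

context
 fixes g :: "real \<Rightarrow> complex"
 assumes g: "continuous_on {0..1} g" "inj_on g {0..1}" "g ` {0..1} \<subseteq> C"
begin

lemma par_arc: "0 \<le> t \<Longrightarrow> t \<le> 1 \<Longrightarrow> g t \<in> C" using g(3) by auto

lemma cone_level: assumes "z \<in> cone" "z \<noteq> 0"
 shows "- \<epsilon> \<le> - \<epsilon> * cmod z" "- \<epsilon> * cmod z < 0" "g (Arg z) \<in> C" "- \<epsilon> * cmod z \<in> I (g (Arg z))"
proof -
 have z: "cmod z \<le> 1" "0 \<le> Arg z" "Arg z \<le> 1" using assms by (auto simp: cone_iff)
 thus 1: "- \<epsilon> \<le> - \<epsilon> * cmod z" "- \<epsilon> * cmod z < 0" "g (Arg z) \<in> C"
  using eps_pos assms(2) par_arc by (auto simp: mult_left_le)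
 thus "- \<epsilon> * cmod z \<in> I (g (Arg z))" by (intro C_levels)
qed

lemma parabolic_map_Ws: "z \<in> cone \<Longrightarrow> z \<noteq> 0 \<Longrightarrow> parabolic_map g z \<in> Ws"
 using C_orbit cone_level by (simp add: parabolic_map_def)

lemma f_parabolic_map: "z \<in> cone \<Longrightarrow> f (parabolic_map g z) = - \<epsilon> * cmod z"
 using f_\<Psi>[OF C_V] cone_level f_x0 by (auto simp: parabolic_map_def)

lemma inj_parabolic_map: "inj_on (parabolic_map g) cone"
proof (rule inj_onI)
 fix z w assume zw: "z \<in> cone" "w \<in> cone" "parabolic_map g z = parabolic_map g w"
 hence n: "cmod z = cmod w" using f_parabolic_map eps_pos by (metis mult_cancel_left neg_equal_0_iff_equal less_irrefl)
 show "z = w"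
 proof (cases "z = 0")
  case False
  hence nz: "z \<noteq> 0" "w \<noteq> 0" using n by auto
  hence "\<Psi> (- \<epsilon> * cmod z) (g (Arg z)) = \<Psi> (- \<epsilon> * cmod w) (g (Arg w))" using zw by (simp add: parabolic_map_def)
  from \<Psi>_eqD(3)[OF _ _ _ _ this, of "- \<epsilon>"] have "\<Psi> (- \<epsilon>) (g (Arg z)) = \<Psi> (- \<epsilon>) (g (Arg w))"
   using cone_level zw nz C_V C_levels eps_pos by simp
  hence "g (Arg z) = g (Arg w)" using C_self cone_level zw nz by simp
  hence "Arg z = Arg w" using inj_onD[OF g(2)] zw nz by (auto simp: cone_iff)
  thus ?thesis using n by (metis rcis_cmod_Arg)
 qed (use n in simp)
qed

lemma continuous_parabolic_map: "continuous_on cone (parabolic_map g)" unfolding continuous_on_sequentially o_def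
proof (intro allI ballI impI, elim conjE)
 fix zs z assume z: "z \<in> cone" "\<forall>n. zs n \<in> cone" "zs \<longlonglongrightarrow> z"
 show "(\<lambda>n. parabolic_map g (zs n)) \<longlonglongrightarrow> parabolic_map g z"
 proof (cases "z = 0")
  case True
  have K: "parabolic_map g (zs n) \<in> insert x0 (Ws \<union> Wu)" for n
   using parabolic_map_Ws[of "zs n"] z(2) by (auto simp: parabolic_map_def)
  have inK: "parabolic_map g (zs n) \<in> K" for n using K[of n] x0_K by (auto intro: Ws_K Wu_K)
  \<comment> \<open>At the vertex the angles need not converge. The levels do, and at level
    \<open>0\<close> the only possible cluster point is \<open>x0\<close>.\<close>
  have "(\<lambda>n. parabolic_map g (zs n)) \<longlonglongrightarrow> x0"
  proof (rule compact_tendsto_unique[OF compact_K])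
   show "\<forall>\<^sub>F n in sequentially. parabolic_map g (zs n) \<in> K" using inK by simp
   fix r l assume r: "strict_mono (r::nat\<Rightarrow>nat)" "((\<lambda>n. parabolic_map g (zs n)) \<circ> r) \<longlonglongrightarrow> l" "l \<in> K"
   have "(\<lambda>n. f (((\<lambda>n. parabolic_map g (zs n)) \<circ> r) n)) \<longlonglongrightarrow> f l" by (rule tendsto_f_K(2)[OF r(2)]) (use inK in simp)
   moreover have "(\<lambda>n. f (((\<lambda>n. parabolic_map g (zs n)) \<circ> r) n)) \<longlonglongrightarrow> - \<epsilon> * cmod z"
    using f_parabolic_map z(2) LIMSEQ_subseq_LIMSEQ[OF z(3) r(1)] by (auto simp: o_def intro!: tendsto_intros)
   ultimately have "f l = 0" using LIMSEQ_unique True by fastforce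
   thus "l = x0" using limit_level_zero[OF _ r(2)] K by simp
  qed
  thus ?thesis using True by (simp add: parabolic_map_def)
 next
  case False
  have "isCont Arg z" using cone_Arg_continuous z(1) False by blast
  hence A: "(\<lambda>n. Arg (zs n)) \<longlonglongrightarrow> Arg z" using z(3) isCont_tendsto_compose by blast
  have ev: "\<forall>\<^sub>F n in sequentially. zs n \<noteq> 0" using z(3) False tendsto_imp_eventually_ne by blast
  hence ev2: "\<forall>\<^sub>F n in sequentially. Arg (zs n) \<in> {0..1}" by eventually_elim (use z(2) in \<open>auto simp: cone_iff\<close>)
  have "Arg z \<in> {0..1}" using z(1) False by (auto simp: cone_iff)
  hence gA: "(\<lambda>n. g (Arg (zs n))) \<longlonglongrightarrow> g (Arg z)" by (intro continuous_on_tendsto_compose[OF g(1) A _ ev2])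
  have "(\<lambda>n. \<Psi> (- \<epsilon> * cmod (zs n)) (g (Arg (zs n)))) \<longlonglongrightarrow> \<Psi> (- \<epsilon> * cmod z) (g (Arg z))"
  proof (rule tendsto_\<Psi>(2)[OF C_V _ gA])
   show "\<forall>\<^sub>F n in sequentially. g (Arg (zs n)) \<in> V" using ev2 by eventually_elim (use C_V par_arc in auto)
  qed (use cone_level z(1) False z(3) in \<open>auto intro!: tendsto_intros\<close>)
  moreover have "\<forall>\<^sub>F n in sequentially. \<Psi> (- \<epsilon> * cmod (zs n)) (g (Arg (zs n))) = parabolic_map g (zs n)"
   using ev by eventually_elim (simp add: parabolic_map_def)
  ultimately show ?thesis using False Lim_transform_eventually by (fastforce simp: parabolic_map_def)
 qed
qed

lemma parabolic_orbit:
 assumes "z \<in> cone" "z \<noteq> 0" "- \<epsilon> \<le> c" "c < 0"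
 shows "c \<in> I (parabolic_map g z)" "\<Psi> c (parabolic_map g z) = parabolic_map g (rcis (- c / \<epsilon>) (Arg z))"
proof -
 note l = cone_level[OF assms(1,2)]
 have c: "c \<in> I (g (Arg z))" using C_levels l(3) assms by blast
 thus "c \<in> I (parabolic_map g z)" using levels_\<Psi>[OF C_V[OF l(3)] l(4)] assms by (simp add: parabolic_map_def)
 have r: "- c / \<epsilon> > 0" using assms eps_pos by (simp add: field_simps)
 have "Arg (rcis (- c / \<epsilon>) (Arg z)) = Arg z" using r Arg_bounded[of z] by (intro Arg_rcis) auto
 moreover have "rcis (- c / \<epsilon>) (Arg z) \<noteq> 0" using assms(4) eps_pos by simp
 moreover have "- \<epsilon> * cmod (rcis (- c / \<epsilon>) (Arg z)) = c"
 proof -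
  have "cmod (rcis (- c / \<epsilon>) (Arg z)) = - c / \<epsilon>" using r by (simp only: complex_mod_rcis abs_of_pos)
  thus ?thesis using eps_pos by simp
 qed
 ultimately show "\<Psi> c (parabolic_map g z) = parabolic_map g (rcis (- c / \<epsilon>) (Arg z))"
  using \<Psi>_\<Psi>[OF C_V[OF l(3)] l(4) c] assms(2) unfolding parabolic_map_def by simp
qed

end

text \<open>The transition map from level \<open>-\<epsilon>\<close> to level \<open>\<epsilon>\<close> has a limit at an end of \<open>C\<close>: otherwise it
 would pass infinitely often through one of the end points of a level arc, but it is injective.\<close>

context
 fixes g :: "real \<Rightarrow> complex"
 assumes g: "continuous_on {0..1} g" "inj_on g {0..1}" "g 0 \<in> C" "g ` {0<..1} \<subseteq> G"
begin

lemma hyp_arc: "0 < t \<Longrightarrow> t \<le> 1 \<Longrightarrow> g t \<in> G" using g(4) by auto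

lemma hyp_levels: "0 < t \<Longrightarrow> t \<le> 1 \<Longrightarrow> - \<epsilon> \<le> c \<Longrightarrow> c \<le> \<epsilon> \<Longrightarrow> c \<in> I (g t)" using G_levels hyp_arc by blast

lemma hyp_V: "0 \<le> t \<Longrightarrow> t \<le> 1 \<Longrightarrow> g t \<in> V" using G_V hyp_arc C_V g(3) by (cases "t = 0") auto

lemma transition_inj:
 assumes "0 < t" "t \<le> 1" "0 < t'" "t' \<le> 1" "- \<epsilon> \<le> c" "c \<le> \<epsilon>" "- \<epsilon> \<le> c'" "c' \<le> \<epsilon>" "\<Psi> c (g t) = \<Psi> c' (g t')"
 shows "c = c'" "t = t'"
proof -
 show "c = c'" using \<Psi>_eqD(1)[OF _ _ _ _ assms(9)] hyp_levels hyp_V assms by simp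
 have "\<Psi> (- \<epsilon>) (g t) = \<Psi> (- \<epsilon>) (g t')" using \<Psi>_eqD(3)[OF _ _ _ _ assms(9)] hyp_levels hyp_V assms eps_pos by simp
 hence "g t = g t'" using G_self hyp_arc assms by simp
 thus "t = t'" using inj_onD[OF g(2)] assms by simp
qed

lemma transition_continuous: "continuous_on {0<..1} (\<lambda>t. \<Psi> \<epsilon> (g t))"
 by (rule continuous_on_\<Psi>[OF continuous_on_const continuous_on_subset[OF g(1)]])
   (use hyp_levels hyp_V eps_pos in auto)

lemma transition_K: "0 < t \<Longrightarrow> t \<le> 1 \<Longrightarrow> - \<epsilon> \<le> c \<Longrightarrow> c \<le> \<epsilon> \<Longrightarrow> \<Psi> c (g t) \<in> K" using hyp_arc by (auto simp: G_def)

text \<open>Read backwards from level \<open>\<epsilon>\<close>, the segments converge to an orbit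
  segment between \<open>g 0\<close> and \<open>p\<close>, unless \<open>p\<close> lies in
  \<open>Wu\<close>. The former is impossible, because the levels of \<open>g 0\<close> are
  negative.\<close>

lemma transition_cluster:
 assumes u: "u \<longlonglongrightarrow> 0" "\<And>n. 0 < u n" "\<And>n. u n \<le> 1" and p: "(\<lambda>n. \<Psi> \<epsilon> (g (u n))) \<longlonglongrightarrow> p"
 shows "p \<in> C'"
proof -
 have eI: "\<epsilon> \<in> I (g (u n))" "- \<epsilon> \<in> I (g (u n))" "g (u n) \<in> V" "f (g (u n)) = - \<epsilon>" for n
  using hyp_levels[OF u(2,3)] eps_pos hyp_V[OF less_imp_le[OF u(2)] u(3)] f_G[OF hyp_arc[OF u(2,3)]] by auto
 have "p \<in> K" "(\<lambda>n. f (\<Psi> \<epsilon> (g (u n)))) \<longlonglongrightarrow> f p" using tendsto_f_K[OF p] transition_K[OF u(2,3)] eps_pos by auto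
 hence "(\<lambda>n::nat. \<epsilon>) \<longlonglongrightarrow> f p" using f_\<Psi>[OF eI(3,1)] by simp
 hence fp: "f p = \<epsilon>" using LIMSEQ_unique[OF tendsto_const] by metis
 hence px: "p \<noteq> x0" using f_x0 eps_pos by auto
 have lim: "(\<lambda>n. g (u n)) \<longlonglongrightarrow> g 0"
  by (rule continuous_on_tendsto_compose[OF g(1) u(1)]) (use u in \<open>auto simp: less_imp_le\<close>)
 have "p \<in> Wu \<or> (g 0 \<noteq> x0 \<and> f (g 0) \<in> I p \<and> g 0 = \<Psi> (f (g 0)) p \<and> f (g 0) \<le> f p \<and>
      (\<forall>c. f (g 0) \<le> c \<and> c \<le> f p \<longrightarrow> \<Psi> c p \<in> K))"
 proof (rule segments_limit'[where zs = "\<lambda>n. \<Psi> \<epsilon> (g (u n))" and ds = "\<lambda>n. - \<epsilon>"])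
  show "\<Psi> \<epsilon> (g (u n)) \<in> V" for n using \<Psi>_mem eI by blast
  show "- \<epsilon> \<in> I (\<Psi> \<epsilon> (g (u n)))" for n using levels_\<Psi> eI by blast
  show "- \<epsilon> \<le> f (\<Psi> \<epsilon> (g (u n)))" for n using f_\<Psi>[OF eI(3,1)] eps_pos by simp
  show "\<Psi> c (\<Psi> \<epsilon> (g (u n))) \<in> K" if "- \<epsilon> \<le> c" "c \<le> f (\<Psi> \<epsilon> (g (u n)))" for n c
  proof -
   have c: "c \<le> \<epsilon>" using that f_\<Psi>[OF eI(3,1)] by simp
   have "\<Psi> c (\<Psi> \<epsilon> (g (u n))) = \<Psi> c (g (u n))" using \<Psi>_\<Psi>[OF eI(3,1)] hyp_levels[OF u(2,3) that(1) c] by blast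
   thus ?thesis using transition_K[OF u(2,3) that(1) c] by simp
  qed
  show "(\<lambda>n. \<Psi> (- \<epsilon>) (\<Psi> \<epsilon> (g (u n)))) \<longlonglongrightarrow> g 0"
  proof -
   have "\<Psi> (- \<epsilon>) (\<Psi> \<epsilon> (g (u n))) = g (u n)" for n using \<Psi>_sym(1)[OF eI(3,1)] eI(4) by simp
   thus ?thesis using lim by simp
  qed
 qed (use p px in auto)
 thus ?thesis
 proof
  assume "p \<in> Wu" thus ?thesis using fp by (simp add: C'_def)
 next
  assume *: "g 0 \<noteq> x0 \<and> f (g 0) \<in> I p \<and> g 0 = \<Psi> (f (g 0)) p \<and> f (g 0) \<le> f p \<and>
      (\<forall>c. f (g 0) \<le> c \<and> c \<le> f p \<longrightarrow> \<Psi> c p \<in> K)"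
  have pV: "p \<in> V" using \<open>p \<in> K\<close> px K_subset by blast
  have "\<epsilon> \<in> I (g 0)" using levels_\<Psi>[OF pV, of "f (g 0)"] * level_mem[OF pV] fp by auto
  hence "\<epsilon> < 0" using Ws_levels_neg[of "g 0"] g(3) by (auto simp: C_def)
  thus ?thesis using eps_pos by simp
 qed
qed

lemma transition_limit_unique:
 assumes u: "u \<longlonglongrightarrow> 0" "\<And>n. 0 < u n" "\<And>n. u n \<le> 1" "(\<lambda>n. \<Psi> \<epsilon> (g (u n))) \<longlonglongrightarrow> b"
  and v: "v \<longlonglongrightarrow> 0" "\<And>n. 0 < v n" "\<And>n. v n \<le> 1" "(\<lambda>n. \<Psi> \<epsilon> (g (v n))) \<longlonglongrightarrow> b'"
 shows "b = b'"
proof (rule ccontr)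
 assume neq: "b \<noteq> b'"
 have b: "b \<in> V" "f b = \<epsilon>" using transition_cluster[OF u] C'_V f_C' by auto
 obtain \<sigma> J where J: "J = {-1..1} \<or> J = {0..1::real}" and \<sigma>: "continuous_on J \<sigma>" "inj_on \<sigma> J" "\<sigma> 0 = b"
  "\<sigma> ` J \<subseteq> level \<epsilon>"
  "\<forall>e. 0 < e \<and> e \<le> 1 \<longrightarrow> openin (top_of_set (level \<epsilon>)) (\<sigma> ` {s\<in>J. \<bar>s\<bar> < e})"
  using section_arc[OF b(1)] unfolding b(2) by blast
 have J0: "0 \<in> J" using J by auto
 \<comment> \<open>The level arc around \<open>b\<close> is cut so short that it misses
   \<open>b'\<close>; \<open>A\<close> is its open and \<open>B\<close> its closed version, and
   \<open>X\<close> collects the end points, at most two.\<close>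
 obtain d where d: "d > 0" "\<And>s. s \<in> J \<Longrightarrow> dist s 0 < d \<Longrightarrow> dist (\<sigma> s) b < dist b' b"
  using \<sigma>(1,3) J0 neq unfolding continuous_on_iff by (metis zero_less_dist_iff)
 define e where "e = min 1 (d / 2)"
 have e: "0 < e" "e \<le> 1" using d(1) by (auto simp: e_def)
 define A where "A = \<sigma> ` {s\<in>J. \<bar>s\<bar> < e}"
 define B where "B = \<sigma> ` {s\<in>J. \<bar>s\<bar> \<le> e}"
 define X where "X = \<sigma> ` ({e, - e} \<inter> J)"
 have BA: "B \<subseteq> A \<union> X"
 proof
  fix y assume "y \<in> B"
  then obtain s where s: "s \<in> J" "\<bar>s\<bar> \<le> e" "y = \<sigma> s" by (auto simp: B_def)
  show "y \<in> A \<union> X"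
  proof (cases "\<bar>s\<bar> < e")
   case False
   hence "s = e \<or> s = - e" using s by (auto simp: abs_if split: if_splits)
   hence "s \<in> {e, - e} \<inter> J" using s by auto
   thus ?thesis using s by (auto simp: X_def)
  qed (use s in \<open>auto simp: A_def\<close>)
 qed
 have AB: "A \<subseteq> B" by (auto simp: A_def B_def)
 have "compact {s\<in>J. \<bar>s\<bar> \<le> e}"
 proof -
  have "{s\<in>J. \<bar>s\<bar> \<le> e} = J \<inter> {-e..e}" by (auto simp: abs_le_iff)
  moreover have "compact J" using J by (rule disjE) simp_all
  ultimately show ?thesis by (simp add: compact_Int_closed)
 qed
 hence "closed B"
  unfolding B_def by (intro compact_imp_closed compact_continuous_image continuous_on_subset[OF \<sigma>(1)]) auto
 have bA: "b \<in> A" unfolding A_def using J0 \<sigma>(3) e by (intro image_eqI[of _ _ 0]) auto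
 have b'B: "b' \<notin> B"
 proof
  assume "b' \<in> B"
  then obtain s where s: "s \<in> J" "\<bar>s\<bar> \<le> e" "b' = \<sigma> s" by (auto simp: B_def)
  hence "dist s 0 < d" using e d(1) by (auto simp: e_def dist_real_def)
  thus False using d(2)[OF s(1)] s(3) by simp
 qed
 have lev: "\<Psi> \<epsilon> (g t) \<in> level \<epsilon>" if "0 < t" "t \<le> 1" for t
  using \<Psi>_mem[OF hyp_V] f_\<Psi>[OF hyp_V] hyp_levels[OF that] that eps_pos by simp
 have evA: "\<forall>\<^sub>F n in sequentially. \<Psi> \<epsilon> (g (u n)) \<in> A"
  by (rule openin_eventually_sequentially[OF \<sigma>(5)[rule_format, OF conjI[OF e], folded A_def] bA u(4)])
    (use lev[OF u(2,3)] in simp)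
 have evB: "\<forall>\<^sub>F n in sequentially. \<Psi> \<epsilon> (g (v n)) \<in> - B" using topological_tendstoD[OF v(4)] \<open>closed B\<close> b'B by blast
 define S where "S = {t \<in> {0<..1}. \<Psi> \<epsilon> (g t) \<in> X}"
 \<comment> \<open>Between a parameter whose image is in \<open>A\<close> and one whose image is off
   \<open>B\<close> the connected image has to pass through \<open>X\<close>: without
   \<open>X\<close>, its part in \<open>A\<close> would be open and closed.\<close>
 have crossing: "\<exists>t\<in>S. t < d" if d: "d > 0" for d
 proof -
  have "\<forall>\<^sub>F n in sequentially. u n < d" "\<forall>\<^sub>F n in sequentially. v n < d"
   using order_tendstoD(2) u(1) v(1) d by blast+
  hence "\<forall>\<^sub>F n in sequentially. u n < d \<and> v n < d \<and> \<Psi> \<epsilon> (g (u n)) \<in> A \<and> \<Psi> \<epsilon> (g (v n)) \<in> - B"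
   using evA evB by eventually_elim auto
  then obtain n where n: "u n < d" "v n < d" "\<Psi> \<epsilon> (g (u n)) \<in> A" "\<Psi> \<epsilon> (g (v n)) \<notin> B"
   by (auto simp: eventually_sequentially)
  define M where "M = closed_segment (u n) (v n)"
  have M: "t \<in> {0<..1} \<and> t < d" if "t \<in> M" for t
   using that u(2,3)[of n] v(2,3)[of n] n by (auto simp: M_def closed_segment_eq_real_ivl split: if_splits)
  define P where "P = (\<lambda>t. \<Psi> \<epsilon> (g t)) ` M"
  have "connected P"
   unfolding P_def by (rule connected_continuous_image[OF continuous_on_subset[OF transition_continuous]])
    (use M in \<open>auto simp: M_def\<close>)
  have PL: "P \<subseteq> level \<epsilon>" using lev M by (auto simp: P_def)
  have "P \<inter> X \<noteq> {}"
  proof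
   assume "P \<inter> X = {}"
   hence eq: "P \<inter> A = P \<inter> B" using BA AB by blast
   obtain A' where "open A'" "A = level \<epsilon> \<inter> A'"
    using \<sigma>(5)[rule_format, OF conjI[OF e], folded A_def] unfolding openin_open by blast
   hence "P \<inter> A = P \<inter> A'" using PL by blast
   hence "openin (top_of_set P) (P \<inter> A)" using \<open>open A'\<close> openin_open_Int by metis
   moreover have "closedin (top_of_set P) (P \<inter> A)" unfolding eq using \<open>closed B\<close> by (rule closedin_closed_Int)
   moreover have "P \<inter> A \<noteq> {}" using n(3) by (auto simp: P_def M_def)
   ultimately have "P \<inter> A = P" using \<open>connected P\<close> connected_clopen by blast
   thus False using n(4) AB by (auto simp: P_def M_def)
  qed
  thus ?thesis using M by (auto simp: P_def S_def)
 qed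
 \<comment> \<open>By injectivity each end point is passed for one parameter only, against passages
   arbitrarily close to \<open>0\<close>.\<close>
 have "finite S"
 proof -
  have "finite X" by (simp add: X_def)
  moreover have "inj_on (\<lambda>t. \<Psi> \<epsilon> (g t)) {0<..1}" using transition_inj(2)[of _ _ \<epsilon> \<epsilon>] eps_pos by (intro inj_onI) auto
  ultimately have "finite ((\<lambda>t. \<Psi> \<epsilon> (g t)) -` X \<inter> {0<..1})" by (rule finite_vimage_IntI)
  moreover have "(\<lambda>t. \<Psi> \<epsilon> (g t)) -` X \<inter> {0<..1} = S" by (auto simp: S_def)
  ultimately show ?thesis by simp
 qed
 moreover have "S \<noteq> {}" using crossing[of 1] by auto
 ultimately have "Min S \<in> S" "\<And>t. t \<in> S \<Longrightarrow> Min S \<le> t" by auto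
 thus False using crossing[of "Min S"] by (force simp: S_def)
qed

text \<open>Compactness of \<open>K\<close> gives one cluster value, and all others agree with it by
  \<open>transition_limit_unique\<close>.\<close>

lemma transition_limit:
 obtains b where "b \<in> C'" "\<And>u. u \<longlonglongrightarrow> 0 \<Longrightarrow> (\<And>n. 0 < u n) \<Longrightarrow> (\<And>n. u n \<le> 1) \<Longrightarrow> (\<lambda>n. \<Psi> \<epsilon> (g (u n))) \<longlonglongrightarrow> b"
proof -
 define w where "w = (\<lambda>n. 1 / real (Suc n))"
 have w: "w \<longlonglongrightarrow> 0" "\<And>n. 0 < w n" "\<And>n. w n \<le> 1" using LIMSEQ_inverse_real_of_nat by (auto simp: w_def inverse_eq_divide)
 have "\<forall>n. \<Psi> \<epsilon> (g (w n)) \<in> K" using transition_K w eps_pos by simp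
 then obtain b r where b: "strict_mono (r::nat\<Rightarrow>nat)" "((\<lambda>n. \<Psi> \<epsilon> (g (w n))) \<circ> r) \<longlonglongrightarrow> b"
  using compact_K unfolding compact_def by meson
 have wr: "(\<lambda>n. w (r n)) \<longlonglongrightarrow> 0" using LIMSEQ_subseq_LIMSEQ[OF w(1) b(1)] by (simp add: o_def)
 have br: "(\<lambda>n. \<Psi> \<epsilon> (g (w (r n)))) \<longlonglongrightarrow> b" using b(2) by (simp add: o_def)
 show thesis
 proof (rule that[of b])
  show "b \<in> C'" by (rule transition_cluster[OF wr _ _ br]) (use w in auto)
  fix u :: "nat \<Rightarrow> real" assume u: "u \<longlonglongrightarrow> 0" "\<And>n. 0 < u n" "\<And>n. u n \<le> 1"
  show "(\<lambda>n. \<Psi> \<epsilon> (g (u n))) \<longlonglongrightarrow> b"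
  proof (rule compact_tendsto_unique[OF compact_K])
   show "\<forall>\<^sub>F n in sequentially. \<Psi> \<epsilon> (g (u n)) \<in> K" using transition_K u eps_pos by simp
   fix s l assume s: "strict_mono (s::nat\<Rightarrow>nat)" "((\<lambda>n. \<Psi> \<epsilon> (g (u n))) \<circ> s) \<longlonglongrightarrow> l"
   have us: "(\<lambda>n. u (s n)) \<longlonglongrightarrow> 0" using LIMSEQ_subseq_LIMSEQ[OF u(1) s(1)] by (simp add: o_def)
   show "l = b" by (rule transition_limit_unique[OF us _ _ _ wr _ _ br]) (use u w s in \<open>auto simp: o_def\<close>)
  qed
 qed
qed

end

end

section \<open>Hyperbolic charts over arcs of passing orbits\<close>

context sectored_flow
begin

text \<open>The real part is the level and the imaginary part the parameter on the arc. The bottom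
  side carries the two separatrices: as the orbit of \<open>g 0\<close> ends at \<open>x0\<close>,
  the positive half of the axis is filled with the orbit of \<open>b\<close>, the limit of the
  transition map.\<close>

definition hyperbolic_map :: "(real \<Rightarrow> complex) \<Rightarrow> complex \<Rightarrow> complex \<Rightarrow> complex" where
 "hyperbolic_map g b z =
   (if z = 0 then x0 else if Im z = 0 \<and> Re z > 0 then \<Psi> (Re z) b else \<Psi> (Re z) (g (Im z)))"

definition rectangle :: "complex set" where
 "rectangle = {z. - \<epsilon> \<le> Re z \<and> Re z \<le> \<epsilon> \<and> 0 \<le> Im z \<and> Im z \<le> 1}"

definition open_rectangle :: "complex set" where
 "open_rectangle = {z. - \<epsilon> < Re z \<and> Re z < \<epsilon> \<and> 0 \<le> Im z \<and> Im z < 1}"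

lemma compact_rectangle: "compact rectangle"
proof -
 have "rectangle = cbox (Complex (- \<epsilon>) 0) (Complex \<epsilon> 1)" by (auto simp: rectangle_def in_cbox_complex_iff)
 thus ?thesis by simp
qed

definition separatrix where "separatrix q = (\<lambda>c. \<Psi> c q) ` {- \<epsilon><..<0}"
definition separatrix' where "separatrix' b = (\<lambda>c. \<Psi> c b) ` {0<..<\<epsilon>}"

definition transition_end :: "(real \<Rightarrow> complex) \<Rightarrow> complex \<Rightarrow> bool" where
 "transition_end g b \<longleftrightarrow> b \<in> C' \<and> (\<forall>u. u \<longlonglongrightarrow> 0 \<longrightarrow> (\<forall>n. 0 < u n) \<longrightarrow> (\<forall>n. u n \<le> 1) \<longrightarrow>
   (\<lambda>n. \<Psi> \<epsilon> (g (u n))) \<longlonglongrightarrow> b)"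

context
 fixes g :: "real \<Rightarrow> complex" and b :: complex
 assumes g: "continuous_on {0..1} g" "inj_on g {0..1}" "g 0 \<in> C" "g ` {0<..1} \<subseteq> G"
  and b: "transition_end g b"
begin

lemmas arc_G = hyp_arc[OF g] and arc_levels = hyp_levels[OF g] and arc_V = hyp_V[OF g]
 and arc_transition_inj = transition_inj[OF g] and arc_transition_K = transition_K[OF g]

lemma b_C': "b \<in> C'" using b by (simp add: transition_end_def)

text \<open>Every value of the chart off \<open>x0\<close> lies on the orbit of a base point at level \<open>-\<epsilon>\<close> or \<open>\<epsilon>\<close>.\<close>

definition base where "base z = (if Im z = 0 \<and> Re z > 0 then b else g (Im z))"

lemma hyperbolic_map_base: "z \<noteq> 0 \<Longrightarrow> hyperbolic_map g b z = \<Psi> (Re z) (base z)"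
 by (simp add: hyperbolic_map_def base_def)

lemma hyperbolic_map_0: "hyperbolic_map g b 0 = x0" by (simp add: hyperbolic_map_def)

lemma base_level:
 assumes "z \<in> rectangle" "z \<noteq> 0"
 shows "base z \<in> V" "Re z \<in> I (base z)" "\<Psi> (Re z) (base z) \<in> K"
proof -
 have z: "- \<epsilon> \<le> Re z" "Re z \<le> \<epsilon>" "0 \<le> Im z" "Im z \<le> 1" using assms by (auto simp: rectangle_def)
 consider "Im z > 0" | "Im z = 0" "Re z > 0" | "Im z = 0" "Re z < 0"
  using assms(2) z by (auto simp: complex_eq_iff) linarith
 hence "base z \<in> V \<and> Re z \<in> I (base z) \<and> \<Psi> (Re z) (base z) \<in> K"
 proof cases
  case 1
  thus ?thesis using arc_V arc_levels arc_transition_K z by (simp add: base_def)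
 next
  case 2
  thus ?thesis using C'_V[OF b_C'] C'_levels[OF b_C'] C'_orbit[OF b_C'] Wu_K z by (simp add: base_def)
 next
  case 3
  thus ?thesis using C_V[OF g(3)] C_levels[OF g(3)] C_orbit[OF g(3)] Ws_K z by (simp add: base_def)
 qed
 thus "base z \<in> V" "Re z \<in> I (base z)" "\<Psi> (Re z) (base z) \<in> K" by auto
qed

lemma hyperbolic_map_V: "z \<in> rectangle \<Longrightarrow> z \<noteq> 0 \<Longrightarrow> hyperbolic_map g b z \<in> V"
 using base_level \<Psi>_mem by (simp add: hyperbolic_map_base)

lemma hyperbolic_map_K: "z \<in> rectangle \<Longrightarrow> hyperbolic_map g b z \<in> K"
 using base_level x0_K by (cases "z = 0") (simp_all add: hyperbolic_map_base hyperbolic_map_0)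

lemma f_hyperbolic_map: "z \<in> rectangle \<Longrightarrow> f (hyperbolic_map g b z) = Re z"
 using base_level f_\<Psi> f_x0 by (cases "z = 0") (simp_all add: hyperbolic_map_base hyperbolic_map_0)

lemma hyperbolic_map_separatrix:
 assumes "z \<in> rectangle" "z \<noteq> 0" "Im z = 0"
 shows "hyperbolic_map g b z \<in> Ws \<union> Wu"
proof -
 have z: "- \<epsilon> \<le> Re z" "Re z \<le> \<epsilon>" "Re z \<noteq> 0" using assms by (auto simp: rectangle_def complex_eq_iff)
 thus ?thesis using C'_orbit[OF b_C'] C_orbit[OF g(3)] assms(2,3)
  by (cases "Re z > 0") (auto simp: hyperbolic_map_def)
qed

lemma hyperbolic_orbit:
 assumes z: "z \<in> rectangle" "z \<noteq> 0" and c: "- \<epsilon> \<le> c" "c \<le> \<epsilon>" "Im z \<noteq> 0 \<or> c * Re z > 0"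
 shows "c \<in> I (hyperbolic_map g b z)" "\<Psi> c (hyperbolic_map g b z) = hyperbolic_map g b (Complex c (Im z))"
proof -
 let ?w = "Complex c (Im z)"
 have w: "?w \<in> rectangle" "?w \<noteq> 0" using z c by (auto simp: rectangle_def complex_eq_iff)
 have base: "base ?w = base z" using c by (auto simp: base_def zero_less_mult_iff)
 have "c \<in> I (base z)" using base_level(2)[OF w] base by simp
 moreover note l = base_level[OF z]
 ultimately show "c \<in> I (hyperbolic_map g b z)" "\<Psi> c (hyperbolic_map g b z) = hyperbolic_map g b ?w"
  using levels_\<Psi>[OF l(1,2)] \<Psi>_\<Psi>[OF l(1,2)] hyperbolic_map_base[OF z(2)] hyperbolic_map_base[OF w(2)] base
  by simp_all
qed

lemma hyperbolic_map_cross: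
 assumes "z \<in> rectangle" "Im z \<noteq> 0"
 shows "hyperbolic_map g b z \<notin> Ws \<union> Wu"
proof -
 have z: "z \<noteq> 0" using assms by auto
 have "\<epsilon> \<in> I (hyperbolic_map g b z)" "- \<epsilon> \<in> I (hyperbolic_map g b z)"
  using hyperbolic_orbit(1)[OF assms(1) z] assms(2) eps_pos by auto
 thus ?thesis using Ws_levels_neg Wu_levels_pos' eps_pos by fastforce
qed

text \<open>The value of \<open>f\<close> gives the real part. Whether the image is
  \<open>x0\<close> or lies in \<open>Ws \<union> Wu\<close> tells the axis from the rest, and off
  the axis flowing back to level \<open>-\<epsilon>\<close> gives the parameter.\<close>

lemma inj_hyperbolic_map: "inj_on (hyperbolic_map g b) rectangle"
proof (rule inj_onI)
 fix z w assume zw: "z \<in> rectangle" "w \<in> rectangle" "hyperbolic_map g b z = hyperbolic_map g b w"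
 hence re: "Re z = Re w" using f_hyperbolic_map by metis
 have im: "Im z = 0 \<longleftrightarrow> Im w = 0" using hyperbolic_map_cross hyperbolic_map_separatrix zw hyperbolic_map_V x0_notin_V
  by (metis hyperbolic_map_def zero_complex.sel(2))
 show "z = w"
 proof (cases "Im z = 0")
  case True thus ?thesis using re im by (simp add: complex_eq_iff)
 next
  case False
  hence nz: "0 < Im z" "Im z \<le> 1" "0 < Im w" "Im w \<le> 1" "- \<epsilon> \<le> Re z" "Re z \<le> \<epsilon>"
   using zw im by (auto simp: rectangle_def)
  hence "\<Psi> (Re z) (g (Im z)) = \<Psi> (Re z) (g (Im w))"
   using zw re unfolding hyperbolic_map_def by (auto simp: complex_eq_iff split: if_splits)
  hence "Im z = Im w" using arc_transition_inj(2) nz by blast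
  thus ?thesis using re by (simp add: complex_eq_iff)
 qed
qed

lemma transition_end_continuous:
 assumes "ts \<longlonglongrightarrow> 0" "\<And>n. 0 \<le> ts n" "\<And>n. ts n \<le> 1"
 shows "(\<lambda>n. if ts n = 0 then b else \<Psi> \<epsilon> (g (ts n))) \<longlonglongrightarrow> b"
proof -
 \<comment> \<open>Parameters equal to \<open>0\<close>, where
   \<open>\<Psi> \<epsilon> (g 0)\<close> has no meaning, are replaced by a positive null sequence,
   so that \<open>transition_end\<close> applies.\<close>
 define u where "u n = (if ts n = 0 then 1 / real (Suc n) else ts n)" for n
 have "u \<longlonglongrightarrow> 0"
 proof (rule tendsto_sandwich[of "\<lambda>n. 0" _ _ "\<lambda>n. ts n + 1 / real (Suc n)"])
  have "(\<lambda>n. 1 / real (Suc n)) \<longlonglongrightarrow> 0" using LIMSEQ_inverse_real_of_nat by (simp add: inverse_eq_divide)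
  thus "(\<lambda>n. ts n + 1 / real (Suc n)) \<longlonglongrightarrow> 0" using tendsto_add[OF assms(1)] by simp
 qed (use assms in \<open>auto simp: u_def\<close>)
 moreover have "0 < u n" "u n \<le> 1" for n using assms(2,3)[of n] by (auto simp: u_def)
 ultimately have "(\<lambda>n. \<Psi> \<epsilon> (g (u n))) \<longlonglongrightarrow> b" using b by (auto simp: transition_end_def)
 hence d: "(\<lambda>n. dist (\<Psi> \<epsilon> (g (u n))) b) \<longlonglongrightarrow> 0" by (rule tendsto_dist_iff[THEN iffD1])
 have "(\<lambda>n. dist (if ts n = 0 then b else \<Psi> \<epsilon> (g (ts n))) b) \<longlonglongrightarrow> 0"
  by (rule tendsto_sandwich[OF _ _ tendsto_const d]) (auto simp: u_def)
 thus ?thesis by (rule tendsto_dist_iff[THEN iffD2])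
qed

lemma continuous_hyperbolic_map: "continuous_on rectangle (hyperbolic_map g b)"
 unfolding continuous_on_sequentially o_def
proof (intro allI ballI impI, elim conjE)
 fix zs z assume z: "z \<in> rectangle" "\<forall>n. zs n \<in> rectangle" "zs \<longlonglongrightarrow> z"
 have re: "(\<lambda>n. Re (zs n)) \<longlonglongrightarrow> Re z" and im: "(\<lambda>n. Im (zs n)) \<longlonglongrightarrow> Im z" using z(3) by (auto intro: tendsto_intros)
 have zn: "- \<epsilon> \<le> Re (zs n)" "Re (zs n) \<le> \<epsilon>" "0 \<le> Im (zs n)" "Im (zs n) \<le> 1" for n
  using z(2) by (auto simp: rectangle_def)
 have z01: "- \<epsilon> \<le> Re z" "Re z \<le> \<epsilon>" "0 \<le> Im z" "Im z \<le> 1" using z(1) by (auto simp: rectangle_def)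
 have gs: "(\<lambda>n. g (Im (zs n))) \<longlonglongrightarrow> g (Im z)" by (rule continuous_on_tendsto_compose[OF g(1) im]) (use zn z01 in auto)
 have gV: "\<forall>\<^sub>F n in sequentially. g (Im (zs n)) \<in> V" using arc_V zn by simp
 consider "z = 0" | "Im z = 0 \<and> Re z > 0" | "z \<noteq> 0" "\<not> (Im z = 0 \<and> Re z > 0)" by blast
 thus "(\<lambda>n. hyperbolic_map g b (zs n)) \<longlonglongrightarrow> hyperbolic_map g b z"
 proof cases
  case 1
  have "(\<lambda>n. hyperbolic_map g b (zs n)) \<longlonglongrightarrow> x0"
  proof (rule compact_tendsto_unique[OF compact_K])
   show "\<forall>\<^sub>F n in sequentially. hyperbolic_map g b (zs n) \<in> K" using hyperbolic_map_K z(2) by simp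
   fix r l assume r: "strict_mono (r::nat\<Rightarrow>nat)" "((\<lambda>n. hyperbolic_map g b (zs n)) \<circ> r) \<longlonglongrightarrow> l" "l \<in> K"
   have l: "(\<lambda>n. hyperbolic_map g b (zs (r n))) \<longlonglongrightarrow> l" using r(2) by (simp add: o_def)
   have "(\<lambda>n. f (hyperbolic_map g b (zs (r n)))) \<longlonglongrightarrow> f l"
    by (rule tendsto_f_K(2)[OF l]) (use hyperbolic_map_K z(2) in auto)
   moreover have re_r: "(\<lambda>n. Re (zs (r n))) \<longlonglongrightarrow> 0" using LIMSEQ_subseq_LIMSEQ[OF re r(1)] 1 by (simp add: o_def)
   ultimately have fl: "f l = 0" using f_hyperbolic_map z(2) LIMSEQ_unique[OF re_r] by simp
   \<comment> \<open>Points on the axis lie on separatrices, points off it on orbits passing by. A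
     subsequence separates the cases, which are settled by \<open>limit_level_zero\<close> and
     \<open>segments_to_x0\<close>.\<close>
   show "l = x0"
   proof (cases "\<exists>\<^sub>F n in sequentially. Im (zs (r n)) = 0")
    case True
    then obtain s where s: "strict_mono (s::nat\<Rightarrow>nat)" "\<And>n. Im (zs (r (s n))) = 0"
     using frequently_subsequenceE by blast
    have "(\<lambda>n. hyperbolic_map g b (zs (r (s n)))) \<longlonglongrightarrow> l" using LIMSEQ_subseq_LIMSEQ[OF l s(1)] by (simp add: o_def)
    moreover have "hyperbolic_map g b (zs (r (s n))) \<in> insert x0 (Ws \<union> Wu)" for n
     using hyperbolic_map_separatrix[of "zs (r (s n))"] z(2) s(2) by (cases "zs (r (s n)) = 0") (auto simp: hyperbolic_map_def)
    ultimately show ?thesis by (rule limit_level_zero[OF _ _ fl, rotated])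
   next
    case False
    hence "\<forall>\<^sub>F n in sequentially. Im (zs (r n)) \<noteq> 0" by (simp add: frequently_def)
    then obtain N where N: "\<And>n. n \<ge> N \<Longrightarrow> Im (zs (r n)) \<noteq> 0" by (auto simp: eventually_sequentially)
    have pos: "0 < Im (zs (r (n + N)))" for n using N[of "n + N"] zn(3)[of "r (n + N)"] by simp
    have q: "(\<lambda>n. g (Im (zs (r (n + N))))) \<longlonglongrightarrow> g 0"
     using LIMSEQ_ignore_initial_segment[OF LIMSEQ_subseq_LIMSEQ[OF gs r(1)], of N] 1 by (simp add: o_def)
    have c: "(\<lambda>n. Re (zs (r (n + N)))) \<longlonglongrightarrow> 0" using LIMSEQ_ignore_initial_segment[OF re_r] by blast
    have "(\<lambda>n. hyperbolic_map g b (zs (r (n + N)))) \<longlonglongrightarrow> l" using LIMSEQ_ignore_initial_segment[OF l] by blast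
    moreover have "hyperbolic_map g b (zs (r (n + N))) = \<Psi> (Re (zs (r (n + N)))) (g (Im (zs (r (n + N)))))" for n
     using pos[of n] by (auto simp: hyperbolic_map_def)
    ultimately have p: "(\<lambda>n. \<Psi> (Re (zs (r (n + N)))) (g (Im (zs (r (n + N)))))) \<longlonglongrightarrow> l" by simp
    show ?thesis by (rule segments_to_x0[OF q g(3) _ c _ _ p]) (use arc_G pos zn in auto)
   qed
  qed
  thus ?thesis using 1 by (simp add: hyperbolic_map_def)
 next
  case 2
  \<comment> \<open>Near the outgoing separatrix the orbits are based at level
    \<open>\<epsilon>\<close>: there the base points extend continuously by \<open>b\<close>,
    whereas the base points at level \<open>-\<epsilon>\<close> tend to \<open>g 0\<close>, which
    lies on another orbit.\<close>
  define T where "T = (\<lambda>t. if t = 0 then b else \<Psi> \<epsilon> (g t))"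
  have T: "(\<lambda>n. T (Im (zs n))) \<longlonglongrightarrow> b"
   unfolding T_def using transition_end_continuous[of "\<lambda>n. Im (zs n)"] im 2 zn by simp
  have TV: "T t \<in> V" if "0 \<le> t" "t \<le> 1" for t
   using that C'_V[OF b_C'] \<Psi>_mem[OF arc_V] arc_levels eps_pos by (auto simp: T_def)
  have "(\<lambda>n. \<Psi> (Re (zs n)) (T (Im (zs n)))) \<longlonglongrightarrow> \<Psi> (Re z) b"
   by (rule tendsto_\<Psi>(2)[OF C'_V[OF b_C'] C'_levels[OF b_C'] T re]) (use TV zn z01 2 in auto)
  moreover have "\<forall>\<^sub>F n in sequentially. Re (zs n) > 0" using order_tendstoD(1)[OF re] 2 by blast
  hence "\<forall>\<^sub>F n in sequentially. \<Psi> (Re (zs n)) (T (Im (zs n))) = hyperbolic_map g b (zs n)"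
  proof eventually_elim
   case (elim n)
   show ?case
   proof (cases "Im (zs n) = 0")
    case True thus ?thesis using elim by (auto simp: T_def hyperbolic_map_def)
   next
    case False
    hence "0 < Im (zs n)" using zn(3)[of n] by simp
    hence "\<Psi> (Re (zs n)) (\<Psi> \<epsilon> (g (Im (zs n)))) = \<Psi> (Re (zs n)) (g (Im (zs n)))"
     using \<Psi>_\<Psi>[OF arc_V[of "Im (zs n)"]] arc_levels zn eps_pos by simp
    thus ?thesis using False by (auto simp: T_def hyperbolic_map_def)
   qed
  qed
  ultimately have "(\<lambda>n. hyperbolic_map g b (zs n)) \<longlonglongrightarrow> \<Psi> (Re z) b" by (rule Lim_transform_eventually)
  thus ?thesis using 2 by (auto simp: hyperbolic_map_def)
 next
  case 3
  have zI: "Re z \<in> I (g (Im z))" using base_level(2)[OF z(1) 3(1)] 3(2) by (simp add: base_def split: if_splits)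
  have "(\<lambda>n. \<Psi> (Re (zs n)) (g (Im (zs n)))) \<longlonglongrightarrow> \<Psi> (Re z) (g (Im z))"
   by (rule tendsto_\<Psi>(2)[OF arc_V zI gs re gV]) (use z01 in auto)
  moreover have "\<forall>\<^sub>F n in sequentially. zs n \<noteq> 0 \<and> \<not> (Im (zs n) = 0 \<and> Re (zs n) > 0)"
  proof (cases "Im z = 0")
   case True
   hence "Re z < 0" using 3 by (auto simp: complex_eq_iff)
   hence "\<forall>\<^sub>F n in sequentially. Re (zs n) < 0" using order_tendstoD(2)[OF re] by blast
   thus ?thesis by eventually_elim auto
  next
   case False
   hence "\<forall>\<^sub>F n in sequentially. Im (zs n) > 0" using order_tendstoD(1)[OF im] z01 by simp
   thus ?thesis by eventually_elim auto
  qed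
  hence "\<forall>\<^sub>F n in sequentially. \<Psi> (Re (zs n)) (g (Im (zs n))) = hyperbolic_map g b (zs n)"
   by eventually_elim (auto simp: hyperbolic_map_def)
  ultimately have "(\<lambda>n. hyperbolic_map g b (zs n)) \<longlonglongrightarrow> \<Psi> (Re z) (g (Im z))" by (rule Lim_transform_eventually)
  thus ?thesis using 3 by (auto simp: hyperbolic_map_def)
 qed
qed

end

end

section \<open>Sectors described by the base points of their orbits\<close>

context sectored_flow
begin

lemma backward_in_Ws:
 assumes "z \<in> Ws" "d \<in> I z" "d \<le> f z" "\<And>c. d \<le> c \<Longrightarrow> c \<le> f z \<Longrightarrow> \<Psi> c z \<in> K"
 shows "\<Psi> d z \<in> Ws"
proof -
 have V: "z \<in> V" using Ws_V assms(1) by simp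
 have "\<Psi> d z \<in> K - {x0}" using assms(3) assms(4)[of d] \<Psi>_mem[OF V assms(2)] x0_notin_V by auto
 moreover have "\<Psi> c (\<Psi> d z) \<in> K" if "c \<in> I (\<Psi> d z)" "f (\<Psi> d z) \<le> c" for c
 proof -
  have c: "c \<in> I z" "d \<le> c" using that levels_\<Psi>[OF V assms(2)] f_\<Psi>[OF V assms(2)] by auto
  have "\<Psi> c z \<in> K" using assms(1,4) c by (cases "c \<le> f z") (auto simp: Ws_def)
  thus ?thesis using \<Psi>_\<Psi>[OF V assms(2) c(1)] by simp
 qed
 ultimately show ?thesis by (auto simp: Ws_def)
qed

text \<open>Traced back, the orbit of \<open>z\<close> reaches the half-circle, because
  \<open>z\<close> is not in \<open>Wu\<close> as well. Up to this contact it belongs to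
  \<open>Ws\<close>, so the contact lies below \<open>-\<epsilon>\<close>, and level
  \<open>-\<epsilon>\<close> is met on the way.\<close>

lemma Ws_base:
 assumes "z \<in> Ws" "- \<epsilon> < f z"
 shows "- \<epsilon> \<in> I z" "\<Psi> (- \<epsilon>) z \<in> C" "\<Psi> (f z) (\<Psi> (- \<epsilon>) z) = z"
proof -
 have V: "z \<in> V" using Ws_V assms(1) by simp
 have "z \<notin> Wu" using Ws_neg[OF assms(1)] Wu_pos[of z] by force
 moreover have "z \<in> K - {x0}" using assms by (simp add: Ws_def)
 ultimately obtain d where d: "d \<in> I z" "d \<le> f z" "dist x0 (\<Psi> d z) = R / 2"
   "\<And>c. d \<le> c \<Longrightarrow> c \<le> f z \<Longrightarrow> \<Psi> c z \<in> K" using exit_K'[of z] by blast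
 have "f (\<Psi> d z) < - \<epsilon>" using Ws_exit[OF backward_in_Ws[OF assms(1) d(1,2,4)] d(3)] .
 hence "d < - \<epsilon>" using f_\<Psi>[OF V d(1)] by simp
 thus e: "- \<epsilon> \<in> I z" using levels_mem_interval[OF V d(1) level_mem[OF V]] assms by auto
 have "\<Psi> (- \<epsilon>) z \<in> Ws" by (rule backward_in_Ws[OF assms(1) e]) (use assms d(4) \<open>d < - \<epsilon>\<close> in auto)
 thus "\<Psi> (- \<epsilon>) z \<in> C" using f_\<Psi>[OF V e] by (simp add: C_def)
 show "\<Psi> (f z) (\<Psi> (- \<epsilon>) z) = z" using \<Psi>_sym(1)[OF V e] .
qed

lemma Wu_base:
 assumes "z \<in> Wu" "f z < \<epsilon>"
 shows "\<epsilon> \<in> I z" "\<Psi> \<epsilon> z \<in> C'" "\<Psi> (f z) (\<Psi> \<epsilon> z) = z"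
 using sectored_flow.Ws_base[OF sectored_reversed, unfolded reversed_Ws reversed_C, OF assms(1)] assms(2) by auto

lemma separatrix_iff:
 assumes "q \<in> C"
 shows "p \<in> separatrix q \<longleftrightarrow> p \<in> Ws \<and> - \<epsilon> < f p \<and> \<Psi> (- \<epsilon>) p = q"
proof
 assume "p \<in> separatrix q"
 then obtain c where c: "- \<epsilon> < c" "c < 0" "p = \<Psi> c q" by (auto simp: separatrix_def)
 have cI: "c \<in> I q" using C_levels assms c by simp
 thus "p \<in> Ws \<and> - \<epsilon> < f p \<and> \<Psi> (- \<epsilon>) p = q"
  using C_orbit[OF assms] c f_\<Psi>[OF C_V[OF assms] cI] \<Psi>_sym(1)[OF C_V[OF assms] cI] f_C[OF assms] by simp
next
 assume p: "p \<in> Ws \<and> - \<epsilon> < f p \<and> \<Psi> (- \<epsilon>) p = q"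
 hence "p = \<Psi> (f p) q" using Ws_base(3)[of p] by simp
 thus "p \<in> separatrix q" unfolding separatrix_def using p Ws_neg[of p] by (intro image_eqI[of _ _ "f p"]) auto
qed

lemma separatrix'_iff:
 assumes "q \<in> C'"
 shows "p \<in> separatrix' q \<longleftrightarrow> p \<in> Wu \<and> f p < \<epsilon> \<and> \<Psi> \<epsilon> p = q"
proof
 assume "p \<in> separatrix' q"
 then obtain c where c: "0 < c" "c < \<epsilon>" "p = \<Psi> c q" by (auto simp: separatrix'_def)
 have cI: "c \<in> I q" using C'_levels assms c by simp
 thus "p \<in> Wu \<and> f p < \<epsilon> \<and> \<Psi> \<epsilon> p = q"
  using C'_orbit[OF assms] c f_\<Psi>[OF C'_V[OF assms] cI] \<Psi>_sym(1)[OF C'_V[OF assms] cI] f_C'[OF assms] by simp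
next
 assume p: "p \<in> Wu \<and> f p < \<epsilon> \<and> \<Psi> \<epsilon> p = q"
 hence "p = \<Psi> (f p) q" using Wu_base(3)[of p] by simp
 thus "p \<in> separatrix' q" unfolding separatrix'_def using p Wu_pos[of p] by (intro image_eqI[of _ _ "f p"]) auto
qed

definition parabolic_map' :: "(real \<Rightarrow> complex) \<Rightarrow> complex \<Rightarrow> complex" where
 "parabolic_map' g z = (if z = 0 then x0 else \<Psi> (\<epsilon> * cmod z) (g (Arg z)))"

lemma reversed_parabolic_map: "sectored_flow.parabolic_map x0 (\<lambda>c. \<Psi> (- c)) \<epsilon> = parabolic_map'"
 unfolding sectored_flow.parabolic_map_def[OF sectored_reversed] parabolic_map'_def by (intro ext) simp

definition parabolic_set where "parabolic_set g = parabolic_map g ` (open_cone - {0})"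
definition parabolic_set' where "parabolic_set' g = parabolic_map' g ` (open_cone - {0})"
definition hyperbolic_set where "hyperbolic_set g b = hyperbolic_map g b ` (open_rectangle - {0})"

lemma reversed_parabolic_set: "sectored_flow.parabolic_set x0 (\<lambda>c. \<Psi> (- c)) \<epsilon> = parabolic_set'"
 unfolding sectored_flow.parabolic_set_def[OF sectored_reversed] parabolic_set'_def reversed_parabolic_map by simp

definition stable_arc :: "(real \<Rightarrow> complex) \<Rightarrow> bool" where
 "stable_arc g \<longleftrightarrow> continuous_on {0..1} g \<and> inj_on g {0..1} \<and> g ` {0..1} \<subseteq> C"

definition unstable_arc :: "(real \<Rightarrow> complex) \<Rightarrow> bool" where
 "unstable_arc g \<longleftrightarrow> continuous_on {0..1} g \<and> inj_on g {0..1} \<and> g ` {0..1} \<subseteq> C'"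

definition crossing_arc :: "(real \<Rightarrow> complex) \<Rightarrow> complex \<Rightarrow> bool" where
 "crossing_arc g b \<longleftrightarrow> continuous_on {0..1} g \<and> inj_on g {0..1} \<and> g 0 \<in> C \<and> g ` {0<..1} \<subseteq> G \<and> transition_end g b"

lemma stable_arcD:
 assumes "stable_arc g"
 shows "continuous_on {0..1} g" "inj_on g {0..1}" "g ` {0..1} \<subseteq> C" using assms by (simp_all add: stable_arc_def)

lemma crossing_arcD:
 assumes "crossing_arc g b"
 shows "continuous_on {0..1} g" "inj_on g {0..1}" "g 0 \<in> C" "g ` {0<..1} \<subseteq> G" "transition_end g b"
 using assms by (simp_all add: crossing_arc_def)

lemma reversed_stable_arc:
 "sectored_flow.stable_arc x0 R (\<lambda>z. - f z) (\<lambda>z. uminus ` I z) (\<lambda>c. \<Psi> (- c)) \<epsilon> = unstable_arc"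
 unfolding sectored_flow.stable_arc_def[OF sectored_reversed] unstable_arc_def reversed_C by simp

lemma open_cone_cone: "open_cone \<subseteq> cone" by (auto simp: open_cone_iff cone_iff)

lemma open_rectangle_rectangle: "open_rectangle \<subseteq> rectangle" by (auto simp: open_rectangle_def rectangle_def)

text \<open>A description without the chart: sectors are compared through the base points of their
  orbits, which reduces their intersections to intersections of arcs.\<close>

lemma parabolic_set_iff:
 assumes "stable_arc g"
 shows "p \<in> parabolic_set g \<longleftrightarrow> p \<in> Ws \<and> - \<epsilon> < f p \<and> \<Psi> (- \<epsilon>) p \<in> g ` {0..1}"
proof
 note g = stable_arcD[OF assms]
 assume "p \<in> parabolic_set g"
 then obtain z where z: "z \<in> open_cone" "z \<noteq> 0" "p = parabolic_map g z" by (auto simp: parabolic_set_def)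
 hence zc: "z \<in> cone" "cmod z < 1" "Arg z \<in> {0..1}" using open_cone_cone by (auto simp: open_cone_iff)
 note l = cone_level[OF g zc(1) z(2)]
 have "- \<epsilon> < f p" using f_parabolic_map[OF g zc(1)] z(3) zc(2) eps_pos by simp
 moreover have "\<Psi> (- \<epsilon>) p = g (Arg z)"
  using \<Psi>_sym(1)[OF C_V[OF l(3)] l(4)] f_C[OF l(3)] z(2,3) by (simp add: parabolic_map_def)
 ultimately show "p \<in> Ws \<and> - \<epsilon> < f p \<and> \<Psi> (- \<epsilon>) p \<in> g ` {0..1}"
  using parabolic_map_Ws[OF g zc(1) z(2)] z(3) zc(3) by simp
next
 assume p: "p \<in> Ws \<and> - \<epsilon> < f p \<and> \<Psi> (- \<epsilon>) p \<in> g ` {0..1}"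
 then obtain t where t: "0 \<le> t" "t \<le> 1" "\<Psi> (- \<epsilon>) p = g t" by auto
 have fp: "f p < 0" using Ws_neg p by blast
 define r where "r = - f p / \<epsilon>"
 have r: "0 < r" "r < 1" using fp p eps_pos by (auto simp: r_def field_simps)
 have rc: "rcis r t \<noteq> 0" using r by simp
 have A: "Arg (rcis r t) = t" using r t pi_gt3 by (intro Arg_rcis) auto
 have m: "cmod (rcis r t) = r" using r by simp
 have "rcis r t \<in> open_cone - {0}" using rc A m r t by (simp add: open_cone_iff)
 moreover have "parabolic_map g (rcis r t) = p"
 proof -
  have "- \<epsilon> * r = f p" using eps_pos by (simp add: r_def)
  thus ?thesis using Ws_base(3)[of p] p t(3) rc A m unfolding parabolic_map_def by simp
 qed
 ultimately show "p \<in> parabolic_set g" unfolding parabolic_set_def by (metis image_eqI)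
qed

lemma parabolic_set'_iff:
 assumes "unstable_arc g"
 shows "p \<in> parabolic_set' g \<longleftrightarrow> p \<in> Wu \<and> f p < \<epsilon> \<and> \<Psi> \<epsilon> p \<in> g ` {0..1}"
 using sectored_flow.parabolic_set_iff[OF sectored_reversed, unfolded reversed_Ws reversed_stable_arc
   reversed_parabolic_set, OF assms, of p] by simp

lemma crossing_not_Ws_Wu:
 assumes "p \<in> V" "- \<epsilon> \<in> I p" "\<Psi> (- \<epsilon>) p \<in> G"
 shows "p \<notin> Ws" "p \<notin> Wu"
proof -
 have "\<epsilon> \<in> I (\<Psi> (- \<epsilon>) p)" using assms(3) by (simp add: G_def)
 hence "\<epsilon> \<in> I p" using levels_\<Psi>[OF assms(1,2)] by simp
 thus "p \<notin> Ws" "p \<notin> Wu" using Ws_levels_neg[of p \<epsilon>] Wu_levels_pos'[of p "- \<epsilon>"] assms(2) eps_pos by auto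
qed

lemma hyperbolic_set_iff:
 assumes "crossing_arc g b"
 shows "p \<in> hyperbolic_set g b \<longleftrightarrow>
  (p \<in> V \<and> \<bar>f p\<bar> < \<epsilon> \<and> - \<epsilon> \<in> I p \<and> \<Psi> (- \<epsilon>) p \<in> g ` {0<..<1}) \<or> p \<in> separatrix (g 0) \<or> p \<in> separatrix' b"
  (is "_ \<longleftrightarrow> ?cross \<or> _ \<or> _")
proof
 note g = crossing_arcD[OF assms]
 assume "p \<in> hyperbolic_set g b"
 then obtain z where z: "z \<in> open_rectangle" "z \<noteq> 0" "p = hyperbolic_map g b z" by (auto simp: hyperbolic_set_def)
 hence zr: "z \<in> rectangle" "- \<epsilon> < Re z" "Re z < \<epsilon>" "0 \<le> Im z" "Im z < 1"
  using open_rectangle_rectangle by (auto simp: open_rectangle_def)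
 consider "Im z > 0" | "Im z = 0" "Re z > 0" | "Im z = 0" "Re z < 0"
  using zr z(2) by (auto simp: complex_eq_iff) linarith
 thus "?cross \<or> p \<in> separatrix (g 0) \<or> p \<in> separatrix' b"
 proof cases
  case 1
  have V: "g (Im z) \<in> V" "Re z \<in> I (g (Im z))" "g (Im z) \<in> G"
   using hyp_V[OF g(1-4)] hyp_levels[OF g(1-4)] hyp_arc[OF g(1-4)] 1 zr by auto
  have p: "p = \<Psi> (Re z) (g (Im z))" using z 1 by (auto simp: hyperbolic_map_def)
  have "- \<epsilon> \<in> I p" "\<Psi> (- \<epsilon>) p = g (Im z)" using \<Psi>_sym[OF V(1,2)] f_G[OF V(3)] p by simp_all
  moreover have "f p = Re z" "p \<in> V" using f_\<Psi>[OF V(1,2)] \<Psi>_mem[OF V(1,2)] p by auto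
  ultimately show ?thesis using 1 zr by (auto simp: abs_less_iff)
 next
  case 2
  hence "p = \<Psi> (Re z) b" using z by (simp add: hyperbolic_map_def)
  thus ?thesis using 2 zr by (auto simp: separatrix'_def)
 next
  case 3
  hence "p = \<Psi> (Re z) (g 0)" using z by (simp add: hyperbolic_map_def)
  thus ?thesis using 3 zr by (auto simp: separatrix_def)
 qed
next
 have eq: "p \<in> hyperbolic_set g b" if "hyperbolic_map g b (Complex c s) = p" "- \<epsilon> < c" "c < \<epsilon>" "0 \<le> s" "s < 1" "c \<noteq> 0 \<or> s \<noteq> 0" for c s
  unfolding hyperbolic_set_def using that
  by (intro image_eqI[of _ _ "Complex c s"]) (auto simp: open_rectangle_def complex_eq_iff)
 assume "?cross \<or> p \<in> separatrix (g 0) \<or> p \<in> separatrix' b"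
 then consider "?cross" | "p \<in> separatrix (g 0)" | "p \<in> separatrix' b" by blast
 thus "p \<in> hyperbolic_set g b"
 proof cases
  case 1
  then obtain s where s: "0 < s" "s < 1" "\<Psi> (- \<epsilon>) p = g s" by auto
  have "hyperbolic_map g b (Complex (f p) s) = p"
  proof -
   have "Complex (f p) s \<noteq> 0" using s by (simp add: complex_eq_iff)
   moreover have "\<Psi> (f p) (g s) = p" using \<Psi>_sym(1)[of p "- \<epsilon>"] 1 s(3) by simp
   ultimately show ?thesis using s(1) by (simp add: hyperbolic_map_def)
  qed
  thus ?thesis using s 1 by (intro eq) (auto simp: abs_less_iff)
 next
  case 2
  then obtain c where c: "- \<epsilon> < c" "c < 0" "p = \<Psi> c (g 0)" by (auto simp: separatrix_def)
  thus ?thesis using eps_pos by (intro eq[of c 0]) (auto simp: hyperbolic_map_def complex_eq_iff)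
 next
  case 3
  then obtain c where c: "0 < c" "c < \<epsilon>" "p = \<Psi> c b" by (auto simp: separatrix'_def)
  thus ?thesis using eps_pos by (intro eq[of c 0]) (auto simp: hyperbolic_map_def complex_eq_iff)
 qed
qed

text \<open>A chart of a sector on a star-shaped domain: contraction to \<open>0\<close> in the domain moves the points of
 the separatrices along their orbits.\<close>

definition sector_chart :: "complex set \<Rightarrow> complex set \<Rightarrow> complex set \<Rightarrow> (complex \<Rightarrow> complex) \<Rightarrow> bool" where
 "sector_chart A D E \<Theta> \<longleftrightarrow> compact E \<and> D \<subseteq> E \<and> continuous_on E \<Theta> \<and> inj_on \<Theta> E \<and>
   0 \<in> D \<and> (\<forall>z\<in>D. \<forall>s\<in>{0..1}. s *\<^sub>R z \<in> D) \<and> \<Theta> 0 = x0 \<and> A = \<Theta> ` (D - {0}) \<and> A \<subseteq> V \<and>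
   (\<forall>z\<in>D. \<forall>s\<in>{0<..1}. \<Theta> z \<in> Ws \<union> Wu \<longrightarrow> \<Theta> (s *\<^sub>R z) = \<Psi> (s * f (\<Theta> z)) (\<Theta> z) \<and> s * f (\<Theta> z) \<in> I (\<Theta> z))"

lemma parabolic_chart:
 assumes "stable_arc g"
 shows "sector_chart (parabolic_set g) open_cone cone (parabolic_map g)" unfolding sector_chart_def
proof (intro conjI ballI impI)
 note g = stable_arcD[OF assms]
 show "compact cone" by (rule compact_cone)
 show "open_cone \<subseteq> cone" by (rule open_cone_cone)
 show "continuous_on cone (parabolic_map g)" by (rule continuous_parabolic_map[OF g])
 show "inj_on (parabolic_map g) cone" by (rule inj_parabolic_map[OF g])
 show "0 \<in> open_cone" by (simp add: open_cone_iff)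
 show "parabolic_map g 0 = x0" by (simp add: parabolic_map_def)
 show "parabolic_set g = parabolic_map g ` (open_cone - {0})" by (rule parabolic_set_def)
 show "parabolic_set g \<subseteq> V" using parabolic_set_iff[OF assms] Ws_V by auto
 have Arg_scale: "Arg (s *\<^sub>R z) = Arg z" if "s > 0" for s and z :: complex
  using that by (simp add: scaleR_conv_of_real)
 show sc: "s *\<^sub>R z \<in> open_cone" if "z \<in> open_cone" "s \<in> {0..1}" for z s
 proof (cases "s = 0")
  case False
  hence s: "0 < s" "s \<le> 1" using that by auto
  show ?thesis
  proof (cases "z = 0")
   case False
   hence z: "cmod z < 1" "0 \<le> Arg z" "Arg z \<le> 1" using that by (auto simp: open_cone_iff)
   have "cmod (s *\<^sub>R z) \<le> 1 * cmod z" unfolding norm_scaleR using s by (intro mult_right_mono) auto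
   hence "cmod (s *\<^sub>R z) < 1" using z by simp
   thus ?thesis unfolding open_cone_iff Arg_scale[OF s(1)] using z by blast
  qed (simp add: open_cone_iff)
 qed (simp add: open_cone_iff)
 fix z s assume z: "z \<in> open_cone" and s: "s \<in> {0<..1::real}" and W: "parabolic_map g z \<in> Ws \<union> Wu"
 have zc: "z \<in> cone" using z open_cone_cone by blast
 have nz: "z \<noteq> 0" using W Ws_V Wu_V x0_notin_V by (auto simp: parabolic_map_def)
 have fz: "f (parabolic_map g z) = - \<epsilon> * cmod z" using f_parabolic_map[OF g zc] .
 have z1: "cmod z < 1" using z nz by (simp add: open_cone_iff)
 have pos: "0 < s * cmod z" using s nz by simp
 have "s * cmod z \<le> 1 * cmod z" using s by (intro mult_right_mono) auto
 hence le1: "s * cmod z \<le> 1" using z1 by simp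
 have c: "- \<epsilon> \<le> s * f (parabolic_map g z)" "s * f (parabolic_map g z) < 0"
  unfolding fz using le1 pos eps_pos by (auto simp: mult.left_commute mult_left_le)
 have r: "- (s * f (parabolic_map g z)) / \<epsilon> = s * cmod z" unfolding fz using eps_pos by simp
 have "rcis (s * cmod z) (Arg z) = s *\<^sub>R z"
  using rcis_cmod_Arg[of z] by (simp add: rcis_def scaleR_conv_of_real mult.assoc)
 thus "parabolic_map g (s *\<^sub>R z) = \<Psi> (s * f (parabolic_map g z)) (parabolic_map g z)"
  "s * f (parabolic_map g z) \<in> I (parabolic_map g z)" using parabolic_orbit[OF g zc nz c] r by simp_all
qed

lemma uminus_mem_image: "- (c::real) \<in> uminus ` A \<longleftrightarrow> c \<in> A" by force

lemma reversed_sector_chart: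
 "sectored_flow.sector_chart x0 R (\<lambda>z. - f z) (\<lambda>z. uminus ` I z) (\<lambda>c. \<Psi> (- c)) = sector_chart"
 unfolding sectored_flow.sector_chart_def[OF sectored_reversed] sector_chart_def reversed_Ws reversed_Wu
 by (intro ext) (simp add: uminus_mem_image Un_commute)

lemma parabolic_chart':
 assumes "unstable_arc g"
 shows "sector_chart (parabolic_set' g) open_cone cone (parabolic_map' g)"
 using sectored_flow.parabolic_chart[OF sectored_reversed] assms
 unfolding reversed_stable_arc reversed_sector_chart reversed_parabolic_set reversed_parabolic_map by simp

lemma hyperbolic_chart:
 assumes "crossing_arc g b"
 shows "sector_chart (hyperbolic_set g b) open_rectangle rectangle (hyperbolic_map g b)" unfolding sector_chart_def
proof (intro conjI ballI impI)
 note g = crossing_arcD[OF assms]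
 show "compact rectangle" by (rule compact_rectangle)
 show "open_rectangle \<subseteq> rectangle" by (rule open_rectangle_rectangle)
 show "continuous_on rectangle (hyperbolic_map g b)" by (rule continuous_hyperbolic_map[OF g])
 show "inj_on (hyperbolic_map g b) rectangle" by (rule inj_hyperbolic_map[OF g])
 show "0 \<in> open_rectangle" using eps_pos by (simp add: open_rectangle_def)
 show "hyperbolic_map g b 0 = x0" by (rule hyperbolic_map_0[OF g])
 show "hyperbolic_set g b = hyperbolic_map g b ` (open_rectangle - {0})" by (rule hyperbolic_set_def)
 show "hyperbolic_set g b \<subseteq> V"
  unfolding hyperbolic_set_def using hyperbolic_map_V[OF g] open_rectangle_rectangle by blast
 show "s *\<^sub>R z \<in> open_rectangle" if "z \<in> open_rectangle" "s \<in> {0..1}" for z s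
 proof -
  have z: "\<bar>Re z\<bar> < \<epsilon>" "0 \<le> Im z" "Im z < 1" using that by (auto simp: open_rectangle_def abs_less_iff)
  have "\<bar>s * Re z\<bar> \<le> 1 * \<bar>Re z\<bar>" unfolding abs_mult using that by (intro mult_right_mono) auto
  moreover have "s * Im z \<le> 1 * Im z" using that z by (intro mult_right_mono) auto
  ultimately have "\<bar>s * Re z\<bar> < \<epsilon>" "s * Im z < 1" using z by linarith+
  thus ?thesis using z that by (auto simp: open_rectangle_def abs_less_iff)
 qed
 fix z s assume z: "z \<in> open_rectangle" and s: "s \<in> {0<..1::real}" and W: "hyperbolic_map g b z \<in> Ws \<union> Wu"
 have zc: "z \<in> rectangle" using z open_rectangle_rectangle by blast
 have nz: "z \<noteq> 0" using W Ws_V Wu_V x0_notin_V hyperbolic_map_0[OF g] by auto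
 \<comment> \<open>Off the axis the chart has no point of \<open>Ws\<close> or \<open>Wu\<close>, so
   only the two separatrices have to move along their orbits.\<close>
 have Im0: "Im z = 0" using hyperbolic_map_cross[OF g zc] W by blast
 hence Re0: "Re z \<noteq> 0" using nz by (simp add: complex_eq_iff)
 have fz: "f (hyperbolic_map g b z) = Re z" using f_hyperbolic_map[OF g zc] .
 have "\<bar>s * Re z\<bar> \<le> 1 * \<bar>Re z\<bar>" unfolding abs_mult using s by (intro mult_right_mono) auto
 hence c: "- \<epsilon> \<le> s * Re z" "s * Re z \<le> \<epsilon>" "s * Re z * Re z > 0"
  using zc s Re0 by (auto simp: rectangle_def mult.assoc zero_less_mult_iff)
 have "Complex (s * Re z) (Im z) = s *\<^sub>R z" using Im0 by (simp add: complex_eq_iff)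
 thus "hyperbolic_map g b (s *\<^sub>R z) = \<Psi> (s * f (hyperbolic_map g b z)) (hyperbolic_map g b z)"
  "s * f (hyperbolic_map g b z) \<in> I (hyperbolic_map g b z)"
  using hyperbolic_orbit[OF g zc nz c(1,2)] c(3) fz by simp_all
qed

end

section \<open>The sectors around the singular point\<close>

context sectored_flow
begin

definition arc_system :: "(real \<Rightarrow> complex) set \<Rightarrow> bool" where
 "arc_system F \<longleftrightarrow> finite F \<and>
   (\<forall>g\<in>F. continuous_on {0..1} g \<and> inj_on g {0..1} \<and> g ` {0..1} \<subseteq> level (- \<epsilon>) \<and>
    openin (top_of_set (level (- \<epsilon>))) (g ` {0<..<1}) \<and> (g ` {0..1} \<subseteq> C \<or> (g 0 \<in> C \<and> g ` {0<..1} \<subseteq> G))) \<and>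
   (\<forall>g\<in>F. \<forall>h\<in>F. g \<noteq> h \<longrightarrow> g ` {0<..<1} \<inter> h ` {0..1} = {}) \<and>
   C \<subseteq> (\<Union>g\<in>F. g ` {0..1}) \<and>
   openin (top_of_set (level (- \<epsilon>))) (C \<union> (\<Union>g\<in>F. g ` {0<..<1}))"

text \<open>The mirror image of \<open>arc_system\<close> at level \<open>\<epsilon>\<close>, kept
  in the literal form that reversal produces, whence \<open>- f y = - \<epsilon>\<close>.\<close>

definition arc_system' :: "(real \<Rightarrow> complex) set \<Rightarrow> bool" where
 "arc_system' F \<longleftrightarrow> finite F \<and>
   (\<forall>g\<in>F. continuous_on {0..1} g \<and> inj_on g {0..1} \<and> g ` {0..1} \<subseteq> {y \<in> V. - f y = - \<epsilon>} \<and>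
    openin (top_of_set {y \<in> V. - f y = - \<epsilon>}) (g ` {0<..<1}) \<and>
    (g ` {0..1} \<subseteq> C' \<or> (g 0 \<in> C' \<and> g ` {0<..1} \<subseteq> G'))) \<and>
   (\<forall>g\<in>F. \<forall>h\<in>F. g \<noteq> h \<longrightarrow> g ` {0<..<1} \<inter> h ` {0..1} = {}) \<and>
   C' \<subseteq> (\<Union>g\<in>F. g ` {0..1}) \<and>
   openin (top_of_set {y \<in> V. - f y = - \<epsilon>}) (C' \<union> (\<Union>g\<in>F. g ` {0<..<1}))"

lemma arc_system_exists: "\<exists>F. arc_system F"
 unfolding arc_system_def by (rule cut_into_arcs[OF compact_C C_G_disjoint local_structure])

lemma arc_system'_exists: "\<exists>F. arc_system' F" using sectored_flow.arc_system_exists[OF sectored_reversed]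
 unfolding sectored_flow.arc_system_def[OF sectored_reversed] arc_system'_def reversed_C reversed_G .

lemma transition_endD:
 assumes "transition_end g b" "u \<longlonglongrightarrow> 0" "\<And>n. 0 < u n" "\<And>n. u n \<le> 1"
 shows "(\<lambda>n. \<Psi> \<epsilon> (g (u n))) \<longlonglongrightarrow> b" using assms unfolding transition_end_def by blast

lemma transition_end_exists:
 assumes "continuous_on {0..1} g" "inj_on g {0..1}" "g 0 \<in> C" "g ` {0<..1} \<subseteq> G"
 shows "\<exists>b. transition_end g b"
proof -
 obtain b where "b \<in> C'" "\<And>u. u \<longlonglongrightarrow> 0 \<Longrightarrow> (\<And>n. 0 < u n) \<Longrightarrow> (\<And>n. u n \<le> 1) \<Longrightarrow> (\<lambda>n. \<Psi> \<epsilon> (g (u n))) \<longlonglongrightarrow> b"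
  using transition_limit[OF assms] by blast
 hence "transition_end g b" unfolding transition_end_def by simp
 thus ?thesis by blast
qed

end

locale sectored_arcs = sectored_flow +
 fixes F F' :: "(real \<Rightarrow> complex) set" and \<beta> :: "(real \<Rightarrow> complex) \<Rightarrow> complex"
 assumes F: "arc_system F" and F': "arc_system' F'"
  and \<beta>: "\<And>g. g \<in> F \<Longrightarrow> \<not> g ` {0..1} \<subseteq> C \<Longrightarrow> transition_end g (\<beta> g)"
begin

definition "F1 = {g \<in> F. g ` {0..1} \<subseteq> C}"
definition "F2 = {g \<in> F. \<not> g ` {0..1} \<subseteq> C}"
definition "F1' = {g \<in> F'. g ` {0..1} \<subseteq> C'}"
definition "F2' = {g \<in> F'. \<not> g ` {0..1} \<subseteq> C'}"

lemma finite_F: "finite F" "finite F1" "finite F2" "finite F1'"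
 using F F' by (auto simp: arc_system_def arc_system'_def F1_def F2_def F1'_def)

lemma F_D: assumes "g \<in> F"
 shows "continuous_on {0..1} g" "inj_on g {0..1}" "g ` {0..1} \<subseteq> level (- \<epsilon>)"
  "openin (top_of_set (level (- \<epsilon>))) (g ` {0<..<1})" "g ` {0..1} \<subseteq> C \<or> (g 0 \<in> C \<and> g ` {0<..1} \<subseteq> G)"
 using bspec[OF conjunct1[OF conjunct2[OF F[unfolded arc_system_def]]] assms] by simp_all

lemma F_disjoint: "g \<in> F \<Longrightarrow> h \<in> F \<Longrightarrow> g \<noteq> h \<Longrightarrow> g ` {0<..<1} \<inter> h ` {0..1} = {}" using F unfolding arc_system_def by blast

lemma F'_disjoint: "g \<in> F' \<Longrightarrow> h \<in> F' \<Longrightarrow> g \<noteq> h \<Longrightarrow> g ` {0<..<1} \<inter> h ` {0..1} = {}"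
 using F' unfolding arc_system'_def by blast

lemma F1_stable: "g \<in> F1 \<Longrightarrow> stable_arc g" using F_D[of g] by (simp add: F1_def stable_arc_def)

lemma F2_crossing: "g \<in> F2 \<Longrightarrow> crossing_arc g (\<beta> g)" using F_D[of g] \<beta>[of g] by (simp add: F2_def crossing_arc_def)

lemma F1'_unstable: "g \<in> F1' \<Longrightarrow> unstable_arc g" using F' by (simp add: F1'_def unstable_arc_def arc_system'_def)

lemma F2'_D: assumes "g \<in> F2'"
 shows "continuous_on {0..1} g" "inj_on g {0..1}" "g 0 \<in> C'" "g ` {0<..1} \<subseteq> G'"
 using bspec[OF conjunct1[OF conjunct2[OF F'[unfolded arc_system'_def]]], of g] assms by (simp_all add: F2'_def)

lemma F2_D: assumes "g \<in> F2"
 shows "g \<in> F" "g 0 \<in> C" "g ` {0<..1} \<subseteq> G" "\<beta> g \<in> C'" "transition_end g (\<beta> g)"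
proof -
 show "g \<in> F" using assms by (simp add: F2_def)
 show "g 0 \<in> C" "g ` {0<..1} \<subseteq> G" "transition_end g (\<beta> g)"
  using F2_crossing[OF assms] unfolding crossing_arc_def by simp_all
 thus "\<beta> g \<in> C'" by (simp add: transition_end_def)
qed

text \<open>\<open>C\<close> enlarged by the interiors of the arcs, which is open in the level set;
  the openness of \<open>U\<close> rests on this.\<close>

definition "entry = C \<union> (\<Union>g\<in>F. g ` {0<..<1})"
definition "U = {x0} \<union> {p \<in> Wu. f p < \<epsilon>} \<union> {p \<in> V. \<bar>f p\<bar> < \<epsilon> \<and> - \<epsilon> \<in> I p \<and> \<Psi> (- \<epsilon>) p \<in> entry}"
text \<open>Hyperbolic sectors are built from level \<open>-\<epsilon>\<close> only. By
  \<open>crossing_end\<close> their outgoing separatrices account for the starting points of the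
  crossing arcs at level \<open>\<epsilon>\<close>.\<close>

definition "sectors = parabolic_set ` F1 \<union> (\<lambda>g. hyperbolic_set g (\<beta> g)) ` F2 \<union> parabolic_set' ` F1'"

lemma entry_open: "openin (top_of_set (level (- \<epsilon>))) entry" using F unfolding entry_def arc_system_def by blast

lemma entry_cases:
 assumes "q \<in> entry"
 obtains "q \<in> C" | g where "g \<in> F2" "q \<in> g ` {0<..<1}"
proof (cases "q \<in> C")
 case False
 then obtain g where g: "g \<in> F" "q \<in> g ` {0<..<1}" using assms by (auto simp: entry_def)
 have "g ` {0<..<1} \<subseteq> g ` {0..1}" by (intro image_mono) auto
 hence "g \<in> F2" using g False by (auto simp: F2_def)
 thus ?thesis using that g by blast
qed

lemma C_arc:
 assumes "q \<in> C"
 obtains g where "g \<in> F1" "q \<in> g ` {0..1}" | g where "g \<in> F2" "q = g 0"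
proof -
 have "C \<subseteq> (\<Union>g\<in>F. g ` {0..1})" using F unfolding arc_system_def by blast
 then obtain g where g: "g \<in> F" "q \<in> g ` {0..1}" using assms by blast
 show thesis
 proof (cases "g \<in> F1")
  case False
  hence g2: "g \<in> F2" using g by (simp add: F1_def F2_def)
  obtain t where t: "0 \<le> t" "t \<le> 1" "q = g t" using g by auto
  have "t = 0"
  proof (rule ccontr)
   assume "t \<noteq> 0"
   hence "q \<in> G" using F2_D(3)[OF g2] t by auto
   thus False using assms C_G_disjoint by blast
  qed
  thus ?thesis using that(2)[OF g2] t by simp
 qed (use that(1) g in blast)
qed

lemma C'_arc:
 assumes "q \<in> C'"
 obtains g where "g \<in> F1'" "q \<in> g ` {0..1}" | g where "g \<in> F2'" "q = g 0"
proof -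
 have "C' \<subseteq> (\<Union>g\<in>F'. g ` {0..1})" using F' unfolding arc_system'_def by blast
 then obtain g where g: "g \<in> F'" "q \<in> g ` {0..1}" using assms by blast
 show thesis
 proof (cases "g \<in> F1'")
  case False
  hence g2: "g \<in> F2'" using g by (simp add: F1'_def F2'_def)
  obtain t where t: "0 \<le> t" "t \<le> 1" "q = g t" using g by auto
  have "t = 0"
  proof (rule ccontr)
   assume "t \<noteq> 0"
   hence "q \<in> G'" using F2'_D(4)[OF g2] t by auto
   moreover have "C' \<inter> G' = {}"
    using sectored_flow.C_G_disjoint[OF sectored_reversed] unfolding reversed_C reversed_G .
   ultimately show False using assms by blast
  qed
  thus ?thesis using that(2)[OF g2] t by simp
 qed (use that(1) g in blast)
qed

text \<open>A point of \<open>C'\<close> that is approached by crossing orbits is the end of one of the finitely many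
 crossing arcs starting at level \<open>-\<epsilon>\<close>.\<close>

lemma crossing_end:
 assumes h: "h \<in> F2'"
 obtains g where "g \<in> F2" "\<beta> g = h 0"
proof -
 note hd = F2'_D[OF h]
 note rev = sectored_flow.transition_cluster[OF sectored_reversed, unfolded reversed_C reversed_G reversed_C', OF hd]
 define u where "u = (\<lambda>n. 1 / real (Suc n))"
 have u: "u \<longlonglongrightarrow> 0" "\<And>n. 0 < u n" "\<And>n. u n \<le> 1" using LIMSEQ_inverse_real_of_nat by (auto simp: u_def inverse_eq_divide)
 define y where "y = (\<lambda>n. h (u n))"
 have yG: "y n \<in> G'" for n
 proof -
  have "u n \<in> {0<..1}" using u(2,3)[of n] by simp
  thus ?thesis unfolding y_def using hd(4) by blast
 qed
 have y: "y n \<in> V" "f (y n) = \<epsilon>" "- \<epsilon> \<in> I (y n)" "\<And>c. - \<epsilon> \<le> c \<Longrightarrow> c \<le> \<epsilon> \<Longrightarrow> \<Psi> c (y n) \<in> K" for n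
  using yG[of n] by (auto simp: G'_def)
 have ylim: "y \<longlonglongrightarrow> h 0"
  unfolding y_def by (rule continuous_on_tendsto_compose[OF hd(1) u(1)]) (use u in \<open>auto simp: less_imp_le\<close>)
 define q where "q = (\<lambda>n. \<Psi> (- \<epsilon>) (y n))"
 have "\<forall>n. q n \<in> K" using y(4) eps_pos by (simp add: q_def)
 then obtain l r where l: "strict_mono (r::nat\<Rightarrow>nat)" "(q \<circ> r) \<longlonglongrightarrow> l" using compact_K unfolding compact_def by meson
 have ur: "(\<lambda>n. u (r n)) \<longlonglongrightarrow> 0" using LIMSEQ_subseq_LIMSEQ[OF u(1) l(1)] by (simp add: o_def)
 have ql: "(\<lambda>n. \<Psi> (- \<epsilon>) (h (u (r n)))) \<longlonglongrightarrow> l" using l(2) by (simp add: o_def q_def y_def)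
 have lC: "l \<in> C" by (rule rev[OF ur _ _ ql]) (use u in auto)
 have qL: "q n \<in> level (- \<epsilon>)" for n using \<Psi>_mem[OF y(1,3)] f_\<Psi>[OF y(1,3)] by (simp add: q_def)
 have evE: "\<forall>\<^sub>F n in sequentially. (q \<circ> r) n \<in> entry"
  by (rule openin_eventually_sequentially[OF entry_open _ l(2)]) (use lC qL in \<open>auto simp: entry_def\<close>)
 have qC: "q n \<notin> C" for n
 proof
  assume "q n \<in> C"
  moreover have "\<epsilon> \<in> I (q n)" using \<Psi>_sym(2)[OF y(1,3)] y(2) by (simp add: q_def)
  ultimately show False using Ws_levels_neg[of "q n" \<epsilon>] eps_pos by (auto simp: C_def)
 qed
 have ev: "\<forall>\<^sub>F n in sequentially. \<exists>g\<in>F2. (q \<circ> r) n \<in> g ` {0<..<1}" using evE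
 proof eventually_elim
  case (elim n)
  thus ?case by (rule entry_cases) (use qC in auto)
 qed
 \<comment> \<open>Pigeonhole: there are finitely many crossing arcs, so one of them contains
   infinitely many of the entry points.\<close>
 have "\<exists>g\<in>F2. \<exists>\<^sub>F n in sequentially. (q \<circ> r) n \<in> g ` {0<..<1}"
 proof (rule ccontr)
  assume "\<not> ?thesis"
  hence "\<forall>g\<in>F2. \<forall>\<^sub>F n in sequentially. (q \<circ> r) n \<notin> g ` {0<..<1}" by (simp add: frequently_def)
  hence "\<forall>\<^sub>F n in sequentially. \<forall>g\<in>F2. (q \<circ> r) n \<notin> g ` {0<..<1}" by (rule eventually_ball_finite[OF finite_F(3)])
  hence "\<forall>\<^sub>F n in sequentially. False" using ev by eventually_elim blast
  thus False by simp
 qed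
 then obtain g where g: "g \<in> F2" and fr: "\<exists>\<^sub>F n in sequentially. (q \<circ> r) n \<in> g ` {0<..<1}" by blast
 obtain s where s: "strict_mono (s::nat\<Rightarrow>nat)" "\<And>n. (q \<circ> r) (s n) \<in> g ` {0<..<1}"
  using frequently_subsequenceE[OF fr] by blast
 have "\<exists>t. 0 < t \<and> t < 1 \<and> q (r (s n)) = g t" for n using s(2)[of n] by auto
 then obtain t where t: "\<And>n. 0 < t n" "\<And>n. t n < 1" "\<And>n. q (r (s n)) = g (t n)" by metis
 have "\<forall>n. t n \<in> {0..1}" using t(1,2) by (simp add: less_imp_le)
 then obtain t0 k where k: "t0 \<in> {0..1}" "strict_mono (k::nat\<Rightarrow>nat)" "(t \<circ> k) \<longlonglongrightarrow> t0"
  using compact_Icc[of "0::real" 1] unfolding compact_def by meson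
 note gd = F_D[OF F2_D(1)[OF g]]
 have "(\<lambda>n. g ((t \<circ> k) n)) \<longlonglongrightarrow> g t0"
  by (rule continuous_on_tendsto_compose[OF gd(1) k(3,1)]) (use t in \<open>auto simp: less_imp_le\<close>)
 moreover have "(\<lambda>n. g ((t \<circ> k) n)) \<longlonglongrightarrow> l"
  using LIMSEQ_subseq_LIMSEQ[OF LIMSEQ_subseq_LIMSEQ[OF l(2) s(1)] k(2)] t(3) by (simp add: o_def)
 ultimately have "g t0 = l" using LIMSEQ_unique by blast
 \<comment> \<open>The limit \<open>l\<close> of the entry points lies in \<open>C\<close>, and a
   crossing arc meets \<open>C\<close> only at its start.\<close>
 have "t0 = 0"
 proof (rule ccontr)
  assume "t0 \<noteq> 0"
  hence "g t0 \<in> G" using F2_D(3)[OF g] k(1) by auto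
  thus False using \<open>g t0 = l\<close> lC C_G_disjoint by blast
 qed
 hence lim: "(\<lambda>n. \<Psi> \<epsilon> (g ((t \<circ> k) n))) \<longlonglongrightarrow> \<beta> g"
  by (intro transition_endD[OF F2_D(5)[OF g]]) (use k(3) t in \<open>auto simp: less_imp_le o_def\<close>)
 have "\<Psi> \<epsilon> (g (t n)) = y (r (s n))" for n
 proof -
  have "g (t n) = \<Psi> (- \<epsilon>) (y (r (s n)))" using t(3)[of n] by (simp add: q_def)
  thus ?thesis using \<Psi>_sym(1)[OF y(1,3)] y(2) by metis
 qed
 hence "(\<lambda>n. y (r (s (k n)))) \<longlonglongrightarrow> \<beta> g" using lim by (simp add: o_def)
 moreover have "(\<lambda>n. y (r (s (k n)))) \<longlonglongrightarrow> h 0"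
  using LIMSEQ_subseq_LIMSEQ[OF LIMSEQ_subseq_LIMSEQ[OF LIMSEQ_subseq_LIMSEQ[OF ylim l(1)] s(1)] k(2)]
  by (simp add: o_def)
 ultimately have "\<beta> g = h 0" using LIMSEQ_unique by blast
 thus thesis using that g by blast
qed

lemma U_eq: "U = insert x0 (\<Union>sectors)"
proof
 show "U \<subseteq> insert x0 (\<Union>sectors)"
 proof
  fix p assume "p \<in> U"
  then consider "p = x0" | "p \<in> Wu" "f p < \<epsilon>"
   | "p \<in> V" "\<bar>f p\<bar> < \<epsilon>" "- \<epsilon> \<in> I p" "\<Psi> (- \<epsilon>) p \<in> entry" by (auto simp: U_def)
  thus "p \<in> insert x0 (\<Union>sectors)"
  proof cases
   case 2
   note b = Wu_base[OF 2]
   show ?thesis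
   proof (rule C'_arc[OF b(2)])
    fix g assume g: "g \<in> F1'" "\<Psi> \<epsilon> p \<in> g ` {0..1}"
    hence "p \<in> parabolic_set' g" using parabolic_set'_iff[OF F1'_unstable] 2 by blast
    thus ?thesis using g by (auto simp: sectors_def)
   next
    fix h assume h: "h \<in> F2'" "\<Psi> \<epsilon> p = h 0"
    \<comment> \<open>An unstable orbit that is not based on an unstable arc is the outgoing side of
      a hyperbolic sector.\<close>
    obtain g where g: "g \<in> F2" "\<beta> g = h 0" using crossing_end[OF h(1)] .
    have "p \<in> separatrix' (\<beta> g)" using separatrix'_iff[OF F2_D(4)[OF g(1)]] 2 h g by simp
    hence "p \<in> hyperbolic_set g (\<beta> g)" using hyperbolic_set_iff[OF F2_crossing[OF g(1)]] by blast
    thus ?thesis using g(1) by (auto simp: sectors_def)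
   qed
  next
   case 3
   show ?thesis
   proof (rule entry_cases[OF 3(4)])
    assume qC: "\<Psi> (- \<epsilon>) p \<in> C"
    have Ip: "I (\<Psi> (- \<epsilon>) p) = I p" "\<Psi> (f p) (\<Psi> (- \<epsilon>) p) = p" using levels_\<Psi>[OF 3(1,3)] \<Psi>_sym(1)[OF 3(1,3)] by auto
    hence "f p < 0" using Ws_levels_neg[of "\<Psi> (- \<epsilon>) p" "f p"] qC level_mem[OF 3(1)] by (auto simp: C_def)
    hence pW: "p \<in> Ws" using C_orbit[OF qC, of "f p"] Ip 3 by simp
    have fp: "- \<epsilon> < f p" using 3 by simp
    show ?thesis
    proof (rule C_arc[OF qC])
     fix g assume g: "g \<in> F1" "\<Psi> (- \<epsilon>) p \<in> g ` {0..1}"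
     hence "p \<in> parabolic_set g" using parabolic_set_iff[OF F1_stable] pW fp by blast
     thus ?thesis using g by (auto simp: sectors_def)
    next
     fix g assume g: "g \<in> F2" "\<Psi> (- \<epsilon>) p = g 0"
     hence "p \<in> separatrix (g 0)" using separatrix_iff[OF F2_D(2)[OF g(1)]] pW fp by simp
     hence "p \<in> hyperbolic_set g (\<beta> g)" using hyperbolic_set_iff[OF F2_crossing[OF g(1)]] by blast
     thus ?thesis using g by (auto simp: sectors_def)
    qed
   next
    fix g assume g: "g \<in> F2" "\<Psi> (- \<epsilon>) p \<in> g ` {0<..<1}"
    hence "p \<in> hyperbolic_set g (\<beta> g)" using hyperbolic_set_iff[OF F2_crossing[OF g(1)]] 3 by blast
    thus ?thesis using g by (auto simp: sectors_def)
   qed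
  qed simp
 qed
 have sepU: "p \<in> U" if "p \<in> Ws" "- \<epsilon> < f p" for p
  using Ws_base[OF that] that Ws_neg[OF that(1)] Ws_V[OF that(1)] by (auto simp: U_def entry_def)
 have sepU': "p \<in> U" if "p \<in> Wu" "f p < \<epsilon>" for p using that by (simp add: U_def)
 show "insert x0 (\<Union>sectors) \<subseteq> U"
 proof
  fix p assume "p \<in> insert x0 (\<Union>sectors)"
  then consider "p = x0" | g where "g \<in> F1" "p \<in> parabolic_set g" | g where "g \<in> F1'" "p \<in> parabolic_set' g"
   | g where "g \<in> F2" "p \<in> hyperbolic_set g (\<beta> g)" by (auto simp: sectors_def)
  thus "p \<in> U"
  proof cases
   case 1 thus ?thesis by (simp add: U_def)
  next
   case 2 thus ?thesis using sepU parabolic_set_iff[OF F1_stable[OF 2(1)]] by blast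
  next
   case 3 thus ?thesis using sepU' parabolic_set'_iff[OF F1'_unstable[OF 3(1)]] by blast
  next
   case (4 g)
   have "(p \<in> V \<and> \<bar>f p\<bar> < \<epsilon> \<and> - \<epsilon> \<in> I p \<and> \<Psi> (- \<epsilon>) p \<in> g ` {0<..<1}) \<or> p \<in> separatrix (g 0) \<or> p \<in> separatrix' (\<beta> g)"
    using hyperbolic_set_iff[OF F2_crossing[OF 4(1)]] 4(2) by blast
   thus ?thesis
   proof (elim disjE)
    assume p: "p \<in> V \<and> \<bar>f p\<bar> < \<epsilon> \<and> - \<epsilon> \<in> I p \<and> \<Psi> (- \<epsilon>) p \<in> g ` {0<..<1}"
    hence "\<Psi> (- \<epsilon>) p \<in> entry" using F2_D(1)[OF 4(1)] by (auto simp: entry_def)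
    thus ?thesis using p by (simp add: U_def)
   next
    assume "p \<in> separatrix (g 0)"
    thus ?thesis using sepU separatrix_iff[OF F2_D(2)[OF 4(1)]] by blast
   next
    assume "p \<in> separatrix' (\<beta> g)"
    thus ?thesis using sepU' separatrix'_iff[OF F2_D(4)[OF 4(1)]] by blast
   qed
  qed
 qed
qed

lemma U_subset: "U \<subseteq> ball x0 R \<inter> half_plane" and x0_U: "x0 \<in> U" and U_V: "U - {x0} \<subseteq> V"
 and f_U: "p \<in> U \<Longrightarrow> \<bar>f p\<bar> < \<epsilon>"
proof -
 show x: "x0 \<in> U" by (simp add: U_def)
 show UV: "U - {x0} \<subseteq> V" using Wu_V by (auto simp: U_def)
 have "x0 \<in> ball x0 R \<inter> half_plane" using R_pos x0_half_plane by simp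
 thus "U \<subseteq> ball x0 R \<inter> half_plane" using UV V_subset by blast
 show "\<bar>f p\<bar> < \<epsilon>" if "p \<in> U" using that Wu_pos[of p] f_x0 eps_pos by (auto simp: U_def)
qed

text \<open>At a point whose orbit comes in through \<open>entry\<close>, this is openness of
  \<open>entry\<close> and continuity of \<open>\<Psi>\<close>. At \<open>x0\<close> and on unstable
  orbits, nearby orbits outside \<open>Wu\<close> can be traced back inside \<open>K\<close> to
  level \<open>-\<epsilon>\<close> by \<open>backward_segment\<close>, and their points at that
  level accumulate only at \<open>C\<close>.\<close>

lemma U_open: "openin (top_of_set half_plane) U"
proof -
 have "openin (top_of_set (ball x0 R \<inter> half_plane)) U"
 proof (rule ccontr)
  assume n: "\<not> ?thesis"
  have "\<exists>ps p. p \<in> U \<and> ps \<longlonglongrightarrow> p \<and> (\<forall>n. ps n \<in> ball x0 R \<inter> half_plane - U)"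
  proof (rule not_openin_sequenceE[OF n U_subset])
   fix ps p assume *: "p \<in> U" "ps \<longlonglongrightarrow> p" "\<And>n. ps n \<in> ball x0 R \<inter> half_plane - U"
   show ?thesis by (intro exI[of _ ps] exI[of _ p] conjI allI *(1,2)) (rule *(3))
  qed
  then obtain ps p where p: "p \<in> U" "ps \<longlonglongrightarrow> p" "\<And>n. ps n \<in> ball x0 R \<inter> half_plane - U" by blast
  have psV: "ps n \<in> V" for n using p(3)[of n] x0_U by (auto simp: V_def)
  have pb: "p \<in> ball x0 R \<inter> half_plane" using p(1) U_subset by blast
  have fl: "(\<lambda>n. f (ps n)) \<longlonglongrightarrow> f p" by (rule tendsto_f[OF p(2)]) (use p(3) pb in auto)
  have "\<forall>\<^sub>F n in sequentially. f (ps n) < \<epsilon>" "\<forall>\<^sub>F n in sequentially. - \<epsilon> < f (ps n)"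
   using order_tendstoD[OF fl] f_U[OF p(1)] by (auto simp: abs_less_iff)
  hence fe: "\<forall>\<^sub>F n in sequentially. \<bar>f (ps n)\<bar> < \<epsilon>" by eventually_elim (simp add: abs_less_iff)
  consider "p \<in> insert x0 Wu" | "p \<in> V" "\<bar>f p\<bar> < \<epsilon>" "- \<epsilon> \<in> I p" "\<Psi> (- \<epsilon>) p \<in> entry" using p(1) by (auto simp: U_def)
  thus False
  proof cases
   case 2
   have "\<forall>\<^sub>F n in sequentially. ps n \<in> V" using psV by simp
   note t = tendsto_\<Psi>[OF 2(1,3) p(2) tendsto_const this]
   have "\<forall>\<^sub>F n in sequentially. \<Psi> (- \<epsilon>) (ps n) \<in> level (- \<epsilon>)"
    using t(1) by eventually_elim (use \<Psi>_mem[OF psV] f_\<Psi>[OF psV] in simp)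
   hence "\<forall>\<^sub>F n in sequentially. \<Psi> (- \<epsilon>) (ps n) \<in> entry"
    by (rule openin_eventually_sequentially[OF entry_open 2(4) t(2)])
   hence "\<forall>\<^sub>F n in sequentially. ps n \<in> U" using fe t(1) by eventually_elim (use psV in \<open>simp add: U_def\<close>)
   thus False using p(3) by (auto simp: eventually_sequentially)
  next
   case 1
   have pin: "dist x0 p < R / 2"
   proof (cases "p = x0")
    case False
    hence pW: "p \<in> Wu" using 1 by simp
    hence "p \<in> K" "f p < \<epsilon>" using Wu_K f_U[OF p(1)] by auto
    thus ?thesis using Wu_exit[OF pW] by (force simp: K_def)
   qed (use R_pos in simp)
   have "\<forall>\<^sub>F n in sequentially. dist x0 (ps n) < R / 2"
    by (rule order_tendstoD(2)[OF tendsto_dist[OF tendsto_const p(2)] pin])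
   hence "\<forall>\<^sub>F n in sequentially. dist x0 (ps n) < R / 2 \<and> \<bar>f (ps n)\<bar> < \<epsilon>" using fe by eventually_elim simp
   then obtain N where N: "\<And>n. n \<ge> N \<Longrightarrow> dist x0 (ps n) < R / 2" "\<And>n. n \<ge> N \<Longrightarrow> \<bar>f (ps n)\<bar> < \<epsilon>"
    by (auto simp: eventually_sequentially)
   define qs where "qs = (\<lambda>n. ps (n + N))"
   have qs: "qs \<longlonglongrightarrow> p" unfolding qs_def using p(2) LIMSEQ_ignore_initial_segment by blast
   have qK: "qs n \<in> K - {x0}" for n
    using N(1)[of "n + N"] psV[of "n + N"] V_subset x0_notin_V by (fastforce simp: qs_def K_def)
   have qU: "qs n \<notin> U" "qs n \<in> V" "\<bar>f (qs n)\<bar> < \<epsilon>" for n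
    using p(3)[of "n + N"] psV N(2)[of "n + N"] by (auto simp: qs_def)
   have qWu: "qs n \<notin> Wu" for n using qU[of n] by (auto simp: U_def)
   have "\<forall>\<^sub>F n in sequentially. - \<epsilon> \<in> I (qs n) \<and> (\<forall>c. - \<epsilon> \<le> c \<and> c \<le> f (qs n) \<longrightarrow> \<Psi> c (qs n) \<in> K)"
    by (rule backward_segment[OF qs 1 _ qK qWu]) (use f_U[OF p(1)] in auto)
   then obtain M where M: "\<And>n. n \<ge> M \<Longrightarrow> - \<epsilon> \<in> I (qs n)"
    "\<And>n c. n \<ge> M \<Longrightarrow> - \<epsilon> \<le> c \<Longrightarrow> c \<le> f (qs n) \<Longrightarrow> \<Psi> c (qs n) \<in> K" by (auto simp: eventually_sequentially)
   define ys where "ys = (\<lambda>n. \<Psi> (- \<epsilon>) (qs (n + M)))"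
   have eI: "- \<epsilon> \<in> I (qs (n + M))" for n using M(1) by simp
   have ysK: "ys n \<in> K" for n unfolding ys_def using M(2)[of "n + M" "- \<epsilon>"] qU(3)[of "n + M"] by auto
   have ysL: "ys n \<in> level (- \<epsilon>)" for n using \<Psi>_mem[OF qU(2) eI] f_\<Psi>[OF qU(2) eI] by (simp add: ys_def)
   have "\<forall>n. ys n \<in> K" using ysK by simp
   then obtain y r where y: "y \<in> K" "strict_mono (r::nat\<Rightarrow>nat)" "(ys \<circ> r) \<longlonglongrightarrow> y"
    using compact_K unfolding compact_def by meson
   have "(\<lambda>n. f ((ys \<circ> r) n)) \<longlonglongrightarrow> f y" by (rule tendsto_f_K(2)[OF y(3)]) (use ysK in simp)
   hence "(\<lambda>n::nat. - \<epsilon>) \<longlonglongrightarrow> f y" using ysL by simp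
   hence fy: "f y = - \<epsilon>" using LIMSEQ_unique[OF tendsto_const] by metis
   hence yx: "y \<noteq> x0" using f_x0 eps_pos by auto
   hence yV: "y \<in> V" using y(1) K_subset by blast
   define qq where "qq = (\<lambda>n. qs (r n + M))"
   have qq: "qq \<longlonglongrightarrow> p"
    using LIMSEQ_subseq_LIMSEQ[OF LIMSEQ_ignore_initial_segment[OF qs, of M] y(2)] by (simp add: qq_def o_def)
   \<comment> \<open>The second alternative would make \<open>-\<epsilon>\<close> a level of an
     orbit in \<open>Wu\<close>.\<close>
   have "y \<in> Ws \<or> (p \<noteq> x0 \<and> f p \<in> I y \<and> p = \<Psi> (f p) y \<and> f y \<le> f p \<and>
      (\<forall>c. f y \<le> c \<and> c \<le> f p \<longrightarrow> \<Psi> c y \<in> K))"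
   proof (rule segments_limit[where zs = "ys \<circ> r" and ds = "\<lambda>n. f (qq n)"])
    show "(ys \<circ> r) n \<in> V" for n using ysL by simp
    show "f (qq n) \<in> I ((ys \<circ> r) n)" for n using \<Psi>_sym(2)[OF qU(2) eI] by (simp add: qq_def ys_def)
    show "f ((ys \<circ> r) n) \<le> f (qq n)" for n
     using ysL[of "r n"] qU(3)[of "r n + M"] by (simp add: qq_def abs_less_iff)
    show "\<Psi> c ((ys \<circ> r) n) \<in> K" if c: "f ((ys \<circ> r) n) \<le> c" "c \<le> f (qq n)" for n c
    proof -
     have c1: "- \<epsilon> \<le> c" "c \<le> f (qs (r n + M))" using c ysL[of "r n"] by (auto simp: qq_def)
     have cI: "c \<in> I (qs (r n + M))" using levels_mem_interval[OF qU(2) eI level_mem[OF qU(2)] c1] .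
     hence "\<Psi> c (ys (r n)) = \<Psi> c (qs (r n + M))" unfolding ys_def using \<Psi>_\<Psi>[OF qU(2) eI] by blast
     thus ?thesis using M(2)[of "r n + M" c] c1 by simp
    qed
    have "\<Psi> (f (qq n)) ((ys \<circ> r) n) = qq n" for n using \<Psi>_sym(1)[OF qU(2) eI] by (simp add: qq_def ys_def)
    thus "(\<lambda>n. \<Psi> (f (qq n)) ((ys \<circ> r) n)) \<longlonglongrightarrow> p" using qq by simp
   qed (use y(3) yx in auto)
   hence "y \<in> Ws"
   proof
    assume *: "p \<noteq> x0 \<and> f p \<in> I y \<and> p = \<Psi> (f p) y \<and> f y \<le> f p \<and>
      (\<forall>c. f y \<le> c \<and> c \<le> f p \<longrightarrow> \<Psi> c y \<in> K)"
    hence "p \<in> Wu" using 1 by simp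
    moreover have "- \<epsilon> \<in> I p" using \<Psi>_sym(2)[OF yV, of "f p"] * fy by simp
    ultimately show ?thesis using Wu_levels_pos'[of p "- \<epsilon>"] eps_pos by simp
   qed
   hence "y \<in> entry" using fy by (simp add: entry_def C_def)
   hence "\<forall>\<^sub>F n in sequentially. (ys \<circ> r) n \<in> entry"
    by (rule openin_eventually_sequentially[OF entry_open _ y(3)]) (use ysL in simp)
   then obtain n where "ys (r n) \<in> entry" by (auto simp: eventually_sequentially)
   hence "qs (r n + M) \<in> U" using qU(2,3)[of "r n + M"] eI[of "r n"] by (simp add: U_def ys_def)
   thus False using qU(1) by blast
  qed
 qed
 moreover have "openin (top_of_set half_plane) (ball x0 R \<inter> half_plane)"
  using openin_open_Int[of "ball x0 R" half_plane] by (simp add: Int_commute)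
 ultimately show ?thesis by (rule openin_trans)
qed

end

section \<open>Disks and half-disks\<close>

text \<open>An automorphism of the disk moves the image of \<open>x\<close> to \<open>0\<close>, as
  the Schwarz lemma requires later.\<close>

lemma normalized_riemann_map:
 assumes "open S" "simply_connected S" "S \<noteq> UNIV" "x \<in> S"
 obtains f g where "f holomorphic_on S" "g holomorphic_on ball 0 1" "f x = 0"
  "\<And>z. z \<in> S \<Longrightarrow> f z \<in> ball 0 1 \<and> g (f z) = z" "\<And>w. w \<in> ball 0 1 \<Longrightarrow> g w \<in> S \<and> f (g w) = w"
proof -
 obtain f g where fg: "f holomorphic_on S" "g holomorphic_on ball 0 1"
  "\<forall>z\<in>S. f z \<in> ball 0 1 \<and> g (f z) = z" "\<forall>z\<in>ball 0 1. g z \<in> S \<and> f (g z) = z"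
  using Riemann_mapping_theorem[of S] assms by auto
 obtain m n where mn: "m (f x) = 0" "m holomorphic_on ball 0 1" "m ` ball 0 1 \<subseteq> ball 0 1"
   "n holomorphic_on ball 0 1" "n ` ball 0 1 \<subseteq> ball 0 1"
   "\<And>z. z \<in> ball 0 1 \<Longrightarrow> m (n z) = z" "\<And>z. z \<in> ball 0 1 \<Longrightarrow> n (m z) = z"
  using ball_biholomorphism_exists[of "f x"] fg(3) assms(4) by blast
 show thesis
 proof (rule that[of "m \<circ> f" "g \<circ> n"])
  show "m \<circ> f holomorphic_on S" using fg by (intro holomorphic_on_compose_gen[OF fg(1) mn(2)]) auto
  show "g \<circ> n holomorphic_on ball 0 1" by (rule holomorphic_on_compose_gen[OF mn(4) fg(2) mn(5)])
 qed (use mn fg in \<open>auto simp: image_subset_iff\<close>)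
qed

text \<open>The maps \<open>f\<close> and \<open>z \<mapsto> cnj (f (cnj z))\<close> differ by a rotation \<open>\<alpha>\<close>, by the Schwarz lemma;
 a square root of \<open>\<alpha>\<close> makes the Riemann map symmetric.\<close>

lemma symmetric_riemann_map:
 assumes S: "open S" "simply_connected S" "S \<noteq> UNIV" "x \<in> S" "Im x = 0"
  and sym: "\<And>z. z \<in> S \<Longrightarrow> cnj z \<in> S"
 obtains f g where "continuous_on S f" "continuous_on (ball 0 1) g"
  "\<And>z. z \<in> S \<Longrightarrow> f z \<in> ball 0 1 \<and> g (f z) = z" "\<And>w. w \<in> ball 0 1 \<Longrightarrow> g w \<in> S \<and> f (g w) = w"
  "\<And>z. z \<in> S \<Longrightarrow> f (cnj z) = cnj (f z)"
proof -
 obtain f g where fg: "f holomorphic_on S" "g holomorphic_on ball 0 1" "f x = 0"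
  "\<And>z. z \<in> S \<Longrightarrow> f z \<in> ball 0 1 \<and> g (f z) = z" "\<And>w. w \<in> ball 0 1 \<Longrightarrow> g w \<in> S \<and> f (g w) = w"
  using normalized_riemann_map[OF S(1-4)] by blast
 have cnjS: "cnj ` S = S"
 proof
  show "cnj ` S \<subseteq> S" using sym by blast
  show "S \<subseteq> cnj ` S"
  proof
   fix z assume "z \<in> S"
   thus "z \<in> cnj ` S" using sym[of z] by (intro image_eqI[of _ _ "cnj z"]) simp_all
  qed
 qed
 have cnjB: "cnj ` ball 0 1 = ball 0 1"
 proof
  show "ball 0 1 \<subseteq> cnj ` ball 0 1"
  proof
   fix z :: complex assume "z \<in> ball 0 1"
   thus "z \<in> cnj ` ball 0 1" by (intro image_eqI[of _ _ "cnj z"]) auto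
  qed
 qed auto
 define fs where "fs = cnj \<circ> f \<circ> cnj"
 define gs where "gs = cnj \<circ> g \<circ> cnj"
 have fs: "fs holomorphic_on S" unfolding fs_def by (rule holomorphic_on_compose_cnj_cnj) (use fg cnjS S in auto)
 have gs: "gs holomorphic_on ball 0 1" unfolding gs_def
  by (rule holomorphic_on_compose_cnj_cnj) (use fg cnjB in auto)
 have fsg: "fs z \<in> ball 0 1" "gs (fs z) = z" if "z \<in> S" for z
  using fg(4)[OF sym[OF that]] by (auto simp: fs_def gs_def)
 have gsf: "gs w \<in> S" "fs (gs w) = w" if "w \<in> ball 0 1" for w
  using fg(5)[of "cnj w"] that sym by (auto simp: fs_def gs_def)
 have x: "cnj x = x" "g 0 = x"
 proof -
  show "cnj x = x" using S(5) by (simp add: complex_eq_iff)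
  show "g 0 = x" using fg(4)[OF S(4)] by (simp add: fg(3))
 qed
 have h1: "fs \<circ> g holomorphic_on ball 0 1" "f \<circ> gs holomorphic_on ball 0 1"
  using fg gs fs gsf by (auto intro!: holomorphic_on_compose_gen)
 have z1: "(fs \<circ> g) 0 = 0" "(f \<circ> gs) 0 = 0" using x fg(3) by (auto simp: fs_def gs_def)
 have n1: "norm ((fs \<circ> g) w) < 1" "norm ((f \<circ> gs) w) < 1" if "norm w < 1" for w using that fg(4,5) fsg gsf by auto
 have le: "norm ((fs \<circ> g) w) \<le> norm w" "norm ((f \<circ> gs) w) \<le> norm w" if "norm w < 1" for w
  using Schwarz_Lemma(1)[OF h1(1) z1(1) n1(1) that] Schwarz_Lemma(1)[OF h1(2) z1(2) n1(2) that] by auto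
 \<comment> \<open>Any nonzero point of the disk serves. The maps \<open>fs \<circ> g\<close> and
   \<open>f \<circ> gs\<close> do not increase the modulus, and the second undoes the first, so the
   Schwarz lemma holds with equality.\<close>
 define w0 :: complex where "w0 = 1 / 2"
 have w0: "norm w0 < 1" "w0 \<noteq> 0" by (auto simp: w0_def)
 have "(f \<circ> gs) ((fs \<circ> g) w0) = w0" using fg(5)[of w0] fsg[of "g w0"] w0 by simp
 hence "norm w0 \<le> norm ((fs \<circ> g) w0)" using le(2)[OF n1(1)[OF w0(1)]] by simp
 hence "norm ((fs \<circ> g) w0) = norm w0" using le(1)[OF w0(1)] by simp
 then obtain \<alpha> where \<alpha>: "\<And>z. norm z < 1 \<Longrightarrow> (fs \<circ> g) z = \<alpha> * z" "norm \<alpha> = 1"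
  using Schwarz_Lemma(3)[OF h1(1) z1(1) n1(1) w0(1)] w0 by blast
 have fs_eq: "fs z = \<alpha> * f z" if "z \<in> S" for z using \<alpha>(1)[of "f z"] fg(4)[OF that] by simp
 define \<beta> where "\<beta> = csqrt \<alpha>"
 have \<beta>2: "\<beta> * \<beta> = \<alpha>" unfolding \<beta>_def using power2_csqrt[of \<alpha>] by (simp add: power2_eq_square)
 have n\<beta>: "norm \<beta> = 1"
 proof -
  have "norm \<beta> * norm \<beta> = 1" using \<beta>2 \<alpha>(2) by (metis norm_mult)
  thus ?thesis by (metis abs_norm_cancel power2_eq_1_iff power2_eq_square real_sqrt_abs2 real_sqrt_one)
 qed
 hence c\<beta>: "cnj \<beta> * \<beta> = 1" using complex_norm_square[of \<beta>] by (simp add: mult.commute)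
 show thesis
 proof (rule that[of "\<lambda>z. \<beta> * f z" "\<lambda>w. g (cnj \<beta> * w)"])
  have B: "cnj \<beta> * w \<in> ball 0 1" if "w \<in> ball 0 1" for w using that n\<beta> by (simp add: norm_mult)
  show "continuous_on S (\<lambda>z. \<beta> * f z)" by (intro continuous_intros holomorphic_on_imp_continuous_on fg)
  show "continuous_on (ball 0 1) (\<lambda>w. g (cnj \<beta> * w))"
   by (rule continuous_on_compose2[OF holomorphic_on_imp_continuous_on[OF fg(2)]])
     (use B in \<open>auto intro!: continuous_intros\<close>)
  show "\<beta> * f z \<in> ball 0 1 \<and> g (cnj \<beta> * (\<beta> * f z)) = z" if "z \<in> S" for z
   using fg(4)[OF that] c\<beta> n\<beta> by (simp add: norm_mult flip: mult.assoc)
  show "g (cnj \<beta> * w) \<in> S \<and> \<beta> * f (g (cnj \<beta> * w)) = w" if "w \<in> ball 0 1" for w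
  proof -
   have "\<beta> * (cnj \<beta> * w) = w" using c\<beta> by (metis mult.assoc mult.commute mult_1)
   thus ?thesis using fg(5)[OF B[OF that]] by simp
  qed
  show "\<beta> * f (cnj z) = cnj (\<beta> * f z)" if "z \<in> S" for z
  proof -
   have "cnj (f z) = \<alpha> * f (cnj z)" using fs_eq[OF sym[OF that]] by (simp add: fs_def)
   hence "cnj (\<beta> * f z) = (cnj \<beta> * \<beta>) * \<beta> * f (cnj z)" by (simp flip: \<beta>2)
   thus ?thesis using c\<beta> by simp
  qed
 qed
qed

lemma contractible_via:
 assumes "continuous_on ({0..1::real} \<times> U) H" "H ` ({0..1} \<times> U) \<subseteq> U"
  and "\<And>p. p \<in> U \<Longrightarrow> H (1, p) = p" "\<And>p. p \<in> U \<Longrightarrow> H (0, p) = (a::'a::topological_space)"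
 shows "contractible U"
proof -
 have "homotopic_with_canon (\<lambda>x. True) U U id (\<lambda>x. a)"
 proof (subst homotopic_with, simp, intro exI[of _ "\<lambda>(t, p). H (1 - t, p)"] conjI ballI)
  show "continuous_map (prod_topology (top_of_set {0..1}) (top_of_set U)) (top_of_set U) (\<lambda>(t, p). H (1 - t, p))"
  proof -
   have "continuous_on ({0..1} \<times> U) (\<lambda>q. H (1 - fst q, snd q))"
    by (rule continuous_on_compose2[OF assms(1)]) (auto intro!: continuous_intros)
   moreover have "H (1 - t, p) \<in> U" if "t \<in> {0..1}" "p \<in> U" for t p
    using assms(2) that by (auto simp: image_subset_iff)
   ultimately show ?thesis by (auto simp: prod_topology_subtopology_eu case_prod_unfold)
  qed
 qed (use assms in auto)
 thus ?thesis unfolding contractible_def by blast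
qed

lemma contractible_open_homeomorphic_disc:
 assumes "contractible U" "open U" "U \<noteq> {}" "bounded (U :: complex set)"
 shows "U homeomorphic (ball 0 1 :: complex set)"
proof -
 have "U \<noteq> UNIV" using assms(4) not_bounded_UNIV by blast
 moreover obtain x where "x \<in> U" using assms by blast
 ultimately obtain f g where fg: "f holomorphic_on U" "g holomorphic_on ball 0 1" "f x = 0"
  "\<And>z. z \<in> U \<Longrightarrow> f z \<in> ball 0 1 \<and> g (f z) = z" "\<And>w. w \<in> ball 0 1 \<Longrightarrow> g w \<in> U \<and> f (g w) = w"
  using normalized_riemann_map[OF assms(2) contractible_imp_simply_connected[OF assms(1)]] by blast
 have "homeomorphism U (ball 0 1) f g"
 proof (rule homeomorphismI)
  show "continuous_on U f" "continuous_on (ball 0 1) g"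
   using fg(1,2) by (auto intro: holomorphic_on_imp_continuous_on)
 qed (use fg(4,5) in auto)
 thus ?thesis by (auto simp: homeomorphic_def)
qed

text \<open>By \<open>H_real\<close> the contraction can be reflected, so the double
  \<open>D\<close> is simply connected. A Riemann map commuting with conjugation matches real points
  with real points. Hence its inverse takes the upper half of the disk to one side of the real axis,
  and the sign \<open>s\<close> exchanges the sides if necessary.\<close>

lemma contractible_homeomorphic_half_disc:
 assumes U: "openin (top_of_set half_plane) U" "bounded U" "x0 \<in> U" "Im x0 = 0"
  and H: "continuous_on ({0..1::real} \<times> U) H" "H ` ({0..1} \<times> U) \<subseteq> U"
  "\<And>p. p \<in> U \<Longrightarrow> H (1, p) = p" "\<And>p. p \<in> U \<Longrightarrow> H (0, p) = x0"
  and H_real: "\<And>s p. s \<in> {0..1} \<Longrightarrow> p \<in> U \<Longrightarrow> Im p = 0 \<Longrightarrow> Im (H (s, p)) = 0"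
 shows "U homeomorphic (ball 0 1 \<inter> half_plane)"
proof -
 obtain W where W: "open W" "U = half_plane \<inter> W" using U(1) by (auto simp: openin_open)
 have U_iff: "z \<in> U \<longleftrightarrow> 0 \<le> Im z \<and> z \<in> W" for z using W by (auto simp: half_plane_def)
 define D where "D = U \<union> cnj ` U"
 have cnj_im: "z \<in> cnj ` A \<longleftrightarrow> cnj z \<in> A" for z A by (metis complex_cnj_cnj image_iff)
 have D_iff: "z \<in> D \<longleftrightarrow> z \<in> U \<or> cnj z \<in> U" for z by (simp add: D_def cnj_im)
 have D_pos: "z \<in> U" if "z \<in> D" "0 \<le> Im z" for z
 proof (cases "z \<in> U")
  case False
  hence c: "cnj z \<in> U" using that by (simp add: D_iff)
  hence "Im z = 0" using that by (simp add: U_iff)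
  hence "cnj z = z" by (simp add: complex_eq_iff)
  thus ?thesis using c by simp
 qed
 have "open D"
 proof -
  \<comment> \<open>Three open pieces: the upper part, its mirror image, and a symmetric set that
    covers the real points.\<close>
  have "D = (W \<inter> {z. Im z > 0}) \<union> cnj -` (W \<inter> {z. Im z > 0}) \<union> (W \<inter> cnj -` W)"
  proof (intro set_eqI iffI)
   fix z assume z: "z \<in> D"
   show "z \<in> (W \<inter> {z. Im z > 0}) \<union> cnj -` (W \<inter> {z. Im z > 0}) \<union> (W \<inter> cnj -` W)"
   proof (cases "Im z = 0")
    case True
    hence "cnj z = z" by (simp add: complex_eq_iff)
    thus ?thesis using z by (auto simp: D_iff U_iff)
   qed (use z in \<open>auto simp: D_iff U_iff\<close>)
  qed (auto simp: D_iff U_iff)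
  moreover have "open (W \<inter> {z. Im z > 0})" using W(1) open_halfspace_Im_gt by blast
  moreover have "open (cnj -` A)" if "open A" for A
   using that by (intro open_vimage) (auto intro: continuous_intros)
  ultimately show ?thesis using W(1) by (metis open_Int open_Un)
 qed
 \<comment> \<open>The reflected contraction. The two formulas agree over the real axis, where the
   values are real by \<open>H_real\<close>.\<close>
 define HD where "HD = (\<lambda>q. if 0 \<le> Im (snd q) then H q else cnj (H (fst q, cnj (snd q))))"
 have "continuous_on ({0..1::real} \<times> D) HD"
 proof -
  have eq: "{0..1::real} \<times> D = ({0..1} \<times> U) \<union> ({0..1} \<times> cnj ` U)" by (auto simp: D_def)
  have im: "Im z \<ge> 0" if "z \<in> U" for z using that by (simp add: U_iff)
  have UA: "U = D \<inter> {z. 0 \<le> Im z}"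
  proof
   show "U \<subseteq> D \<inter> {z. 0 \<le> Im z}" using im by (auto simp: D_iff)
   show "D \<inter> {z. 0 \<le> Im z} \<subseteq> U" using D_pos by blast
  qed
  have UB: "cnj ` U = D \<inter> {z. Im z \<le> 0}"
  proof (rule set_eqI)
   fix z
   have "cnj z \<in> D \<longleftrightarrow> z \<in> D" by (auto simp: D_iff)
   moreover have "cnj z \<in> U \<longleftrightarrow> cnj z \<in> D \<and> 0 \<le> Im (cnj z)" using UA by auto
   ultimately show "z \<in> cnj ` U \<longleftrightarrow> z \<in> D \<inter> {z. Im z \<le> 0}" by (simp add: cnj_im)
  qed
  have prod: "T \<times> (D \<inter> {z. P z}) = (T \<times> D) \<inter> {q. P (snd q)}" for T :: "real set" and P by auto
  have A: "{0..1::real} \<times> U = ({0..1} \<times> D) \<inter> {q. 0 \<le> Im (snd q)}"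
   by (rule prod[of "{0..1}" "\<lambda>z. 0 \<le> Im z", folded UA])
  have B: "{0..1::real} \<times> cnj ` U = ({0..1} \<times> D) \<inter> {q. Im (snd q) \<le> 0}"
   by (rule prod[of "{0..1}" "\<lambda>z. Im z \<le> 0", folded UB])
  have clA: "closedin (top_of_set ({0..1::real} \<times> D)) ({0..1} \<times> U)"
   unfolding A by (intro closedin_closed_Int closed_Collect_le continuous_intros)
  have clB: "closedin (top_of_set ({0..1::real} \<times> D)) ({0..1} \<times> cnj ` U)"
   unfolding B by (intro closedin_closed_Int closed_Collect_le continuous_intros)
  have cB: "continuous_on ({0..1::real} \<times> cnj ` U) (\<lambda>q. cnj (H (fst q, cnj (snd q))))"
   by (intro continuous_on_cnj continuous_on_compose2[OF H(1)] continuous_intros) (auto simp: cnj_im)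
  show ?thesis unfolding HD_def eq
  proof (rule continuous_on_cases_local)
   fix q :: "real \<times> complex" assume "q \<in> {0..1} \<times> U \<and> \<not> 0 \<le> Im (snd q) \<or> q \<in> {0..1} \<times> cnj ` U \<and> 0 \<le> Im (snd q)"
   hence q: "fst q \<in> {0..1}" "cnj (snd q) \<in> U" "Im (snd q) = 0" using im by (auto simp: cnj_im) fastforce+
   hence c: "cnj (snd q) = snd q" by (simp add: complex_eq_iff)
   hence "Im (H q) = 0" using H_real[of "fst q" "snd q"] q by simp
   hence "cnj (H q) = H q" by (simp add: complex_eq_iff)
   thus "H q = cnj (H (fst q, cnj (snd q)))" using c by simp
  qed (use clA clB H(1) cB eq in auto)
 qed
 moreover have "HD ` ({0..1::real} \<times> D) \<subseteq> D"
 proof (rule image_subsetI)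
  fix q :: "real \<times> complex" assume q: "q \<in> {0..1} \<times> D"
  show "HD q \<in> D"
  proof (cases "0 \<le> Im (snd q)")
   case True
   hence "snd q \<in> U" using D_pos q by auto
   hence "q \<in> {0..1} \<times> U" using q by (auto simp: mem_Times_iff)
   hence "H q \<in> U" using H(2) by blast
   thus ?thesis using True by (simp add: HD_def D_def)
  next
   case False
   hence "cnj (snd q) \<in> U" using q by (auto simp: D_iff U_iff)
   hence "H (fst q, cnj (snd q)) \<in> U" using H(2) q by (auto simp: image_subset_iff)
   thus ?thesis using False by (simp add: HD_def D_iff)
  qed
 qed
 moreover have "HD (1, p) = p" "HD (0, p) = x0" if "p \<in> D" for p
 proof -
  have x0: "cnj x0 = x0" using U(4) by (simp add: complex_eq_iff)
  have "HD (1, p) = p \<and> HD (0, p) = x0"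
  proof (cases "p \<in> U")
   case True
   thus ?thesis using H(3,4) by (simp add: HD_def U_iff)
  next
   case False
   hence "cnj p \<in> U" using that by (simp add: D_iff)
   moreover have "\<not> 0 \<le> Im p"
   proof
    assume "0 \<le> Im p"
    hence "Im p = 0" using calculation by (simp add: U_iff)
    hence "cnj p = p" by (simp add: complex_eq_iff)
    thus False using calculation False by simp
   qed
   ultimately show ?thesis using H(3,4) x0 by (simp add: HD_def)
  qed
  thus "HD (1, p) = p" "HD (0, p) = x0" by auto
 qed
 ultimately have "contractible D" by (rule contractible_via)
 hence sc: "simply_connected D" by (rule contractible_imp_simply_connected)
 have "bounded (cnj ` U)" using U(2) by (simp add: bounded_iff)
 hence "bounded D" using U(2) by (simp add: D_def)
 hence DU: "D \<noteq> UNIV" using not_bounded_UNIV by blast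
 have xD: "x0 \<in> D" using U(3) by (simp add: D_def)
 have symD: "cnj z \<in> D" if "z \<in> D" for z using that by (auto simp: D_iff)
 obtain f g where fg: "continuous_on D f" "continuous_on (ball 0 1) g"
  "\<And>z. z \<in> D \<Longrightarrow> f z \<in> ball 0 1 \<and> g (f z) = z" "\<And>w. w \<in> ball 0 1 \<Longrightarrow> g w \<in> D \<and> f (g w) = w"
  "\<And>z. z \<in> D \<Longrightarrow> f (cnj z) = cnj (f z)" using symmetric_riemann_map[OF \<open>open D\<close> sc DU xD U(4) symD] by blast
 have g_cnj: "g (cnj w) = cnj (g w)" if "w \<in> ball 0 1" for w
 proof -
  have "f (cnj (g w)) = cnj w" using fg(4,5) that by simp
  thus ?thesis using fg(3)[OF symD[OF conjunct1[OF fg(4)[OF that]]]] by simp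
 qed
 have g_real: "Im w = 0" if "w \<in> ball 0 1" "Im (g w) = 0" for w
 proof -
  have "cnj (g w) = g w" using that(2) by (simp add: complex_eq_iff)
  hence "f (g (cnj w)) = f (g w)" using g_cnj[OF that(1)] by simp
  hence "cnj w = w" using fg(4)[of w] fg(4)[of "cnj w"] that(1) by simp
  thus ?thesis by (simp add: complex_eq_iff)
 qed
 have real_g: "Im (g w) = 0" if "w \<in> ball 0 1" "Im w = 0" for w
 proof -
  have "cnj w = w" using that(2) by (simp add: complex_eq_iff)
  hence "cnj (g w) = g w" using g_cnj[OF that(1)] by simp
  thus ?thesis by (simp add: complex_eq_iff)
 qed
 define P where "P = ball 0 1 \<inter> {w. Im w > 0}"
 have "convex P" unfolding P_def by (intro convex_Int convex_ball convex_halfspace_Im_gt)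
 hence "connected P" by (rule convex_connected)
 moreover have "continuous_on P (\<lambda>w. Im (g w))"
  by (intro continuous_intros continuous_on_subset[OF fg(2)]) (auto simp: P_def)
 ultimately have "connected ((\<lambda>w. Im (g w)) ` P)" by (intro connected_continuous_image)
 hence conn: "connected (Im ` g ` P)" by (simp add: image_image)
 have "0 \<notin> Im ` g ` P" using g_real by (auto simp: P_def)
 hence dich: "(\<forall>w\<in>P. Im (g w) > 0) \<or> (\<forall>w\<in>P. Im (g w) < 0)"
 proof -
  { fix w w' assume "w \<in> P" "w' \<in> P" "Im (g w) \<le> 0" "Im (g w') \<ge> 0"
   hence "0 \<in> Im ` g ` P" using connectedD_interval[OF conn, of "Im (g w)" "Im (g w')" 0] by blast }
  thus ?thesis using \<open>0 \<notin> Im ` g ` P\<close> by (meson not_le less_imp_le)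
 qed
 define s :: real where "s = (if \<forall>w\<in>P. Im (g w) > 0 then 1 else -1)"
 have s: "s = 1 \<or> s = -1" by (simp add: s_def)
 have pos: "Im (g (s *\<^sub>R w)) > 0" if "w \<in> ball 0 1" "Im w > 0" for w
 proof (cases "\<forall>w\<in>P. Im (g w) > 0")
  case True thus ?thesis using that by (auto simp: s_def P_def)
 next
  case False
  hence neg: "\<forall>w\<in>P. Im (g w) < 0" using dich by blast
  have "- cnj w \<in> P" using that by (auto simp: P_def)
  hence "Im (g (- cnj w)) < 0" using neg by blast
  moreover have "g (- w) = cnj (g (- cnj w))" using g_cnj[of "- cnj w"] that by simp
  moreover have "s = -1" using False unfolding s_def by (rule if_not_P)
  ultimately show ?thesis by simp
 qed
 have neg: "Im (g (s *\<^sub>R w)) < 0" if "w \<in> ball 0 1" "Im w < 0" for w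
 proof -
  have "g (s *\<^sub>R w) = cnj (g (s *\<^sub>R cnj w))" using g_cnj[of "s *\<^sub>R cnj w"] that s by auto
  thus ?thesis using pos[of "cnj w"] that by simp
 qed
 have sb: "s *\<^sub>R w \<in> ball 0 1" if "w \<in> ball 0 1" for w :: complex using that s by auto
 have ss: "s *\<^sub>R s *\<^sub>R w = w" for w :: complex using s by auto
 have "homeomorphism U (ball 0 1 \<inter> half_plane) (\<lambda>z. s *\<^sub>R f z) (\<lambda>w. g (s *\<^sub>R w))"
 proof (rule homeomorphismI)
  have UD: "U \<subseteq> D" by (simp add: D_def)
  show "continuous_on U (\<lambda>z. s *\<^sub>R f z)" by (intro continuous_intros continuous_on_subset[OF fg(1) UD])
  show "continuous_on (ball 0 1 \<inter> half_plane) (\<lambda>w. g (s *\<^sub>R w))"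
   by (rule continuous_on_compose2[OF fg(2)]) (use sb in \<open>auto intro!: continuous_intros\<close>)
  show "(\<lambda>z. s *\<^sub>R f z) ` U \<subseteq> ball 0 1 \<inter> half_plane"
  proof (rule image_subsetI)
   fix z assume z: "z \<in> U"
   have b: "s *\<^sub>R f z \<in> ball 0 1" using sb fg(3) z UD by blast
   have "g (s *\<^sub>R s *\<^sub>R f z) = z" unfolding ss using fg(3) z UD by blast
   moreover have "0 \<le> Im z" using z by (simp add: U_iff)
   ultimately have "\<not> Im (s *\<^sub>R f z) < 0" using neg[OF b] by force
   thus "s *\<^sub>R f z \<in> ball 0 1 \<inter> half_plane" using b by (simp add: half_plane_def)
  qed
  show "(\<lambda>w. g (s *\<^sub>R w)) ` (ball 0 1 \<inter> half_plane) \<subseteq> U"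
  proof (rule image_subsetI)
   fix w :: complex assume w: "w \<in> ball 0 1 \<inter> half_plane"
   have "Im (g (s *\<^sub>R w)) \<ge> 0"
    using pos[of w] real_g[of "s *\<^sub>R w"] sb[of w] w by (cases "Im w = 0") (auto simp: half_plane_def)
   moreover have "g (s *\<^sub>R w) \<in> D" using fg(4) sb w by blast
   ultimately show "g (s *\<^sub>R w) \<in> U" by (intro D_pos)
  qed
  show "g (s *\<^sub>R s *\<^sub>R f z) = z" if "z \<in> U" for z unfolding ss using fg(3) that UD by blast
  show "s *\<^sub>R f (g (s *\<^sub>R w)) = w" if "w \<in> ball 0 1 \<inter> half_plane" for w using fg(4)[OF sb[of w]] that ss by simp
 qed
 thus ?thesis by (auto simp: homeomorphic_def)
qed

context level_flow
begin

text \<open>The boundary of the half-plane is invariant, by invariance of domain.\<close>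

lemma half_plane_interior_image:
 fixes \<phi> :: "complex \<Rightarrow> complex"
 assumes "open N" "continuous_on N \<phi>" "inj_on \<phi> N" "\<phi> ` N \<subseteq> V" "z \<in> N"
 shows "Im (\<phi> z) > 0"
proof (rule ccontr)
 assume "\<not> Im (\<phi> z) > 0"
 have "open (\<phi> ` N)" by (rule invariance_of_domain[OF assms(2,1,3)])
 then obtain e where e: "e > 0" "ball (\<phi> z) e \<subseteq> \<phi> ` N" using assms(5) open_contains_ball by blast
 define w where "w = \<phi> z - Complex 0 (e / 2)"
 have "dist (\<phi> z) w = cmod (Complex 0 (e / 2))" by (simp add: w_def dist_norm)
 also have "\<dots> = e / 2" using e(1) by (simp add: cmod_def)
 finally have "w \<in> ball (\<phi> z) e" using e(1) by simp
 hence "w \<in> V" using e(2) assms(4) by blast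
 hence "Im w \<ge> 0" using V_subset by (auto simp: half_plane_def)
 thus False using \<open>\<not> Im (\<phi> z) > 0\<close> e(1) by (simp add: w_def)
qed

lemma orbit_interior:
 assumes z: "z \<in> V" "c \<in> I z" "Im z > 0"
 shows "Im (\<Psi> c z) > 0"
proof -
 \<comment> \<open>Raising every level by the same amount is injective near \<open>z\<close>, unlike
   flowing to the fixed level \<open>c\<close>, so invariance of domain applies.\<close>
 define d where "d = c - f z"
 define N where "N = {y \<in> V. Im y > 0 \<and> f y + d \<in> I y}"
 have N: "y \<in> V" "f y + d \<in> I y" if "y \<in> N" for y using that by (auto simp: N_def)
 have fV: "continuous_on V f" using continuous_on_subset[OF continuous_f V_subset] .
 have "openin (top_of_set V) (V \<inter> (\<lambda>y. (f y + d, y)) -` dom)"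
  by (rule continuous_openin_preimage[OF _ _ open_levels]) (auto intro!: continuous_intros fV)
 then obtain T where T: "open T" "V \<inter> (\<lambda>y. (f y + d, y)) -` dom = V \<inter> T" by (auto simp: openin_open)
 have "N = T \<inter> (ball x0 R - {x0}) \<inter> {y. Im y > 0}"
 proof -
  have "N = V \<inter> T \<inter> {y. Im y > 0}" unfolding T(2)[symmetric] by (auto simp: N_def)
  also have "\<dots> = T \<inter> (ball x0 R - {x0}) \<inter> {y. Im y > 0}" by (auto simp: V_def half_plane_def)
  finally show ?thesis .
 qed
 hence oN: "open N" using T(1) by (auto intro!: open_Int open_Diff open_halfspace_Im_gt)
 have "Im (\<Psi> (f z + d) z) > 0"
 proof (rule half_plane_interior_image[OF oN, where \<phi> = "\<lambda>y. \<Psi> (f y + d) y"])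
  show "continuous_on N (\<lambda>y. \<Psi> (f y + d) y)"
   by (intro continuous_on_\<Psi> continuous_intros continuous_on_subset[OF fV]) (auto simp: N_def)
  show "inj_on (\<lambda>y. \<Psi> (f y + d) y) N"
  proof (rule inj_onI)
   fix y y' assume y: "y \<in> N" "y' \<in> N" "\<Psi> (f y + d) y = \<Psi> (f y' + d) y'"
   note e = \<Psi>_eqD[OF N(1)[OF y(1)] N(2)[OF y(1)] N(1)[OF y(2)] N(2)[OF y(2)] y(3)]
   have "f y = f y'" using e(1) by simp
   thus "y = y'" using e(3)[of "f y"] level_mem[OF N(1)[OF y(1)]] \<Psi>_self N(1) y by metis
  qed
  show "(\<lambda>y. \<Psi> (f y + d) y) ` N \<subseteq> V" using \<Psi>_mem N by blast
  show "z \<in> N" using z by (simp add: N_def d_def)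
 qed
 thus ?thesis by (simp add: d_def)
qed

lemma orbit_real:
 assumes "z \<in> V" "c \<in> I z" "Im z = 0"
 shows "Im (\<Psi> c z) = 0"
proof (rule ccontr)
 assume "Im (\<Psi> c z) \<noteq> 0"
 moreover have "\<Psi> c z \<in> V" using \<Psi>_mem assms by blast
 ultimately have "Im (\<Psi> c z) > 0" using V_subset by (auto simp: half_plane_def)
 hence "Im (\<Psi> (f z) (\<Psi> c z)) > 0" by (rule orbit_interior[OF \<open>\<Psi> c z \<in> V\<close> \<Psi>_sym(2)[OF assms(1,2)]])
 thus False unfolding \<Psi>_sym(1)[OF assms(1,2)] using assms(3) by simp
qed

end

section \<open>Intersections of the sectors, and the contraction of their union\<close>

context sectored_arcs
begin

text \<open>The inside of a hyperbolic chart is open in the plane, so by invariance of domain its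
  image avoids the boundary line. The open arc lies on the same orbits, and orbits do not change
  between the line and the open half-plane.\<close>

lemma F2_not_real:
 assumes "g \<in> F2" "0 < t" "t < 1"
 shows "Im (g t) > 0"
proof -
 note g = crossing_arcD[OF F2_crossing[OF assms(1)]]
 define N where "N = {z. - \<epsilon> < Re z} \<inter> {z. Re z < \<epsilon>} \<inter> {z. 0 < Im z} \<inter> {z. Im z < 1}"
 have oN: "open N" unfolding N_def
  by (intro open_Int open_halfspace_Re_lt open_halfspace_Re_gt open_halfspace_Im_lt open_halfspace_Im_gt)
 have NR: "N \<subseteq> rectangle - {0}" by (auto simp: N_def rectangle_def)
 have "Im (hyperbolic_map g (\<beta> g) (Complex 0 t)) > 0"
 proof (rule half_plane_interior_image[OF oN, where \<phi> = "hyperbolic_map g (\<beta> g)"])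
  show "continuous_on N (hyperbolic_map g (\<beta> g))"
   using continuous_on_subset[OF continuous_hyperbolic_map[OF g]] NR by blast
  show "inj_on (hyperbolic_map g (\<beta> g)) N" using inj_on_subset[OF inj_hyperbolic_map[OF g]] NR by blast
  show "hyperbolic_map g (\<beta> g) ` N \<subseteq> V" using hyperbolic_map_V[OF g] NR by blast
  show "Complex 0 t \<in> N" using assms eps_pos by (simp add: N_def)
 qed
 moreover have "hyperbolic_map g (\<beta> g) (Complex 0 t) = \<Psi> 0 (g t)"
  using assms by (simp add: hyperbolic_map_def complex_eq_iff)
 moreover have "g t \<in> V" "0 \<in> I (g t)" using hyp_V[OF g(1-4)] hyp_levels[OF g(1-4)] assms eps_pos by auto
 ultimately show ?thesis using orbit_real[of "g t" 0] V_subset by (force simp: half_plane_def)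
qed

text \<open>This serves the half-disk case: on the boundary line the contraction then moves points
  along their own orbits, which stay on that line.\<close>

lemma U_real:
 assumes "p \<in> U" "Im p = 0"
 shows "p \<in> insert x0 (Ws \<union> Wu)"
proof (rule ccontr)
 assume n: "p \<notin> insert x0 (Ws \<union> Wu)"
 hence p: "p \<in> V" "\<bar>f p\<bar> < \<epsilon>" "- \<epsilon> \<in> I p" "\<Psi> (- \<epsilon>) p \<in> entry" using assms(1) by (auto simp: U_def)
 show False
 proof (rule entry_cases[OF p(4)])
  assume C: "\<Psi> (- \<epsilon>) p \<in> C"
  have fI: "f p \<in> I (\<Psi> (- \<epsilon>) p)" "\<Psi> (f p) (\<Psi> (- \<epsilon>) p) = p" using \<Psi>_sym[OF p(1,3)] by auto
  hence "f p < 0" using Ws_levels_neg C by (auto simp: C_def)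
  hence "p \<in> Ws" using C_orbit[OF C, of "f p"] fI p(2) by simp
  thus False using n by simp
 next
  fix g assume g: "g \<in> F2" "\<Psi> (- \<epsilon>) p \<in> g ` {0<..<1}"
  hence "Im (\<Psi> (- \<epsilon>) p) > 0" using F2_not_real[OF g(1)] by auto
  thus False using orbit_real[OF p(1,3) assms(2)] by simp
 qed
qed

text \<open>A sector is determined by its base points: \<open>X\<close> and \<open>Y\<close> for the separatrices, \<open>Z\<close> for the orbits
 passing by.\<close>

definition sector_set :: "complex set \<Rightarrow> complex set \<Rightarrow> complex set \<Rightarrow> complex set" where
 "sector_set X Y Z = {p \<in> Ws. - \<epsilon> < f p \<and> \<Psi> (- \<epsilon>) p \<in> X} \<union> {p \<in> Wu. f p < \<epsilon> \<and> \<Psi> \<epsilon> p \<in> Y} \<union>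
   {p \<in> V. \<bar>f p\<bar> < \<epsilon> \<and> - \<epsilon> \<in> I p \<and> \<Psi> (- \<epsilon>) p \<in> Z}"

lemma Ws_Wu_disjoint: "p \<in> Ws \<Longrightarrow> p \<notin> Wu" using Ws_neg Wu_pos by force

text \<open>\<open>Ws\<close>, \<open>Wu\<close> and the orbits through \<open>G\<close> are
  pairwise disjoint, so the three parts intersect separately.\<close>

lemma sector_set_Int:
 assumes "Z \<subseteq> G" "Z' \<subseteq> G" "Z \<inter> Z' = {}"
 shows "sector_set X Y Z \<inter> sector_set X' Y' Z' = sector_set (X \<inter> X') (Y \<inter> Y') {}"
proof (rule set_eqI)
 fix p
 have G: "p \<notin> Ws \<and> p \<notin> Wu" if "p \<in> V" "- \<epsilon> \<in> I p" "\<Psi> (- \<epsilon>) p \<in> G" using crossing_not_Ws_Wu[OF that] by blast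
 consider "p \<in> Ws" "p \<notin> Wu" | "p \<notin> Ws" "p \<in> Wu" | "p \<notin> Ws" "p \<notin> Wu" using Ws_Wu_disjoint by blast
 thus "p \<in> sector_set X Y Z \<inter> sector_set X' Y' Z' \<longleftrightarrow> p \<in> sector_set (X \<inter> X') (Y \<inter> Y') {}"
  by cases (use G assms in \<open>auto simp: sector_set_def\<close>)
qed

lemma sector_set_separatrices:
 assumes "X \<subseteq> C" "Y \<subseteq> C'"
 shows "sector_set X Y {} = \<Union>(separatrix ` X \<union> separatrix' ` Y)"
proof -
 have "p \<in> separatrix q \<longleftrightarrow> p \<in> Ws \<and> - \<epsilon> < f p \<and> \<Psi> (- \<epsilon>) p = q" if "q \<in> X" for p q
  using separatrix_iff assms(1) that by blast
 moreover have "p \<in> separatrix' q \<longleftrightarrow> p \<in> Wu \<and> f p < \<epsilon> \<and> \<Psi> \<epsilon> p = q" if "q \<in> Y" for p q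
  using separatrix'_iff assms(2) that by blast
 ultimately show ?thesis unfolding sector_set_def Union_Un_distrib by auto
qed

lemma parabolic_set_eq: "g \<in> F1 \<Longrightarrow> parabolic_set g = sector_set (g ` {0..1}) {} {}"
 using parabolic_set_iff[OF F1_stable] by (auto simp: sector_set_def)

lemma parabolic_set'_eq: "g \<in> F1' \<Longrightarrow> parabolic_set' g = sector_set {} (g ` {0..1}) {}"
 using parabolic_set'_iff[OF F1'_unstable] by (auto simp: sector_set_def)

lemma hyperbolic_set_eq:
 "g \<in> F2 \<Longrightarrow> hyperbolic_set g (\<beta> g) = sector_set {g 0} {\<beta> g} (g ` {0<..<1})"
 using hyperbolic_set_iff[OF F2_crossing] separatrix_iff[OF F2_D(2)] separatrix'_iff[OF F2_D(4)]
 by (auto simp: sector_set_def)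

text \<open>Distinct arcs of a system meet at most in the two end points of either; for two
  parabolic sectors this is the source of the bound \<open>2\<close>.\<close>

lemma arcs_Int:
 fixes g h :: "real \<Rightarrow> complex"
 assumes "g ` {0<..<1} \<inter> h ` {0..1} = {}"
 shows "finite (g ` {0..1} \<inter> h ` {0..1})" "card (g ` {0..1} \<inter> h ` {0..1}) \<le> 2"
proof -
 have "{0..1::real} = insert 0 (insert 1 {0<..<1})" by auto
 hence "g ` {0..1} = insert (g 0) (insert (g 1) (g ` {0<..<1}))" by (metis image_insert)
 hence sub: "g ` {0..1} \<inter> h ` {0..1} \<subseteq> {g 0, g 1}" using assms by blast
 thus "finite (g ` {0..1} \<inter> h ` {0..1})" using finite_subset by blast
 have "card (g ` {0..1} \<inter> h ` {0..1}) \<le> card {g 0, g 1}" using sub by (intro card_mono) auto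
 also have "\<dots> \<le> 2" by (simp add: card_insert_if)
 finally show "card (g ` {0..1} \<inter> h ` {0..1}) \<le> 2" .
qed

definition meet_in_separatrices :: "complex set \<Rightarrow> complex set \<Rightarrow> bool" where
 "meet_in_separatrices A B \<longleftrightarrow> (\<exists>\<C>. finite \<C> \<and> card \<C> \<le> 2 \<and> \<C> \<subseteq> separatrix ` C \<union> separatrix' ` C' \<and> A \<inter> B = \<Union>\<C>)"

lemma meet_sector_sets:
 assumes "X \<subseteq> C" "Y \<subseteq> C'" "Z \<subseteq> G" "Z' \<subseteq> G" "Z \<inter> Z' = {}"
  and "finite (X \<inter> X')" "finite (Y \<inter> Y')" "card (X \<inter> X') + card (Y \<inter> Y') \<le> 2"
 shows "meet_in_separatrices (sector_set X Y Z) (sector_set X' Y' Z')" unfolding meet_in_separatrices_def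
proof (intro exI conjI)
 let ?C = "separatrix ` (X \<inter> X') \<union> separatrix' ` (Y \<inter> Y')"
 show "finite ?C" using assms by simp
 have "card ?C \<le> card (separatrix ` (X \<inter> X')) + card (separatrix' ` (Y \<inter> Y'))" by (rule card_Un_le)
 also have "\<dots> \<le> card (X \<inter> X') + card (Y \<inter> Y')" using assms by (intro add_mono card_image_le) auto
 finally show "card ?C \<le> 2" using assms by simp
 show "?C \<subseteq> separatrix ` C \<union> separatrix' ` C'" using assms by blast
 show "sector_set X Y Z \<inter> sector_set X' Y' Z' = \<Union>?C"
  unfolding sector_set_Int[OF assms(3-5)] using assms by (intro sector_set_separatrices) auto
qed

lemma meet_sym: "meet_in_separatrices A B \<Longrightarrow> meet_in_separatrices B A"
 unfolding meet_in_separatrices_def by (simp add: Int_commute)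

lemma card_Int_singleton: "card (A \<inter> {x}) \<le> 1" "card ({x} \<inter> A) \<le> 1" "finite ({x} \<inter> A)" "finite (A \<inter> {x})"
 using card_mono[of "{x}" "A \<inter> {x}"] card_mono[of "{x}" "{x} \<inter> A"] by auto

text \<open>Distinct sectors share separatrices only. Two hyperbolic ones have at most one incoming
  and one outgoing separatrix in common; a parabolic sector of stable orbits and one of unstable
  orbits have none.\<close>

lemma sectors_meet:
 assumes "A \<in> sectors" "B \<in> sectors" "A \<noteq> B"
 shows "meet_in_separatrices A B"
proof -
 have open_sub: "g ` {0<..<1} \<subseteq> g ` {0..1}" for g :: "real \<Rightarrow> complex" by (intro image_mono) auto
 have hG: "g ` {0<..<1} \<subseteq> G" if "g \<in> F2" for g
 proof -
  have "g ` {0<..<1} \<subseteq> g ` {0<..1}" by (intro image_mono) auto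
  thus ?thesis using F2_D(3)[OF that] by blast
 qed
 have PP: "meet_in_separatrices (parabolic_set g) (parabolic_set h)" if "g \<in> F1" "h \<in> F1" "g \<noteq> h" for g h
 proof -
  have "g ` {0<..<1} \<inter> h ` {0..1} = {}" using F_disjoint that by (simp add: F1_def)
  thus ?thesis unfolding parabolic_set_eq[OF that(1)] parabolic_set_eq[OF that(2)]
   using arcs_Int[of g h] that by (intro meet_sector_sets) (auto simp: F1_def)
 qed
 have QQ: "meet_in_separatrices (parabolic_set' g) (parabolic_set' h)" if "g \<in> F1'" "h \<in> F1'" "g \<noteq> h" for g h
 proof -
  have "g ` {0<..<1} \<inter> h ` {0..1} = {}" using F'_disjoint that by (simp add: F1'_def)
  thus ?thesis unfolding parabolic_set'_eq[OF that(1)] parabolic_set'_eq[OF that(2)]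
   using arcs_Int[of g h] that by (intro meet_sector_sets) (auto simp: F1'_def)
 qed
 have HH: "meet_in_separatrices (hyperbolic_set g (\<beta> g)) (hyperbolic_set h (\<beta> h))"
  if "g \<in> F2" "h \<in> F2" "g \<noteq> h" for g h
 proof -
  have "g ` {0<..<1} \<inter> h ` {0..1} = {}" using F_disjoint F2_D(1) that by blast
  hence d: "g ` {0<..<1} \<inter> h ` {0<..<1} = {}" using open_sub[of h] by blast
  have "card ({g 0} \<inter> {h 0}) + card ({\<beta> g} \<inter> {\<beta> h}) \<le> 1 + 1" by (intro add_mono card_Int_singleton)
  thus ?thesis unfolding hyperbolic_set_eq[OF that(1)] hyperbolic_set_eq[OF that(2)]
   using F2_D[OF that(1)] hG that d by (intro meet_sector_sets) auto
 qed
 have PH: "meet_in_separatrices (parabolic_set g) (hyperbolic_set h (\<beta> h))" if "g \<in> F1" "h \<in> F2" for g h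
  unfolding parabolic_set_eq[OF that(1)] hyperbolic_set_eq[OF that(2)]
  using hG[OF that(2)] card_Int_singleton[where A = "g ` {0..1}" and x = "h 0"] that(1)
  by (intro meet_sector_sets) (auto simp: F1_def)
 have QH: "meet_in_separatrices (parabolic_set' g) (hyperbolic_set h (\<beta> h))" if "g \<in> F1'" "h \<in> F2" for g h
  unfolding parabolic_set'_eq[OF that(1)] hyperbolic_set_eq[OF that(2)]
  using hG[OF that(2)] card_Int_singleton[where A = "g ` {0..1}" and x = "\<beta> h"] that(1)
  by (intro meet_sector_sets) (auto simp: F1'_def)
 have PQ: "meet_in_separatrices (parabolic_set g) (parabolic_set' h)" if "g \<in> F1" "h \<in> F1'" for g h
  unfolding parabolic_set_eq[OF that(1)] parabolic_set'_eq[OF that(2)]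
  using that(1) by (intro meet_sector_sets) (auto simp: F1_def)
 from assms(1,2) show ?thesis unfolding sectors_def
  apply (elim UnE imageE)
      apply (use assms(3) PP QQ HH PH QH PQ meet_sym in metis)+
  done
qed

lemma meet_subset: "meet_in_separatrices A B \<Longrightarrow> A \<inter> B \<subseteq> Ws \<union> Wu"
 using separatrix_iff separatrix'_iff unfolding meet_in_separatrices_def by (fastforce simp: subset_iff)

text \<open>The closed chart adds to the sector and \<open>x0\<close> only points outside
  \<open>U\<close>. So each sector together with \<open>x0\<close> is closed in \<open>U\<close>,
  which allows the contractions of the sectors to be pasted.\<close>

lemma sector_charts:
 assumes "A \<in> sectors"
 shows "\<exists>D E \<Theta>. sector_chart A D E \<Theta> \<and> U \<inter> \<Theta> ` E \<subseteq> insert x0 A"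
proof -
 have sub: "U \<inter> \<Theta> ` E \<subseteq> insert x0 A" if ch: "sector_chart A D E \<Theta>" and out: "\<And>z. z \<in> E - D \<Longrightarrow> \<Theta> z \<notin> U" for D E \<Theta>
 proof
  fix p assume p: "p \<in> U \<inter> \<Theta> ` E"
  obtain z where z: "z \<in> E" "p = \<Theta> z" "p \<in> U" using p by blast
  hence "z \<in> D" using out by blast
  thus "p \<in> insert x0 A" using ch z(2) unfolding sector_chart_def by (cases "z = 0") auto
 qed
 have outer: "\<bar>f p\<bar> = \<epsilon> \<Longrightarrow> p \<notin> U" for p using f_U by force
 show ?thesis using assms unfolding sectors_def
 proof (elim UnE imageE)
  fix g assume g: "A = parabolic_set g" "g \<in> F1"
  note s = F1_stable[OF g(2)]
  have "parabolic_map g z \<notin> U" if z: "z \<in> cone - open_cone" for z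
  proof (rule outer)
   have "cmod z = 1" using z by (auto simp: cone_iff open_cone_iff)
   thus "\<bar>f (parabolic_map g z)\<bar> = \<epsilon>" using f_parabolic_map[of g z] s z eps_pos by (simp add: stable_arc_def)
  qed
  thus ?thesis using parabolic_chart[OF s] sub unfolding g(1) by blast
 next
  fix g assume g: "A = parabolic_set' g" "g \<in> F1'"
  note s = F1'_unstable[OF g(2)]
  have "parabolic_map' g z \<notin> U" if z: "z \<in> cone - open_cone" for z
  proof (rule outer)
   have "cmod z = 1" using z by (auto simp: cone_iff open_cone_iff)
   moreover have "- f (parabolic_map' g z) = - \<epsilon> * cmod z"
    using sectored_flow.f_parabolic_map[OF sectored_reversed, unfolded reversed_parabolic_map reversed_C, of g z]
     s z by (simp add: unstable_arc_def)
   ultimately show "\<bar>f (parabolic_map' g z)\<bar> = \<epsilon>" using eps_pos by simp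
  qed
  thus ?thesis using parabolic_chart'[OF s] sub unfolding g(1) by blast
 next
  fix g assume g: "A = hyperbolic_set g (\<beta> g)" "g \<in> F2"
  note cr = F2_crossing[OF g(2)]
  note h = crossing_arcD[OF cr]
  have g1: "g 1 \<in> G" using h(4) by auto
  \<comment> \<open>The far end of a crossing arc lies in \<open>G\<close>, hence not in
    \<open>C\<close>, and the interior of another arc of the system is disjoint from this
    one.\<close>
  have g1_entry: "g 1 \<notin> entry"
  proof
   assume "g 1 \<in> entry"
   thus False
   proof (rule entry_cases)
    assume "g 1 \<in> C" thus False using g1 C_G_disjoint by blast
   next
    fix k assume k: "k \<in> F2" "g 1 \<in> k ` {0<..<1}"
    have "g 1 \<in> g ` {0..1}" by auto
    hence "k = g" using F_disjoint[of k g] F2_D(1) k g(2) by blast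
    then obtain t where "0 < t" "t < 1" "g 1 = g t" using k(2) by auto
    thus False using inj_onD[OF h(2), of 1 t] by auto
   qed
  qed
  have "hyperbolic_map g (\<beta> g) z \<notin> U" if z: "z \<in> rectangle - open_rectangle" for z
  proof (cases "\<bar>Re z\<bar> = \<epsilon>")
   case True
   thus ?thesis using outer f_hyperbolic_map[OF h] z by simp
  next
   case False
   hence z1: "- \<epsilon> \<le> Re z" "Re z \<le> \<epsilon>" "Im z = 1" using z eps_pos by (auto simp: rectangle_def open_rectangle_def)
   let ?p = "hyperbolic_map g (\<beta> g) z"
   have p: "?p = \<Psi> (Re z) (g 1)" using z1 by (auto simp: hyperbolic_map_def)
   have V: "g 1 \<in> V" "Re z \<in> I (g 1)" using hyp_V[OF h(1-4)] hyp_levels[OF h(1-4)] z1 by auto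
   have e: "- \<epsilon> \<in> I ?p" "\<Psi> (- \<epsilon>) ?p = g 1" "?p \<in> V"
    unfolding p using \<Psi>_sym[OF V] f_G[OF g1] \<Psi>_mem[OF V] by simp_all
   hence "?p \<notin> Wu" using Wu_levels_pos'[of ?p "- \<epsilon>"] eps_pos by auto
   thus ?thesis using e g1_entry x0_notin_V by (auto simp: U_def)
  qed
  thus ?thesis using hyperbolic_chart[OF cr] sub unfolding g(1) by blast
 qed
qed

text \<open>In each chart multiply by \<open>s\<close>. On a separatrix this gives
  \<open>\<Psi> (s * f p) p\<close> whatever the chart, so the contractions agree where sectors
  meet, and finitely many closed pieces paste to a continuous map.\<close>

lemma U_contraction:
 obtains H where "continuous_on ({0..1::real} \<times> U) H" "H ` ({0..1} \<times> U) \<subseteq> U"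
  "\<And>p. p \<in> U \<Longrightarrow> H (1, p) = p" "\<And>p. p \<in> U \<Longrightarrow> H (0, p) = x0" "\<And>s. s \<in> {0..1} \<Longrightarrow> H (s, x0) = x0"
  "\<And>s p. s \<in> {0<..1} \<Longrightarrow> p \<in> U \<Longrightarrow> p \<in> Ws \<union> Wu \<Longrightarrow> H (s, p) = \<Psi> (s * f p) p \<and> s * f p \<in> I p"
proof -
 have "\<forall>A\<in>sectors. \<exists>D E \<Theta>. sector_chart A D E \<Theta> \<and> U \<inter> \<Theta> ` E \<subseteq> insert x0 A" using sector_charts by blast
 then obtain D E \<Theta> where DE: "\<forall>A\<in>sectors. sector_chart A (D A) (E A) (\<Theta> A) \<and> U \<inter> \<Theta> A ` E A \<subseteq> insert x0 A"
  unfolding bchoice_iff by blast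
 define \<Lambda> where "\<Lambda> A = inv_into (E A) (\<Theta> A)" for A
 define h where "h A q = \<Theta> A (fst q *\<^sub>R \<Lambda> A (snd q))" for A and q :: "real \<times> complex"
 \<comment> \<open>Without sectors \<open>U\<close> would be the single point \<open>x0\<close>,
   which is not open in the half-plane.\<close>
 obtain A0 where A0: "A0 \<in> sectors"
 proof -
  have "sectors \<noteq> {}"
  proof
   assume "sectors = {}"
   hence "openin (top_of_set half_plane) {x0}" using U_open unfolding U_eq by simp
   then obtain e where e: "e > 0" "ball x0 e \<inter> half_plane \<subseteq> {x0}" unfolding openin_contains_ball by blast
   have "x0 + \<i> * of_real (e / 2) \<in> ball x0 e \<inter> half_plane"
    using e(1) x0_half_plane by (simp add: dist_norm norm_mult half_plane_def)
   thus False using e by auto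
  qed
  thus thesis using that by blast
 qed
 have chart: "compact (E A)" "D A \<subseteq> E A" "continuous_on (E A) (\<Theta> A)" "inj_on (\<Theta> A) (E A)"
   "0 \<in> D A" "\<Theta> A 0 = x0" "A = \<Theta> A ` (D A - {0})" "A \<subseteq> V"
   "\<And>z s. z \<in> D A \<Longrightarrow> s \<in> {0..1} \<Longrightarrow> s *\<^sub>R z \<in> D A"
   "\<And>z s. z \<in> D A \<Longrightarrow> s \<in> {0<..1} \<Longrightarrow> \<Theta> A z \<in> Ws \<union> Wu \<Longrightarrow>
    \<Theta> A (s *\<^sub>R z) = \<Psi> (s * f (\<Theta> A z)) (\<Theta> A z) \<and> s * f (\<Theta> A z) \<in> I (\<Theta> A z)"
   "U \<inter> \<Theta> A ` E A \<subseteq> insert x0 A" if "A \<in> sectors" for A using bspec[OF DE that] unfolding sector_chart_def by blast+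
 have im: "\<Theta> A ` D A = insert x0 A" if A: "A \<in> sectors" for A
 proof -
  have "D A = insert 0 (D A - {0})" using chart(5)[OF A] by blast
  hence "\<Theta> A ` D A = insert (\<Theta> A 0) (\<Theta> A ` (D A - {0}))" by (metis image_insert)
  thus ?thesis using chart(6,7)[OF A] by simp
 qed
 have AU: "insert x0 A \<subseteq> U" if "A \<in> sectors" for A using that U_eq by blast
 have closed_piece: "insert x0 A = U \<inter> \<Theta> A ` E A" if A: "A \<in> sectors" for A
  using chart(11)[OF A] im[OF A] chart(2)[OF A] AU[OF A] by blast
 have \<Lambda>: "\<Lambda> A p \<in> D A" "\<Theta> A (\<Lambda> A p) = p" if A: "A \<in> sectors" and p: "p \<in> insert x0 A" for A p
 proof -
  obtain z where z: "z \<in> D A" "p = \<Theta> A z" using im[OF A] p by blast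
  hence "\<Lambda> A p = z" unfolding \<Lambda>_def using chart(2,4)[OF A] by (simp add: inv_into_f_f subset_iff)
  thus "\<Lambda> A p \<in> D A" "\<Theta> A (\<Lambda> A p) = p" using z by auto
 qed
 have \<Lambda>x0: "\<Lambda> A x0 = 0" if A: "A \<in> sectors" for A
  unfolding \<Lambda>_def using chart(2,4,5,6)[OF A] by (metis inv_into_f_f subsetD)
 have h_x0: "h A (s, x0) = x0" if "A \<in> sectors" for A s using that \<Lambda>x0[of A] chart(6)[of A] by (simp add: h_def)
 have h_W: "h A (s, p) = (if s = 0 then x0 else \<Psi> (s * f p) p)" "s \<noteq> 0 \<Longrightarrow> s * f p \<in> I p"
  if A: "A \<in> sectors" and p: "p \<in> A" "p \<in> Ws \<union> Wu" and s: "s \<in> {0..1}" for A s p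
 proof -
  have L: "\<Lambda> A p \<in> D A" "\<Theta> A (\<Lambda> A p) = p" using \<Lambda>[OF A] p by auto
  have *: "h A (s, p) = \<Theta> A (s *\<^sub>R \<Lambda> A p)" by (simp add: h_def)
  have **: "s \<in> {0<..1}" if "s \<noteq> 0" using s that by auto
  show "h A (s, p) = (if s = 0 then x0 else \<Psi> (s * f p) p)"
   using * chart(10)[OF A L(1) **] L(2) p(2) chart(6)[OF A] by (cases "s = 0") auto
  show "s * f p \<in> I p" if "s \<noteq> 0" using chart(10)[OF A L(1) **[OF that]] L(2) p(2) by simp
 qed
 have h_U: "h A (s, p) \<in> U" if A: "A \<in> sectors" and "p \<in> insert x0 A" "s \<in> {0..1}" for A s p
 proof -
  have "s *\<^sub>R \<Lambda> A p \<in> D A" using chart(9)[OF A \<Lambda>(1)[OF A that(2)] that(3)] .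
  hence "\<Theta> A (s *\<^sub>R \<Lambda> A p) \<in> insert x0 A" using im[OF A] by blast
  thus ?thesis using AU[OF A] by (auto simp: h_def)
 qed
 define X where "X = top_of_set ({0..1::real} \<times> U)"
 define T where "T A = {0..1::real} \<times> insert x0 A" for A
 have TU: "T A \<subseteq> {0..1} \<times> U" if "A \<in> sectors" for A using that AU by (auto simp: T_def)
 have fin: "finite sectors" using finite_F by (simp add: sectors_def)
 obtain H where H: "continuous_map X (top_of_set U) H"
  "\<And>q A. \<lbrakk>A \<in> sectors; q \<in> topspace X \<inter> T A\<rbrakk> \<Longrightarrow> H q = h A q"
 proof (rule pasting_lemma_exists_closed[OF fin, of X T "top_of_set U" h])
  show "topspace X \<subseteq> \<Union>(T ` sectors)"
  proof
   fix q assume q: "q \<in> topspace X"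
   hence "fst q \<in> {0..1}" "snd q \<in> insert x0 (\<Union>sectors)" using U_eq by (auto simp: X_def)
   thus "q \<in> \<Union>(T ` sectors)" using A0 by (cases q) (auto simp: T_def)
  qed
  show "closedin X (T A)" if "A \<in> sectors" for A
  proof -
   note A = that
   have "T A = ({0..1} \<times> U) \<inter> ({0..1} \<times> \<Theta> A ` E A)" unfolding T_def closed_piece[OF A] by auto
   moreover have "closed (\<Theta> A ` E A)" using chart(1,3)[OF A] by (intro compact_imp_closed compact_continuous_image)
   ultimately show ?thesis unfolding X_def
    using closedin_closed_Int[OF closed_Times[OF closed_atLeastAtMost, of "\<Theta> A ` E A" 0 1]] by metis
  qed
  show "continuous_map (subtopology X (T A)) (top_of_set U) (h A)" if "A \<in> sectors" for A
  proof -
   have "subtopology X (T A) = top_of_set (T A)"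
    unfolding X_def subtopology_subtopology using TU[OF that] by (simp add: Int_absorb1)
   moreover have "h A ` T A \<subseteq> U" using h_U[OF that] by (auto simp: T_def)
   moreover have "continuous_on (T A) (h A)"
   proof -
    note A = that
    have eq: "h A = (\<lambda>q. \<Theta> A (fst q *\<^sub>R \<Lambda> A (snd q)))" by (auto simp: h_def)
    have "continuous_on (\<Theta> A ` E A) (\<Lambda> A)"
     by (rule continuous_on_inv[OF chart(3)[OF A] chart(1)[OF A]]) (use chart(4)[OF A] in \<open>simp add: \<Lambda>_def\<close>)
    hence c: "continuous_on (insert x0 A) (\<Lambda> A)" using continuous_on_subset closed_piece[OF A] by (metis inf_le2)
    show ?thesis unfolding eq
    proof (rule continuous_on_compose2[OF chart(3)[OF A]])
     show "continuous_on (T A) (\<lambda>q. fst q *\<^sub>R \<Lambda> A (snd q))"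
      by (intro continuous_intros continuous_on_compose2[OF c]) (auto simp: T_def)
     show "(\<lambda>q. fst q *\<^sub>R \<Lambda> A (snd q)) ` T A \<subseteq> E A"
     proof (rule image_subsetI)
      fix q assume "q \<in> T A"
      hence "fst q \<in> {0..1}" "snd q \<in> insert x0 A" by (auto simp: T_def)
      thus "fst q *\<^sub>R \<Lambda> A (snd q) \<in> E A" using chart(9)[OF A \<Lambda>(1)[OF A]] chart(2)[OF A] by blast
     qed
    qed
   qed
   ultimately show ?thesis by auto
  qed
  show "h A q = h B q" if AB: "A \<in> sectors" "B \<in> sectors" "q \<in> topspace X \<inter> T A \<inter> T B" for A B q
  proof (cases "A = B \<or> snd q = x0")
   case True
   thus ?thesis using h_x0[OF AB(1), of "fst q"] h_x0[OF AB(2), of "fst q"] by (cases q) auto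
  next
   case False
   obtain s p where q: "q = (s, p)" by (cases q)
   have p: "p \<in> A" "p \<in> B" "s \<in> {0..1}" using AB(3) False q by (auto simp: T_def)
   note S = AB(1,2)
   have "p \<in> Ws \<union> Wu" using meet_subset[OF sectors_meet[OF S]] False p by blast
   thus ?thesis using h_W(1)[OF S(1) p(1) _ p(3)] h_W(1)[OF S(2) p(2) _ p(3)] q by simp
  qed
 qed blast
 have H_eq: "H (s, p) = h A (s, p)" if "A \<in> sectors" "p \<in> insert x0 A" "s \<in> {0..1}" for A s p
 proof (rule H(2)[OF that(1)])
  have "(s, p) \<in> T A" using that by (simp add: T_def)
  thus "(s, p) \<in> topspace X \<inter> T A" using TU[OF that(1)] by (auto simp: X_def)
 qed
 have piece: "\<exists>A\<in>sectors. p \<in> A" if "p \<in> U" "p \<noteq> x0" for p using that U_eq by blast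
 show thesis
 proof (rule that[of H])
  show "continuous_on ({0..1} \<times> U) H" "H ` ({0..1} \<times> U) \<subseteq> U" using H(1) by (auto simp: X_def)
  show 3: "H (s, x0) = x0" if "s \<in> {0..1}" for s using H_eq[OF A0, of x0 s] h_x0[OF A0] that by simp
  show "H (1, p) = p" if p: "p \<in> U" for p
  proof (cases "p = x0")
   case False
   then obtain A where A: "A \<in> sectors" "p \<in> A" using piece p by blast
   hence "H (1, p) = h A (1, p)" using H_eq by simp
   also have "\<dots> = p" using \<Lambda>(2)[OF A(1)] A(2) by (simp add: h_def)
   finally show ?thesis .
  qed (use 3 in simp)
  show "H (0, p) = x0" if p: "p \<in> U" for p
  proof (cases "p = x0")
   case False
   then obtain A where A: "A \<in> sectors" "p \<in> A" using piece p by blast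
   hence "H (0, p) = h A (0, p)" using H_eq by simp
   also have "\<dots> = x0" using chart(6)[OF A(1)] by (simp add: h_def)
   finally show ?thesis .
  qed (use 3 in simp)
  show "H (s, p) = \<Psi> (s * f p) p \<and> s * f p \<in> I p" if s: "s \<in> {0<..1}" and p: "p \<in> U" "p \<in> Ws \<union> Wu" for s p
  proof -
   have "p \<noteq> x0" using p(2) Ws_V Wu_V x0_notin_V by blast
   then obtain A where A: "A \<in> sectors" "p \<in> A" using piece p by blast
   have s': "s \<in> {0..1}" "s \<noteq> 0" using s by auto
   have "H (s, p) = h A (s, p)" using H_eq A s' by simp
   thus ?thesis using h_W[OF A p(2) s'(1)] s'(2) by simp
  qed
 qed
qed

lemma U_disc:
 "U homeomorphic (if Im x0 = 0 then ball 0 1 \<inter> half_plane else ball 0 1)"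
 if inner: "Im x0 \<noteq> 0 \<Longrightarrow> ball x0 R \<subseteq> {z. Im z > 0}"
proof -
 obtain H where H: "continuous_on ({0..1::real} \<times> U) H" "H ` ({0..1} \<times> U) \<subseteq> U"
  "\<And>p. p \<in> U \<Longrightarrow> H (1, p) = p" "\<And>p. p \<in> U \<Longrightarrow> H (0, p) = x0" "\<And>s. s \<in> {0..1} \<Longrightarrow> H (s, x0) = x0"
  "\<And>s p. s \<in> {0<..1} \<Longrightarrow> p \<in> U \<Longrightarrow> p \<in> Ws \<union> Wu \<Longrightarrow> H (s, p) = \<Psi> (s * f p) p \<and> s * f p \<in> I p" using U_contraction by metis
 have bd: "bounded U" using bounded_subset[OF bounded_ball] U_subset by blast
 show ?thesis
 proof (cases "Im x0 = 0")
  case True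
  have "U homeomorphic (ball 0 1 \<inter> half_plane)"
  proof (rule contractible_homeomorphic_half_disc[OF U_open bd x0_U True H(1-4)])
   fix s p assume s: "s \<in> {0..1::real}" and p: "p \<in> U" "Im p = 0"
   show "Im (H (s, p)) = 0"
   proof (cases "p = x0 \<or> s = 0")
    case True
    hence "H (s, p) = x0" using H(4,5) s p by auto
    thus ?thesis using \<open>Im x0 = 0\<close> by simp
   next
    case False
    hence W: "p \<in> Ws \<union> Wu" using U_real[OF p] by blast
    hence "p \<in> V" using Ws_V Wu_V by blast
    moreover have "s \<in> {0<..1}" using s False by auto
    ultimately show ?thesis using H(6)[OF _ p(1) W] orbit_real p(2) by metis
   qed
  qed
  thus ?thesis using True by simp
 next
  case False
  have "contractible U" by (rule contractible_via[OF H(1-4)])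
  moreover have "open U"
  proof -
   obtain W where W: "open W" "U = half_plane \<inter> W" using U_open by (auto simp: openin_open)
   have "U = W \<inter> ball x0 R"
   proof
    show "W \<inter> ball x0 R \<subseteq> U" using inner[OF False] W(2) by (force simp: half_plane_def)
   qed (use U_subset W(2) in blast)
   thus ?thesis using open_Int[OF W(1) open_ball, of x0 R] by simp
  qed
  ultimately have "U homeomorphic (ball 0 1 :: complex set)"
   using contractible_open_homeomorphic_disc x0_U bd by blast
  thus ?thesis using False by simp
 qed
qed

end

section \<open>The Lyapunov function of a gradient flow\<close>

lemma flow_mem: "flow S v \<Longrightarrow> p \<in> topspace S \<Longrightarrow> v t p \<in> topspace S"
 unfolding flow_def continuous_map_def by (auto simp: Pi_iff)

lemma flow_continuous_orbit:
 assumes "flow S v" "p \<in> topspace S"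
 shows "continuous_map euclideanreal S (\<lambda>t. v t p)"
proof -
 have "continuous_map euclideanreal (prod_topology euclideanreal S) (\<lambda>t. (t, p))"
  using assms(2) by (intro continuous_map_pairedI) (auto simp: continuous_map_const)
 hence "continuous_map euclideanreal S ((\<lambda>(t, p). v t p) \<circ> (\<lambda>t. (t, p)))"
  using assms(1) unfolding flow_def by (blast intro: continuous_map_compose)
 thus ?thesis by (simp add: o_def)
qed

lemma flow_add: "flow S v \<Longrightarrow> p \<in> topspace S \<Longrightarrow> v (s + t) p = v s (v t p)"
 and flow_0: "flow S v \<Longrightarrow> p \<in> topspace S \<Longrightarrow> v 0 p = p" by (simp_all add: flow_def)

text \<open>For large \<open>n\<close> the time \<open>t / n\<close> is short enough to fix
  \<open>p\<close>, and the group law multiplies this up to \<open>t\<close>.\<close>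

lemma flow_locally_fixed:
 assumes fl: "flow S v" and p: "p \<in> topspace S" and e: "e > 0" "\<And>s. \<bar>s\<bar> < e \<Longrightarrow> v s p = p"
 shows "p \<in> singular_points S v"
proof -
 have "v t p = p" for t
 proof -
  obtain n where n: "\<bar>t\<bar> / e < real n" using reals_Archimedean2 by blast
  hence n0: "n > 0" using e(1) by (cases n) (auto simp: divide_less_0_iff)
  define s where "s = t / real n"
  have "\<bar>s\<bar> < e" using n n0 e(1) by (simp add: s_def field_simps)
  hence vs: "v s p = p" using e(2) by blast
  have "v (real k * s) p = p" for k
  proof (induction k)
   case (Suc k)
   have "v (real (Suc k) * s) p = v s (v (real k * s) p)"
    using flow_add[OF fl p, of s "real k * s"] by (simp add: algebra_simps)
   thus ?case using Suc vs by simp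
  qed (use flow_0[OF fl p] in simp)
  from this[of n] show ?thesis using n0 by (simp add: s_def)
 qed
 thus ?thesis using p by (simp add: singular_points_def)
qed

lemma level_arc_homeomorphic:
 assumes h: "homeomorphic_map S S' h" and p: "p \<in> topspace S" and la: "level_arc S' f (h p)"
 shows "level_arc S (f \<circ> h) p"
proof -
 obtain k where k: "homeomorphic_maps S S' h k" using h homeomorphic_map_maps by blast
 have kc: "continuous_map S' S k" and hc: "continuous_map S S' h"
  and kh: "\<And>x. x \<in> topspace S \<Longrightarrow> k (h x) = x" and hk: "\<And>y. y \<in> topspace S' \<Longrightarrow> h (k y) = y"
  using k by (auto simp: homeomorphic_maps_def)
 obtain \<sigma> J where J: "J = {-1..1::real} \<or> J = {0..1}"
  and \<sigma>: "continuous_map (top_of_set J) S' \<sigma>" "inj_on \<sigma> J" "\<sigma> 0 = h p" "\<forall>s\<in>J. f (\<sigma> s) = f (h p)"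
  and W: "\<forall>e. 0 < e \<and> e \<le> 1 \<longrightarrow> (\<exists>W. openin S' W \<and> {y \<in> W. f y = f (h p)} = \<sigma> ` {s\<in>J. \<bar>s\<bar> < e})"
  using la unfolding level_arc_def by blast
 have \<sigma>S: "\<sigma> s \<in> topspace S'" if "s \<in> J" for s using \<sigma>(1) that by (auto simp: continuous_map_def)
 show ?thesis unfolding level_arc_def
 proof (intro exI[of _ "k \<circ> \<sigma>"] exI[of _ J] conjI allI impI)
  show "J = {-1..1} \<or> J = {0..1}" by (rule J)
  show "continuous_map (top_of_set J) S (k \<circ> \<sigma>)" using \<sigma>(1) kc by (rule continuous_map_compose)
  show "inj_on (k \<circ> \<sigma>) J" by (intro inj_onI) (metis \<sigma>S comp_apply hk inj_onD[OF \<sigma>(2)])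
  show "(k \<circ> \<sigma>) 0 = p" using \<sigma>(3) kh[OF p] by simp
  show "\<forall>s\<in>J. (f \<circ> h) ((k \<circ> \<sigma>) s) = (f \<circ> h) p" using \<sigma>(4) \<sigma>S hk by simp
  fix e :: real assume "0 < e \<and> e \<le> 1"
  then obtain W where W: "openin S' W" "{y \<in> W. f y = f (h p)} = \<sigma> ` {s\<in>J. \<bar>s\<bar> < e}" using W by blast
  have "{x \<in> {x \<in> topspace S. h x \<in> W}. (f \<circ> h) x = (f \<circ> h) p} = {x \<in> topspace S. h x \<in> {y \<in> W. f y = f (h p)}}" by auto
  also have "\<dots> = (k \<circ> \<sigma>) ` {s\<in>J. \<bar>s\<bar> < e}" unfolding W(2)
  proof
   show "{x \<in> topspace S. h x \<in> \<sigma> ` {s\<in>J. \<bar>s\<bar> < e}} \<subseteq> (k \<circ> \<sigma>) ` {s\<in>J. \<bar>s\<bar> < e}" using kh by (force simp: image_iff)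
   show "(k \<circ> \<sigma>) ` {s\<in>J. \<bar>s\<bar> < e} \<subseteq> {x \<in> topspace S. h x \<in> \<sigma> ` {s\<in>J. \<bar>s\<bar> < e}}"
    using kc \<sigma>S hk by (auto simp: continuous_map_def)
  qed
  finally show "\<exists>W. openin S W \<and> {y \<in> W. (f \<circ> h) y = (f \<circ> h) p} = (k \<circ> \<sigma>) ` {s\<in>J. \<bar>s\<bar> < e}"
   using openin_continuous_map_preimage[OF hc W(1)] by blast
 qed
qed

locale generated_gradient_flow =
 fixes S :: "'a topology" and \<A> :: "'a chart set" and g and f :: "'a \<Rightarrow> real" and X w
 assumes atlas: "smooth_atlas S \<A>" and metric: "riemannian_metric \<A> g"
  and gradient: "gradient_vector_field \<A> g f X" and flow: "flow S w" and generates: "generates \<A> X w"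
begin

lemma chart_exists: "p \<in> topspace S \<Longrightarrow> \<exists>c\<in>\<A>. p \<in> fst c" using atlas unfolding smooth_atlas_def by blast

lemma chart_props:
 assumes "c \<in> \<A>"
 shows "openin S (fst c)" "openin (top_of_set half_plane) (snd c ` fst c)"
  "homeomorphic_map (subtopology S (fst c)) (top_of_set (snd c ` fst c)) (snd c)"
  "inj_on (snd c) (fst c)" "fst c \<subseteq> topspace S"
proof -
 have c: "chart S (fst c, snd c)" using atlas assms by (simp add: smooth_atlas_def)
 thus *: "openin S (fst c)" "openin (top_of_set half_plane) (snd c ` fst c)"
  "homeomorphic_map (subtopology S (fst c)) (top_of_set (snd c ` fst c)) (snd c)" unfolding chart_def by auto
 thus "fst c \<subseteq> topspace S" using openin_subset by blast
 thus "inj_on (snd c) (fst c)" using homeomorphic_imp_injective_map[OF *(3)] by (simp add: Int_absorb1)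
qed

lemma metric_pos: "c \<in> \<A> \<Longrightarrow> p \<in> fst c \<Longrightarrow> a \<noteq> 0 \<Longrightarrow> g c p a a > 0"
 and metric_linear: "c \<in> \<A> \<Longrightarrow> p \<in> fst c \<Longrightarrow> linear (g c p a)"
 using metric unfolding riemannian_metric_def bilinear_def by blast+

lemma metric_zero: "c \<in> \<A> \<Longrightarrow> p \<in> fst c \<Longrightarrow> g c p 0 0 = 0" using linear_0[OF metric_linear] by blast

definition G where "G c = f \<circ> inv_into (fst c) (snd c)"

lemma G_chart: "c \<in> \<A> \<Longrightarrow> p \<in> fst c \<Longrightarrow> G c (snd c p) = f p" using chart_props(4) by (simp add: G_def)

lemma G_derivative: "c \<in> \<A> \<Longrightarrow> p \<in> fst c \<Longrightarrow>
 (G c has_derivative g c p (X c p)) (at (snd c p) within snd c ` fst c)"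
 using gradient unfolding gradient_vector_field_def G_def by blast

lemma continuous_f: "continuous_map S euclideanreal f"
proof (rule continuous_map_openin_preimage_eq[THEN iffD2], intro conjI allI impI)
 show "f \<in> topspace S \<rightarrow> topspace euclideanreal" by simp
 fix T :: "real set" assume T: "openin euclideanreal T"
 show "openin S (topspace S \<inter> f -` T)"
 proof (subst openin_subopen, intro ballI)
  fix p assume p: "p \<in> topspace S \<inter> f -` T"
  then obtain c where c: "c \<in> \<A>" "p \<in> fst c" using chart_exists by blast
  have "continuous_on (snd c ` fst c) (G c)" unfolding continuous_on_eq_continuous_within
   using has_derivative_continuous[OF G_derivative[OF c(1)]] by blast
  hence "continuous_map (top_of_set (snd c ` fst c)) euclideanreal (G c)" by simp
  hence "continuous_map (subtopology S (fst c)) euclideanreal (G c \<circ> snd c)"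
   using chart_props(3)[OF c(1)] continuous_map_compose homeomorphic_imp_continuous_map by blast
  hence "openin (subtopology S (fst c)) {x \<in> topspace (subtopology S (fst c)). (G c \<circ> snd c) x \<in> T}"
   using T by (rule openin_continuous_map_preimage)
  moreover have "{x \<in> topspace (subtopology S (fst c)). (G c \<circ> snd c) x \<in> T} = fst c \<inter> f -` T"
   using G_chart[OF c(1)] chart_props(5)[OF c(1)] by auto
  ultimately have "openin S (fst c \<inter> f -` T)" using chart_props(1)[OF c(1)] openin_trans_full by metis
  moreover have "fst c \<inter> f -` T \<subseteq> topspace S \<inter> f -` T" using chart_props(5)[OF c(1)] by blast
  ultimately show "\<exists>T'. openin S T' \<and> p \<in> T' \<and> T' \<subseteq> topspace S \<inter> f -` T" using c p by blast
 qed
qed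

lemma stays_in_chart:
 assumes "c \<in> \<A>" "p \<in> topspace S"
 shows "open {s. w s p \<in> fst c}"
proof -
 have "openin euclideanreal {s \<in> topspace euclideanreal. w s p \<in> fst c}"
  using flow_continuous_orbit[OF flow assms(2)] chart_props(1)[OF assms(1)] by (rule openin_continuous_map_preimage)
 thus ?thesis by simp
qed

lemma coordinate_velocity:
 assumes c: "c \<in> \<A>" and p: "p \<in> topspace S" "w t p \<in> fst c"
 shows "((\<lambda>s. snd c (w s p)) has_vector_derivative X c (w t p)) (at t)"
proof -
 have "((\<lambda>s. snd c (w s (w t p))) has_vector_derivative X c (w t p)) (at 0)"
  using generates c p(2) unfolding generates_def by blast
 hence "((\<lambda>s. snd c (w (s + t) p)) has_vector_derivative X c (w t p)) (at 0)" using flow_add[OF flow p(1)] by simp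
 hence "((\<lambda>s. snd c (w (s + t) p)) \<circ> (\<lambda>s. s - t) has_vector_derivative 1 *\<^sub>R X c (w t p)) (at t)"
  by (intro vector_diff_chain_at) (auto intro!: derivative_eq_intros)
 thus ?thesis by (simp add: o_def)
qed

text \<open>Because \<open>df = g(X, -)\<close>, the derivative of \<open>f\<close> along an orbit
  is the squared length of the field.\<close>

lemma orbit_derivative:
 assumes c: "c \<in> \<A>" and p: "p \<in> topspace S" "w t p \<in> fst c"
 shows "((\<lambda>s. f (w s p)) has_real_derivative g c (w t p) (X c (w t p)) (X c (w t p))) (at t)"
proof -
 define A where "A = {s. w s p \<in> fst c}"
 have A: "open A" "t \<in> A" using stays_in_chart[OF c p(1)] p(2) by (auto simp: A_def)
 let ?X = "X c (w t p)"
 have "((\<lambda>s. snd c (w s p)) has_derivative (\<lambda>s. s *\<^sub>R ?X)) (at t within A)"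
  using coordinate_velocity[OF assms] has_derivative_at_withinI by (auto simp: has_vector_derivative_def)
 \<comment> \<open>At boundary points \<open>G c\<close> has a derivative only within the chart
   image, so the chain rule is applied within the open set \<open>A\<close> of times spent in the
   chart.\<close>
 moreover have "(G c has_derivative g c (w t p) ?X) (at (snd c (w t p)) within (\<lambda>s. snd c (w s p)) ` A)"
  by (rule has_derivative_subset[OF G_derivative[OF c p(2)]]) (auto simp: A_def)
 ultimately have "(G c \<circ> (\<lambda>s. snd c (w s p)) has_derivative g c (w t p) ?X \<circ> (\<lambda>s. s *\<^sub>R ?X)) (at t within A)"
  by (rule diff_chain_within)
 hence "(G c \<circ> (\<lambda>s. snd c (w s p)) has_derivative g c (w t p) ?X \<circ> (\<lambda>s. s *\<^sub>R ?X)) (at t)"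
  using A at_within_open by metis
 moreover have "g c (w t p) ?X \<circ> (\<lambda>s. s *\<^sub>R ?X) = (\<lambda>s. s * g c (w t p) ?X ?X)"
  using linear_cmul[OF metric_linear[OF c p(2)]] by (auto simp: o_def)
 ultimately have "(G c \<circ> (\<lambda>s. snd c (w s p)) has_derivative (\<lambda>s. s * g c (w t p) ?X ?X)) (at t)" by simp
 hence "((\<lambda>s. f (w s p)) has_derivative (\<lambda>s. s * g c (w t p) ?X ?X)) (at t)"
 proof (rule has_derivative_transform_within_open[OF _ A(1,2)])
  show "(G c \<circ> (\<lambda>s. snd c (w s p))) s = f (w s p)" if "s \<in> A" for s using that G_chart[OF c] by (simp add: A_def)
 qed
 moreover have "(\<lambda>s. s * g c (w t p) ?X ?X) = (*) (g c (w t p) ?X ?X)" by (simp add: fun_eq_iff)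
 ultimately show ?thesis by (simp add: has_field_derivative_def)
qed

lemma orbit_derivative_nonneg:
 assumes "p \<in> topspace S"
 shows "\<exists>y. ((\<lambda>s. f (w s p)) has_real_derivative y) (at t) \<and> y \<ge> 0"
proof -
 obtain c where c: "c \<in> \<A>" "w t p \<in> fst c" using chart_exists flow_mem[OF flow assms] by blast
 have "g c (w t p) (X c (w t p)) (X c (w t p)) \<ge> 0"
  using metric_pos[OF c] metric_zero[OF c] by (cases "X c (w t p) = 0") (auto simp: less_imp_le)
 thus ?thesis using orbit_derivative[OF c(1) assms c(2)] by blast
qed

lemma orbit_mono: "p \<in> topspace S \<Longrightarrow> a \<le> b \<Longrightarrow> f (w a p) \<le> f (w b p)"
 by (rule DERIV_nonneg_imp_nondecreasing) (use orbit_derivative_nonneg in auto)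

text \<open>If the field vanishes along the orbit during an interval of times, the coordinates are
  constant there, so the orbit rests and, by the group law, rests forever. A single zero would not
  do: a continuous field need not have unique integral curves, and an orbit may pass through
  it.\<close>

lemma critical_interval_singular:
 assumes p: "p \<in> topspace S" and ab: "a < b"
  and crit: "\<And>t c. a < t \<Longrightarrow> t < b \<Longrightarrow> c \<in> \<A> \<Longrightarrow> w t p \<in> fst c \<Longrightarrow> X c (w t p) = 0"
 shows "p \<in> singular_points S w"
proof -
 define t where "t = (a + b) / 2"
 have t: "a < t" "t < b" using ab by (auto simp: t_def)
 define q where "q = w t p"
 have q: "q \<in> topspace S" unfolding q_def using flow_mem[OF flow p] .
 obtain c where c: "c \<in> \<A>" "q \<in> fst c" using chart_exists q by blast
 have "open ({s. w s p \<in> fst c} \<inter> {a<..<b})" by (intro open_Int stays_in_chart[OF c(1) p] open_greaterThanLessThan)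
 moreover have "t \<in> {s. w s p \<in> fst c} \<inter> {a<..<b}" using t c by (auto simp: q_def)
 ultimately obtain e where e: "e > 0" "ball t e \<subseteq> {s. w s p \<in> fst c} \<inter> {a<..<b}" using open_contains_ball by blast
 have "snd c (w s p) = snd c q" if s: "s \<in> ball t e" for s
 proof -
  have "((\<lambda>s. snd c (w s p)) has_derivative (\<lambda>h. 0)) (at u within ball t e)" if u: "u \<in> ball t e" for u
  proof -
   have uu: "w u p \<in> fst c" "a < u" "u < b" using e(2) u by auto
   have "((\<lambda>s. snd c (w s p)) has_vector_derivative 0) (at u)"
    using coordinate_velocity[OF c(1) p uu(1)] crit[OF uu(2,3) c(1) uu(1)] by simp
   thus ?thesis by (auto simp: has_vector_derivative_def intro: has_derivative_at_withinI)
  qed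
  then obtain k where k: "\<And>u. u \<in> ball t e \<Longrightarrow> snd c (w u p) = k"
   using has_derivative_zero_constant[OF convex_ball, of t e "\<lambda>s. snd c (w s p)"] by blast
  have "t \<in> ball t e" using e(1) by simp
  thus ?thesis using k s by (simp add: q_def)
 qed
 hence const: "w s p = q" if "s \<in> ball t e" for s
  using inj_onD[OF chart_props(4)[OF c(1)], of "w s p" q] that e(2) c(2) by blast
 have fixed: "q \<in> singular_points S w"
 proof (rule flow_locally_fixed[OF flow q e(1)])
  fix s :: real assume "\<bar>s\<bar> < e"
  hence "w (s + t) p = q" by (intro const) (simp add: dist_real_def)
  thus "w s q = q" using flow_add[OF flow p] by (simp add: q_def)
 qed
 have "p = w (- t) q" using flow_add[OF flow p, of "- t" t] flow_0[OF flow p] by (simp add: q_def)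
 also have "\<dots> = q" using fixed by (simp add: singular_points_def)
 finally show ?thesis using fixed by simp
qed

text \<open>The derivative is nonnegative. Failure of strictness would make \<open>f\<close>, and
  with it the squared length of the field, trivial on an interval of times.\<close>

lemma orbit_strict_mono:
 assumes p: "p \<in> topspace S" "p \<notin> singular_points S w"
 shows "strict_mono (\<lambda>t. f (w t p))"
proof (rule strict_monoI, rule ccontr)
 fix a b :: real assume ab: "a < b" "\<not> f (w a p) < f (w b p)"
 have eq: "f (w t p) = f (w a p)" if "t \<in> {a<..<b}" for t
  using orbit_mono[OF p(1), of a t] orbit_mono[OF p(1), of t b] ab that by auto
 have "p \<in> singular_points S w"
 proof (rule critical_interval_singular[OF p(1) ab(1)])
  fix t c assume t: "a < t" "t < b" and c: "c \<in> \<A>" "w t p \<in> fst c"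
  have "((\<lambda>s. f (w s p)) has_real_derivative 0) (at t)"
  proof (rule DERIV_cong_ev[THEN iffD1, OF refl _ refl])
   show "((\<lambda>s. f (w a p)) has_real_derivative 0) (at t)" by simp
   have "\<forall>\<^sub>F s in nhds t. s \<in> {a<..<b}" using t by (intro eventually_nhds_in_open) auto
   thus "\<forall>\<^sub>F s in nhds t. f (w a p) = f (w s p)" by eventually_elim (use eq in simp)
  qed
  hence "g c (w t p) (X c (w t p)) (X c (w t p)) = 0"
   using orbit_derivative[OF c(1) p(1) c(2)] DERIV_unique by blast
  thus "X c (w t p) = 0" using metric_pos[OF c] by force
 qed
 thus False using p by blast
qed

text \<open>Supplies on every nonconstant orbit, after an arbitrarily short time, a point at which
  the inverse function theorem is available.\<close>

lemma noncritical_times: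
 assumes p: "p \<in> topspace S" "p \<notin> singular_points S w" and e: "e > 0"
 shows "\<exists>t c. 0 \<le> t \<and> t < e \<and> c \<in> \<A> \<and> w t p \<in> fst c \<and> X c (w t p) \<noteq> 0"
 using critical_interval_singular[OF p(1) e] p(2) less_imp_le by metis

text \<open>The level set is read off from the local inverse of \<open>(F, L)\<close>. At the boundary the field is tangent, so that
 \<open>L = Im\<close> is possible and the arc can be cut off at the boundary.\<close>

lemma noncritical_level_arc:
 assumes c: "c \<in> \<A>" and q: "q \<in> fst c" "X c q \<noteq> 0"
 shows "level_arc S f q"
proof -
 define \<psi> where "\<psi> = snd c"
 define \<Omega> where "\<Omega> = \<psi> ` fst c"
 define z where "z = \<psi> q"
 let ?X = "X c q"
 have qS: "q \<in> topspace S" using chart_props(5)[OF c] q by blast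
 have z\<Omega>: "z \<in> \<Omega>" using q by (simp add: z_def \<Omega>_def)
 have \<Omega>: "openin (top_of_set half_plane) \<Omega>" using chart_props(2)[OF c] by (simp add: \<Omega>_def \<psi>_def)
 hence \<Omega>H: "\<Omega> \<subseteq> half_plane" using openin_imp_subset by blast
 obtain \<Omega>' where \<Omega>': "open \<Omega>'" "\<Omega> = half_plane \<inter> \<Omega>'" using \<Omega> by (auto simp: openin_open)
 have q0: "w 0 q = q" using flow_0[OF flow qS] .
 have stays: "\<forall>\<^sub>F s in at 0. w s q \<in> fst c"
  using eventually_nhds_in_open[OF stays_in_chart[OF c qS], of 0] q q0 by (simp add: eventually_at_filter eventually_mono)
 have "((\<lambda>s. \<psi> (w s q)) has_vector_derivative ?X) (at 0)"
  using coordinate_velocity[OF c qS, of 0] q q0 by (simp add: \<psi>_def)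
 hence vel: "((\<lambda>s. \<psi> (w s q)) has_derivative (\<lambda>s. s *\<^sub>R ?X)) (at 0)" by (simp add: has_vector_derivative_def)
 \<comment> \<open>At a boundary point the height of the orbit has a minimum at time
   \<open>0\<close>, so the velocity is tangent to the boundary.\<close>
 have X_real: "Im ?X = 0" if "Im z = 0"
 proof -
  have "((\<lambda>s. Im (\<psi> (w s q))) has_derivative (\<lambda>s. s * Im ?X)) (at 0)" using has_derivative_Im[OF vel] by simp
  moreover have "\<forall>\<^sub>F s in at 0. Im (\<psi> (w 0 q)) \<le> Im (\<psi> (w s q))" using stays
  proof eventually_elim
   case (elim s)
   hence "\<psi> (w s q) \<in> half_plane" using \<Omega>H by (auto simp: \<Omega>_def)
   thus ?case using that q0 by (simp add: z_def half_plane_def)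
  qed
  ultimately have "(\<lambda>s. s * Im ?X) = (\<lambda>s. 0)" by (rule has_derivative_local_min)
  from fun_cong[OF this, of 1] show ?thesis by simp
 qed
 \<comment> \<open>The extension to an open set is what makes the inverse function theorem
   applicable at boundary points.\<close>
 obtain W F where W: "open W" "z \<in> W" and F: "Cn_on_open 1 F W" "\<forall>y\<in>\<Omega> \<inter> W. F y = G c y"
 proof -
  have "Cr_on 1 (G c) \<Omega>" using gradient c unfolding gradient_vector_field_def G_def \<Omega>_def \<psi>_def by blast
  hence "\<exists>W F. open W \<and> z \<in> W \<and> (\<forall>n. enat n \<le> 1 \<longrightarrow> Cn_on_open n F W) \<and> (\<forall>y\<in>\<Omega> \<inter> W. F y = G c y)"
   using z\<Omega> unfolding Cr_on_def by blast
  thus thesis using that by (metis enat_1 order_refl)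
 qed
 have fF: "f x = F (\<psi> x)" if "x \<in> fst c" "\<psi> x \<in> W" for x
  using that F(2) G_chart[OF c that(1)] by (simp add: \<Omega>_def \<psi>_def)
 have fq: "f q = F z" using fF[OF q(1)] W(2) by (simp add: z_def)
 define D where "D y = frechet_derivative F (at y)" for y
 have FD: "(F has_derivative D y) (at y)" if "y \<in> W" for y
  using F(1) that unfolding D_def by (simp add: frechet_derivative_works)
 have Dcont: "continuous_on W (\<lambda>y. D y i)" if "i \<in> Basis" for i using F(1) that by (simp add: D_def)
 have Dlin: "D y u = Re u * D y 1 + Im u * D y \<i>" if "y \<in> W" for y u
 proof -
  have l: "linear (D y)" using FD[OF that] has_derivative_linear by blast
  have "u = Re u *\<^sub>R 1 + Im u *\<^sub>R \<i>" by (simp add: complex_eq_iff)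
  hence "D y u = D y (Re u *\<^sub>R 1 + Im u *\<^sub>R \<i>)" by simp
  also have "\<dots> = Re u * D y 1 + Im u * D y \<i>" using linear_add[OF l] linear_cmul[OF l] by simp
  finally show ?thesis .
 qed
 have DX: "D z ?X > 0"
 proof -
  have "(F \<circ> (\<lambda>s. \<psi> (w s q)) has_derivative D z \<circ> (\<lambda>s. s *\<^sub>R ?X)) (at 0)"
   using FD[OF W(2)] q0 by (intro diff_chain_at vel) (simp add: z_def)
  moreover have "\<forall>\<^sub>F s in at 0. (F \<circ> (\<lambda>s. \<psi> (w s q))) s = f (w s q)"
  proof -
   have "((\<lambda>s. \<psi> (w s q)) \<longlongrightarrow> z) (at 0)" using has_derivative_continuous[OF vel] q0 by (simp add: isCont_def z_def)
   hence "\<forall>\<^sub>F s in at 0. \<psi> (w s q) \<in> W" using W by (rule topological_tendstoD)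
   with stays show ?thesis by eventually_elim (use fF in simp)
  qed
  ultimately have "((\<lambda>s. f (w s q)) has_derivative D z \<circ> (\<lambda>s. s *\<^sub>R ?X)) (at 0)"
   by (rule has_derivative_transform_eventually) (use fq q0 in \<open>simp_all add: z_def\<close>)
  moreover have "((\<lambda>s. f (w s q)) has_derivative (*) (g c q ?X ?X)) (at 0)"
   using orbit_derivative[OF c qS, of 0] q q0 by (simp add: has_field_derivative_def)
  ultimately have "D z \<circ> (\<lambda>s. s *\<^sub>R ?X) = (*) (g c q ?X ?X)" by (rule has_derivative_unique)
  from fun_cong[OF this, of 1] have "D z ?X = g c q ?X ?X" by simp
  thus ?thesis using metric_pos[OF c q(1) q(2)] by simp
 qed
 \<comment> \<open>A linear function that is injective on the kernel of \<open>D z\<close>. At a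
   boundary point \<open>?X\<close> is real with \<open>D z ?X > 0\<close>, so \<open>D z 1\<close>
   is nonzero and \<open>L\<close> is the height.\<close>
 define L :: "complex \<Rightarrow> real" where "L = (if D z 1 \<noteq> 0 then Im else Re)"
 have L_Im: "L = Im" if "Im z = 0" using DX Dlin[OF W(2), of ?X] X_real[OF that] by (auto simp: L_def)
 have L: "continuous_on A L" for A by (auto simp: L_def intro: continuous_intros)
 have linL: "linear L" by (auto simp: L_def linear_iff)
 define \<Phi> where "\<Phi> y = Complex (F y) (L y)" for y
 \<comment> \<open>The derivative of \<open>\<Phi>\<close>, written through the partial derivatives
   of \<open>F\<close> so that its continuity in \<open>y\<close> is visible.\<close>
 define T where "T y = D y 1 *\<^sub>R Blinfun (\<lambda>v. complex_of_real (Re v)) + D y \<i> *\<^sub>R Blinfun (\<lambda>v. complex_of_real (Im v))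
   + Blinfun (\<lambda>v. Complex 0 (L v))" for y
 have blin: "bounded_linear h" if "\<And>u v. h (u + v) = h u + h v" "\<And>r u. h (r *\<^sub>R u) = r *\<^sub>R h u" for h :: "complex \<Rightarrow> complex"
  using that by (simp add: linear_iff flip: linear_conv_bounded_linear)
 have T: "blinfun_apply (T y) v = Complex (D y v) (L v)" if "y \<in> W" for y v
 proof -
  have "bounded_linear (\<lambda>v. complex_of_real (Re v))" "bounded_linear (\<lambda>v. complex_of_real (Im v))" "bounded_linear (\<lambda>v. Complex 0 (L v))"
   using linear_add[OF linL] linear_cmul[OF linL] by (intro blin; simp add: complex_eq_iff)+
  thus ?thesis
   using Dlin[OF that, of v] by (simp add: T_def blinfun.add_left blinfun.scaleR_left bounded_linear_Blinfun_apply complex_eq_iff)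
 qed
 \<comment> \<open>At an interior point the neighborhood stays in the open half-plane. At a boundary
   point membership in the half-plane is a condition on the sign of the parameter instead.\<close>
 define U0 where "U0 = \<Omega>' \<inter> W \<inter> (if Im z = 0 then UNIV else {y. Im y > 0})"
 have U0: "open U0" "z \<in> U0" "U0 \<subseteq> W" using \<Omega>' W z\<Omega> open_halfspace_Im_gt[of 0] by (auto simp: U0_def half_plane_def)
 have \<Phi>': "(\<Phi> has_derivative blinfun_apply (T y)) (at y)" if "y \<in> U0" for y
 proof -
  have y: "y \<in> W" using that U0(3) by blast
  have "(L has_derivative L) (at y)" using linL by (simp add: linear_imp_has_derivative)
  hence "((\<lambda>y. complex_of_real (F y) + \<i> * complex_of_real (L y)) has_derivative
    (\<lambda>v. complex_of_real (D y v) + \<i> * complex_of_real (L v))) (at y)" using FD[OF y] by (intro derivative_intros)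
  moreover have "blinfun_apply (T y) = (\<lambda>v. complex_of_real (D y v) + \<i> * complex_of_real (L v))"
   using T[OF y] by (simp add: fun_eq_iff Complex_eq)
  ultimately show ?thesis by (simp add: \<Phi>_def[abs_def] Complex_eq)
 qed
 have "continuous_on U0 T"
  unfolding T_def by (intro continuous_intros continuous_on_subset[OF Dcont U0(3)]) (auto simp: Basis_complex_def)
 moreover have "\<exists>T'. T' o\<^sub>L T z = id_blinfun"
 proof (cases "D z 1 = 0")
  case False
  let ?h = "\<lambda>u. Complex ((Re u - D z \<i> * Im u) / D z 1) (Im u)"
  have "bounded_linear ?h" using False by (intro blin) (simp_all add: complex_eq_iff divide_simps, simp_all add: algebra_simps)
  hence "blinfun_apply (Blinfun ?h o\<^sub>L T z) v = v" for v
   using False Dlin[OF W(2), of v] by (simp add: T[OF W(2)] bounded_linear_Blinfun_apply L_def complex_eq_iff)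
  hence "Blinfun ?h o\<^sub>L T z = id_blinfun" by (intro blinfun_eqI) simp
  thus ?thesis by blast
 next
  case True
  hence Di: "D z \<i> \<noteq> 0" using DX Dlin[OF W(2), of ?X] by auto
  let ?h = "\<lambda>u. Complex (Im u) (Re u / D z \<i>)"
  have "bounded_linear ?h" by (rule blin) (simp_all add: complex_eq_iff add_divide_distrib)
  hence "blinfun_apply (Blinfun ?h o\<^sub>L T z) v = v" for v
   using True Di Dlin[OF W(2), of v] by (simp add: T[OF W(2)] bounded_linear_Blinfun_apply L_def complex_eq_iff)
  hence "Blinfun ?h o\<^sub>L T z = id_blinfun" by (intro blinfun_eqI) simp
  thus ?thesis by blast
 qed
 ultimately obtain U' V \<gamma> where U': "open U'" "U' \<subseteq> U0" "z \<in> U'" "open V" "\<Phi> z \<in> V" "homeomorphism U' V \<Phi> \<gamma>"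
  using inverse_function_theorem[OF U0(1) \<Phi>' _ U0(2)] by metis
 obtain \<beta> where \<beta>: "\<beta> > 0" "cball (\<Phi> z) \<beta> \<subseteq> V" using U'(4,5) open_contains_cball by blast
 define \<sigma> where "\<sigma> s = \<gamma> (Complex (F z) (L z + \<beta> * s))" for s
 \<comment> \<open>At a boundary point \<open>L\<close> is the height, so the level set stops at
   \<open>L = 0\<close> and only one half of the interval remains.\<close>
 define J where "J = (if Im z = 0 then {0..1} else {-1..1::real})"
 have J1: "\<bar>s\<bar> \<le> 1" if "s \<in> J" for s using that by (auto simp: J_def split: if_splits)
 have pV: "Complex (F z) (L z + \<beta> * s) \<in> V" if "s \<in> J" for s
 proof -
  have "\<Phi> z - Complex (F z) (L z + \<beta> * s) = \<i> * of_real (- (\<beta> * s))" by (simp add: \<Phi>_def complex_eq_iff)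
  hence "dist (\<Phi> z) (Complex (F z) (L z + \<beta> * s)) = \<beta> * \<bar>s\<bar>"
   using \<beta>(1) by (simp add: dist_norm norm_mult abs_mult del: of_real_minus)
  also have "\<dots> \<le> \<beta>" using J1[OF that] \<beta>(1) by (simp add: mult_left_le)
  finally show ?thesis using \<beta>(2) by auto
 qed
 have \<sigma>: "\<sigma> s \<in> U'" "F (\<sigma> s) = F z" "L (\<sigma> s) = L z + \<beta> * s" if "s \<in> J" for s
 proof -
  have "\<Phi> (\<sigma> s) = Complex (F z) (L z + \<beta> * s)" "\<sigma> s \<in> U'"
   using U'(6) pV[OF that] by (auto simp: homeomorphism_def \<sigma>_def)
  thus "\<sigma> s \<in> U'" "F (\<sigma> s) = F z" "L (\<sigma> s) = L z + \<beta> * s" by (simp_all add: \<Phi>_def)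
 qed
 have \<sigma>\<Omega>: "\<sigma> s \<in> \<Omega>" if s: "s \<in> J" for s
 proof -
  have "\<sigma> s \<in> U0" using \<sigma>(1)[OF s] U'(2) by blast
  moreover have "0 \<le> Im (\<sigma> s)" if "Im z = 0" using \<sigma>(3)[OF s] L_Im[OF that] s \<beta>(1) that by (simp add: J_def)
  ultimately show ?thesis by (auto simp: U0_def \<Omega>'(2) half_plane_def split: if_splits)
 qed
 obtain k where k: "homeomorphic_maps (subtopology S (fst c)) (top_of_set \<Omega>) \<psi> k"
  using chart_props(3)[OF c] homeomorphic_map_maps unfolding \<Omega>_def \<psi>_def by blast
 have top: "topspace (subtopology S (fst c)) = fst c" using chart_props(5)[OF c] by auto
 have kc: "continuous_map (top_of_set \<Omega>) (subtopology S (fst c)) k"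
  and \<psi>c: "continuous_map (subtopology S (fst c)) (top_of_set \<Omega>) \<psi>"
  and k\<psi>: "\<And>x. x \<in> fst c \<Longrightarrow> k (\<psi> x) = x" and \<psi>k: "\<And>y. y \<in> \<Omega> \<Longrightarrow> \<psi> (k y) = y"
  using k top by (auto simp: homeomorphic_maps_def)
 have kmem: "k y \<in> fst c" if "y \<in> \<Omega>" for y using kc that top by (auto simp: continuous_map_def)
 show ?thesis unfolding level_arc_def
 proof (intro exI[of _ "k \<circ> \<sigma>"] exI[of _ J] conjI allI impI)
  show "J = {-1..1} \<or> J = {0..1}" by (simp add: J_def)
  have "continuous_on J \<sigma>" unfolding \<sigma>_def Complex_eq
   by (rule continuous_on_compose2[of V]) (use U'(6) pV in \<open>auto simp: homeomorphism_def Complex_eq intro!: continuous_intros\<close>)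
  hence "continuous_map (top_of_set J) (top_of_set \<Omega>) \<sigma>" using \<sigma>\<Omega> by auto
  hence "continuous_map (top_of_set J) (subtopology S (fst c)) (k \<circ> \<sigma>)" using kc by (rule continuous_map_compose)
  thus "continuous_map (top_of_set J) S (k \<circ> \<sigma>)" using continuous_map_into_fulltopology by blast
  show "inj_on (k \<circ> \<sigma>) J"
  proof (rule inj_onI)
   fix s s' assume s: "s \<in> J" "s' \<in> J" "(k \<circ> \<sigma>) s = (k \<circ> \<sigma>) s'"
   hence "L (\<sigma> s) = L (\<sigma> s')" using \<psi>k \<sigma>\<Omega> by (metis comp_apply)
   hence "\<beta> * s = \<beta> * s'" using \<sigma>(3)[OF s(1)] \<sigma>(3)[OF s(2)] by linarith
   thus "s = s'" using \<beta>(1) by simp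
  qed
  have "\<sigma> 0 = \<gamma> (\<Phi> z)" by (simp add: \<sigma>_def \<Phi>_def)
  thus "(k \<circ> \<sigma>) 0 = q" using U'(3,6) k\<psi>[OF q(1)] by (simp add: homeomorphism_def z_def)
  have \<sigma>k: "\<psi> (k (\<sigma> s)) = \<sigma> s" "f (k (\<sigma> s)) = f q" if s: "s \<in> J" for s
  proof -
   show 1: "\<psi> (k (\<sigma> s)) = \<sigma> s" using \<psi>k[OF \<sigma>\<Omega>[OF s]] .
   have "\<sigma> s \<in> W" using \<sigma>(1)[OF s] U'(2) U0(3) by auto
   thus "f (k (\<sigma> s)) = f q" using fF[OF kmem[OF \<sigma>\<Omega>[OF s]]] \<sigma>(2)[OF s] fq 1 by simp
  qed
  thus "\<forall>s\<in>J. f ((k \<circ> \<sigma>) s) = f q" by simp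
  fix e :: real assume e: "0 < e \<and> e \<le> 1"
  define box where "box = U' \<inter> {y. \<bar>L y - L z\<bar> < \<beta> * e}"
  have "open box" unfolding box_def using L[of UNIV] by (intro open_Int U' open_Collect_less continuous_intros)
  have "openin (subtopology S (fst c)) {x \<in> topspace (subtopology S (fst c)). \<psi> x \<in> \<Omega> \<inter> box}"
   by (rule openin_continuous_map_preimage[OF \<psi>c openin_open_Int[OF \<open>open box\<close>]])
  hence op: "openin S {x \<in> fst c. \<psi> x \<in> \<Omega> \<inter> box}"
   using chart_props(1)[OF c] openin_trans_full unfolding top by blast
  have "{x \<in> {x \<in> fst c. \<psi> x \<in> \<Omega> \<inter> box}. f x = f q} = (k \<circ> \<sigma>) ` {s\<in>J. \<bar>s\<bar> < e}"
  proof
   show "(k \<circ> \<sigma>) ` {s\<in>J. \<bar>s\<bar> < e} \<subseteq> {x \<in> {x \<in> fst c. \<psi> x \<in> \<Omega> \<inter> box}. f x = f q}"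
   proof (rule image_subsetI)
    fix s assume s: "s \<in> {s\<in>J. \<bar>s\<bar> < e}"
    hence "\<sigma> s \<in> box" using \<sigma>(1,3)[of s] \<beta>(1) by (simp add: box_def abs_mult)
    thus "(k \<circ> \<sigma>) s \<in> {x \<in> {x \<in> fst c. \<psi> x \<in> \<Omega> \<inter> box}. f x = f q}" using s \<sigma>k[of s] kmem \<sigma>\<Omega> by simp
   qed
   show "{x \<in> {x \<in> fst c. \<psi> x \<in> \<Omega> \<inter> box}. f x = f q} \<subseteq> (k \<circ> \<sigma>) ` {s\<in>J. \<bar>s\<bar> < e}"
   proof
    fix x assume x: "x \<in> {x \<in> {x \<in> fst c. \<psi> x \<in> \<Omega> \<inter> box}. f x = f q}"
    define s where "s = (L (\<psi> x) - L z) / \<beta>"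
    have bs: "\<beta> * s = L (\<psi> x) - L z" using \<beta>(1) by (simp add: s_def)
    have yU: "\<psi> x \<in> U'" "\<bar>L (\<psi> x) - L z\<bar> < \<beta> * e" using x by (auto simp: box_def)
    hence "F (\<psi> x) = F z" using fF[of x] x fq U'(2) U0(3) by auto
    hence "\<Phi> (\<psi> x) = Complex (F z) (L z + \<beta> * s)" using bs by (simp add: \<Phi>_def)
    hence "\<psi> x = \<sigma> s" using U'(6) yU(1) unfolding \<sigma>_def homeomorphism_def by metis
    hence "x = (k \<circ> \<sigma>) s" using k\<psi>[of x] x by simp
    moreover have se: "\<bar>s\<bar> < e" using yU(2) \<beta>(1) by (simp add: s_def field_simps)
    moreover have "s \<in> J"
    proof -
     have "s \<ge> 0" if "Im z = 0"
     proof -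
      have "\<psi> x \<in> half_plane" using x \<Omega>H by blast
      thus ?thesis using that \<beta>(1) L_Im[OF that] by (simp add: s_def half_plane_def)
     qed
     thus ?thesis using se e by (auto simp: J_def abs_less_iff)
    qed
    ultimately show "x \<in> (k \<circ> \<sigma>) ` {s\<in>J. \<bar>s\<bar> < e}" by blast
   qed
  qed
  with op show "\<exists>W. openin S W \<and> {y \<in> W. f y = f q} = (k \<circ> \<sigma>) ` {s\<in>J. \<bar>s\<bar> < e}" by blast
 qed
qed

end

text \<open>The function is pulled back along the equivalence. The change of time is an increasing
  bijection of the line fixing \<open>0\<close>, so it preserves strict growth and carries the times
  from \<open>0\<close> to \<open>\<tau> e\<close> back to those from \<open>0\<close> to
  \<open>e\<close>.\<close>

lemma gradient_flow_lyapunov: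
 fixes S :: "'a topology"
 assumes "gradient_flow S v"
 obtains F where "continuous_map S euclideanreal F"
  "\<And>p. p \<in> topspace S \<Longrightarrow> p \<notin> singular_points S v \<Longrightarrow> strict_mono (\<lambda>t. F (v t p))"
  "\<And>p e. p \<in> topspace S \<Longrightarrow> p \<notin> singular_points S v \<Longrightarrow> e > 0 \<Longrightarrow>
    \<exists>t. 0 \<le> t \<and> t < e \<and> level_arc S F (v t p)"
proof -
 obtain S' :: "'a topology" and w \<A> g f X where *: "flow S v" "smooth_atlas S' \<A>" "riemannian_metric \<A> g"
    "gradient_vector_field \<A> g f X" "flow S' w" "generates \<A> X w"
  and eq: "topologically_equivalent S v S' w" using assms unfolding gradient_flow_def by blast
 interpret generated_gradient_flow S' \<A> g f X w by unfold_locales (fact *)+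
 obtain h where "equivalence_on S v (topspace S) S' w (topspace S') h"
  using eq unfolding topologically_equivalent_def by blast
 hence h: "homeomorphic_map S S' h"
  and \<tau>: "\<And>p. p \<in> topspace S \<Longrightarrow> \<exists>\<tau>::real \<Rightarrow> real.
    strict_mono_on (time_interval v (topspace S) p) \<tau> \<and>
    \<tau> ` time_interval v (topspace S) p = time_interval w (topspace S') (h p) \<and> \<tau> 0 = 0 \<and>
    (\<forall>t\<in>time_interval v (topspace S) p. h (v t p) = w (\<tau> t) (h p))" unfolding equivalence_on_def by auto
 have hS: "h p \<in> topspace S'" if "p \<in> topspace S" for p
  using h that by (metis homeomorphic_imp_surjective_map imageI)
 have h_inj: "inj_on h (topspace S)" using h homeomorphic_imp_injective_map by blast
 have ti: "time_interval v (topspace S) p = UNIV" if "p \<in> topspace S" for p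
  using flow_mem[OF *(1) that] by (simp add: time_interval_def)
 have ti': "time_interval w (topspace S') p = UNIV" if "p \<in> topspace S'" for p
  using flow_mem[OF *(5) that] by (simp add: time_interval_def)
 have \<tau>': "\<exists>\<tau>::real \<Rightarrow> real. strict_mono \<tau> \<and> surj \<tau> \<and> \<tau> 0 = 0 \<and> (\<forall>t. h (v t p) = w (\<tau> t) (h p))"
  if "p \<in> topspace S" for p using \<tau>[OF that] unfolding ti[OF that] ti'[OF hS[OF that]] by simp
 have nonsing: "h p \<notin> singular_points S' w" if p: "p \<in> topspace S" "p \<notin> singular_points S v" for p
 proof
  assume s: "h p \<in> singular_points S' w"
  obtain \<tau> where "\<forall>t. h (v t p) = w (\<tau> t) (h p)" using \<tau>'[OF p(1)] by blast
  hence "h (v t p) = h p" for t using s by (simp add: singular_points_def)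
  hence "v t p = p" for t using inj_onD[OF h_inj] flow_mem[OF *(1) p(1)] p(1) by blast
  thus False using p by (simp add: singular_points_def)
 qed
 show thesis
 proof (rule that[of "f \<circ> h"])
  show "continuous_map S euclideanreal (f \<circ> h)"
   using continuous_map_compose[OF homeomorphic_imp_continuous_map[OF h] continuous_f] .
  fix p assume p: "p \<in> topspace S" "p \<notin> singular_points S v"
  obtain \<tau> where t: "strict_mono \<tau>" "surj \<tau>" "\<tau> 0 = 0" "\<And>t. h (v t p) = w (\<tau> t) (h p)" using \<tau>'[OF p(1)] by blast
  have "strict_mono (\<lambda>t. f (w t (h p)))" using orbit_strict_mono[OF hS[OF p(1)] nonsing[OF p]] .
  hence "strict_mono ((\<lambda>t. f (w t (h p))) \<circ> \<tau>)" using t(1) by (rule strict_mono_o)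
  thus "strict_mono (\<lambda>t. (f \<circ> h) (v t p))" using t(4) by (simp add: o_def)
  fix e :: real assume e: "e > 0"
  have te: "\<tau> e > 0" using t(1,3) e by (metis strict_monoD)
  obtain s c where s: "0 \<le> s" "s < \<tau> e" "c \<in> \<A>" "w s (h p) \<in> fst c" "X c (w s (h p)) \<noteq> 0"
   using noncritical_times[OF hS[OF p(1)] nonsing[OF p] te] by blast
  obtain t' where t': "s = \<tau> t'" using t(2) by (metis surjD)
  have "0 \<le> t'" using s(1) t(1,3) t' by (metis strict_mono_less_eq)
  moreover have "t' < e" using s(2) t(1) t' by (simp add: strict_mono_less)
  moreover have "level_arc S (f \<circ> h) (v t' p)"
  proof (rule level_arc_homeomorphic[OF h flow_mem[OF *(1) p(1)]])
   show "level_arc S' f (h (v t' p))" using noncritical_level_arc[OF s(3-5)] t(4) t' by simp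
  qed
  ultimately show "\<exists>t. 0 \<le> t \<and> t < e \<and> level_arc S (f \<circ> h) (v t p)" by blast
 qed
qed

section \<open>The flow in a chart\<close>

lemma level_arc_shift: "level_arc T (\<lambda>p. f p - a) p \<longleftrightarrow> level_arc T f p" by (simp add: level_arc_def)

locale local_flow =
 fixes S :: "'a topology" and v :: "real \<Rightarrow> 'a \<Rightarrow> 'a" and F :: "'a \<Rightarrow> real"
  and N :: "'a set" and k :: "complex \<Rightarrow> 'a" and \<phi> :: "'a \<Rightarrow> complex" and x0 :: complex and R :: real
 assumes flow: "flow S v" and Hausdorff: "Hausdorff_space S"
  and continuous_F: "continuous_map S euclideanreal F"
  and F_strict: "\<And>p. p \<in> topspace S \<Longrightarrow> p \<notin> singular_points S v \<Longrightarrow> strict_mono (\<lambda>t. F (v t p))"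
  and F_arcs: "\<And>p e. p \<in> topspace S \<Longrightarrow> p \<notin> singular_points S v \<Longrightarrow> e > 0 \<Longrightarrow>
    \<exists>t. 0 \<le> t \<and> t < e \<and> level_arc S F (v t p)"
  and x0: "x0 \<in> half_plane" and R: "R > 0" and N: "openin S N"
  and chart: "homeomorphic_maps (top_of_set (ball x0 R \<inter> half_plane)) (subtopology S N) k \<phi>"
  and isolated: "N \<inter> singular_points S v = {k x0}"
begin

definition "B = ball x0 R \<inter> half_plane"
definition "V0 = ball x0 R \<inter> half_plane - {x0}"
definition "M = k ` V0"
definition "Fx p = F p - F (k x0)"

lemma N_top: "N \<subseteq> topspace S" "topspace (subtopology S N) = N" using openin_subset[OF N] by auto

lemma x0_B: "x0 \<in> B" using x0 R by (simp add: B_def)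

lemma chart_props:
 shows "continuous_map (top_of_set B) (subtopology S N) k" "continuous_map (subtopology S N) (top_of_set B) \<phi>"
  "\<And>z. z \<in> B \<Longrightarrow> \<phi> (k z) = z" "\<And>p. p \<in> N \<Longrightarrow> k (\<phi> p) = p" "\<And>z. z \<in> B \<Longrightarrow> k z \<in> N" "\<And>p. p \<in> N \<Longrightarrow> \<phi> p \<in> B"
proof -
 show k: "continuous_map (top_of_set B) (subtopology S N) k"
  and \<phi>: "continuous_map (subtopology S N) (top_of_set B) \<phi>" using chart by (auto simp: homeomorphic_maps_def B_def)
 show "\<And>z. z \<in> B \<Longrightarrow> \<phi> (k z) = z" "\<And>p. p \<in> N \<Longrightarrow> k (\<phi> p) = p"
  using chart N_top by (auto simp: homeomorphic_maps_def B_def)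
 show "\<And>z. z \<in> B \<Longrightarrow> k z \<in> N" using k N_top by (auto simp: continuous_map_def)
 show "\<And>p. p \<in> N \<Longrightarrow> \<phi> p \<in> B" using \<phi> N_top by (auto simp: continuous_map_def)
qed

lemma V0_B: "V0 = B - {x0}" by (simp add: V0_def B_def)

lemma M_eq: "M = N - {k x0}"
proof
 show "M \<subseteq> N - {k x0}"
 proof
  fix p assume "p \<in> M"
  then obtain z where z: "z \<in> B" "z \<noteq> x0" "p = k z" by (auto simp: M_def V0_B)
  hence "k z \<noteq> k x0" using chart_props(3)[OF z(1)] chart_props(3)[OF x0_B] by metis
  thus "p \<in> N - {k x0}" using z chart_props(5) by simp
 qed
 show "N - {k x0} \<subseteq> M"
 proof
  fix p assume p: "p \<in> N - {k x0}"
  hence "\<phi> p \<noteq> x0" using chart_props(4)[of p] by auto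
  hence "\<phi> p \<in> V0" using p chart_props(6)[of p] by (simp add: V0_B)
  thus "p \<in> M" using p chart_props(4)[of p] unfolding M_def by (metis DiffD1 image_eqI)
 qed
qed

lemma k_homeomorphic:
 assumes "A \<subseteq> B"
 shows "homeomorphic_map (top_of_set A) (subtopology S (k ` A)) k"
proof -
 have h: "homeomorphic_map (top_of_set B) (subtopology S N) k"
  using chart unfolding B_def homeomorphic_maps_map by blast
 have "homeomorphic_map (subtopology (top_of_set B) A) (subtopology (subtopology S N) (k ` A)) k"
 proof (rule homeomorphic_map_subtopologies_alt[OF h])
  fix z assume "z \<in> topspace (top_of_set B)"
  hence z: "z \<in> B" by simp
  show "k z \<in> k ` A \<longleftrightarrow> z \<in> A"
  proof
   assume "k z \<in> k ` A"
   then obtain y where y: "y \<in> A" "k z = k y" by blast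
   hence "z = y" using chart_props(3)[OF z] chart_props(3)[of y] assms by auto
   thus "z \<in> A" using y by simp
  qed blast
 qed
 moreover have "subtopology (top_of_set B) A = top_of_set A"
  using assms by (simp add: subtopology_subtopology Int_absorb1)
 moreover have "subtopology (subtopology S N) (k ` A) = subtopology S (k ` A)"
 proof -
  have "k ` A \<subseteq> N" using assms chart_props(5) by blast
  thus ?thesis by (simp add: subtopology_subtopology Int_absorb1)
 qed
 ultimately show ?thesis by simp
qed

lemma M_open: "openin S M"
proof -
 have "k x0 \<in> topspace S" using chart_props(5)[OF x0_B] N_top by blast
 hence "closedin S {k x0}" using Hausdorff closedin_Hausdorff_singleton by metis
 thus ?thesis unfolding M_eq using N by (rule openin_diff[rotated])
qed

lemma M_top: "M \<subseteq> topspace S" and M_nonsingular: "p \<in> M \<Longrightarrow> p \<notin> singular_points S v"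
 using N_top isolated by (auto simp: M_eq)

lemma M_\<phi>: "p \<in> M \<Longrightarrow> \<phi> p \<in> V0" "p \<in> M \<Longrightarrow> k (\<phi> p) = p" "z \<in> V0 \<Longrightarrow> \<phi> (k z) = z" "z \<in> V0 \<Longrightarrow> k z \<in> M"
proof -
 show "p \<in> M \<Longrightarrow> \<phi> p \<in> V0" using chart_props(4)[of p] chart_props(6)[of p] by (auto simp: V0_B M_eq)
 show "p \<in> M \<Longrightarrow> k (\<phi> p) = p" using chart_props(4) by (simp add: M_eq)
 show "z \<in> V0 \<Longrightarrow> \<phi> (k z) = z" using chart_props(3) by (simp add: V0_B)
 show "z \<in> V0 \<Longrightarrow> k z \<in> M" by (simp add: M_def)
qed

lemma Fx_strict: "p \<in> M \<Longrightarrow> strict_mono (\<lambda>t. Fx (v t p))"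
 using F_strict[of p] M_top M_nonsingular by (auto simp: Fx_def strict_mono_def)

lemma Fx_inj: "p \<in> M \<Longrightarrow> Fx (v s p) = Fx (v t p) \<Longrightarrow> s = t" using strict_mono_eq[OF Fx_strict] by blast

lemma continuous_Fx: "continuous_map S euclideanreal Fx"
 unfolding Fx_def by (intro continuous_map_diff continuous_F) simp

text \<open>An orbit may leave the chart and return; the condition on the whole segment selects the
  passage that contains time \<open>0\<close>.\<close>

definition "stay z = {t. \<forall>s\<in>closed_segment 0 t. v s (k z) \<in> M}"
definition "f z = Fx (k z)"
definition "I z = (\<lambda>t. Fx (v t (k z))) ` stay z"
text \<open>Unique among all times, spent in the chart or not, because \<open>Fx\<close> is strictly
  increasing along the orbit.\<close>

definition "arrival c z = (THE t. Fx (v t (k z)) = c)"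
definition "\<Psi> c z = \<phi> (v (arrival c z) (k z))"

lemma arrival_eq: assumes "z \<in> V0" shows "arrival (Fx (v t (k z))) z = t"
 unfolding arrival_def by (rule the_equality) (use Fx_inj[OF M_\<phi>(4)[OF assms]] in auto)

lemma stayD: "t \<in> stay z \<Longrightarrow> v t (k z) \<in> M" "t \<in> stay z \<Longrightarrow> s \<in> closed_segment 0 t \<Longrightarrow> s \<in> stay z"
proof -
 show "t \<in> stay z \<Longrightarrow> v t (k z) \<in> M" by (auto simp: stay_def)
 assume "t \<in> stay z" "s \<in> closed_segment 0 t"
 thus "s \<in> stay z" unfolding stay_def using subset_closed_segment[of 0 s 0 t] by auto
qed

lemma flow_k: "z \<in> V0 \<Longrightarrow> v 0 (k z) = k z" "z \<in> V0 \<Longrightarrow> v (s + t) (k z) = v s (v t (k z))"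
 using flow_0[OF flow] flow_add[OF flow] M_\<phi>(4) M_top by blast+

lemma stay_0: "z \<in> V0 \<Longrightarrow> 0 \<in> stay z" using flow_k(1) M_\<phi>(4) by (simp add: stay_def)

lemma I_D:
 assumes "z \<in> V0" "c \<in> I z"
 shows "arrival c z \<in> stay z" "Fx (v (arrival c z) (k z)) = c" "v (arrival c z) (k z) \<in> M"
  "\<Psi> c z \<in> V0" "k (\<Psi> c z) = v (arrival c z) (k z)" "f (\<Psi> c z) = c"
proof -
 obtain t where t: "t \<in> stay z" "c = Fx (v t (k z))" using assms(2) by (auto simp: I_def)
 have "arrival c z = t" using arrival_eq[OF assms(1)] t by simp
 thus "arrival c z \<in> stay z" "Fx (v (arrival c z) (k z)) = c" and M: "v (arrival c z) (k z) \<in> M"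
  using t stayD(1) by auto
 thus "\<Psi> c z \<in> V0" "k (\<Psi> c z) = v (arrival c z) (k z)" "f (\<Psi> c z) = c"
  using M_\<phi>(1,2)[OF M] by (simp_all add: \<Psi>_def f_def)
qed

lemma stay_shift:
 assumes z: "z \<in> V0" "t \<in> stay z" and q: "k q = v t (k z)"
 shows "s \<in> stay q \<longleftrightarrow> s + t \<in> stay z"
proof -
 have A: "v u (k q) = v (u + t) (k z)" for u using flow_k(2)[OF z(1)] q by simp
 show ?thesis
 proof
  assume s: "s \<in> stay q"
  show "s + t \<in> stay z" unfolding stay_def
  proof (intro CollectI ballI)
   fix u assume "u \<in> closed_segment 0 (s + t)"
   hence "u \<in> closed_segment 0 t \<or> u - t \<in> closed_segment 0 s"
    by (auto simp: closed_segment_eq_real_ivl split: if_splits)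
   thus "v u (k z) \<in> M"
   proof
    assume "u - t \<in> closed_segment 0 s"
    hence "v (u - t) (k q) \<in> M" using s by (auto simp: stay_def)
    thus ?thesis using A[of "u - t"] by simp
   qed (use z(2) in \<open>auto simp: stay_def\<close>)
  qed
 next
  assume s: "s + t \<in> stay z"
  show "s \<in> stay q" unfolding stay_def
  proof (intro CollectI ballI)
   fix u assume "u \<in> closed_segment 0 s"
   hence "u + t \<in> closed_segment 0 t \<or> u + t \<in> closed_segment 0 (s + t)"
    by (auto simp: closed_segment_eq_real_ivl split: if_splits)
   hence "v (u + t) (k z) \<in> M" using s z(2) by (auto simp: stay_def)
   thus "v u (k q) \<in> M" using A by simp
  qed
 qed
qed

lemma I_shift:
 assumes "z \<in> V0" "c \<in> I z"
 shows "I (\<Psi> c z) = I z" "d \<in> I z \<Longrightarrow> \<Psi> d (\<Psi> c z) = \<Psi> d z"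
proof -
 note D = I_D[OF assms]
 let ?t = "arrival c z" and ?q = "\<Psi> c z"
 have A: "v u (k ?q) = v (u + ?t) (k z)" for u using flow_k(2)[OF assms(1)] D(5) by simp
 have ts: "s \<in> stay ?q \<longleftrightarrow> s + ?t \<in> stay z" for s using stay_shift[OF assms(1) D(1,5)] .
 show "I ?q = I z"
 proof
  show "I ?q \<subseteq> I z" using ts A by (auto simp: I_def)
  show "I z \<subseteq> I ?q"
  proof
   fix d assume "d \<in> I z"
   then obtain s where s: "s \<in> stay z" "d = Fx (v s (k z))" by (auto simp: I_def)
   hence "s - ?t \<in> stay ?q" "d = Fx (v (s - ?t) (k ?q))" using ts[of "s - ?t"] A[of "s - ?t"] by auto
   thus "d \<in> I ?q" by (auto simp: I_def)
  qed
 qed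
 show "\<Psi> d ?q = \<Psi> d z" if "d \<in> I z"
 proof -
  note E = I_D[OF assms(1) that]
  have "Fx (v (arrival d z - ?t) (k ?q)) = d" using A[of "arrival d z - ?t"] E(2) by simp
  hence "arrival d ?q = arrival d z - ?t" using arrival_eq[OF D(4)] by metis
  thus ?thesis using A[of "arrival d z - ?t"] by (simp add: \<Psi>_def)
 qed
qed

lemma continuous_joint: "continuous_map (top_of_set (UNIV \<times> V0)) S (\<lambda>(t, z). v t (k z))"
proof -
 let ?X = "top_of_set ((UNIV :: real set) \<times> V0)"
 have "continuous_map ?X (top_of_set B) snd" by (auto simp: V0_B intro!: continuous_intros)
 hence "continuous_map ?X (subtopology S N) (k \<circ> snd)" using chart_props(1) by (rule continuous_map_compose)
 hence "continuous_map ?X S (k \<circ> snd)" using continuous_map_into_fulltopology by blast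
 moreover have "continuous_map ?X euclideanreal fst" by (auto intro!: continuous_intros)
 ultimately have "continuous_map ?X (prod_topology euclideanreal S) (\<lambda>q. (fst q, (k \<circ> snd) q))"
  by (intro continuous_map_pairedI)
 hence "continuous_map ?X S ((\<lambda>(t, p). v t p) \<circ> (\<lambda>q. (fst q, (k \<circ> snd) q)))"
  using flow unfolding flow_def by (blast intro: continuous_map_compose)
 thus ?thesis by (simp add: o_def case_prod_unfold)
qed

definition "A2 = {(t, z). z \<in> V0 \<and> v t (k z) \<in> M}"

lemma A2_open: "openin (top_of_set (UNIV \<times> V0)) A2"
proof -
 have "A2 = {q \<in> topspace (top_of_set (UNIV \<times> V0)). (\<lambda>(t, z). v t (k z)) q \<in> M}" by (auto simp: A2_def)
 thus ?thesis using openin_continuous_map_preimage[OF continuous_joint M_open] by simp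
qed

lemma continuous_A2: "continuous_on A2 (\<lambda>(t, z). \<phi> (v t (k z)))"
proof -
 have sub: "A2 \<subseteq> UNIV \<times> V0" by (auto simp: A2_def)
 have "continuous_map (top_of_set A2) S (\<lambda>(t, z). v t (k z))"
  using continuous_map_from_subtopology[OF continuous_joint, of A2] sub
  by (simp add: subtopology_subtopology Int_absorb1)
 moreover have "(\<lambda>(t, z). v t (k z)) ` A2 \<subseteq> N" by (auto simp: A2_def M_eq)
 ultimately have "continuous_map (top_of_set A2) (subtopology S N) (\<lambda>(t, z). v t (k z))"
  by (auto simp: continuous_map_in_subtopology)
 hence "continuous_map (top_of_set A2) (top_of_set B) (\<phi> \<circ> (\<lambda>(t, z). v t (k z)))"
  using chart_props(2) by (rule continuous_map_compose)
 thus ?thesis by (simp add: o_def case_prod_unfold)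
qed

lemma continuous_Fx_joint: "continuous_on (UNIV \<times> V0) (\<lambda>(t, z). Fx (v t (k z)))"
 using continuous_map_compose[OF continuous_joint continuous_Fx] by (simp add: o_def case_prod_unfold)

lemma continuous_Fx_orbit:
 assumes "z \<in> V0"
 shows "continuous_on T (\<lambda>s. Fx (v s (k z)))"
proof -
 have "continuous_on T (\<lambda>s. (s, z))" by (intro continuous_intros)
 moreover have "(\<lambda>s. (s, z)) ` T \<subseteq> UNIV \<times> V0" using assms by auto
 ultimately show ?thesis using continuous_on_compose2[OF continuous_Fx_joint, of T "\<lambda>s. (s, z)"] by simp
qed

lemma stay_open:
 assumes "z \<in> V0" "t \<in> stay z"
 obtains e where "e > 0" "\<And>s. \<bar>s - t\<bar> < e \<Longrightarrow> s \<in> stay z"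
proof -
 have "(t, z) \<in> A2" using assms stayD(1) by (simp add: A2_def)
 then obtain e where e: "e > 0" "\<forall>q\<in>UNIV \<times> V0. dist q (t, z) < e \<longrightarrow> q \<in> A2"
  using A2_open unfolding openin_euclidean_subtopology_iff by blast
 have near: "v s (k z) \<in> M" if "\<bar>s - t\<bar> < e" for s
 proof -
  have "dist (s, z) (t, z) < e" using that by (simp add: dist_Pair_Pair dist_real_def)
  thus ?thesis using e(2) assms(1) by (auto simp: A2_def)
 qed
 have "s \<in> stay z" if s: "\<bar>s - t\<bar> < e" for s unfolding stay_def
 proof (intro CollectI ballI)
  fix u assume "u \<in> closed_segment 0 s"
  hence "u \<in> closed_segment 0 t \<or> \<bar>u - t\<bar> < e" using s by (auto simp: closed_segment_eq_real_ivl split: if_splits)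
  thus "v u (k z) \<in> M" using near assms(2) by (auto simp: stay_def)
 qed
 thus thesis using that e(1) by blast
qed

text \<open>On a compact range of times that contains \<open>0\<close> and reaches past the arrival
  time, a whole tube of nearby orbits stays in \<open>M\<close>. In the tube the values at
  \<open>t - \<eta>\<close> and \<open>t + \<eta>\<close> lie on both sides of the level, and the
  intermediate value theorem gives an arrival in between. Openness of the domain of
  \<open>\<Psi>\<close> and continuity of \<open>\<Psi>\<close> both follow.\<close>

lemma levels_limit:
 assumes z: "z \<in> V0" "c \<in> I z" and zs: "zs \<longlonglongrightarrow> z" "\<And>n. zs n \<in> V0" and cs: "cs \<longlonglongrightarrow> c" and e: "e > 0"
 shows "\<forall>\<^sub>F n in sequentially. cs n \<in> I (zs n) \<and> \<bar>arrival (cs n) (zs n) - arrival c z\<bar> \<le> e"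
proof -
 note D = I_D[OF z]
 define t where "t = arrival c z"
 obtain r where r: "r > 0" "\<And>s. \<bar>s - t\<bar> < r \<Longrightarrow> s \<in> stay z" using stay_open[OF z(1) D(1)] unfolding t_def by blast
 define \<eta> where "\<eta> = min e (r / 2)"
 have \<eta>: "\<eta> > 0" "\<eta> \<le> e" "\<eta> < r" using e r(1) by (auto simp: \<eta>_def)
 define a where "a = min 0 (t - \<eta>)"
 define b where "b = max 0 (t + \<eta>)"
 have ab: "s \<in> stay z" if "s \<in> {a..b}" for s
 proof -
  have m: "t - \<eta> \<in> stay z" "t + \<eta> \<in> stay z" using r(2) \<eta> by auto
  have "s \<in> closed_segment 0 (t - \<eta>) \<or> s \<in> closed_segment 0 (t + \<eta>) \<or> \<bar>s - t\<bar> < r"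
   using that \<eta> by (auto simp: a_def b_def closed_segment_eq_real_ivl split: if_splits)
  thus ?thesis using m stayD(2) r(2) by blast
 qed
 have tube: "\<forall>\<^sub>F n in sequentially. \<forall>s\<in>{a..b}. v s (k (zs n)) \<in> M"
 proof (rule ccontr)
  assume "\<not> ?thesis"
  hence fr: "\<exists>\<^sub>F n in sequentially. \<exists>s\<in>{a..b}. v s (k (zs n)) \<notin> M" by (simp add: frequently_def)
  obtain q where q: "strict_mono (q::nat\<Rightarrow>nat)" "\<And>n. \<exists>s\<in>{a..b}. v s (k (zs (q n))) \<notin> M"
   using frequently_subsequenceE[OF fr] by blast
  obtain ss where ss: "\<And>n. ss n \<in> {a..b}" "\<And>n. v (ss n) (k (zs (q n))) \<notin> M" using q(2) by metis
  obtain s u where s: "s \<in> {a..b}" "strict_mono (u::nat\<Rightarrow>nat)" "(ss \<circ> u) \<longlonglongrightarrow> s"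
   using compact_Icc[of a b] ss(1) unfolding compact_def by meson
  have "(\<lambda>n. (ss (u n), zs (q (u n)))) \<longlonglongrightarrow> (s, z)"
   using s(3) LIMSEQ_subseq_LIMSEQ[OF LIMSEQ_subseq_LIMSEQ[OF zs(1) q(1)] s(2)]
   by (intro tendsto_Pair) (auto simp: o_def)
  moreover have "(s, z) \<in> A2" using stayD(1)[OF ab[OF s(1)]] z(1) by (simp add: A2_def)
  ultimately have "\<forall>\<^sub>F n in sequentially. (ss (u n), zs (q (u n))) \<in> A2"
   using zs(2) by (intro openin_eventually_sequentially[OF A2_open]) auto
  thus False using ss(2) by (auto simp: A2_def eventually_sequentially)
 qed
 have lim: "(\<lambda>n. Fx (v s (k (zs n)))) \<longlonglongrightarrow> Fx (v s (k z))" for s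
 proof -
  have "(\<lambda>n. (s, zs n)) \<longlonglongrightarrow> (s, z)" by (intro tendsto_Pair tendsto_const zs)
  from continuous_on_tendsto_compose[OF continuous_Fx_joint this] show ?thesis using z(1) zs(2) by simp
 qed
 have st: "strict_mono (\<lambda>t. Fx (v t (k z)))" using Fx_strict M_\<phi>(4) z(1) by blast
 have lt: "Fx (v (t - \<eta>) (k z)) < c" "c < Fx (v (t + \<eta>) (k z))"
  using strict_monoD[OF st, of "t - \<eta>" t] strict_monoD[OF st, of t "t + \<eta>"] \<eta>(1) D(2) by (auto simp: t_def)
 have "(\<lambda>n. cs n - Fx (v (t - \<eta>) (k (zs n)))) \<longlonglongrightarrow> c - Fx (v (t - \<eta>) (k z))" by (intro tendsto_diff cs lim)
 hence lo: "\<forall>\<^sub>F n in sequentially. 0 < cs n - Fx (v (t - \<eta>) (k (zs n)))" by (rule order_tendstoD(1)) (use lt in simp)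
 have "(\<lambda>n. Fx (v (t + \<eta>) (k (zs n))) - cs n) \<longlonglongrightarrow> Fx (v (t + \<eta>) (k z)) - c" by (intro tendsto_diff cs lim)
 hence "\<forall>\<^sub>F n in sequentially. 0 < Fx (v (t + \<eta>) (k (zs n))) - cs n" by (rule order_tendstoD(1)) (use lt in simp)
 with lo show ?thesis using tube
 proof eventually_elim
  case (elim n)
  have cont: "continuous_on {t - \<eta>..t + \<eta>} (\<lambda>s. Fx (v s (k (zs n))))" using continuous_Fx_orbit[OF zs(2)] .
  obtain s where s: "t - \<eta> \<le> s" "s \<le> t + \<eta>" "Fx (v s (k (zs n))) = cs n"
   using IVT'[of "\<lambda>s. Fx (v s (k (zs n)))" "t - \<eta>" "cs n" "t + \<eta>", OF _ _ _ cont] elim \<eta>(1) by auto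
  have "closed_segment 0 s \<subseteq> {a..b}" using s \<eta> by (auto simp: a_def b_def closed_segment_eq_real_ivl)
  hence "s \<in> stay (zs n)" using elim(3) by (auto simp: stay_def)
  hence "cs n \<in> I (zs n)" using s(3) unfolding I_def by (intro image_eqI[of _ _ s]) auto
  moreover have "arrival (cs n) (zs n) = s" using arrival_eq[OF zs(2)] s(3) by metis
  ultimately show ?case using s \<eta>(2) by (auto simp: t_def abs_le_iff)
 qed
qed

lemma levels_open_aux: "openin (top_of_set (UNIV \<times> V0)) {(c, z). z \<in> V0 \<and> c \<in> I z}"
proof (rule ccontr)
 assume n: "\<not> ?thesis"
 show False
 proof (rule not_openin_sequenceE[OF n])
  show "{(c, z). z \<in> V0 \<and> c \<in> I z} \<subseteq> UNIV \<times> V0" by auto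
  fix qs q assume q: "q \<in> {(c, z). z \<in> V0 \<and> c \<in> I z}" "qs \<longlonglongrightarrow> q"
   "\<And>n. qs n \<in> UNIV \<times> V0 - {(c, z). z \<in> V0 \<and> c \<in> I z}"
  obtain c z where cz: "q = (c, z)" "z \<in> V0" "c \<in> I z" using q(1) by auto
  have V: "snd (qs n) \<in> V0" "fst (qs n) \<notin> I (snd (qs n))" for n using q(3)[of n] by (auto simp: case_prod_unfold)
  have "(\<lambda>n. snd (qs n)) \<longlonglongrightarrow> z" "(\<lambda>n. fst (qs n)) \<longlonglongrightarrow> c" using tendsto_snd[OF q(2)] tendsto_fst[OF q(2)] cz(1) by auto
  from levels_limit[OF cz(2,3) this(1) V(1) this(2), of 1] V(2)
  show False by (auto simp: eventually_sequentially)
 qed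
qed

lemma continuous_\<Psi>_aux: "continuous_on {(c, z). z \<in> V0 \<and> c \<in> I z} (\<lambda>(c, z). \<Psi> c z)"
 unfolding continuous_on_sequentially o_def
proof (intro allI ballI impI, elim conjE)
 fix qs q assume q: "q \<in> {(c, z). z \<in> V0 \<and> c \<in> I z}" "\<forall>n. qs n \<in> {(c, z). z \<in> V0 \<and> c \<in> I z}" "qs \<longlonglongrightarrow> q"
 obtain c z where cz: "q = (c, z)" "z \<in> V0" "c \<in> I z" using q(1) by auto
 have V: "snd (qs n) \<in> V0" "fst (qs n) \<in> I (snd (qs n))" for n
  using q(2)[rule_format, of n] by (auto simp: case_prod_unfold)
 have lim: "(\<lambda>n. snd (qs n)) \<longlonglongrightarrow> z" "(\<lambda>n. fst (qs n)) \<longlonglongrightarrow> c"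
  using tendsto_snd[OF q(3)] tendsto_fst[OF q(3)] cz(1) by auto
 have tm: "(\<lambda>n. arrival (fst (qs n)) (snd (qs n))) \<longlonglongrightarrow> arrival c z" unfolding tendsto_iff
 proof (intro allI impI)
  fix e :: real assume e: "e > 0"
  have "\<forall>\<^sub>F n in sequentially. fst (qs n) \<in> I (snd (qs n)) \<and> \<bar>arrival (fst (qs n)) (snd (qs n)) - arrival c z\<bar> \<le> e / 2"
   by (rule levels_limit[OF cz(2,3) lim(1) V(1) lim(2)]) (use e in simp)
  thus "\<forall>\<^sub>F n in sequentially. dist (arrival (fst (qs n)) (snd (qs n))) (arrival c z) < e"
   by eventually_elim (use e in \<open>auto simp: dist_real_def\<close>)
 qed
 have "(\<lambda>n. (arrival (fst (qs n)) (snd (qs n)), snd (qs n))) \<longlonglongrightarrow> (arrival c z, z)" by (intro tendsto_Pair tm lim)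
 from continuous_on_tendsto_compose[OF continuous_A2 this]
 have "(\<lambda>n. \<Psi> (fst (qs n)) (snd (qs n))) \<longlonglongrightarrow> \<Psi> c z"
  using I_D(3)[OF cz(2,3)] cz(2) I_D(3)[OF V] V(1) by (simp add: A2_def \<Psi>_def)
 thus "(\<lambda>n. case qs n of (c, z) \<Rightarrow> \<Psi> c z) \<longlonglongrightarrow> (case q of (c, z) \<Rightarrow> \<Psi> c z)" using cz(1) by (simp add: case_prod_unfold)
qed

lemma level_flow: "level_flow x0 R f I \<Psi>"
proof (unfold_locales, fold V0_def)
 show "x0 \<in> half_plane" "R > 0" by (fact x0 R)+
 have "continuous_map (top_of_set B) euclideanreal (Fx \<circ> k)"
  using continuous_map_compose[OF continuous_map_into_fulltopology[OF chart_props(1)] continuous_Fx] .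
 thus "continuous_on (ball x0 R \<inter> half_plane) f" by (simp add: f_def o_def B_def cong: continuous_on_cong)
 show "f x0 = 0" by (simp add: f_def Fx_def)
 fix z assume z: "z \<in> V0"
 show "f z \<in> I z" unfolding I_def f_def using stay_0[OF z] flow_k(1)[OF z] by (intro image_eqI[of _ _ 0]) auto
 show "is_interval (I z)"
 proof -
  have "is_interval (stay z)" unfolding is_interval_1
  proof (intro ballI allI impI)
   fix a b c assume "a \<in> stay z" "b \<in> stay z" "a \<le> c \<and> c \<le> b"
   hence "c \<in> closed_segment 0 a \<or> c \<in> closed_segment 0 b" by (auto simp: closed_segment_eq_real_ivl)
   thus "c \<in> stay z" using stayD(2) \<open>a \<in> stay z\<close> \<open>b \<in> stay z\<close> by blast
  qed
  hence "connected (stay z)" by (simp add: is_interval_connected_1)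
  moreover have "continuous_on (stay z) (\<lambda>t. Fx (v t (k z)))" using continuous_Fx_orbit[OF z] .
  ultimately have "connected (I z)" unfolding I_def by (intro connected_continuous_image)
  thus ?thesis by (simp add: is_interval_connected_1)
 qed
 show "\<Psi> (f z) z = z"
 proof -
  have "f z = Fx (v 0 (k z))" using flow_k(1)[OF z] by (simp add: f_def)
  hence "arrival (f z) z = 0" using arrival_eq[OF z] by metis
  thus ?thesis using flow_k(1)[OF z] M_\<phi>(3)[OF z] by (simp add: \<Psi>_def)
 qed
 show "\<exists>c\<in>I z. level_arc (top_of_set V0) f (\<Psi> c z)"
 proof -
  \<comment> \<open>An arc is available within any short time, in particular before the orbit leaves
    the chart.\<close>
  obtain e where e: "e > 0" "\<And>s. \<bar>s - 0\<bar> < e \<Longrightarrow> s \<in> stay z" using stay_open[OF z stay_0[OF z]] by blast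
  obtain t where t: "0 \<le> t" "t < e" "level_arc S F (v t (k z))"
   using F_arcs[OF _ M_nonsingular[OF M_\<phi>(4)[OF z]] e(1)] M_\<phi>(4)[OF z] M_top by blast
  have tz: "t \<in> stay z" using e(2) t by simp
  define p where "p = v t (k z)"
  have p: "p \<in> M" using stayD(1)[OF tz] by (simp add: p_def)
  have c: "Fx p \<in> I z" using tz by (auto simp: I_def p_def)
  have \<Psi>p: "\<Psi> (Fx p) z = \<phi> p" using arrival_eq[OF z] by (simp add: \<Psi>_def p_def)
  have "level_arc (subtopology S M) F (k (\<phi> p))"
   unfolding M_\<phi>(2)[OF p] using level_arc_open_subset[OF t(3) M_open] p by (simp add: p_def)
  moreover have "homeomorphic_map (top_of_set V0) (subtopology S M) k"
   unfolding M_def by (rule k_homeomorphic) (simp add: V0_B)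
  ultimately have "level_arc (top_of_set V0) (F \<circ> k) (\<phi> p)"
   using M_\<phi>(1)[OF p] by (intro level_arc_homeomorphic) auto
  hence "level_arc (top_of_set V0) (\<lambda>z. (F \<circ> k) z - F (k x0)) (\<phi> p)" by (simp only: level_arc_shift)
  hence "level_arc (top_of_set V0) f (\<Psi> (Fx p) z)"
   unfolding \<Psi>p by (simp add: f_def Fx_def cong: if_cong) (simp add: f_def[abs_def] Fx_def)
  thus ?thesis using c by blast
 qed
next
 fix z c assume zc: "z \<in> V0" "c \<in> I z"
 show "\<Psi> c z \<in> V0" "f (\<Psi> c z) = c" using I_D[OF zc] by auto
 show "I (\<Psi> c z) = I z" using I_shift(1)[OF zc] .
 show "\<Psi> d (\<Psi> c z) = \<Psi> d z" if "d \<in> I z" for d using I_shift(2)[OF zc that] .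
next
 show "openin (top_of_set (UNIV \<times> V0)) {(c, z). z \<in> V0 \<and> c \<in> I z}" by (rule levels_open_aux)
 show "continuous_on {(c, z). z \<in> V0 \<and> c \<in> I z} (\<lambda>(c, z). \<Psi> c z)" by (rule continuous_\<Psi>_aux)
qed

end

section \<open>Models of sectors\<close>

lemma homeomorphism_homeomorphic_map:
 assumes "homeomorphism D B \<kappa> j"
 shows "homeomorphic_map (top_of_set D) (top_of_set B) \<kappa>"
proof -
 have "homeomorphic_maps (top_of_set D) (top_of_set B) \<kappa> j"
  using assms unfolding homeomorphic_maps_def homeomorphism_def by auto
 thus ?thesis using homeomorphic_map_maps by blast
qed

text \<open>\<open>near\<close> and \<open>far\<close> say that \<open>e \<circ> \<kappa>\<close>
  becomes large exactly near the puncture, so the neighborhoods of \<open>0\<close> match those of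
  the added end.\<close>

lemma homeomorphic_map_add_end:
 fixes D :: "complex set" and \<kappa> :: "complex \<Rightarrow> 'b::topological_space"
 assumes hom: "homeomorphism (D - {0}) B \<kappa> j" and D: "0 \<in> D"
  and near: "\<And>c. \<exists>r>0. \<forall>z\<in>D - {0}. cmod z < r \<longrightarrow> c < e (\<kappa> z)"
  and far: "\<And>r. r > 0 \<Longrightarrow> \<exists>c. \<forall>z\<in>D - {0}. c < e (\<kappa> z) \<longrightarrow> cmod z < r"
 shows "homeomorphic_map (top_of_set D) (add_end B e) (\<lambda>z. if z = 0 then None else Some (\<kappa> z))"
  (is "homeomorphic_map _ _ ?m")
proof (rule bijective_open_imp_homeomorphic_map)
 have \<kappa>B: "\<kappa> ` (D - {0}) = B" and j\<kappa>: "\<And>z. z \<in> D - {0} \<Longrightarrow> j (\<kappa> z) = z"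
  and \<kappa>c: "continuous_on (D - {0}) \<kappa>" using hom by (auto simp: homeomorphism_def)
 have B: "\<kappa> z \<in> B" if "z \<in> D" "z \<noteq> 0" for z using \<kappa>B that by blast
 have D': "openin (top_of_set D) (D - {0})" by (rule openin_delete) simp
 show "continuous_map (top_of_set D) (add_end B e) ?m" unfolding continuous_map_def
 proof (intro conjI allI impI)
  show "?m \<in> topspace (top_of_set D) \<rightarrow> topspace (add_end B e)" using B by auto
  fix W assume W: "openin (add_end B e) W"
  let ?W = "{p \<in> B. Some p \<in> W}"
  let ?P = "(D - {0}) \<inter> \<kappa> -` ?W"
  have "openin (top_of_set B) ?W" using W unfolding openin_add_end by blast
  hence "openin (top_of_set (D - {0})) ?P" using \<kappa>c[unfolded continuous_on_open \<kappa>B] by blast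
  hence P: "openin (top_of_set D) ?P" using D' by (rule openin_trans)
  show "openin (top_of_set D) {z \<in> topspace (top_of_set D). ?m z \<in> W}"
  proof (cases "None \<in> W")
   case False
   hence "{z \<in> topspace (top_of_set D). ?m z \<in> W} = ?P" using B by auto
   thus ?thesis using P by simp
  next
   case True
   then obtain c where c: "\<forall>p\<in>B. c < e p \<longrightarrow> Some p \<in> W" using W unfolding openin_add_end by blast
   obtain r where r: "r > 0" "\<forall>z\<in>D - {0}. cmod z < r \<longrightarrow> c < e (\<kappa> z)" using near by blast
   have "{z \<in> topspace (top_of_set D). ?m z \<in> W} = ?P \<union> (D \<inter> ball 0 r)"
   proof
    show "{z \<in> topspace (top_of_set D). ?m z \<in> W} \<subseteq> ?P \<union> (D \<inter> ball 0 r)"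
    proof
     fix z assume "z \<in> {z \<in> topspace (top_of_set D). ?m z \<in> W}"
     thus "z \<in> ?P \<union> (D \<inter> ball 0 r)" using B[of z] r(1) by (cases "z = 0") auto
    qed
    have "?m z \<in> W" if "z \<in> D" "cmod z < r" for z using that c r(2) B True by auto
    thus "?P \<union> (D \<inter> ball 0 r) \<subseteq> {z \<in> topspace (top_of_set D). ?m z \<in> W}" by (intro Un_least subsetI) simp_all
   qed
   moreover have "openin (top_of_set D) (D \<inter> ball 0 r)" by (intro openin_open_Int) simp
   ultimately show ?thesis using openin_Un[OF P] by metis
  qed
 qed
 show "open_map (top_of_set D) (add_end B e) ?m" unfolding open_map_def
 proof (intro allI impI)
  fix U assume U: "openin (top_of_set D) U"
  hence UD: "U \<subseteq> D" using openin_imp_subset by blast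
  have UD': "openin (top_of_set (D - {0})) (U - {0})"
  proof -
   obtain O' where "open O'" "U = D \<inter> O'" using U by (auto simp: openin_open)
   hence "U - {0} = (D - {0}) \<inter> O'" by blast
   thus ?thesis using \<open>open O'\<close> by (auto simp: openin_open)
  qed
  have eq: "{p \<in> B. Some p \<in> ?m ` U} = \<kappa> ` (U - {0})"
  proof
   show "{p \<in> B. Some p \<in> ?m ` U} \<subseteq> \<kappa> ` (U - {0})" by (auto split: if_splits)
   show "\<kappa> ` (U - {0}) \<subseteq> {p \<in> B. Some p \<in> ?m ` U}"
   proof
    fix p assume "p \<in> \<kappa> ` (U - {0})"
    then obtain z where z: "z \<in> U" "z \<noteq> 0" "p = \<kappa> z" by blast
    hence "p \<in> B" using B UD by auto
    moreover have "Some p \<in> ?m ` U" using z by (intro image_eqI[of _ _ z]) auto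
    ultimately show "p \<in> {p \<in> B. Some p \<in> ?m ` U}" by simp
   qed
  qed
  show "openin (add_end B e) (?m ` U)" unfolding openin_add_end
  proof (intro conjI impI)
   show "?m ` U \<subseteq> insert None (Some ` B)" using B UD by auto
   show "openin (top_of_set B) {p \<in> B. Some p \<in> ?m ` U}"
    unfolding eq using homeomorphism_imp_open_map[OF hom UD'] .
   assume "None \<in> ?m ` U"
   hence "0 \<in> U" by (auto split: if_splits)
   then obtain r where r: "r > 0" "\<forall>z\<in>D. dist z 0 < r \<longrightarrow> z \<in> U"
    using U unfolding openin_euclidean_subtopology_iff by blast
   obtain c where c: "\<forall>z\<in>D - {0}. c < e (\<kappa> z) \<longrightarrow> cmod z < r" using far r(1) by blast
   have "Some p \<in> ?m ` U" if p: "p \<in> B" "c < e p" for p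
   proof -
    obtain z where z: "z \<in> D - {0}" "p = \<kappa> z" using p(1) \<kappa>B by blast
    hence "z \<in> U" using c r(2) p(2) by simp
    thus ?thesis using z eq p(1) by blast
   qed
   thus "\<exists>c. \<forall>p\<in>B. c < e p \<longrightarrow> Some p \<in> ?m ` U" by blast
  qed
 qed
 show "?m ` topspace (top_of_set D) = topspace (add_end B e)"
 proof
  show "?m ` topspace (top_of_set D) \<subseteq> topspace (add_end B e)" using B by auto
  have "Some p \<in> ?m ` D" if p: "p \<in> B" for p
  proof -
   obtain z where "z \<in> D - {0}" "p = \<kappa> z" using p \<kappa>B by blast
   thus ?thesis by (intro image_eqI[of _ _ z]) auto
  qed
  moreover have "None \<in> ?m ` D" using D by (intro image_eqI[of _ _ 0]) auto
  ultimately show "topspace (add_end B e) \<subseteq> ?m ` topspace (top_of_set D)" by auto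
 qed
 show "inj_on ?m (topspace (top_of_set D))"
 proof (rule inj_onI)
  fix z w assume zw: "z \<in> topspace (top_of_set D)" "w \<in> topspace (top_of_set D)" "?m z = ?m w"
  show "z = w"
  proof (cases "z = 0 \<or> w = 0")
   case True
   thus ?thesis using zw(3) by (simp split: if_splits)
  next
   case False
   hence "\<kappa> z = \<kappa> w" "z \<in> D - {0}" "w \<in> D - {0}" using zw by simp_all
   thus ?thesis using j\<kappa> by metis
  qed
 qed
qed

text \<open>The modulus in \<open>(0, 1)\<close> becomes time through the inverse of a logistic
  function. With \<open>\<sigma> = 1\<close> the puncture is at time \<open>+\<infinity>\<close>,
  with \<open>\<sigma> = -1\<close> at time \<open>-\<infinity>\<close>.\<close>

definition parabolic_model :: "real \<Rightarrow> complex \<Rightarrow> real \<times> real" where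
 "parabolic_model \<sigma> z = (\<sigma> * ln ((1 - cmod z) / cmod z), Arg z)"

definition parabolic_point :: "real \<Rightarrow> real \<times> real \<Rightarrow> complex" where
 "parabolic_point \<sigma> p = rcis (1 / (1 + exp (\<sigma> * fst p))) (snd p)"

lemma parabolic_point_polar:
 assumes "p \<in> UNIV \<times> {0..1}"
 shows "cmod (parabolic_point \<sigma> p) = 1 / (1 + exp (\<sigma> * fst p))" "Arg (parabolic_point \<sigma> p) = snd p"
  "parabolic_point \<sigma> p \<in> open_cone - {0}"
proof -
 define r where "r = 1 / (1 + exp (\<sigma> * fst p))"
 have r: "0 < r" "r < 1" unfolding r_def by (auto simp: add_pos_pos)
 have p: "0 \<le> snd p" "snd p \<le> 1" using assms by auto
 show c: "cmod (parabolic_point \<sigma> p) = 1 / (1 + exp (\<sigma> * fst p))"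
  using r by (simp add: parabolic_point_def flip: r_def)
 show a: "Arg (parabolic_point \<sigma> p) = snd p"
  using p r pi_gt_1 by (simp add: parabolic_point_def Arg_rcis flip: r_def)
 show "parabolic_point \<sigma> p \<in> open_cone - {0}" using a c p r by (auto simp: open_cone_iff simp flip: r_def)
qed

lemma parabolic_homeomorphism:
 assumes \<sigma>: "\<sigma> * \<sigma> = 1"
 shows "homeomorphism (open_cone - {0}) (UNIV \<times> {0..1}) (parabolic_model \<sigma>) (parabolic_point \<sigma>)"
proof (rule homeomorphismI)
 have \<sigma>': "\<sigma> * (\<sigma> * x) = x" for x using \<sigma> by (simp flip: mult.assoc)
 have open_cone: "0 < cmod z" "cmod z < 1" "0 \<le> Arg z" "Arg z \<le> 1" if "z \<in> open_cone - {0}" for z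
  using that by (auto simp: open_cone_iff)
 have "continuous_on (open_cone - {0}) Arg"
 proof (intro continuous_at_imp_continuous_on ballI)
  fix z assume "z \<in> open_cone - {0}"
  thus "isCont Arg z" using open_cone[of z] by (intro cone_Arg_continuous) (auto simp: cone_iff)
 qed
 moreover have "continuous_on (open_cone - {0}) (\<lambda>z. ln ((1 - cmod z) / cmod z))"
 proof (intro continuous_intros ballI)
  fix z assume "z \<in> open_cone - {0}"
  thus "cmod z \<noteq> 0" "(1 - cmod z) / cmod z \<noteq> 0" using open_cone[of z] by auto
 qed
 ultimately show "continuous_on (open_cone - {0}) (parabolic_model \<sigma>)"
  unfolding parabolic_model_def[abs_def] by (intro continuous_on_Pair continuous_on_mult continuous_on_const)
 have "1 + exp x \<noteq> 0" for x :: real using exp_gt_zero[of x] by linarith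
 thus "continuous_on (UNIV \<times> {0..1}) (parabolic_point \<sigma>)"
  unfolding parabolic_point_def[abs_def] rcis_def by (intro continuous_intros) auto
 show "parabolic_model \<sigma> ` (open_cone - {0}) \<subseteq> UNIV \<times> {0..1}" using open_cone by (auto simp: parabolic_model_def)
 show "parabolic_point \<sigma> ` (UNIV \<times> {0..1}) \<subseteq> open_cone - {0}" by (intro image_subsetI parabolic_point_polar(3))
 show "parabolic_point \<sigma> (parabolic_model \<sigma> z) = z" if z: "z \<in> open_cone - {0}" for z
 proof -
  note c = open_cone[OF z]
  have "exp (\<sigma> * fst (parabolic_model \<sigma> z)) = (1 - cmod z) / cmod z" using c by (simp add: parabolic_model_def \<sigma>')
  moreover have "1 / (1 + (1 - cmod z) / cmod z) = cmod z" using c by (simp add: field_simps)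
  ultimately have "1 / (1 + exp (\<sigma> * fst (parabolic_model \<sigma> z))) = cmod z" by metis
  thus ?thesis by (simp add: parabolic_point_def parabolic_model_def rcis_cmod_Arg)
 qed
 show "parabolic_model \<sigma> (parabolic_point \<sigma> p) = p" if "p \<in> UNIV \<times> {0..1}" for p
 proof -
  have "(1 - 1 / (1 + a)) / (1 / (1 + a)) = a" if "a > 0" for a :: real using that by (simp add: field_simps)
  thus ?thesis using parabolic_point_polar(1,2)[OF that] by (simp add: parabolic_model_def \<sigma>' prod_eq_iff)
 qed
qed

lemma parabolic_model_end:
 assumes \<sigma>: "\<sigma> * \<sigma> = 1" and z: "z \<in> open_cone - {0}"
 shows "c < \<sigma> * fst (parabolic_model \<sigma> z) \<longleftrightarrow> cmod z < 1 / (1 + exp c)"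
proof -
 have r: "0 < cmod z" "cmod z < 1" using z by (auto simp: open_cone_iff)
 have "c < \<sigma> * fst (parabolic_model \<sigma> z) \<longleftrightarrow> c < ln ((1 - cmod z) / cmod z)"
  using \<sigma> by (simp add: parabolic_model_def flip: mult.assoc)
 also have "\<dots> \<longleftrightarrow> exp c < (1 - cmod z) / cmod z" using r exp_less_cancel_iff[of c "ln ((1 - cmod z) / cmod z)"] by simp
 also have "\<dots> \<longleftrightarrow> cmod z < 1 / (1 + exp c)" using r exp_gt_zero[of c] by (simp add: field_simps add_pos_pos)
 finally show ?thesis .
qed

lemma parabolic_end_homeomorphic:
 assumes \<sigma>: "\<sigma> * \<sigma> = 1"
 shows "homeomorphic_map (top_of_set open_cone) (add_end (UNIV \<times> {0..1}) (\<lambda>p. \<sigma> * fst p))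
  (\<lambda>z. if z = 0 then None else Some (parabolic_model \<sigma> z))"
proof (rule homeomorphic_map_add_end[OF parabolic_homeomorphism[OF \<sigma>]])
 show "0 \<in> open_cone" by (simp add: open_cone_iff)
 show "\<exists>r>0. \<forall>z\<in>open_cone - {0}. cmod z < r \<longrightarrow> c < \<sigma> * fst (parabolic_model \<sigma> z)" for c
  using parabolic_model_end[OF \<sigma>] by (intro exI[of _ "1 / (1 + exp c)"]) (auto simp: add_pos_pos)
 show "\<exists>c. \<forall>z\<in>open_cone - {0}. c < \<sigma> * fst (parabolic_model \<sigma> z) \<longrightarrow> cmod z < r" if "r > 0" for r
 proof -
  define s where "s = min r (1/2)"
  have s: "0 < s" "s < 1" "s \<le> r" using that by (auto simp: s_def)
  have "1 / (1 + exp (ln ((1 - s) / s))) = 1 / (1 + (1 - s) / s)" using s by simp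
  also have "\<dots> = s" using s by (simp add: field_simps)
  finally have "1 / (1 + exp (ln ((1 - s) / s))) = s" .
  thus ?thesis using s parabolic_model_end[OF \<sigma>, of _ "ln ((1 - s) / s)"] by (intro exI[of _ "ln ((1 - s) / s)"]) auto
 qed
qed

section \<open>The hyperbolic model: from the open rectangle through the half-plane to the Reeb
  strip\<close>

definition squash :: "real \<Rightarrow> real" where "squash d = d / (1 + \<bar>d\<bar>)"
definition unsquash :: "real \<Rightarrow> real" where "unsquash c = c / (1 - \<bar>c\<bar>)"

lemma squash_less_1: "\<bar>squash d\<bar> < 1" by (simp add: squash_def abs_if field_simps)

lemma unsquash_squash: "unsquash (squash d) = d"
 by (cases "d \<ge> 0") (simp_all add: squash_def unsquash_def field_simps)

lemma squash_unsquash: "\<bar>c\<bar> < 1 \<Longrightarrow> squash (unsquash c) = c"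
 by (cases "c \<ge> 0") (simp_all add: squash_def unsquash_def field_simps)

lemma squash_0_iff [simp]: "squash d = 0 \<longleftrightarrow> d = 0" by (auto simp: squash_def)

lemma squash_nonneg [simp]: "0 \<le> squash d \<longleftrightarrow> 0 \<le> d"
 unfolding squash_def zero_le_divide_iff using abs_ge_zero[of d] by linarith

lemma strict_mono_squash: "strict_mono squash"
proof (rule strict_monoI)
 fix x y :: real assume "x < y"
 then consider "0 \<le> x" "0 \<le> y" | "x < 0" "y < 0" | "x < 0" "0 \<le> y" by linarith
 thus "squash x < squash y"
 proof cases
  case 3
  hence "squash x < 0" "0 \<le> squash y" by (auto simp: squash_def divide_less_0_iff)
  thus ?thesis by linarith
 qed (use \<open>x < y\<close> in \<open>simp_all add: squash_def field_simps\<close>)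
qed

text \<open>The two coordinates are stretched separately, so that level and orbit parameter stay
  separate in the half-plane.\<close>

definition spread :: "real \<Rightarrow> complex \<Rightarrow> complex" where
 "spread \<epsilon> z = Complex (unsquash (Re z / \<epsilon>)) (unsquash (Im z))"

definition unspread :: "real \<Rightarrow> complex \<Rightarrow> complex" where
 "unspread \<epsilon> w = Complex (\<epsilon> * squash (Re w)) (squash (Im w))"

definition open_rect :: "real \<Rightarrow> complex set" where
 "open_rect \<epsilon> = {z. - \<epsilon> < Re z \<and> Re z < \<epsilon> \<and> 0 \<le> Im z \<and> Im z < 1}"

lemma unsquash_sign: "\<bar>c\<bar> < 1 \<Longrightarrow> 0 < unsquash c \<longleftrightarrow> 0 < c" "\<bar>c\<bar> < 1 \<Longrightarrow> unsquash c < 0 \<longleftrightarrow> c < 0"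
 by (simp_all add: unsquash_def zero_less_divide_iff divide_less_0_iff)

lemma spread_homeomorphism:
 assumes \<epsilon>: "\<epsilon> > 0"
 shows "homeomorphism (open_rect \<epsilon>) half_plane (spread \<epsilon>) (unspread \<epsilon>)"
proof (rule homeomorphismI)
 have r: "\<bar>Re z / \<epsilon>\<bar> < 1" "\<bar>Im z\<bar> < 1" if "z \<in> open_rect \<epsilon>" for z
  using that \<epsilon> by (auto simp: open_rect_def field_simps)
 have r': "1 - \<bar>Re z / \<epsilon>\<bar> \<noteq> 0" "1 - \<bar>Im z\<bar> \<noteq> 0" if "z \<in> open_rect \<epsilon>" for z using r[OF that] by linarith+
 show "continuous_on (open_rect \<epsilon>) (spread \<epsilon>)"
  unfolding spread_def[abs_def] unsquash_def Complex_eq by (intro continuous_intros) (use r' \<epsilon> in auto)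
 show "continuous_on half_plane (unspread \<epsilon>)" unfolding unspread_def[abs_def] squash_def Complex_eq
  by (intro continuous_intros) (auto simp: add_nonneg_eq_0_iff)
 show "spread \<epsilon> ` open_rect \<epsilon> \<subseteq> half_plane" by (auto simp: spread_def half_plane_def open_rect_def unsquash_def)
 show "unspread \<epsilon> ` half_plane \<subseteq> open_rect \<epsilon>"
 proof (intro image_subsetI)
  fix w assume w: "w \<in> half_plane"
  have "\<bar>\<epsilon> * squash (Re w)\<bar> < \<epsilon>" using squash_less_1[of "Re w"] \<epsilon> by (simp add: abs_mult)
  thus "unspread \<epsilon> w \<in> open_rect \<epsilon>"
   using squash_less_1[of "Im w"] w by (auto simp: open_rect_def unspread_def half_plane_def abs_less_iff)
 qed
 show "unspread \<epsilon> (spread \<epsilon> z) = z" if "z \<in> open_rect \<epsilon>" for z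
  using squash_unsquash[OF r(1)[OF that]] squash_unsquash[OF r(2)[OF that]] \<epsilon>
  by (simp add: spread_def unspread_def complex_eq_iff)
 show "spread \<epsilon> (unspread \<epsilon> w) = w" for w
  using \<epsilon> by (simp add: spread_def unspread_def complex_eq_iff unsquash_squash)
qed

text \<open>At the point of the half-plane that belongs to \<open>(s, y)\<close> this is
  \<open>2 * exp y\<close>, because \<open>(2 s e^y)^2 + 4 e^(2y) (1 - s^2) = 4 e^(2y)\<close>; thus
  \<open>y\<close>, and then \<open>s\<close>, can be recovered.\<close>

definition radius :: "complex \<Rightarrow> real" where
 "radius w = sqrt ((Re w)\<^sup>2 + 4 * Im w)"

definition strip_model :: "complex \<Rightarrow> real \<times> real" where
 "strip_model w = (Re w / radius w, ln (radius w / 2))"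

text \<open>On the strip, \<^const>\<open>reeb_flow\<close> preserves the imaginary part of \<open>strip_point\<close> and increases the real part, so
 that \<open>strip_point\<close> identifies the strip with the punctured half-plane, and its lower end with the puncture.\<close>

definition strip_point :: "real \<times> real \<Rightarrow> complex" where
 "strip_point p = Complex (2 * fst p * exp (snd p)) ((exp (snd p))\<^sup>2 * (1 - (fst p)\<^sup>2))"

lemma radius_props:
 assumes "w \<in> half_plane - {0}"
 shows "radius w > 0" "(radius w)\<^sup>2 = (Re w)\<^sup>2 + 4 * Im w" "\<bar>Re w\<bar> \<le> radius w"
proof -
 have w: "Im w \<ge> 0" "Re w \<noteq> 0 \<or> Im w \<noteq> 0" using assms by (auto simp: half_plane_def complex_eq_iff)
 hence "(Re w)\<^sup>2 + 4 * Im w > 0" by (auto intro: add_pos_nonneg add_nonneg_pos)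
 thus "radius w > 0" "(radius w)\<^sup>2 = (Re w)\<^sup>2 + 4 * Im w" by (simp_all add: radius_def)
 have "sqrt ((Re w)\<^sup>2) \<le> radius w" unfolding radius_def using w by (intro real_sqrt_le_mono) simp
 thus "\<bar>Re w\<bar> \<le> radius w" by simp
qed

lemma strip_point_half_plane: assumes "p \<in> {-1..1} \<times> UNIV" shows "strip_point p \<in> half_plane - {0}"
proof -
 have "(fst p)\<^sup>2 \<le> 1" using assms by (auto simp: abs_square_le_1)
 thus ?thesis by (auto simp: strip_point_def half_plane_def complex_eq_iff)
qed

lemma strip_homeomorphism: "homeomorphism (half_plane - {0}) ({-1..1} \<times> UNIV) strip_model strip_point"
proof (rule homeomorphismI)
 have "continuous_on (half_plane - {0}) radius" unfolding radius_def[abs_def] by (intro continuous_intros)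
 thus "continuous_on (half_plane - {0}) strip_model"
  unfolding strip_model_def[abs_def] by (intro continuous_intros) (use radius_props(1) in force)+
 show "continuous_on ({-1..1} \<times> UNIV) strip_point"
  unfolding strip_point_def[abs_def] Complex_eq by (intro continuous_intros)
 show "strip_model ` (half_plane - {0}) \<subseteq> {-1..1} \<times> UNIV"
 proof (intro image_subsetI)
  fix w assume "w \<in> half_plane - {0}"
  from radius_props(1,3)[OF this] have "-1 \<le> Re w / radius w \<and> Re w / radius w \<le> 1" by (simp add: field_simps) linarith
  thus "strip_model w \<in> {-1..1} \<times> UNIV" by (simp add: strip_model_def)
 qed
 show "strip_point ` ({-1..1} \<times> UNIV) \<subseteq> half_plane - {0}" by (intro image_subsetI strip_point_half_plane)
 show "strip_point (strip_model w) = w" if "w \<in> half_plane - {0}" for w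
 proof -
  note r = radius_props(1,2)[OF that]
  have "(radius w / 2)\<^sup>2 * (1 - (Re w / radius w)\<^sup>2) = ((radius w)\<^sup>2 - (Re w)\<^sup>2) / 4" using r(1) by (simp add: field_simps)
  thus ?thesis using r by (simp add: strip_point_def strip_model_def complex_eq_iff)
 qed
 show "strip_model (strip_point p) = p" if "p \<in> {-1..1} \<times> UNIV" for p
 proof -
  have "(2 * fst p * exp (snd p))\<^sup>2 + 4 * ((exp (snd p))\<^sup>2 * (1 - (fst p)\<^sup>2)) = (2 * exp (snd p))\<^sup>2"
   by (simp add: power2_eq_square algebra_simps)
  hence "radius (strip_point p) = 2 * exp (snd p)"
   unfolding radius_def strip_point_def complex.sel by (simp only: real_sqrt_abs) simp
  thus ?thesis by (simp add: strip_model_def strip_point_def prod_eq_iff)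
 qed
qed

lemma strip_end_homeomorphic:
 "homeomorphic_map (top_of_set half_plane) (add_end ({-1..1} \<times> UNIV) (\<lambda>p. - snd p))
  (\<lambda>w. if w = 0 then None else Some (strip_model w))"
proof (rule homeomorphic_map_add_end[OF strip_homeomorphism])
 have e: "c < - snd (strip_model w) \<longleftrightarrow> radius w < 2 * exp (- c)" if w: "w \<in> half_plane - {0}" for w c
 proof -
  have "c < - snd (strip_model w) \<longleftrightarrow> ln (radius w / 2) < - c" by (auto simp: strip_model_def)
  also have "\<dots> \<longleftrightarrow> radius w / 2 < exp (- c)"
   using radius_props(1)[OF w] exp_less_cancel_iff[of "ln (radius w / 2)" "- c"] by simp
  finally show ?thesis by auto
 qed
 show "0 \<in> half_plane" by (simp add: half_plane_def)
 show "\<exists>r>0. \<forall>w\<in>half_plane - {0}. cmod w < r \<longrightarrow> c < - snd (strip_model w)" for c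
 proof -
  have "continuous_on UNIV radius" unfolding radius_def[abs_def] by (intro continuous_intros)
  hence "isCont radius 0" by (simp add: continuous_on_eq_continuous_at)
  moreover have "radius 0 = 0" by (simp add: radius_def)
  ultimately obtain r where "r > 0" "\<forall>w. dist w 0 < r \<longrightarrow> dist (radius w) 0 < 2 * exp (- c)"
   unfolding continuous_at_eps_delta by (metis exp_gt_zero mult_pos_pos zero_less_numeral)
  thus ?thesis using e by (intro exI[of _ r]) (auto simp: dist_real_def)
 qed
 show "\<exists>c. \<forall>w\<in>half_plane - {0}. c < - snd (strip_model w) \<longrightarrow> cmod w < r" if r: "r > 0" for r
 proof -
  define \<delta> where "\<delta> = min 1 (r / 2)"
  have \<delta>: "0 < \<delta>" "\<delta> \<le> 1" "2 * \<delta> \<le> r" using r by (auto simp: \<delta>_def)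
  have "cmod w < r" if w: "w \<in> half_plane - {0}" "- ln (\<delta> / 2) < - snd (strip_model w)" for w
  proof -
   note q = radius_props[OF w(1)]
   have q\<delta>: "radius w < \<delta>" using e[OF w(1)] w(2) \<delta>(1) by simp
   have "Im w \<ge> 0" using w(1) by (simp add: half_plane_def)
   hence "\<bar>Im w\<bar> \<le> (radius w)\<^sup>2" using q(2) zero_le_power2[of "Re w"] by linarith
   also have "\<dots> \<le> radius w" using q\<delta> \<delta>(2) q(1) by (simp add: power2_eq_square mult_left_le)
   finally show ?thesis using q(3) cmod_le[of w] q\<delta> \<delta>(3) by linarith
  qed
  thus ?thesis by blast
 qed
qed

lemma reeb_flow_strip:
 assumes p: "p \<in> {-1..1} \<times> UNIV"
 shows "reeb_flow t p \<in> {-1..1} \<times> UNIV"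
  "strip_point (reeb_flow t p) = Complex (exp (snd p) * ((1 + fst p) * exp t - (1 - fst p) * exp (- t))) (Im (strip_point p))"
proof -
 define s y where "s = fst p" and "y = snd p"
 \<comment> \<open>The map at time \<open>t\<close> sends \<open>s\<close> to \<open>b / a\<close>
   and adds \<open>ln a\<close> to \<open>y\<close>; the identity \<open>a^2 - b^2 = 1 - s^2\<close>
   gives the invariance of the imaginary part.\<close>
 define a where "a = cosh t + s * sinh t"
 define b where "b = s * cosh t + sinh t"
 have s: "-1 \<le> s" "s \<le> 1" using p by (auto simp: s_def)
 have ab: "2 * a = (1 + s) * exp t + (1 - s) * exp (- t)" "2 * b = (1 + s) * exp t - (1 - s) * exp (- t)"
  by (simp_all add: a_def b_def cosh_def sinh_def field_simps)
 have "(1 + s) * exp t \<ge> 0" "(1 - s) * exp (- t) \<ge> 0" using s by simp_all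
 moreover have "(1 + s) * exp t > 0 \<or> (1 - s) * exp (- t) > 0" using s by (auto simp: zero_less_mult_iff)
 ultimately have a: "a > 0" and ba: "\<bar>b\<bar> \<le> a" using ab by linarith+
 have pt: "reeb_flow t p = (b / a, y + ln a)" by (simp add: reeb_flow_def case_prod_unfold s_def y_def a_def b_def)
 have "\<bar>b / a\<bar> \<le> 1" using a ba by simp
 hence "-1 \<le> b / a \<and> b / a \<le> 1" by linarith
 thus "reeb_flow t p \<in> {-1..1} \<times> UNIV" by (simp add: pt)
 have e: "exp (y + ln a) = exp y * a" using a by (simp add: exp_add)
 have "a\<^sup>2 - b\<^sup>2 = (1 - s\<^sup>2) * ((cosh t)\<^sup>2 - (sinh t)\<^sup>2)" by (simp add: a_def b_def power2_eq_square algebra_simps)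
 hence "a\<^sup>2 - b\<^sup>2 = 1 - s\<^sup>2" by (simp add: cosh_square_eq)
 moreover have "(exp y * a)\<^sup>2 * (1 - (b / a)\<^sup>2) = (exp y)\<^sup>2 * (a\<^sup>2 - b\<^sup>2)"
  using a by (simp add: power_mult_distrib power_divide right_diff_distrib)
 ultimately have 1: "(exp (y + ln a))\<^sup>2 * (1 - (b / a)\<^sup>2) = (exp y)\<^sup>2 * (1 - s\<^sup>2)" unfolding e by simp
 have "2 * (b / a) * exp (y + ln a) = exp y * (2 * b)" unfolding e using a by simp
 thus "strip_point (reeb_flow t p) = Complex (exp (snd p) * ((1 + fst p) * exp t - (1 - fst p) * exp (- t))) (Im (strip_point p))"
  unfolding strip_point_def pt fst_conv snd_conv 1 ab(2) by (simp only: s_def y_def complex.sel)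
qed

text \<open>Along an orbit the real part is \<open>b * exp t - a * exp (- t)\<close> with
  nonnegative \<open>a\<close>, \<open>b\<close> that are not both zero. Vanishing of
  \<open>a\<close> or \<open>b\<close> marks the two bounding lines, whose levels fill only one half
  of the interval.\<close>

lemma reeb_levels:
 assumes \<epsilon>: "\<epsilon> > 0" and p: "p \<in> {-1..1} \<times> UNIV"
 defines "\<gamma> \<equiv> \<lambda>t. \<epsilon> * squash (Re (strip_point (reeb_flow t p)))"
 shows "strict_mono \<gamma>"
  "range \<gamma> = (if fst p = 1 then {0<..<\<epsilon>} else if fst p = - 1 then {- \<epsilon><..<0} else {- \<epsilon><..<\<epsilon>})"
proof -
 define a b where "a = exp (snd p) * (1 - fst p)" and "b = exp (snd p) * (1 + fst p)"
 have ab: "a \<ge> 0" "b \<ge> 0" "a > 0 \<or> b > 0" "a = 0 \<longleftrightarrow> fst p = 1" "b = 0 \<longleftrightarrow> fst p = -1"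
  using p by (auto simp: a_def b_def zero_less_mult_iff add_eq_0_iff)
 define h where "h t = b * exp t - a * exp (- t)" for t
 have \<gamma>: "\<gamma> t = \<epsilon> * squash (h t)" for t
  using reeb_flow_strip(2)[OF p, of t] by (simp add: \<gamma>_def h_def a_def b_def algebra_simps)
 have "strict_mono h"
 proof (rule strict_monoI)
  fix t u :: real assume tu: "t < u"
  have "b * exp t \<le> b * exp u" "a * exp (- u) \<le> a * exp (- t)" using tu ab by (simp_all add: mult_left_mono)
  moreover have "b * exp t < b * exp u \<or> a * exp (- u) < a * exp (- t)" using tu ab(3) by auto
  ultimately show "h t < h u" unfolding h_def by linarith
 qed
 hence "strict_mono (squash \<circ> h)" using strict_mono_squash by (intro strict_mono_o)
 thus "strict_mono \<gamma>" using \<epsilon> by (auto simp: \<gamma> strict_mono_def)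
 have onto: "c \<in> range \<gamma>" if c: "\<bar>c\<bar> < \<epsilon>" "\<exists>t. h t = unsquash (c / \<epsilon>)" for c
 proof -
  obtain t where "h t = unsquash (c / \<epsilon>)" using c by blast
  hence "\<gamma> t = c" using c(1) \<epsilon> squash_unsquash[of "c / \<epsilon>"] by (simp add: \<gamma>)
  thus ?thesis by blast
 qed
 have bd: "\<bar>\<gamma> t\<bar> < \<epsilon>" for t using squash_less_1[of "h t"] \<epsilon> by (simp add: \<gamma> abs_mult)
 have sgn: "0 < \<gamma> t \<longleftrightarrow> 0 < h t" "\<gamma> t < 0 \<longleftrightarrow> h t < 0" for t
  using \<epsilon> by (auto simp: \<gamma> squash_def zero_less_mult_iff mult_less_0_iff zero_less_divide_iff divide_less_0_iff)
 have us: "0 < unsquash (c / \<epsilon>) \<longleftrightarrow> 0 < c" "unsquash (c / \<epsilon>) < 0 \<longleftrightarrow> c < 0" if "\<bar>c\<bar> < \<epsilon>" for c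
  using that \<epsilon> unsquash_sign[of "c / \<epsilon>"] by (simp_all add: zero_less_divide_iff divide_less_0_iff)
 consider "a = 0" "b > 0" | "b = 0" "a > 0" | "a > 0" "b > 0" using ab by force
 thus "range \<gamma> = (if fst p = 1 then {0<..<\<epsilon>} else if fst p = - 1 then {- \<epsilon><..<0} else {- \<epsilon><..<\<epsilon>})"
 proof cases
  case 1
  have "range \<gamma> \<subseteq> {0<..<\<epsilon>}" using bd sgn 1 by (auto simp: h_def abs_less_iff)
  moreover have "c \<in> range \<gamma>" if c: "c \<in> {0<..<\<epsilon>}" for c
  proof (rule onto)
   have "h (ln (unsquash (c / \<epsilon>) / b)) = unsquash (c / \<epsilon>)" using us(1)[of c] c 1 by (simp add: h_def)
   thus "\<exists>t. h t = unsquash (c / \<epsilon>)" by blast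
  qed (use c in auto)
  ultimately show ?thesis using 1 ab(4) by auto
 next
  case 2
  have "range \<gamma> \<subseteq> {- \<epsilon><..<0}" using bd sgn 2 by (auto simp: h_def abs_less_iff) (metis minus_less_iff)
  moreover have "c \<in> range \<gamma>" if c: "c \<in> {- \<epsilon><..<0}" for c
  proof (rule onto)
   have "h (- ln (- unsquash (c / \<epsilon>) / a)) = unsquash (c / \<epsilon>)" using us(2)[of c] c 2 by (simp add: h_def divide_neg_pos)
   thus "\<exists>t. h t = unsquash (c / \<epsilon>)" by blast
  qed (use c in auto)
  ultimately show ?thesis using 2 ab(4,5) by auto
 next
  case 3
  have "range \<gamma> \<subseteq> {- \<epsilon><..<\<epsilon>}" using bd by (auto simp: abs_less_iff) (metis minus_less_iff)
  moreover have "c \<in> range \<gamma>" if c: "c \<in> {- \<epsilon><..<\<epsilon>}" for c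
  proof (rule onto)
   define d where "d = unsquash (c / \<epsilon>)"
   \<comment> \<open>The positive root of \<open>b * X^2 - d * X - a = 0\<close>, which is the
     equation \<open>h t = d\<close> for \<open>X = exp t\<close>.\<close>
   define X where "X = (d + sqrt (d\<^sup>2 + 4 * a * b)) / (2 * b)"
   have ab4: "4 * a * b > 0" using 3 by simp
   have "\<bar>d\<bar> < sqrt (d\<^sup>2 + 4 * a * b)" using ab4 by (intro real_less_rsqrt) simp
   hence X: "X > 0" using 3 by (simp add: X_def)
   have "(2 * b * X - d)\<^sup>2 = d\<^sup>2 + 4 * a * b" using 3 ab4 by (simp add: X_def)
   hence "4 * b * (b * X * X - a) = 4 * b * (d * X)" by (simp add: power2_eq_square algebra_simps)
   hence "b * X * X - a = d * X" using 3 by simp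
   hence "b * X - a / X = d" using X by (simp add: field_simps)
   hence "h (ln X) = d" using X by (simp add: h_def exp_minus field_simps)
   thus "\<exists>t. h t = unsquash (c / \<epsilon>)" unfolding d_def by blast
  qed (use c in auto)
  ultimately show ?thesis using 3 ab(4,5) by auto
 qed
qed

section \<open>Sectors on the surface\<close>

context local_flow
begin

lemma x0_singular: "k x0 \<in> singular_points S v" and x0_topspace: "k x0 \<in> topspace S" and x0_fixed: "v t (k x0) = k x0"
proof -
 show "k x0 \<in> singular_points S v" using isolated by blast
 thus "k x0 \<in> topspace S" "v t (k x0) = k x0" by (auto simp: singular_points_def)
qed

lemma orbit_avoids_x0: assumes "p \<in> M" shows "v t p \<noteq> k x0"
proof
 assume "v t p = k x0"
 hence "v (- t + t) p = k x0" using flow_add[OF flow, of p "- t" t] assms M_top x0_fixed by auto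
 thus False using flow_0[OF flow, of p] assms M_top by (auto simp: M_eq)
qed

text \<open>If the orbit had level \<open>0\<close> at time \<open>t\<close>, strict growth would
  force the times \<open>ts n\<close> to converge to \<open>t\<close>, and the limit would be
  \<open>v t p\<close> instead of the singular point. The argument covers the whole orbit, also
  outside the chart.\<close>

lemma no_zero_level:
 assumes p: "p \<in> M" and lim: "limitin S (\<lambda>n. v (ts n) p) (k x0) sequentially"
 shows "Fx (v t p) \<noteq> 0"
proof
 assume z: "Fx (v t p) = 0"
 note st = Fx_strict[OF p]
 have "limitin euclideanreal (Fx \<circ> (\<lambda>n. v (ts n) p)) (Fx (k x0)) sequentially"
  by (rule continuous_map_limit[OF continuous_Fx lim])
 hence Flim: "(\<lambda>n. Fx (v (ts n) p)) \<longlonglongrightarrow> 0" by (simp add: o_def Fx_def)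
 have "ts \<longlonglongrightarrow> t" unfolding tendsto_iff
 proof (intro allI impI)
  fix e :: real assume e: "e > 0"
  have "Fx (v (t - e) p) < 0" "0 < Fx (v (t + e) p)"
   using strict_monoD[OF st, of "t - e" t] strict_monoD[OF st, of t "t + e"] e z by auto
  hence "\<forall>\<^sub>F n in sequentially. Fx (v (t - e) p) < Fx (v (ts n) p)"
   "\<forall>\<^sub>F n in sequentially. Fx (v (ts n) p) < Fx (v (t + e) p)" using order_tendstoD[OF Flim] by auto
  thus "\<forall>\<^sub>F n in sequentially. dist (ts n) t < e"
   by eventually_elim (simp add: strict_mono_less[OF st] dist_real_def abs_less_iff)
 qed
 hence "limitin euclideanreal ts t sequentially" by simp
 hence "limitin S ((\<lambda>s. v s p) \<circ> ts) (v t p) sequentially"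
  using continuous_map_limit[OF flow_continuous_orbit[OF flow]] p M_top by blast
 hence "v t p = k x0" using limitin_Hausdorff_unique[OF _ lim] Hausdorff by (auto simp: o_def)
 thus False using orbit_avoids_x0[OF p] by blast
qed

lemma chart_homeomorphic:
 assumes \<Theta>: "homeomorphic_map (top_of_set D) (top_of_set (insert x0 A)) \<Theta>" and A: "A \<subseteq> V0"
 obtains G where "homeomorphic_map (subtopology S (insert (k x0) (k ` A))) (top_of_set D) G"
  "\<And>z. z \<in> D \<Longrightarrow> G (k (\<Theta> z)) = z"
proof -
 have "insert x0 A \<subseteq> B" using A x0_B by (auto simp: V0_B)
 hence "homeomorphic_map (top_of_set D) (subtopology S (k ` insert x0 A)) (k \<circ> \<Theta>)"
  using homeomorphic_map_compose[OF \<Theta> k_homeomorphic] by blast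
 then obtain G where G: "homeomorphic_maps (top_of_set D) (subtopology S (insert (k x0) (k ` A))) (k \<circ> \<Theta>) G"
  using homeomorphic_map_maps by (metis image_insert)
 have "homeomorphic_map (subtopology S (insert (k x0) (k ` A))) (top_of_set D) G"
  using G homeomorphic_maps_map by blast
 moreover have "G (k (\<Theta> z)) = z" if "z \<in> D" for z using G that by (simp add: homeomorphic_maps_def)
 ultimately show thesis using that by blast
qed

lemma sectorI:
 assumes \<Theta>: "homeomorphic_map (top_of_set D) (top_of_set (insert x0 A)) \<Theta>" and A: "A \<subseteq> V0"
  and z0: "0 \<in> D" "\<Theta> 0 = x0" and J: "nondegenerate_interval J" "J \<subseteq> {0..<2 * pi}"
  and g: "homeomorphic_map (top_of_set D) (top_of_set (insert 0 {rcis r \<theta> | r \<theta>. r \<in> {0<..<1} \<and> \<theta> \<in> J})) g" "g 0 = 0"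
 shows "sector S v (k x0) (k ` A)"
proof -
 obtain G where G: "homeomorphic_map (subtopology S (insert (k x0) (k ` A))) (top_of_set D) G"
  "\<And>z. z \<in> D \<Longrightarrow> G (k (\<Theta> z)) = z" using chart_homeomorphic[OF \<Theta> A] by blast
 have AM: "k ` A \<subseteq> M" using A by (auto simp: M_def)
 show ?thesis unfolding sector_def
 proof (intro conjI exI)
  show "k ` A \<subseteq> topspace S" using AM M_top by blast
  show "k x0 \<notin> k ` A" using AM by (auto simp: M_eq)
  show "homeomorphic_map (subtopology S (insert (k x0) (k ` A)))
    (top_of_set (insert 0 {rcis r \<theta> | r \<theta>. r \<in> {0<..<1} \<and> \<theta> \<in> J})) (g \<circ> G)"
   by (rule homeomorphic_map_compose[OF G(1) g(1)])
  show "(g \<circ> G) (k x0) = 0" using G(2)[OF z0(1)] z0(2) g(2) by simp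
 qed (fact x0_singular J)+
qed

text \<open>Levels are the common clock: the change of time sends \<open>t\<close> to the model time
  at which the model orbit has level \<open>Fx (v t p)\<close>. The hypothesis
  \<open>maximal\<close> excludes that the orbit, perhaps after leaving the chart, meets the sector
  at a level foreign to its model orbit.\<close>

lemma modelled_onI:
 fixes Q :: "(real \<times> real) set"
 assumes \<Theta>: "homeomorphic_map (top_of_set D) (top_of_set (insert x0 A)) \<Theta>" and A: "A \<subseteq> V0"
  and z0: "0 \<in> D" "\<Theta> 0 = x0" and hom: "homeomorphism (D - {0}) Q \<kappa> j"
  and m: "homeomorphic_map (top_of_set D) (add_end Q e) (\<lambda>z. if z = 0 then None else Some (\<kappa> z))"
  and w: "\<And>t p. p \<in> Q \<Longrightarrow> w t p \<in> Q" "\<And>p. p \<in> Q \<Longrightarrow> w 0 p = p"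
  and orbit: "\<And>t p. p \<in> Q \<Longrightarrow> f (\<Theta> (j (w t p))) \<in> I (\<Theta> (j p)) \<and>
          \<Psi> (f (\<Theta> (j (w t p)))) (\<Theta> (j p)) = \<Theta> (j (w t p))"
  and mono: "\<And>p. p \<in> Q \<Longrightarrow> strict_mono (\<lambda>t. f (\<Theta> (j (w t p))))"
  and range: "\<And>p. p \<in> Q \<Longrightarrow> is_interval (range (\<lambda>t. f (\<Theta> (j (w t p)))))"
  and maximal: "\<And>t p. p \<in> Q \<Longrightarrow> v t (k (\<Theta> (j p))) \<in> k ` A \<Longrightarrow>
          Fx (v t (k (\<Theta> (j p)))) \<in> range (\<lambda>t. f (\<Theta> (j (w t p))))"
 shows "modelled_on S v (k x0) (k ` A) w Q e"
proof -
 let ?m = "\<lambda>z. if z = 0 then None else Some (\<kappa> z)"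
 let ?A = "insert (k x0) (k ` A)"
 obtain G where G: "homeomorphic_map (subtopology S ?A) (top_of_set D) G"
  "\<And>z. z \<in> D \<Longrightarrow> G (k (\<Theta> z)) = z" using chart_homeomorphic[OF \<Theta> A] by blast
 have AM: "k ` A \<subseteq> M" using A by (auto simp: M_def)
 have j: "j q \<in> D - {0}" "\<kappa> (j q) = q" if "q \<in> Q" for q using hom that by (auto simp: homeomorphism_def)
 have \<kappa>: "\<kappa> z \<in> Q" "j (\<kappa> z) = z" if "z \<in> D - {0}" for z using hom that by (auto simp: homeomorphism_def)
 have \<Theta>im: "\<Theta> ` D = insert x0 A" and \<Theta>inj: "inj_on \<Theta> D"
  using homeomorphic_imp_surjective_map[OF \<Theta>] homeomorphic_imp_injective_map[OF \<Theta>] by simp_all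
 have \<Theta>A: "\<Theta> z \<in> A" if "z \<in> D - {0}" for z
 proof -
  have "\<Theta> z \<noteq> x0" using inj_onD[OF \<Theta>inj, of z 0] z0 that by auto
  thus ?thesis using \<Theta>im that by blast
 qed
 have h: "?m (G (k (\<Theta> (j q)))) = Some q" if "q \<in> Q" for q using j[OF that] G(2) by auto
 have "\<exists>\<tau>::real \<Rightarrow> real. strict_mono_on (time_interval v ?A p) \<tau> \<and>
   \<tau> ` time_interval v ?A p = time_interval (add_fixed_point w) (topspace (add_end Q e)) ((?m \<circ> G) p) \<and> \<tau> 0 = 0 \<and>
   (\<forall>t\<in>time_interval v ?A p. (?m \<circ> G) (v t p) = add_fixed_point w (\<tau> t) ((?m \<circ> G) p))" if p: "p \<in> ?A" for p
 proof (cases "p = k x0")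
  case True
  have n: "(?m \<circ> G) p = None" using True G(2)[OF z0(1)] z0(2) by simp
  have "time_interval v ?A p = UNIV" using x0_fixed True by (simp add: time_interval_def)
  moreover have "time_interval (add_fixed_point w) (topspace (add_end Q e)) None = UNIV"
   by (simp add: time_interval_def add_fixed_point_def)
  ultimately show ?thesis
   using n x0_fixed True by (intro exI[of _ "\<lambda>t. t"]) (auto simp: add_fixed_point_def strict_mono_on_def)
 next
  case False
  then obtain a where a: "a \<in> A" "p = k a" using p by blast
  then obtain z where z: "z \<in> D" "a = \<Theta> z" using \<Theta>im by blast
  have "z \<noteq> 0" using z z0(2) a A by (auto simp: V0_B)
  define q where "q = \<kappa> z"
  have q: "q \<in> Q" "p = k (\<Theta> (j q))" using \<kappa>[of z] z a \<open>z \<noteq> 0\<close> by (auto simp: q_def)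
  define b where "b = \<Theta> (j q)"
  have b: "b \<in> V0" "p = k b" using \<Theta>A[OF j(1)[OF q(1)]] A q(2) by (auto simp: b_def)
  have pM: "p \<in> M" using AM a by blast
  note st = Fx_strict[OF pM]
  define \<gamma> where "\<gamma> t = f (\<Theta> (j (w t q)))" for t
  have \<gamma>: "strict_mono \<gamma>" "is_interval (range \<gamma>)" using mono[OF q(1)] range[OF q(1)] by (simp_all add: \<gamma>_def[abs_def])
  have inv: "inv \<gamma> (\<gamma> u) = u" for u using strict_mono_imp_inj_on[OF \<gamma>(1)] by (rule inv_f_f)
  have \<gamma>0: "\<gamma> 0 = Fx (v 0 p)" using w(2)[OF q(1)] flow_k(1)[OF b(1)] b(2) by (simp add: \<gamma>_def f_def b_def)
  have \<gamma>I: "\<gamma> u \<in> I b" "\<Psi> (\<gamma> u) b = \<Theta> (j (w u q))" for u using orbit[OF q(1)] by (simp_all add: \<gamma>_def b_def)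
  have at: "v t p = k (\<Theta> (j (w u q)))" if "Fx (v t p) = \<gamma> u" for t u
  proof -
   have "arrival (\<gamma> u) b = t" using arrival_eq[OF b(1), of t] that b(2) by simp
   thus ?thesis using I_D(5)[OF b(1) \<gamma>I(1), of u] \<gamma>I(2) b(2) by simp
  qed
  have T: "{t. v t p \<in> ?A} = {t. Fx (v t p) \<in> range \<gamma>}"
  proof (intro Collect_cong iffI)
   fix t assume "v t p \<in> ?A"
   hence "v t p \<in> k ` A" using orbit_avoids_x0[OF pM] by blast
   thus "Fx (v t p) \<in> range \<gamma>" using maximal[OF q(1), of t] q(2) by (simp add: \<gamma>_def[abs_def])
  next
   fix t assume "Fx (v t p) \<in> range \<gamma>"
   then obtain u where "Fx (v t p) = \<gamma> u" by blast
   hence "v t p = k (\<Theta> (j (w u q)))" by (rule at)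
   thus "v t p \<in> ?A" using \<Theta>A[OF j(1)[OF w(1)[OF q(1)]]] by blast
  qed
  \<comment> \<open>Strict growth makes the set of times spent in the sector an interval, so it is
    its own component of \<open>0\<close>.\<close>
  have "is_interval {t. Fx (v t p) \<in> range \<gamma>}" unfolding is_interval_1
  proof (intro ballI allI impI)
   fix r s t assume rst: "r \<in> {t. Fx (v t p) \<in> range \<gamma>}" "s \<in> {t. Fx (v t p) \<in> range \<gamma>}" "r \<le> t \<and> t \<le> s"
   have "Fx (v r p) \<le> Fx (v t p)" "Fx (v t p) \<le> Fx (v s p)" using rst(3) strict_mono_less_eq[OF st] by auto
   thus "t \<in> {t. Fx (v t p) \<in> range \<gamma>}" using rst(1,2) \<gamma>(2) unfolding is_interval_1 by blast
  qed
  hence "connected {t. Fx (v t p) \<in> range \<gamma>}" by (simp add: is_interval_connected_1)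
  moreover have "0 \<in> {t. Fx (v t p) \<in> range \<gamma>}" using \<gamma>0 by (metis mem_Collect_eq rangeI)
  ultimately have TI: "time_interval v ?A p = {t. Fx (v t p) \<in> range \<gamma>}"
   unfolding time_interval_def T by (rule connected_component_eq_self)
  have TI': "time_interval (add_fixed_point w) (topspace (add_end Q e)) (Some q) = UNIV"
   using w(1)[OF q(1)] by (simp add: time_interval_def add_fixed_point_def)
  have hp: "(?m \<circ> G) p = Some q" using h[OF q(1)] q(2) by simp
  show ?thesis unfolding hp TI TI'
  proof (intro exI[of _ "\<lambda>t. inv \<gamma> (Fx (v t p))"] conjI ballI)
   show "strict_mono_on {t. Fx (v t p) \<in> range \<gamma>} (\<lambda>t. inv \<gamma> (Fx (v t p)))"
   proof (rule strict_mono_onI)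
    fix r s assume rs: "r \<in> {t. Fx (v t p) \<in> range \<gamma>}" "s \<in> {t. Fx (v t p) \<in> range \<gamma>}" "r < s"
    obtain r' s' where *: "Fx (v r p) = \<gamma> r'" "Fx (v s p) = \<gamma> s'" using rs(1,2) by blast
    have "\<gamma> r' < \<gamma> s'" using strict_monoD[OF st rs(3)] * by simp
    thus "inv \<gamma> (Fx (v r p)) < inv \<gamma> (Fx (v s p))" using * inv strict_mono_less[OF \<gamma>(1)] by simp
   qed
   have "u \<in> (\<lambda>t. inv \<gamma> (Fx (v t p))) ` {t. Fx (v t p) \<in> range \<gamma>}" for u
   proof (rule image_eqI)
    have "Fx (v (arrival (\<gamma> u) b) p) = \<gamma> u" using I_D(2)[OF b(1) \<gamma>I(1)] b(2) by simp
    thus "u = inv \<gamma> (Fx (v (arrival (\<gamma> u) b) p))" "arrival (\<gamma> u) b \<in> {t. Fx (v t p) \<in> range \<gamma>}" using inv by auto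
   qed
   thus "(\<lambda>t. inv \<gamma> (Fx (v t p))) ` {t. Fx (v t p) \<in> range \<gamma>} = UNIV" by blast
   show "inv \<gamma> (Fx (v 0 p)) = 0" unfolding \<gamma>0[symmetric] by (rule inv)
   fix t assume "t \<in> {t. Fx (v t p) \<in> range \<gamma>}"
   then obtain u where u: "Fx (v t p) = \<gamma> u" by blast
   show "(?m \<circ> G) (v t p) = add_fixed_point w (inv \<gamma> (Fx (v t p))) (Some q)"
    using at[OF u] h[OF w(1)[OF q(1)]] inv u by (simp add: add_fixed_point_def)
  qed
 qed
 moreover have "homeomorphic_map (subtopology S ?A) (subtopology (add_end Q e) (topspace (add_end Q e))) (?m \<circ> G)"
  unfolding subtopology_topspace by (rule homeomorphic_map_compose[OF G(1) m])
 moreover have "?A \<subseteq> topspace S" using AM M_top x0_topspace by blast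
 moreover have "(?m \<circ> G) (k x0) = None" using G(2)[OF z0(1)] z0(2) by simp
 ultimately show ?thesis unfolding modelled_on_def equivalence_on_def by (intro exI[of _ "?m \<circ> G"] conjI ballI) auto
qed

end

lemma half_disc_polar:
 "insert 0 {rcis r \<theta> | r \<theta>. r \<in> {0<..<1} \<and> \<theta> \<in> {0..pi}} = ball 0 1 \<inter> half_plane"
proof
 show "insert 0 {rcis r \<theta> | r \<theta>. r \<in> {0<..<1} \<and> \<theta> \<in> {0..pi}} \<subseteq> ball 0 1 \<inter> half_plane"
  by (auto simp: half_plane_def sin_ge_zero)
 show "ball 0 1 \<inter> half_plane \<subseteq> insert 0 {rcis r \<theta> | r \<theta>. r \<in> {0<..<1} \<and> \<theta> \<in> {0..pi}}"
 proof
  fix z assume z: "z \<in> ball 0 1 \<inter> half_plane"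
  show "z \<in> insert 0 {rcis r \<theta> | r \<theta>. r \<in> {0<..<1} \<and> \<theta> \<in> {0..pi}}"
  proof (cases "z = 0")
   case False
   have "0 \<le> Arg z" "Arg z \<le> pi" using z Arg_less_0[of z] Arg_le_pi[of z] by (auto simp: half_plane_def)
   thus ?thesis
    using z False rcis_cmod_Arg[of z] by (intro insertI2 CollectI exI[of _ "cmod z"] exI[of _ "Arg z"]) auto
  qed simp
 qed
qed

lemma half_disc_homeomorphism:
 "homeomorphism half_plane (ball 0 1 \<inter> half_plane) (\<lambda>w. w /\<^sub>R (1 + cmod w)) (\<lambda>u. u /\<^sub>R (1 - cmod u))"
proof (rule homeomorphismI)
 have pos: "1 + cmod w > 0" for w by (simp add: add_pos_nonneg)
 have nm: "cmod (w /\<^sub>R (1 + cmod w)) = cmod w / (1 + cmod w)" for w using pos[of w] by (simp add: divide_inverse)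
 have "1 + cmod w \<noteq> 0" for w using pos[of w] by linarith
 thus "continuous_on half_plane (\<lambda>w. w /\<^sub>R (1 + cmod w))" by (intro continuous_intros) auto
 show "continuous_on (ball 0 1 \<inter> half_plane) (\<lambda>u. u /\<^sub>R (1 - cmod u))" by (intro continuous_intros) auto
 show "(\<lambda>w. w /\<^sub>R (1 + cmod w)) ` half_plane \<subseteq> ball 0 1 \<inter> half_plane"
 proof (intro image_subsetI)
  fix w assume "w \<in> half_plane"
  moreover have "cmod (w /\<^sub>R (1 + cmod w)) < 1" unfolding nm using pos[of w] by simp
  ultimately show "w /\<^sub>R (1 + cmod w) \<in> ball 0 1 \<inter> half_plane" using pos[of w] by (simp add: half_plane_def)
 qed
 show "(\<lambda>u. u /\<^sub>R (1 - cmod u)) ` (ball 0 1 \<inter> half_plane) \<subseteq> half_plane" by (auto simp: half_plane_def)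
 show "(w /\<^sub>R (1 + cmod w)) /\<^sub>R (1 - cmod (w /\<^sub>R (1 + cmod w))) = w" for w
 proof -
  have "1 - cmod (w /\<^sub>R (1 + cmod w)) = inverse (1 + cmod w)" unfolding nm using pos[of w] by (simp add: field_simps)
  thus ?thesis using pos[of w] by simp
 qed
 show "(u /\<^sub>R (1 - cmod u)) /\<^sub>R (1 + cmod (u /\<^sub>R (1 - cmod u))) = u" if "u \<in> ball 0 1 \<inter> half_plane" for u
 proof -
  have u1: "1 - cmod u > 0" using that by simp
  hence "cmod (u /\<^sub>R (1 - cmod u)) = cmod u / (1 - cmod u)" by (simp add: divide_inverse)
  hence "1 + cmod (u /\<^sub>R (1 - cmod u)) = inverse (1 - cmod u)" using u1 by (simp add: field_simps)
  thus ?thesis using u1 by simp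
 qed
qed

context sectored_flow
begin

lemma open_rectangle_eq: "open_rectangle = open_rect \<epsilon>" by (simp add: open_rectangle_def open_rect_def)

lemma sector_chart_homeomorphic:
 assumes "sector_chart A D E \<Theta>"
 shows "homeomorphic_map (top_of_set D) (top_of_set (insert x0 A)) \<Theta>" "A \<subseteq> V" "0 \<in> D" "\<Theta> 0 = x0" "A = \<Theta> ` (D - {0})"
proof -
 have ch: "compact E" "D \<subseteq> E" "continuous_on E \<Theta>" "inj_on \<Theta> E"
  and *: "A \<subseteq> V" "0 \<in> D" "\<Theta> 0 = x0" "A = \<Theta> ` (D - {0})"
  using assms unfolding sector_chart_def by - ((elim conjE, assumption)+)
 show "A \<subseteq> V" "0 \<in> D" "\<Theta> 0 = x0" "A = \<Theta> ` (D - {0})" by (fact *)+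
 obtain \<tau> where "homeomorphism E (\<Theta> ` E) \<Theta> \<tau>" using homeomorphism_compact[OF ch(1,3) refl ch(4)] by blast
 moreover have "\<Theta> ` D = insert x0 A" using * by blast
 moreover have "\<Theta> ` D \<subseteq> \<Theta> ` E" using ch(2) by (rule image_mono)
 ultimately have "homeomorphism D (insert x0 A) \<Theta> \<tau>"
  using homeomorphism_of_subsets[of E "\<Theta> ` E" \<Theta> \<tau> D "insert x0 A"] ch(2) by simp
 thus "homeomorphic_map (top_of_set D) (top_of_set (insert x0 A)) \<Theta>" by (rule homeomorphism_homeomorphic_map)
qed

lemma parabolic_map'_orbit:
 assumes g: "continuous_on {0..1} g" "inj_on g {0..1}" "g ` {0..1} \<subseteq> C'" and z: "z \<in> cone"
 shows "f (parabolic_map' g z) = \<epsilon> * cmod z"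
  "z \<noteq> 0 \<Longrightarrow> 0 < c \<Longrightarrow> c \<le> \<epsilon> \<Longrightarrow> c \<in> I (parabolic_map' g z) \<and>
    \<Psi> c (parabolic_map' g z) = parabolic_map' g (rcis (c / \<epsilon>) (Arg z))"
proof -
 note rev = sectored_reversed
 have g': "g ` {0..1} \<subseteq> sectored_flow.C x0 R (\<lambda>z. - f z) (\<lambda>z. uminus ` I z) (\<lambda>c. \<Psi> (- c)) \<epsilon>"
  using g(3) by (simp add: reversed_C)
 show "f (parabolic_map' g z) = \<epsilon> * cmod z"
  using sectored_flow.f_parabolic_map[OF rev g(1,2) g' z] by (simp add: reversed_parabolic_map)
 show "z \<noteq> 0 \<Longrightarrow> 0 < c \<Longrightarrow> c \<le> \<epsilon> \<Longrightarrow> c \<in> I (parabolic_map' g z) \<and>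
    \<Psi> c (parabolic_map' g z) = parabolic_map' g (rcis (c / \<epsilon>) (Arg z))"
  using sectored_flow.parabolic_orbit[OF rev g(1,2) g' z, of "- c"] by (simp add: reversed_parabolic_map uminus_mem_image)
qed

end

context local_flow
begin

lemma limitin_k:
 assumes "ps \<longlonglongrightarrow> p" "\<And>n. ps n \<in> B" "p \<in> B"
 shows "limitin S (\<lambda>n. k (ps n)) (k p) sequentially"
proof -
 have "limitin (top_of_set B) ps p sequentially" using assms by (simp add: limitin_subtopology)
 hence "limitin S (k \<circ> ps) (k p) sequentially"
  by (rule continuous_map_limit[OF continuous_map_into_fulltopology[OF chart_props(1)]])
 thus ?thesis by (simp add: o_def)
qed

text \<open>The levels of the complete orbit form an interval, and \<open>no_zero_level\<close>
  keeps \<open>0\<close> out of it.\<close>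

lemma orbit_sign:
 assumes z: "z \<in> V0" and cs: "\<And>n. cs n \<in> I z" "(\<lambda>n. \<Psi> (cs n) z) \<longlonglongrightarrow> x0"
 shows "f z < 0 \<Longrightarrow> Fx (v t (k z)) < 0" "f z > 0 \<Longrightarrow> Fx (v t (k z)) > 0"
proof -
 have "limitin S (\<lambda>n. k (\<Psi> (cs n) z)) (k x0) sequentially"
  using I_D(4)[OF z cs(1)] by (intro limitin_k cs(2) x0_B) (auto simp: V0_B)
 hence lim: "limitin S (\<lambda>n. v (arrival (cs n) z) (k z)) (k x0) sequentially" using I_D(5)[OF z cs(1)] by simp
 have "connected (range (\<lambda>s. Fx (v s (k z))))" by (intro connected_continuous_image continuous_Fx_orbit z) simp
 hence iv: "is_interval (range (\<lambda>s. Fx (v s (k z))))" by (simp add: is_interval_connected_1)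
 have n: "0 \<notin> range (\<lambda>s. Fx (v s (k z)))" using no_zero_level[OF M_\<phi>(4)[OF z] lim] by auto
 have m: "f z \<in> range (\<lambda>s. Fx (v s (k z)))" using flow_k(1)[OF z] by (intro image_eqI[of _ _ 0]) (auto simp: f_def)
 have m': "Fx (v t (k z)) \<in> range (\<lambda>s. Fx (v s (k z)))" by blast
 show "f z < 0 \<Longrightarrow> Fx (v t (k z)) < 0" using iv[unfolded is_interval_1, rule_format, OF m m', of 0] n by linarith
 show "f z > 0 \<Longrightarrow> Fx (v t (k z)) > 0" using iv[unfolded is_interval_1, rule_format, OF m' m, of 0] n by linarith
qed

text \<open>Levels determine times along an orbit, so an interval of levels corresponds to an
  interval of times.\<close>

lemma orbit_arcI:
 assumes z: "z \<in> V0" and ab: "a < b" "{a<..<b} \<subseteq> I z"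
 shows "orbit_arc S v (k ` (\<lambda>c. \<Psi> c z) ` {a<..<b})"
proof -
 define T where "T = {t. Fx (v t (k z)) \<in> {a<..<b}}"
 note st = Fx_strict[OF M_\<phi>(4)[OF z]]
 have arr: "arrival c z \<in> T" "k (\<Psi> c z) = v (arrival c z) (k z)" if "c \<in> {a<..<b}" for c
  using I_D(2,5)[OF z, of c] that ab(2) by (auto simp: T_def)
 have arr': "v t (k z) = k (\<Psi> (Fx (v t (k z))) z)" if "t \<in> T" for t
  using arr(2)[of "Fx (v t (k z))"] arrival_eq[OF z, of t] that by (simp add: T_def)
 show ?thesis unfolding orbit_arc_def
 proof (intro exI conjI)
  show "k z \<in> topspace S" using M_\<phi>(4)[OF z] M_top by blast
  show "nondegenerate_interval T" unfolding nondegenerate_interval_def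
  proof
   show "is_interval T" unfolding is_interval_1
   proof (intro ballI allI impI)
    fix r s t assume rst: "r \<in> T" "s \<in> T" "r \<le> t \<and> t \<le> s"
    have "Fx (v r (k z)) \<le> Fx (v t (k z))" "Fx (v t (k z)) \<le> Fx (v s (k z))"
     using rst(3) strict_mono_less_eq[OF st] by auto
    thus "t \<in> T" using rst(1,2) by (auto simp: T_def)
   qed
   obtain c where c: "a < c" "c < b" using dense ab(1) by blast
   obtain d where d: "c < d" "d < b" using dense c by blast
   have "Fx (v (arrival c z) (k z)) < Fx (v (arrival d z) (k z))"
    using I_D(2)[OF z, of c] I_D(2)[OF z, of d] c d ab(2) by (auto simp: subset_iff)
   hence "arrival c z < arrival d z" using strict_mono_less[OF st] by simp
   thus "\<exists>a\<in>T. \<exists>b\<in>T. a < b" using arr(1)[of c] arr(1)[of d] c d by auto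
  qed
  show "inj_on (\<lambda>t. v t (k z)) T" using Fx_inj[OF M_\<phi>(4)[OF z]] by (intro inj_onI) simp
  show "k ` (\<lambda>c. \<Psi> c z) ` {a<..<b} = (\<lambda>t. v t (k z)) ` T"
  proof
   show "k ` (\<lambda>c. \<Psi> c z) ` {a<..<b} \<subseteq> (\<lambda>t. v t (k z)) ` T" unfolding image_image
   proof (intro image_subsetI)
    fix c assume c: "c \<in> {a<..<b}"
    show "k (\<Psi> c z) \<in> (\<lambda>t. v t (k z)) ` T" unfolding arr(2)[OF c] by (intro imageI arr(1)[OF c])
   qed
   show "(\<lambda>t. v t (k z)) ` T \<subseteq> k ` (\<lambda>c. \<Psi> c z) ` {a<..<b}"
   proof (intro image_subsetI)
    fix t assume t: "t \<in> T"
    hence "Fx (v t (k z)) \<in> {a<..<b}" by (simp add: T_def)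
    thus "v t (k z) \<in> k ` (\<lambda>c. \<Psi> c z) ` {a<..<b}" by (subst arr'[OF t]) (intro imageI)
   qed
  qed
 qed
qed

text \<open>The case \<open>\<sigma> = 1\<close> is that of stable orbits, with negative levels, and
  \<open>\<sigma> = -1\<close> that of unstable ones.\<close>

lemma parabolic_sectorI:
 assumes \<Theta>: "homeomorphic_map (top_of_set open_cone) (top_of_set (insert x0 A)) \<Theta>" "A \<subseteq> V0"
  "\<Theta> 0 = x0" "A = \<Theta> ` (open_cone - {0})"
  and \<sigma>: "\<sigma> = 1 \<or> \<sigma> = -1" and \<epsilon>: "\<epsilon> > 0"
  and f: "\<And>z. z \<in> open_cone \<Longrightarrow> f (\<Theta> z) = - \<sigma> * \<epsilon> * cmod z"
  and orbit: "\<And>z r. z \<in> open_cone - {0} \<Longrightarrow> 0 < r \<Longrightarrow> r < 1 \<Longrightarrow>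
    - \<sigma> * \<epsilon> * r \<in> I (\<Theta> z) \<and> \<Psi> (- \<sigma> * \<epsilon> * r) (\<Theta> z) = \<Theta> (rcis r (Arg z))"
 shows "parabolic_sector S v (k x0) (k ` A)"
proof -
 have \<sigma>2: "\<sigma> * \<sigma> = 1" using \<sigma> by auto
 have c0: "0 \<in> open_cone" by (simp add: open_cone_iff)
 have J: "nondegenerate_interval {0..1::real}"
  unfolding nondegenerate_interval_def by (intro conjI bexI[of _ 0] bexI[of _ 1]) (auto simp: is_interval_cc)
 let ?J = "UNIV \<times> {0..1::real} :: (real \<times> real) set"
 let ?j = "parabolic_point \<sigma>"
 have tr: "translation_flow t p \<in> ?J" if "p \<in> ?J" for t p using that by (auto simp: translation_flow_def)
 define r where "r t p = 1 / (1 + exp (\<sigma> * (fst p + t)))" for t and p :: "real \<times> real"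
 have r: "0 < r t p" "r t p < 1" for t p by (auto simp: r_def add_pos_pos)
 have jr: "?j (translation_flow t p) = rcis (r t p) (Arg (?j p))" if "p \<in> ?J" for t p
  using parabolic_point_polar(2)[OF that, of \<sigma>]
  by (simp add: parabolic_point_def translation_flow_def case_prod_unfold r_def)
 have lev: "f (\<Theta> (?j (translation_flow t p))) = - \<sigma> * \<epsilon> * r t p" if "p \<in> ?J" for t p
  using f[of "?j (translation_flow t p)"] parabolic_point_polar(1,3)[OF tr[OF that], of \<sigma> t]
  by (simp add: r_def translation_flow_def case_prod_unfold)
 have "modelled_on S v (k x0) (k ` A) translation_flow ?J (\<lambda>p. \<sigma> * fst p)"
 proof (rule modelled_onI[OF \<Theta>(1,2) c0 \<Theta>(3) parabolic_homeomorphism[OF \<sigma>2] parabolic_end_homeomorphic[OF \<sigma>2]])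
  fix p assume p: "p \<in> ?J"
  show "translation_flow t p \<in> ?J" for t by (rule tr[OF p])
  show "translation_flow 0 p = p" by (simp add: translation_flow_def case_prod_unfold)
  show "f (\<Theta> (?j (translation_flow t p))) \<in> I (\<Theta> (?j p)) \<and>
    \<Psi> (f (\<Theta> (?j (translation_flow t p)))) (\<Theta> (?j p)) = \<Theta> (?j (translation_flow t p))" for t
   unfolding lev[OF p] using orbit[OF parabolic_point_polar(3)[OF p, of \<sigma>] r, of t p] jr[OF p, of t] by simp
  show "strict_mono (\<lambda>t. f (\<Theta> (?j (translation_flow t p))))" unfolding lev[OF p]
  proof (rule strict_monoI)
   fix s t :: real assume st: "s < t"
   have pos: "0 < 1 + exp x" for x :: real by (simp add: add_pos_pos)
   have "- \<sigma> * r s p < - \<sigma> * r t p" using \<sigma>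
   proof
    assume "\<sigma> = 1"
    thus ?thesis using st pos by (auto simp: r_def intro!: divide_strict_left_mono mult_pos_pos)
   next
    assume "\<sigma> = -1"
    thus ?thesis using st pos by (auto simp: r_def intro!: divide_strict_left_mono mult_pos_pos)
   qed
   thus "- \<sigma> * \<epsilon> * r s p < - \<sigma> * \<epsilon> * r t p" using \<epsilon> by (simp add: mult.assoc mult.left_commute[of _ \<epsilon>])
  qed
  have ne: "1 + exp x \<noteq> 0" for x :: real using exp_gt_zero[of x] by linarith
  have "continuous_on UNIV (\<lambda>t. - \<sigma> * \<epsilon> * r t p)" unfolding r_def by (intro continuous_intros) (use ne in auto)
  thus "is_interval (range (\<lambda>t. f (\<Theta> (?j (translation_flow t p)))))"
   unfolding lev[OF p] is_interval_connected_1 by (rule connected_continuous_image) simp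
  fix t assume "v t (k (\<Theta> (?j p))) \<in> k ` A"
  then obtain z where z: "z \<in> open_cone - {0}" "v t (k (\<Theta> (?j p))) = k (\<Theta> z)" using \<Theta>(4) by blast
  hence "Fx (v t (k (\<Theta> (?j p)))) = - \<sigma> * \<epsilon> * cmod z" using f[of z] by (simp add: f_def)
  moreover have "r (\<sigma> * ln ((1 - cmod z) / cmod z) - fst p) p = cmod z"
  proof -
   have c: "0 < cmod z" "cmod z < 1" using z(1) by (auto simp: open_cone_iff)
   have eq: "\<sigma> * (fst p + (\<sigma> * ln ((1 - cmod z) / cmod z) - fst p)) = ln ((1 - cmod z) / cmod z)"
    using \<sigma>2 by (simp flip: mult.assoc)
   have "r (\<sigma> * ln ((1 - cmod z) / cmod z) - fst p) p = 1 / (1 + (1 - cmod z) / cmod z)"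
    unfolding r_def eq using c by simp
   also have "\<dots> = cmod z" using c by (simp add: field_simps)
   finally show ?thesis .
  qed
  ultimately show "Fx (v t (k (\<Theta> (?j p)))) \<in> range (\<lambda>t. f (\<Theta> (?j (translation_flow t p))))"
   unfolding lev[OF p] by (metis rangeI)
 qed
 hence "modelled_on S v (k x0) (k ` A) translation_flow ?J fst \<or>
   modelled_on S v (k x0) (k ` A) translation_flow ?J (\<lambda>p. - fst p)" using \<sigma> by auto
 moreover have "sector S v (k x0) (k ` A)"
 proof (rule sectorI[OF \<Theta>(1,2) c0 \<Theta>(3) J])
  show "{0..1} \<subseteq> {0..<2 * pi}" using pi_gt3 by auto
  show "homeomorphic_map (top_of_set open_cone) (top_of_set (insert 0 {rcis r \<theta> |r \<theta>. r \<in> {0<..<1} \<and> \<theta> \<in> {0..1}})) (\<lambda>z. z)"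
   unfolding open_cone_def by (simp add: homeomorphic_map_id[unfolded id_def])
 qed simp
 ultimately show ?thesis unfolding parabolic_sector_def using J by blast
qed

lemma hyperbolic_sectorI:
 assumes \<Theta>: "homeomorphic_map (top_of_set (open_rect \<epsilon>)) (top_of_set (insert x0 A)) \<Theta>" "A \<subseteq> V0"
  "\<Theta> 0 = x0" "A = \<Theta> ` (open_rect \<epsilon> - {0})" and \<epsilon>: "\<epsilon> > 0"
  and f: "\<And>z. z \<in> open_rect \<epsilon> \<Longrightarrow> f (\<Theta> z) = Re z"
  and orbit: "\<And>z c. z \<in> open_rect \<epsilon> - {0} \<Longrightarrow> \<bar>c\<bar> < \<epsilon> \<Longrightarrow> Im z \<noteq> 0 \<or> c * Re z > 0 \<Longrightarrow>
    c \<in> I (\<Theta> z) \<and> \<Psi> c (\<Theta> z) = \<Theta> (Complex c (Im z))"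
  and sign: "\<And>z t. z \<in> open_rect \<epsilon> - {0} \<Longrightarrow> Im z = 0 \<Longrightarrow> Fx (v t (k (\<Theta> z))) * Re z > 0"
 shows "hyperbolic_sector S v (k x0) (k ` A)"
proof -
 let ?Q = "{-1..1} \<times> UNIV :: (real \<times> real) set"
 define \<Theta>' where "\<Theta>' = \<Theta> \<circ> unspread \<epsilon>"
 have hom: "homeomorphism (open_rect \<epsilon>) half_plane (spread \<epsilon>) (unspread \<epsilon>)" by (rule spread_homeomorphism[OF \<epsilon>])
 have \<Theta>': "homeomorphic_map (top_of_set half_plane) (top_of_set (insert x0 A)) \<Theta>'" unfolding \<Theta>'_def
  by (rule homeomorphic_map_compose[OF homeomorphism_homeomorphic_map[OF homeomorphism_symD[OF hom]] \<Theta>(1)])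
 have \<Theta>'0: "0 \<in> half_plane" "\<Theta>' 0 = x0" using \<Theta>(3) by (simp_all add: \<Theta>'_def unspread_def squash_def half_plane_def Complex_eq)
 have rect: "unspread \<epsilon> w \<in> open_rect \<epsilon> - {0}" if "w \<in> half_plane - {0}" for w
  using hom that \<epsilon> by (auto simp: homeomorphism_def unspread_def complex_eq_iff)
 have j: "unspread \<epsilon> (strip_point p) \<in> open_rect \<epsilon> - {0}" if "p \<in> ?Q" for p
  by (rule rect[OF strip_point_half_plane[OF that]])
 have w0: "reeb_flow 0 p = p" for p by (simp add: reeb_flow_def case_prod_unfold)
 define \<gamma> where "\<gamma> p t = \<epsilon> * squash (Re (strip_point (reeb_flow t p)))" for p t
 have jw: "unspread \<epsilon> (strip_point (reeb_flow t p)) = Complex (\<gamma> p t) (Im (unspread \<epsilon> (strip_point p)))" if "p \<in> ?Q" for t p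
  unfolding \<gamma>_def reeb_flow_strip(2)[OF that] unspread_def by simp
 have lev: "f (\<Theta>' (strip_point (reeb_flow t p))) = \<gamma> p t" if "p \<in> ?Q" for t p
  using f j[OF reeb_flow_strip(1)[OF that]] jw[OF that] by (simp add: \<Theta>'_def)
 note levels = reeb_levels[OF \<epsilon>, folded \<gamma>_def]
 have "modelled_on S v (k x0) (k ` A) reeb_flow ?Q (\<lambda>p. - snd p)"
 proof (rule modelled_onI[OF \<Theta>' \<Theta>(2) \<Theta>'0 strip_homeomorphism strip_end_homeomorphic])
  fix p assume p: "p \<in> ?Q"
  let ?z = "unspread \<epsilon> (strip_point p)"
  have Re: "Re ?z = \<gamma> p 0" by (simp add: \<gamma>_def w0 unspread_def)
  have L: "\<gamma> p t \<in> (if fst p = 1 then {0<..<\<epsilon>} else if fst p = - 1 then {- \<epsilon><..<0} else {- \<epsilon><..<\<epsilon>})" for t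
   using levels(2)[OF p] by blast
  have Im: "Im ?z = 0 \<longleftrightarrow> fst p = 1 \<or> fst p = -1" by (auto simp: unspread_def strip_point_def power2_eq_1_iff)
  show "reeb_flow t p \<in> ?Q" for t by (rule reeb_flow_strip(1)[OF p])
  show "reeb_flow 0 p = p" by (rule w0)
  show "f (\<Theta>' (strip_point (reeb_flow t p))) \<in> I (\<Theta>' (strip_point p)) \<and>
    \<Psi> (f (\<Theta>' (strip_point (reeb_flow t p)))) (\<Theta>' (strip_point p)) = \<Theta>' (strip_point (reeb_flow t p))" for t
  proof -
   have "Im ?z \<noteq> 0 \<or> \<gamma> p t * Re ?z > 0"
    using L[of t] L[of 0] Im by (auto simp: Re intro: mult_pos_pos mult_neg_neg)
   moreover have "\<bar>\<gamma> p t\<bar> < \<epsilon>" using L[of t] \<epsilon> by (auto split: if_splits)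
   ultimately show ?thesis using orbit[OF j[OF p], of "\<gamma> p t"] unfolding lev[OF p] by (simp add: \<Theta>'_def jw[OF p])
  qed
  show "strict_mono (\<lambda>t. f (\<Theta>' (strip_point (reeb_flow t p))))" unfolding lev[OF p] by (rule levels(1)[OF p])
  show "is_interval (range (\<lambda>t. f (\<Theta>' (strip_point (reeb_flow t p)))))"
   unfolding lev[OF p] levels(2)[OF p] by (simp add: is_interval_oo)
  fix t assume "v t (k (\<Theta>' (strip_point p))) \<in> k ` A"
  then obtain z where z: "z \<in> open_rect \<epsilon> - {0}" "v t (k (\<Theta>' (strip_point p))) = k (\<Theta> z)" using \<Theta>(4) by blast
  hence "Fx (v t (k (\<Theta>' (strip_point p)))) = Re z" using f[of z] by (simp add: f_def)
  hence F: "\<bar>Fx (v t (k (\<Theta>' (strip_point p))))\<bar> < \<epsilon>" using z(1) by (auto simp: open_rect_def)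
  have "Fx (v t (k (\<Theta>' (strip_point p)))) \<in> (if fst p = 1 then {0<..<\<epsilon>} else if fst p = - 1 then {- \<epsilon><..<0} else {- \<epsilon><..<\<epsilon>})"
  \<comment> \<open>A separatrix might return to the sector on the other side of \<open>x0\<close>,
    at a level of the opposite sign; \<open>sign\<close> excludes this. The other orbits of the
    model use the full range of levels.\<close>
  proof (cases "Im ?z = 0")
   case True
   hence "Fx (v t (k (\<Theta>' (strip_point p)))) * \<gamma> p 0 > 0" using sign[OF j[OF p], of t] by (simp add: \<Theta>'_def Re)
   thus ?thesis using Im True L[of 0] F by (auto simp: zero_less_mult_iff)
  qed (use F Im in auto)
  thus "Fx (v t (k (\<Theta>' (strip_point p)))) \<in> range (\<lambda>t. f (\<Theta>' (strip_point (reeb_flow t p))))"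
   unfolding lev[OF p] levels(2)[OF p] .
 qed
 moreover have "sector S v (k x0) (k ` A)"
 \<comment> \<open>The chart domain is the half-plane here, so the angles run from \<open>0\<close>
   to \<open>pi\<close>.\<close>
 proof (rule sectorI[OF \<Theta>' \<Theta>(2) \<Theta>'0, of "{0..pi}"])
  show "nondegenerate_interval {0..pi}"
   unfolding nondegenerate_interval_def by (intro conjI bexI[of _ 0] bexI[of _ pi]) (auto simp: is_interval_cc)
  show "{0..pi} \<subseteq> {0..<2 * pi}" using pi_gt3 by auto
  show "homeomorphic_map (top_of_set half_plane) (top_of_set (insert 0 {rcis r \<theta> |r \<theta>. r \<in> {0<..<1} \<and> \<theta> \<in> {0..pi}}))
    (\<lambda>w. w /\<^sub>R (1 + cmod w))"
   unfolding half_disc_polar by (rule homeomorphism_homeomorphic_map[OF half_disc_homeomorphism])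
 qed simp
 ultimately show ?thesis unfolding hyperbolic_sector_def by blast
qed

end

section \<open>Excluding centers and elliptic sectors\<close>

lemma equivalence_on_time:
 assumes eq: "equivalence_on S v A S' w Q h" and p: "p \<in> A" and T: "time_interval w Q (h p) = UNIV"
 obtains \<rho> where "strict_mono \<rho>" "\<rho> 0 = (0::real)" "\<And>u. v (\<rho> u) p \<in> A" "\<And>u. h (v (\<rho> u) p) = w u (h p)"
proof -
 let ?T = "time_interval v A p"
 obtain \<tau> :: "real \<Rightarrow> real" where \<tau>: "strict_mono_on ?T \<tau>" "\<tau> ` ?T = UNIV" "\<tau> 0 = 0" "\<And>t. t \<in> ?T \<Longrightarrow> h (v t p) = w (\<tau> t) (h p)"
  using eq p T unfolding equivalence_on_def by metis
 have "\<forall>u. \<exists>t. t \<in> ?T \<and> \<tau> t = u" using \<tau>(2) by (metis UNIV_I imageE)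
 then obtain \<rho> where \<rho>: "\<And>u. \<rho> u \<in> ?T" "\<And>u. \<tau> (\<rho> u) = u" by metis
 have TA: "v t p \<in> A" if "t \<in> ?T" for t
  using that connected_component_subset[of "{t. v t p \<in> A}" 0] by (auto simp: time_interval_def)
 \<comment> \<open>The component of \<open>0\<close> is empty unless it contains \<open>0\<close>,
   and the values of \<open>\<rho>\<close> show that it is not empty.\<close>
 have "{t. v t p \<in> A} \<noteq> {} \<Longrightarrow> 0 \<in> ?T \<or> ?T = {}"
  unfolding time_interval_def using connected_component_eq_empty connected_component_refl_eq by blast
 hence 0: "0 \<in> ?T" using \<rho>(1) TA by blast
 have inj: "inj_on \<tau> ?T" using \<tau>(1) strict_mono_on_imp_inj_on by blast
 show thesis
 proof (rule that)
  show "strict_mono \<rho>"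
  proof (rule strict_monoI, rule ccontr)
   fix s t :: real assume "s < t" "\<not> \<rho> s < \<rho> t"
   then consider "\<rho> t < \<rho> s" | "\<rho> t = \<rho> s" by linarith
   thus False
   proof cases
    case 1
    thus False using strict_mono_onD[OF \<tau>(1) \<rho>(1) \<rho>(1) 1] \<rho>(2) \<open>s < t\<close> by simp
   next
    case 2
    thus False using \<rho>(2) \<open>s < t\<close> by (metis less_irrefl)
   qed
  qed
  show "\<rho> 0 = 0" using inj_onD[OF inj _ \<rho>(1) 0, of 0] \<rho>(2) \<tau>(3) by simp
  show "v (\<rho> u) p \<in> A" for u using TA[OF \<rho>(1)] .
  show "h (v (\<rho> u) p) = w u (h p)" for u using \<tau>(4)[OF \<rho>(1)] \<rho>(2) by simp
 qed
qed

text \<open>A full turn of the rotation brings a point back, while \<open>F\<close> has strictly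
  increased along its orbit.\<close>

lemma no_center:
 assumes strict: "\<And>p. p \<in> topspace S \<Longrightarrow> p \<notin> singular_points S v \<Longrightarrow> strict_mono (\<lambda>t. F (v t p) :: real)"
 shows "\<not> center S v x"
proof
 assume "center S v x"
 then obtain N h where eq: "equivalence_on S v N euclidean (\<lambda>t z. cis t * z) (ball 0 1) h"
  unfolding center_def by blast
 have N: "N \<subseteq> topspace S" and h: "homeomorphic_map (subtopology S N) (top_of_set (ball 0 1)) h"
  using eq unfolding equivalence_on_def by simp_all
 have tN: "topspace (subtopology S N) = N" using N by auto
 have inj: "inj_on h N" and im: "h ` N = ball 0 1"
  using homeomorphic_imp_injective_map[OF h] homeomorphic_imp_surjective_map[OF h] tN by simp_all
 have "(1 / 2 :: complex) \<in> ball 0 1" by simp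
 then obtain p where p: "p \<in> N" "h p = 1 / 2" using im by (metis imageE)
 have "time_interval (\<lambda>t z. cis t * z) (ball 0 1) (h p) = UNIV"
  unfolding time_interval_def p(2) by (simp add: norm_mult norm_divide)
 then obtain \<rho> where \<rho>: "strict_mono \<rho>" "\<rho> 0 = 0" "\<And>u. v (\<rho> u) p \<in> N" "\<And>u. h (v (\<rho> u) p) = cis u * h p"
  using equivalence_on_time[OF eq p(1)] by blast
 have "h (v (\<rho> (2 * pi)) p) = h (v (\<rho> 0) p)" using \<rho>(4) by simp
 hence e: "v (\<rho> (2 * pi)) p = v (\<rho> 0) p" using inj_onD[OF inj] \<rho>(3) by blast
 have "h (v (\<rho> pi) p) \<noteq> h (v (\<rho> 0) p)" unfolding \<rho>(4) p(2) by simp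
 hence "v (\<rho> pi) p \<noteq> v (\<rho> 0) p" by metis
 hence "p \<notin> singular_points S v" unfolding singular_points_def by (metis (mono_tags, lifting) mem_Collect_eq)
 hence st: "strict_mono (\<lambda>t. F (v t p))" using strict p(1) N by blast
 have "\<rho> 0 < \<rho> (2 * pi)" using strict_monoD[OF \<rho>(1), of 0 "2 * pi"] by simp
 hence "F (v (\<rho> 0) p) < F (v (\<rho> (2 * pi)) p)" using strict_monoD[OF st] by blast
 thus False using e by simp
qed

text \<open>Along an orbit in an elliptic sector, \<open>F\<close> would increase from \<open>F x\<close> to \<open>F x\<close>.\<close>

lemma no_elliptic_sector:
 assumes F: "continuous_map S euclideanreal F"
  and strict: "\<And>p. p \<in> topspace S \<Longrightarrow> p \<notin> singular_points S v \<Longrightarrow> strict_mono (\<lambda>t. F (v t p) :: real)"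
 shows "\<not> elliptic_sector S v x A"
proof
 assume "elliptic_sector S v x A"
 let ?Q = "{-1<..<1} \<times> UNIV :: (real \<times> real) set"
 let ?X = "add_end ?Q snd" and ?w = "add_fixed_point reeb_flow"
 obtain h where eq: "equivalence_on S v (insert x A) ?X ?w (topspace ?X) h"
  using \<open>elliptic_sector S v x A\<close> unfolding elliptic_sector_def modelled_on_def by blast
 have sub: "insert x A \<subseteq> topspace S" and h: "homeomorphic_map (subtopology S (insert x A)) ?X h"
  using eq unfolding equivalence_on_def subtopology_topspace by blast+
 have tA: "topspace (subtopology S (insert x A)) = insert x A" using sub by auto
 obtain H where "homeomorphic_maps (subtopology S (insert x A)) ?X h H" using h homeomorphic_map_maps by blast
 hence Hc: "continuous_map ?X (subtopology S (insert x A)) H" and Hh: "\<And>p. p \<in> insert x A \<Longrightarrow> H (h p) = p"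
  and hH: "\<And>q. q \<in> topspace ?X \<Longrightarrow> h (H q) = q" unfolding homeomorphic_maps_def using tA by auto
 have FH: "continuous_map ?X euclideanreal (F \<circ> H)"
  using continuous_map_compose[OF continuous_map_into_fulltopology[OF Hc] F] .
 \<comment> \<open>The orbit through the middle of the strip: its height \<open>ln (cosh u)\<close>
   tends to infinity for both signs of \<open>u\<close>, so both of its ends approach the added
   point.\<close>
 define p where "p = H (Some (0, 0))"
 have "Some (0, 0) \<in> topspace ?X" by simp
 hence p: "p \<in> insert x A" "h p = Some (0, 0)"
  using Hc hH[of "Some (0, 0)"] tA unfolding p_def continuous_map_def by auto
 define y where "y u = (sinh u / cosh u, ln (cosh u))" for u :: real
 have y: "reeb_flow u (0, 0) = y u" for u by (simp add: reeb_flow_def y_def)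
 have c1: "cosh u > (0::real)" for u by (simp add: cosh_real_pos)
 have yQ: "y u \<in> ?Q" for u
 proof -
  have "cosh u - sinh u > 0" "cosh u + sinh u > 0" by (simp_all only: cosh_minus_sinh cosh_plus_sinh exp_gt_zero)
  hence "sinh u < cosh u" "- sinh u < cosh u" by linarith+
  hence "-1 < sinh u / cosh u \<and> sinh u / cosh u < 1" using c1[of u] by (simp add: less_divide_eq)
  thus ?thesis by (simp add: y_def)
 qed
 have wy: "?w u (h p) = Some (y u)" for u by (simp add: add_fixed_point_def p(2) y)
 have "time_interval ?w (topspace ?X) (h p) = UNIV" unfolding time_interval_def wy using yQ by simp
 then obtain \<rho> where \<rho>: "strict_mono \<rho>" "\<rho> 0 = 0" "\<And>u. v (\<rho> u) p \<in> insert x A" "\<And>u. h (v (\<rho> u) p) = ?w u (h p)"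
  using equivalence_on_time[OF eq p(1)] by blast
 have v: "v (\<rho> u) p = H (Some (y u))" for u using Hh[OF \<rho>(3)] \<rho>(4) wy by metis
 have "h (v (\<rho> 1) p) \<noteq> h (v (\<rho> 0) p)" unfolding \<rho>(4) wy by (simp add: y_def)
 hence "v (\<rho> 1) p \<noteq> v (\<rho> 0) p" by metis
 hence "p \<notin> singular_points S v" unfolding singular_points_def by (metis (mono_tags, lifting) mem_Collect_eq)
 hence st: "strict_mono (\<lambda>t. F (v t p))" using strict p(1) sub by blast
 have mono: "F (v (\<rho> s) p) < F (v (\<rho> t) p)" if "s < t" for s t using strict_monoD[OF st strict_monoD[OF \<rho>(1) that]] .
 have lim: "(\<lambda>n. F (v (\<rho> (us n)) p)) \<longlonglongrightarrow> F (H None)" if us: "filterlim (\<lambda>n. \<bar>us n\<bar>) at_top sequentially" for us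
 proof -
  have "limitin ?X (\<lambda>n. Some (y (us n))) None sequentially" unfolding limitin_def
  proof (intro conjI allI impI)
   fix W assume W: "openin ?X W \<and> None \<in> W"
   then obtain c where c: "\<forall>q\<in>?Q. c < snd q \<longrightarrow> Some q \<in> W" unfolding openin_add_end by blast
   have "\<forall>\<^sub>F n in sequentially. \<bar>us n\<bar> > c + ln 2" using us unfolding filterlim_at_top_dense by blast
   thus "\<forall>\<^sub>F n in sequentially. Some (y (us n)) \<in> W"
   proof eventually_elim
    case (elim n)
    have "exp \<bar>us n\<bar> / 2 < cosh (us n)" by (cases "us n \<ge> 0") (simp_all add: cosh_def)
    hence "ln (exp \<bar>us n\<bar> / 2) < ln (cosh (us n))" by (simp add: c1)
    hence "c < snd (y (us n))" using elim by (simp add: y_def ln_div)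
    thus ?case using c yQ by blast
   qed
  qed simp
  from continuous_map_limit[OF FH this] show ?thesis by (simp add: o_def v)
 qed
 have "filterlim (\<lambda>n. \<bar>real n\<bar>) at_top sequentially" "filterlim (\<lambda>n. \<bar>- real n\<bar>) at_top sequentially"
  using filterlim_real_sequentially by simp_all
 from this[THEN lim] have l: "(\<lambda>n. F (v (\<rho> (real n)) p)) \<longlonglongrightarrow> F (H None)" "(\<lambda>n. F (v (\<rho> (- real n)) p)) \<longlonglongrightarrow> F (H None)" .
 have "F (v (\<rho> 1) p) \<le> F (H None)"
  by (rule LIMSEQ_le_const[OF l(1)], intro exI[of _ 1]) (use mono in \<open>auto simp: le_less\<close>)
 moreover have "F (H None) \<le> F (v (\<rho> 0) p)"
  by (rule LIMSEQ_le_const2[OF l(2)], intro exI[of _ 0]) (use mono in \<open>auto simp: le_less\<close>)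
 ultimately show False using mono[of 0 1] by simp
qed

section \<open>Assembling the sector decomposition\<close>

context local_flow
begin

context
 fixes \<epsilon> :: real and FA FA' :: "(real \<Rightarrow> complex) set" and \<beta> :: "(real \<Rightarrow> complex) \<Rightarrow> complex"
 assumes arcs: "sectored_arcs x0 R f I \<Psi> \<epsilon> FA FA' \<beta>"
begin

interpretation sa: sectored_arcs x0 R f I \<Psi> \<epsilon> FA FA' \<beta> by (rule arcs)

lemma V_eq: "sa.V = V0" by (simp add: sa.V_def V0_def)

lemma separatrix_sign:
 assumes "z \<in> sa.Ws \<union> sa.Wu"
 shows "Fx (v t (k z)) * f z > 0"
proof -
 \<comment> \<open>Levels between \<open>f z\<close> and \<open>0\<close> that tend to
   \<open>0\<close>, for either sign of \<open>f z\<close>.\<close>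
 define cs where "cs n = f z * inverse (real (Suc n))" for n
 have cs: "cs \<longlonglongrightarrow> 0" unfolding cs_def by (rule tendsto_mult_right_zero[OF LIMSEQ_inverse_real_of_nat])
 have i: "0 < inverse (real (Suc n))" "inverse (real (Suc n)) \<le> 1" for n by (simp_all add: field_simps)
 show ?thesis
 proof (cases "z \<in> sa.Ws")
  case True
  have neg: "f z < 0" by (rule sa.Ws_neg[OF True])
  have z: "z \<in> V0" using sa.Ws_V[OF True] V_eq by simp
  have csI: "cs n \<in> I z" for n
  proof (rule sa.Ws_levels[OF True])
   show "f z \<le> cs n" "cs n < 0" using i[of n] neg by (simp_all only: cs_def mult_less_0_iff mult_le_cancel_left1) auto
  qed
  show ?thesis using orbit_sign(1)[OF z csI sa.Ws_tendsto[OF True cs csI] neg, of t] neg by (rule mult_neg_neg)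
 next
  case False
  hence W: "z \<in> sa.Wu" using assms by blast
  have pos: "f z > 0" by (rule sa.Wu_pos[OF W])
  have z: "z \<in> V0" using sa.Wu_V[OF W] V_eq by simp
  have csI: "cs n \<in> I z" for n
  proof (rule sa.Wu_levels[OF W])
   show "cs n \<le> f z" "0 < cs n" using i[of n] pos by (simp_all only: cs_def zero_less_mult_iff mult_le_cancel_left2) auto
  qed
  show ?thesis using orbit_sign(2)[OF z csI sa.Wu_tendsto[OF W cs csI] pos, of t] pos by (rule mult_pos_pos)
 qed
qed

lemma stable_sector:
 assumes "g \<in> sa.F1"
 shows "parabolic_sector S v (k x0) (k ` sa.parabolic_set g)"
proof -
 note st = sa.F1_stable[OF assms]
 note g = sa.stable_arcD[OF st]
 note ch = sa.sector_chart_homeomorphic[OF sa.parabolic_chart[OF st]]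
 have \<epsilon>: "\<epsilon> > 0" by (rule sa.eps_pos)
 show ?thesis
 proof (rule parabolic_sectorI[OF ch(1) _ ch(4,5) _ \<epsilon>, of 1])
  show "sa.parabolic_set g \<subseteq> V0" using ch(2) V_eq by simp
  show "f (sa.parabolic_map g z) = - 1 * \<epsilon> * cmod z" if "z \<in> open_cone" for z
   using sa.f_parabolic_map[OF g, of z] that sa.open_cone_cone by auto
  show "- 1 * \<epsilon> * r \<in> I (sa.parabolic_map g z) \<and>
    \<Psi> (- 1 * \<epsilon> * r) (sa.parabolic_map g z) = sa.parabolic_map g (rcis r (Arg z))"
   if "z \<in> open_cone - {0}" "0 < r" "r < 1" for z r
  proof -
   have "z \<in> cone" "z \<noteq> 0" "- \<epsilon> \<le> - \<epsilon> * r" "- \<epsilon> * r < 0" using that sa.open_cone_cone \<epsilon> by auto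
   from sa.parabolic_orbit[OF g this] show ?thesis using \<epsilon> by simp
  qed
 qed simp
qed

lemma unstable_sector:
 assumes "g \<in> sa.F1'"
 shows "parabolic_sector S v (k x0) (k ` sa.parabolic_set' g)"
proof -
 note st = sa.F1'_unstable[OF assms]
 have g: "continuous_on {0..1} g" "inj_on g {0..1}" "g ` {0..1} \<subseteq> sa.C'"
  using st unfolding sa.unstable_arc_def by blast+
 note ch = sa.sector_chart_homeomorphic[OF sa.parabolic_chart'[OF st]]
 have \<epsilon>: "\<epsilon> > 0" by (rule sa.eps_pos)
 show ?thesis
 proof (rule parabolic_sectorI[OF ch(1) _ ch(4,5) _ \<epsilon>, of "-1"])
  show "sa.parabolic_set' g \<subseteq> V0" using ch(2) V_eq by simp
  show "f (sa.parabolic_map' g z) = - (-1) * \<epsilon> * cmod z" if "z \<in> open_cone" for z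
   using sa.parabolic_map'_orbit(1)[OF g, of z] that sa.open_cone_cone by auto
  show "- (-1) * \<epsilon> * r \<in> I (sa.parabolic_map' g z) \<and>
    \<Psi> (- (-1) * \<epsilon> * r) (sa.parabolic_map' g z) = sa.parabolic_map' g (rcis r (Arg z))"
   if "z \<in> open_cone - {0}" "0 < r" "r < 1" for z r
  proof -
   have "z \<in> cone" "z \<noteq> 0" "0 < \<epsilon> * r" "\<epsilon> * r \<le> \<epsilon>" using that sa.open_cone_cone \<epsilon> by auto
   from sa.parabolic_map'_orbit(2)[OF g this] show ?thesis using \<epsilon> by simp
  qed
 qed simp
qed

lemma crossing_sector:
 assumes "g \<in> sa.F2"
 shows "hyperbolic_sector S v (k x0) (k ` sa.hyperbolic_set g (\<beta> g))"
proof -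
 note cr = sa.F2_crossing[OF assms]
 note g = sa.crossing_arcD[OF cr]
 note ch = sa.sector_chart_homeomorphic[OF sa.hyperbolic_chart[OF cr], unfolded sa.open_rectangle_eq]
 have \<epsilon>: "\<epsilon> > 0" by (rule sa.eps_pos)
 have rect: "z \<in> sa.rectangle" if "z \<in> open_rect \<epsilon>" for z
  using that sa.open_rectangle_rectangle unfolding sa.open_rectangle_eq by blast
 have f: "f (sa.hyperbolic_map g (\<beta> g) z) = Re z" if "z \<in> open_rect \<epsilon>" for z
  using sa.f_hyperbolic_map[OF g rect[OF that]] .
 show ?thesis
 proof (rule hyperbolic_sectorI[OF ch(1) _ ch(4,5) \<epsilon> f])
  show "sa.hyperbolic_set g (\<beta> g) \<subseteq> V0" using ch(2) V_eq by simp
  show "c \<in> I (sa.hyperbolic_map g (\<beta> g) z) \<and>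
    \<Psi> c (sa.hyperbolic_map g (\<beta> g) z) = sa.hyperbolic_map g (\<beta> g) (Complex c (Im z))"
   if z: "z \<in> open_rect \<epsilon> - {0}" and c: "\<bar>c\<bar> < \<epsilon>" "Im z \<noteq> 0 \<or> c * Re z > 0" for z c
  proof -
   have "z \<in> sa.rectangle" "z \<noteq> 0" "- \<epsilon> \<le> c" "c \<le> \<epsilon>" using rect z c by auto
   from sa.hyperbolic_orbit[OF g this c(2)] show ?thesis by blast
  qed
  show "Fx (v t (k (sa.hyperbolic_map g (\<beta> g) z))) * Re z > 0" if z: "z \<in> open_rect \<epsilon> - {0}" "Im z = 0" for z t
  proof -
   have "z \<in> sa.rectangle" "z \<noteq> 0" using rect z by auto
   from separatrix_sign[OF sa.hyperbolic_map_separatrix[OF g this z(2)], of t] show ?thesis using f[of z] z(1) by simp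
  qed
 qed
qed

lemma separatrix_orbit_arc:
 assumes "X \<in> sa.separatrix ` sa.C \<union> sa.separatrix' ` sa.C'"
 shows "orbit_arc S v (k ` X)" using assms
proof
 assume "X \<in> sa.separatrix ` sa.C"
 then obtain q where q: "q \<in> sa.C" "X = (\<lambda>c. \<Psi> c q) ` {- \<epsilon><..<0}" by (auto simp: sa.separatrix_def)
 show ?thesis unfolding q(2) using sa.C_V[OF q(1)] sa.C_levels[OF q(1)] sa.eps_pos V_eq by (intro orbit_arcI) auto
next
 assume "X \<in> sa.separatrix' ` sa.C'"
 then obtain q where q: "q \<in> sa.C'" "X = (\<lambda>c. \<Psi> c q) ` {0<..<\<epsilon>}" by (auto simp: sa.separatrix'_def)
 show ?thesis unfolding q(2) using sa.C'_V[OF q(1)] sa.C'_levels[OF q(1)] sa.eps_pos V_eq by (intro orbit_arcI) auto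
qed

lemma sector_decomposition:
 assumes boundary: "k x0 \<in> surface_boundary S \<longleftrightarrow> Im x0 = 0"
  and inner: "Im x0 \<noteq> 0 \<Longrightarrow> ball x0 R \<subseteq> {z. Im z > 0}"
 shows "sector_decomposition S v (k x0) (k ` sa.U) ((`) k ` sa.sectors)" unfolding sector_decomposition_def
proof (intro conjI ballI impI)
 have UB: "sa.U \<subseteq> B" using sa.U_subset by (simp add: B_def)
 have sB: "A \<subseteq> B" if "A \<in> sa.sectors" for A using that UB unfolding sa.U_eq by blast
 have kinj: "inj_on k B" using chart_props(3) by (metis inj_onI)
 show "openin S (k ` sa.U)"
 proof -
  have "openin (top_of_set B) sa.U" using sa.U_open UB by (rule openin_subset_trans) (simp add: B_def)
  moreover have "homeomorphic_map (top_of_set B) (subtopology S N) k"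
   using chart unfolding B_def homeomorphic_maps_map by blast
  ultimately have "openin (subtopology S N) (k ` sa.U)"
   using homeomorphic_imp_open_map unfolding open_map_def by blast
  thus ?thesis using N openin_trans_full by blast
 qed
 show "k x0 \<in> k ` sa.U" using sa.x0_U by blast
 have "sa.U homeomorphic (if k x0 \<in> surface_boundary S then ball 0 1 \<inter> half_plane else ball (0::complex) 1)"
  using sa.U_disc[OF inner] boundary by simp
 hence "top_of_set sa.U homeomorphic_space top_of_set (if k x0 \<in> surface_boundary S then ball 0 1 \<inter> half_plane else ball (0::complex) 1)"
  unfolding homeomorphic_def homeomorphic_space using homeomorphism_homeomorphic_map by blast
 moreover have "top_of_set sa.U homeomorphic_space subtopology S (k ` sa.U)"
  using k_homeomorphic[OF UB] unfolding homeomorphic_space by blast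
 ultimately show "subtopology S (k ` sa.U) homeomorphic_space
   top_of_set (if k x0 \<in> surface_boundary S then ball 0 1 \<inter> half_plane else ball 0 1)"
  using homeomorphic_space_sym homeomorphic_space_trans by blast
 show "finite ((`) k ` sa.sectors)" using sa.finite_F by (simp add: sa.sectors_def)
 show "k ` sa.U = insert (k x0) (\<Union> ((`) k ` sa.sectors))" unfolding sa.U_eq by blast
 show "parabolic_sector S v (k x0) A \<or> hyperbolic_sector S v (k x0) A \<or> elliptic_sector S v (k x0) A"
  if "A \<in> (`) k ` sa.sectors" for A
  using that stable_sector unstable_sector crossing_sector unfolding sa.sectors_def by (elim imageE UnE) auto
 fix A A' assume A: "A \<in> (`) k ` sa.sectors" "A' \<in> (`) k ` sa.sectors" "A \<noteq> A'"
 then obtain D D' where D: "D \<in> sa.sectors" "D' \<in> sa.sectors" "A = k ` D" "A' = k ` D'" "D \<noteq> D'" by blast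
 obtain \<C> where C: "finite \<C>" "card \<C> \<le> 2" "\<C> \<subseteq> sa.separatrix ` sa.C \<union> sa.separatrix' ` sa.C'" "D \<inter> D' = \<Union>\<C>"
  using sa.sectors_meet[OF D(1,2,5)] unfolding sa.meet_in_separatrices_def by blast
 show "\<exists>\<C>. finite \<C> \<and> card \<C> \<le> 2 \<and> (\<forall>C\<in>\<C>. orbit_arc S v C) \<and> A \<inter> A' = \<Union>\<C>"
 proof (intro exI[of _ "(`) k ` \<C>"] conjI ballI)
  show "finite ((`) k ` \<C>)" using C(1) by simp
  show "card ((`) k ` \<C>) \<le> 2" using card_image_le[OF C(1)] C(2) order_trans by blast
  show "orbit_arc S v Y" if "Y \<in> (`) k ` \<C>" for Y using that C(3) separatrix_orbit_arc by blast
  have "k ` D \<inter> k ` D' = k ` (D \<inter> D')" using inj_on_image_Int[OF kinj sB[OF D(1)] sB[OF D(2)]] by simp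
  thus "A \<inter> A' = \<Union> ((`) k ` \<C>)" unfolding D C(4) by blast
 qed
qed

end

lemma finitely_sectored_x0:
 assumes boundary: "k x0 \<in> surface_boundary S \<longleftrightarrow> Im x0 = 0"
  and inner: "Im x0 \<noteq> 0 \<Longrightarrow> ball x0 R \<subseteq> {z. Im z > 0}"
 shows "\<exists>U \<S>. sector_decomposition S v (k x0) U \<S>"
proof -
 interpret lf: level_flow x0 R f I \<Psi> by (rule level_flow)
 obtain \<epsilon> where "lf.eps_bound \<epsilon>" using lf.eps_bound_exists by blast
 then interpret sf: sectored_flow x0 R f I \<Psi> \<epsilon> by unfold_locales
 obtain FA where FA: "sf.arc_system FA" using sf.arc_system_exists by blast
 obtain FA' where FA': "sf.arc_system' FA'" using sf.arc_system'_exists by blast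
 have "\<exists>b. sf.transition_end g b" if g: "g \<in> FA" "\<not> g ` {0..1} \<subseteq> sf.C" for g
  using bspec[OF conjunct1[OF conjunct2[OF FA[unfolded sf.arc_system_def]]] g(1)] g(2)
  by (intro sf.transition_end_exists) auto
 hence "\<exists>\<beta>. \<forall>g. g \<in> FA \<longrightarrow> \<not> g ` {0..1} \<subseteq> sf.C \<longrightarrow> sf.transition_end g (\<beta> g)" by metis
 then obtain \<beta> where \<beta>: "\<And>g. g \<in> FA \<Longrightarrow> \<not> g ` {0..1} \<subseteq> sf.C \<Longrightarrow> sf.transition_end g (\<beta> g)" by blast
 have "sectored_arcs x0 R f I \<Psi> \<epsilon> FA FA' \<beta>" by unfold_locales (fact FA FA' \<beta>)+
 from sector_decomposition[OF this boundary inner] show ?thesis by blast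
qed

end

section \<open>The chart at the singular point, and the conclusion\<close>

lemma local_flow_exists:
 fixes S :: "'a topology"
 assumes S: "surface S" and fl: "flow S v" and x: "isolated_singular_point S v x"
  and F: "continuous_map S euclideanreal F"
  and strict: "\<And>p. p \<in> topspace S \<Longrightarrow> p \<notin> singular_points S v \<Longrightarrow> strict_mono (\<lambda>t. F (v t p))"
  and arcs: "\<And>p e. p \<in> topspace S \<Longrightarrow> p \<notin> singular_points S v \<Longrightarrow> e > 0 \<Longrightarrow>
    \<exists>t. 0 \<le> t \<and> t < e \<and> level_arc S F (v t p)"
 obtains N k \<phi> x0 R where "local_flow S v F N k \<phi> x0 R" "k x0 = x" "x \<in> surface_boundary S \<longleftrightarrow> Im x0 = 0"
  "Im x0 \<noteq> 0 \<longrightarrow> ball x0 R \<subseteq> {z. Im z > 0}"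
proof -
 obtain U0 where U0: "openin S U0" "U0 \<inter> singular_points S v = {x}"
  using x unfolding isolated_singular_point_def by blast
 have xS: "x \<in> topspace S" using U0 openin_subset by blast
 \<comment> \<open>A boundary point needs the chart that witnesses it; at any other point no chart
   has height \<open>0\<close>.\<close>
 have "\<exists>U \<phi>. chart S (U, \<phi>) \<and> x \<in> U \<and> (x \<in> surface_boundary S \<longleftrightarrow> Im (\<phi> x) = 0)"
 proof (cases "x \<in> surface_boundary S")
  case True
  thus ?thesis unfolding surface_boundary_def by blast
 next
  case False
  obtain U \<phi> where "chart S (U, \<phi>)" "x \<in> U" using S xS unfolding surface_def by blast
  thus ?thesis using False unfolding surface_boundary_def by blast
 qed
 then obtain U \<phi> where ch: "chart S (U, \<phi>)" "x \<in> U" "x \<in> surface_boundary S \<longleftrightarrow> Im (\<phi> x) = 0" by blast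
 have U: "openin S U" and W: "openin (top_of_set half_plane) (\<phi> ` U)"
  and h: "homeomorphic_map (subtopology S U) (top_of_set (\<phi> ` U)) \<phi>" using ch(1) by (simp_all add: chart_def)
 have tU: "topspace (subtopology S U) = U" using openin_subset[OF U] by auto
 obtain k where k: "homeomorphic_maps (subtopology S U) (top_of_set (\<phi> ` U)) \<phi> k"
  using h homeomorphic_map_maps by blast
 have k\<phi>: "\<And>p. p \<in> U \<Longrightarrow> k (\<phi> p) = p" and \<phi>k: "\<And>z. z \<in> \<phi> ` U \<Longrightarrow> \<phi> (k z) = z"
  using k tU by (auto simp: homeomorphic_maps_def)
 have kh: "homeomorphic_map (top_of_set (\<phi> ` U)) (subtopology S U) k" using k homeomorphic_maps_map by blast
 define x0 where "x0 = \<phi> x"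
 have "openin (subtopology S U) (U \<inter> U0)" using U0(1) by (rule openin_subtopology_Int2)
 hence "openin (top_of_set (\<phi> ` U)) (\<phi> ` (U \<inter> U0))"
  using homeomorphic_imp_open_map[OF h] unfolding open_map_def by blast
 hence op: "openin (top_of_set half_plane) (\<phi> ` (U \<inter> U0))" using W by (rule openin_trans)
 have x0in: "x0 \<in> \<phi> ` (U \<inter> U0)" using ch(2) U0(2) by (auto simp: x0_def)
 obtain r where r: "r > 0" "ball x0 r \<inter> half_plane \<subseteq> \<phi> ` (U \<inter> U0)"
  using op x0in unfolding openin_contains_ball by blast
 have x0H: "x0 \<in> half_plane" using x0in openin_imp_subset[OF op] by blast
 \<comment> \<open>At an interior point the radius is bounded by the height, which keeps the disk
   above the real axis.\<close>
 define R where "R = (if Im x0 = 0 then r else min r (Im x0))"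
 have R: "R > 0" "R \<le> r" using r(1) x0H by (auto simp: R_def half_plane_def)
 define Q where "Q = ball x0 R \<inter> half_plane"
 have Q: "Q \<subseteq> \<phi> ` (U \<inter> U0)" using r(2) R(2) by (auto simp: Q_def)
 hence QU: "Q \<subseteq> \<phi> ` U" by blast
 have "openin (top_of_set half_plane) Q" unfolding Q_def by (metis Int_commute openin_open_Int open_ball)
 hence "openin (top_of_set (\<phi> ` U)) Q" using QU openin_imp_subset[OF W] openin_subset_trans by blast
 hence "openin (subtopology S U) (k ` Q)" using homeomorphic_imp_open_map[OF kh] unfolding open_map_def by blast
 hence N: "openin S (k ` Q)" using U openin_trans_full by blast
 have kQ: "k ` Q \<subseteq> U \<inter> U0" using Q k\<phi> by auto
 have kx: "k x0 = x" using k\<phi> ch(2) by (simp add: x0_def)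
 have maps: "homeomorphic_maps (top_of_set Q) (subtopology S (k ` Q)) k \<phi>"
 proof -
  have "homeomorphic_maps (top_of_set (\<phi> ` U)) (subtopology S U) k \<phi>" using k homeomorphic_maps_sym by blast
  hence "homeomorphic_maps (subtopology (top_of_set (\<phi> ` U)) Q) (subtopology (subtopology S U) (k ` Q)) k \<phi>"
   by (rule homeomorphic_maps_subtopologies) (use QU tU kQ \<phi>k in auto)
  moreover have "subtopology (top_of_set (\<phi> ` U)) Q = top_of_set Q"
   using QU by (simp add: subtopology_subtopology Int_absorb1)
  moreover have "subtopology (subtopology S U) (k ` Q) = subtopology S (k ` Q)"
   using kQ by (simp add: subtopology_subtopology Int_absorb1)
  ultimately show ?thesis by simp
 qed
 show thesis
 proof (rule that)
  show "local_flow S v F (k ` Q) k \<phi> x0 R"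
  proof
   show "flow S v" "continuous_map S euclideanreal F" by (fact fl F)+
   show "Hausdorff_space S" using S by (simp add: surface_def)
   show "x0 \<in> half_plane" "R > 0" "openin S (k ` Q)" by (fact x0H R N)+
   show "homeomorphic_maps (top_of_set (ball x0 R \<inter> half_plane)) (subtopology S (k ` Q)) k \<phi>"
    using maps by (simp add: Q_def)
   have "x0 \<in> Q" using R(1) x0H by (simp add: Q_def)
   thus "k ` Q \<inter> singular_points S v = {k x0}" using kQ U0(2) kx by blast
  qed (fact strict arcs)+
  show "k x0 = x" by (rule kx)
  show "x \<in> surface_boundary S \<longleftrightarrow> Im x0 = 0" using ch(3) by (simp add: x0_def)
  show "Im x0 \<noteq> 0 \<longrightarrow> ball x0 R \<subseteq> {z. Im z > 0}"
  proof (intro impI subsetI)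
   assume i: "Im x0 \<noteq> 0"
   fix z assume "z \<in> ball x0 R"
   hence "cmod (x0 - z) < Im x0" using i by (simp add: R_def dist_norm)
   moreover have "\<bar>Im (x0 - z)\<bar> \<le> cmod (x0 - z)" by (rule abs_Im_le_cmod)
   ultimately show "z \<in> {z. Im z > 0}" by simp
  qed
 qed
qed

theorem theorem1:
 fixes S :: "'a topology" and v :: "real \<Rightarrow> 'a \<Rightarrow> 'a" and x :: 'a
 assumes "surface S"
  and "gradient_flow S v"
  and "isolated_singular_point S v x"
 shows "nontrivial_finitely_sectored S v x \<and> (\<nexists>A. elliptic_sector S v x A)"
proof -
 have fl: "flow S v" using assms(2) by (simp add: gradient_flow_def)
 obtain F where F: "continuous_map S euclideanreal F"
  "\<And>p. p \<in> topspace S \<Longrightarrow> p \<notin> singular_points S v \<Longrightarrow> strict_mono (\<lambda>t. F (v t p))"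
  "\<And>p e. p \<in> topspace S \<Longrightarrow> p \<notin> singular_points S v \<Longrightarrow> e > 0 \<Longrightarrow>
    \<exists>t. 0 \<le> t \<and> t < e \<and> level_arc S F (v t p)" using gradient_flow_lyapunov[OF assms(2)] by metis
 obtain N k \<phi> x0 R where l: "local_flow S v F N k \<phi> x0 R" "k x0 = x" "x \<in> surface_boundary S \<longleftrightarrow> Im x0 = 0"
  "Im x0 \<noteq> 0 \<longrightarrow> ball x0 R \<subseteq> {z. Im z > 0}" by (rule local_flow_exists[OF assms(1) fl assms(3) F])
 have "\<exists>U \<S>. sector_decomposition S v x U \<S>" using local_flow.finitely_sectored_x0[OF l(1)] l(2-4) by simp
 moreover have "x \<in> singular_points S v" using assms(3) unfolding isolated_singular_point_def by blast
 ultimately have "finitely_sectored S v x" unfolding finitely_sectored_def by blast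
 moreover have "\<not> center S v x" by (rule no_center[where F = F, OF F(2)])
 moreover have "\<not> elliptic_sector S v x A" for A by (rule no_elliptic_sector[where F = F, OF F(1,2)])
 ultimately show ?thesis unfolding nontrivial_finitely_sectored_def by blast
qed

end
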